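(* Let $X\subseteq \mathbf R^d$ be open, let $\omega \in \mathscr P(\mathbf R^{2d})$ be independent of the first variable, i.e. $\omega(x,\xi)=\omega(\xi)$, let $f\in \mathscr D'(X)$ and let $p,q\in [1,\infty ]$. Then $$ WF_{\mathscr FL^q_{(\omega )}}(f) = WF_{M^{p,q}_{(\omega )}}(f) = DF_{\mathscr FL^q_{(\omega )}}(f) = DF_{M^{p,q}_{(\omega )}}(f), $$ whatever choices of lattices, parallelepipeds and admissible Gabor pairs are used in the definitions of $DF_{\mathscr FL^q_{(\omega )}}(f)$ and $DF_{M^{p,q}_{(\omega )}}(f)$.
   Context: **Weights.** $\mathscr P(\mathbf R^n)$ is the set of positive measurable functions $\omega$ on $\mathbf R^n$ for which there are a positive polynomial $v$ on $\mathbf R^n$ and a constant $C$ such that $\omega(x+y)\le C\omega(x)v(y)$ for all $x,y\in\mathbf R^n$. A weight in $\mathscr P(\mathbf R^{2d})$ independent of $x$ is identified with an element of $\mathscr P(\mathbf R^d)$ and written $\omega(\xi)$. **Transforms.** $\widehat f(\xi)=\mathscr Ff(\xi)=(2\pi)^{-d/2}\int f(x)e^{-i\langle x,\xi\rangle}\,dx$, extended to $\mathscr S'(\mathbf R^d)$. For a fixed window $\phi\in\mathscr S(\mathbf R^d)\setminus 0$, $V_\phi f(x,\xi)=\mathscr F(f\,\overline{\phi(\cdot-x)})(\xi)$. **Continuous wave-front sets.** For an open cone $\Gamma\subseteq\mathbf R^d\setminus 0$ put (values $+\infty$ allowed, usual modifications when $p$ or $q$ is $\infty$) $$|g|_{\mathscr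 FL^{q,\Gamma}_{(\omega)}}=\Big(\int_\Gamma|\widehat g(\xi)\omega(\xi)|^q\,d\xi\Big)^{1/q},\qquad |g|_{M^{p,q,\Gamma}_{(\omega)}}=\Big(\int_\Gamma\Big(\int_{\mathbf R^d}|V_\phi g(x,\xi)\omega(\xi)|^p\,dx\Big)^{q/p}d\xi\Big)^{1/q}.$$ $WF_{\mathscr FL^q_{(\omega)}}(f)$ (respectively $WF_{M^{p,q}_{(\omega)}}(f)$) is the set of all $(x_0,\xi_0)\in X\times(\mathbf R^d\setminus 0)$ such that for every $\chi\in C_0^\infty(X)$ with $\chi(x_0)\ne0$ and every open conical neighbourhood $\Gamma$ of $\xi_0$ one has $|\chi f|_{\mathscr FL^{q,\Gamma}_{(\omega)}}=+\infty$ (respectively $|\chi f|_{M^{p,q,\Gamma}_{(\omega)}}=+\infty$). **Lattices.** A lattice $\Lambda\subseteq\mathbf R^d$ with basis $e_1,\dots,e_d$ (a basis of $\mathbf R^d$) is a set $\Lambda=\{x_0+t_1e_1+\cdots+t_de_d : t_1,\dots,t_d\in\mathbf Z\}$ for some $x_0\in\Lambda$. A $\Lambda$-parallelepiped is a parallelepiped spanned by $e_1,\dots,e_d$ with corners in $\Lambda$; $\mathcal A(\Lambda)$ is the set of these. If $\Lambda_1,\Lambda_2$ are lattices with bases $e_1,\dots,e_d$ and $\varepsilon_1,\dots,\varepsilon_d$, then $(\Lambda_1,\Lambda_2)$ is a strongly admissible lattice pair if for some $0<c<2\pi$ one has $\langle e_j,\varepsilon_j\rangle=c$ for all $j$ and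 $\langle e_j,\varepsilon_k\rangle=0$ for $j\ne k$. **Discrete semi-norm.** For a discrete set $H\subseteq\mathbf R^d$, $|g|^{(D)}_{\mathscr FL^q_{(\omega)}(H)}=\big(\sum_{\xi_k\in H}|\widehat g(\xi_k)\omega(\xi_k)|^q\big)^{1/q}$ (supremum if $q=\infty$). **Discrete wave-front set of Fourier Lebesgue type.** For $x_0\in X$, let $(\Lambda_1,\Lambda_2)$ be a strongly admissible lattice pair and let $D\in\mathcal A(\Lambda_1)$ contain $x_0$ in its interior. Then $(x_0,\xi_0)\in X\times(\mathbf R^d\setminus0)$ belongs to $DF_{\mathscr FL^q_{(\omega)}}(f)$ if and only if for each $\chi\in C_0^\infty(D\cap X)$ with $\chi(x_0)\neq0$ and each open conical neighbourhood $\Gamma$ of $\xi_0$ one has $|\chi f|^{(D)}_{\mathscr FL^q_{(\omega)}(\Gamma\cap\Lambda_2)}=\infty$. **Admissible Gabor pairs.** Let $\Lambda_1=\{x_j\}_{j\in J}$ and $\Lambda_2=\{\xi_k\}_{k\in J}$ be lattices in $\mathbf R^d$ and let $\varphi,\psi\in C_0^\infty(\mathbf R^d)$ be non-negative. For $\varepsilon\in(0,1]$ set $\varphi^\varepsilon=\varphi(\cdot/\varepsilon)$, $\psi^\varepsilon=\psi(\cdot/\varepsilon)$, $$\varphi^\varepsilon_{j,k}(x)=\varphi^\varepsilon(x-\varepsilon x_j)e^{i\langle x,\xi_k\rangle},\qquad \psi^\varepsilon_{j,k}(x)=\psi^\varepsilon(x-\varepsilon x_j)e^{i\langle x,\xi_k\rangle}.$$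 $(\{\varphi^\varepsilon_{j,k}\}_{j,k\in J},\{\psi^\varepsilon_{j,k}\}_{j,k\in J})$ is an admissible Gabor pair if for each $\varepsilon\in(0,1]$ the two families are dual Gabor frames, i.e. both are frames of $L^2(\mathbf R^d)$ and $g=\sum_{j,k}(g,\psi^\varepsilon_{j,k})_{L^2}\varphi^\varepsilon_{j,k}$ for all $g\in L^2(\mathbf R^d)$. **Discrete wave-front set of modulation space type.** Let an admissible Gabor pair with respect to $\Lambda_1,\Lambda_2$ be given. For $x_0\in X$ let $J_{x_0}(\varepsilon)$ be the set of $j\in J$ with $x_0\in\operatorname{supp}\varphi^\varepsilon_{j,k}$ or $x_0\in\operatorname{supp}\psi^\varepsilon_{j,k}$ (these supports do not depend on $k$). Put $c_{j,k}(\varepsilon)=C_{\varphi,\psi}\,(f,\psi^\varepsilon_{j,k})_{L^2}$, where $(\cdot,\cdot)_{L^2}$ is the extension of the $L^2$ scalar product to the duality between distributions and test functions, and $C_{\varphi,\psi}\neq0$ is a constant depending only on the frames (the coefficients in the expansion $f=\sum_{j,k}c_{j,k}(\varepsilon)\varphi_{j,k}^\varepsilon$). Then $(x_0,\xi_0)\in X\times(\mathbf R^d\setminus0)$ belongs to $DF_{M^{p,q}_{(\omega)}}(f)$ if and only if for each $\varepsilon\in(0,1]$ such that $\operatorname{supp}\psi^\varepsilon_{j,k}\subseteq X$ for all $j\in J_{x_0}(\varepsilon)$ (so that the coefficients below are defined) and each open conical neighbourhood $\Gamma$ of $\xi_0$ one has $$\Big(\sum_{\xi_k\in\Gamma\cap\Lambda_2}\Big(\sum_{j\in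 J_{x_0}(\varepsilon)}|c_{j,k}(\varepsilon)\omega(\xi_k)|^p\Big)^{q/p}\Big)^{1/q}=\infty$$ (usual modifications if $p$ or $q$ is $\infty$). *)

theory Defs
  imports "HOL-Probability.Essential_Supremum"
begin

section \<open>Weights\<close>

definition moderate_weights :: "('a::euclidean_space \<Rightarrow> real) set" where
  "moderate_weights = {\<omega>. \<omega> \<in> borel_measurable lebesgue \<and> (\<forall>x. 0 < \<omega> x) \<and>
     (\<exists>v C. real_polynomial_function v \<and> (\<forall>x. 0 < v x) \<and>
        (\<forall>x y. \<omega> (x + y) \<le> C * \<omega> x * v y))}"

section \<open>Test functions, Schwartz functions, distributions\<close>

primrec iter_partial :: "'d list \<Rightarrow> (real^'d \<Rightarrow> complex) \<Rightarrow> real^'d \<Rightarrow> complex" where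
  "iter_partial [] \<phi> = \<phi>"
| "iter_partial (j # js) \<phi> = (\<lambda>x. frechet_derivative (iter_partial js \<phi>) (at x) (axis j 1))"

definition smooth :: "(real^'d \<Rightarrow> complex) \<Rightarrow> bool" where
  "smooth \<phi> \<longleftrightarrow> (\<forall>js x. iter_partial js \<phi> differentiable (at x))"

definition supp :: "(real^'d \<Rightarrow> complex) \<Rightarrow> (real^'d) set" where
  "supp \<phi> = closure {x. \<phi> x \<noteq> 0}"

text \<open>The set \<open>X\<close> is not required to be open, since the spaces \<open>C\<^sub>0\<^sup>\<infinity>(D \<inter> X)\<close> with \<open>D\<close> a
  parallelepiped are needed; the functions are always smooth on the whole space.\<close>

definition test_functions :: "(real^'d) set \<Rightarrow> (real^'d \<Rightarrow> complex) set" where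
  "test_functions X = {\<phi>. smooth \<phi> \<and> compact (supp \<phi>) \<and> supp \<phi> \<subseteq> X}"

definition schwartz :: "(real^'d \<Rightarrow> complex) set" where
  "schwartz = {\<phi>. smooth \<phi> \<and>
     (\<forall>(N::nat) js. bounded (range (\<lambda>x. (1 + norm x) ^ N *\<^sub>R iter_partial js \<phi> x)))}"

text \<open>The values of \<open>f\<close> outside \<^term>\<open>test_functions X\<close> are irrelevant.\<close>

definition distributions :: "(real^'d) set \<Rightarrow> ((real^'d \<Rightarrow> complex) \<Rightarrow> complex) set" where
  "distributions X = {f.
     (\<forall>\<phi>\<in>test_functions X. \<forall>\<theta>\<in>test_functions X. f (\<lambda>x. \<phi> x + \<theta> x) = f \<phi> + f \<theta>) \<and>
     (\<forall>\<phi>\<in>test_functions X. \<forall>c. f (\<lambda>x. c * \<phi> x) = c * f \<phi>) \<and>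
     (\<forall>K. compact K \<and> K \<subseteq> X \<longrightarrow>
        (\<exists>C N. \<forall>\<phi>\<in>test_functions K.
           cmod (f \<phi>) \<le> C * (\<Sum>js | length js \<le> N. SUP x. cmod (iter_partial js \<phi> x))))}"

text \<open>Cut-off functions are called \<open>\<kappa>\<close>, as the letter chi is the library's vector binder.
  If \<open>f\<close> is a distribution on \<open>X\<close> and \<open>\<kappa>\<close> a test function on \<open>X\<close>, then \<open>dmult \<kappa> f\<close> is the
  product \<open>\<kappa>f\<close>, defined on all smooth functions on the whole space, in particular on all
  Schwartz functions.\<close>

definition dmult ::
  "(real^'d \<Rightarrow> complex) \<Rightarrow> ((real^'d \<Rightarrow> complex) \<Rightarrow> complex) \<Rightarrow> (real^'d \<Rightarrow> complex) \<Rightarrow> complex" where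
  "dmult \<kappa> f = (\<lambda>\<phi>. f (\<lambda>x. \<kappa> x * \<phi> x))"

section \<open>Fourier and short-time Fourier transform\<close>

definition fourier :: "(real^'d \<Rightarrow> complex) \<Rightarrow> real^'d \<Rightarrow> complex" where
  "fourier \<phi> \<xi> = of_real ((2 * pi) powr (- real CARD('d) / 2)) *
     (\<integral>x. \<phi> x * exp (- \<i> * of_real (x \<bullet> \<xi>)) \<partial>lborel)"

definition dfourier ::
  "((real^'d \<Rightarrow> complex) \<Rightarrow> complex) \<Rightarrow> (real^'d \<Rightarrow> complex) \<Rightarrow> complex" where
  "dfourier g = (\<lambda>\<phi>. g (fourier \<phi>))"

definition represents ::
  "(real^'d \<Rightarrow> complex) \<Rightarrow> ((real^'d \<Rightarrow> complex) \<Rightarrow> complex) \<Rightarrow> bool" where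
  "represents h u \<longleftrightarrow>
     (\<forall>\<phi>\<in>schwartz. integrable lborel (\<lambda>x. h x * \<phi> x) \<and> u \<phi> = (\<integral>x. h x * \<phi> x \<partial>lborel))"

text \<open>The Fourier transform of a tempered distribution \<open>g\<close>, as a function. It is only used for
  compactly supported \<open>g\<close>, whose Fourier transform is given by a (unique) continuous function.\<close>

definition fourier_fun :: "((real^'d \<Rightarrow> complex) \<Rightarrow> complex) \<Rightarrow> real^'d \<Rightarrow> complex" where
  "fourier_fun g = (THE h. continuous_on UNIV h \<and> represents h (dfourier g))"

definition stft ::
  "(real^'d \<Rightarrow> complex) \<Rightarrow> ((real^'d \<Rightarrow> complex) \<Rightarrow> complex) \<Rightarrow> real^'d \<Rightarrow> real^'d \<Rightarrow> complex" where
  "stft \<phi> g x \<xi> = fourier_fun (dmult (\<lambda>y. cnj (\<phi> (y - x))) g) \<xi>"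

section \<open>Norms with values in $[0,\infty]$\<close>

definition ennreal_powr :: "ennreal \<Rightarrow> real \<Rightarrow> ennreal" where
  "ennreal_powr a r = (if a = \<infinity> then \<infinity> else ennreal (enn2real a powr r))"

text \<open>For a counting measure this is the \<open>\<ell>\<^sup>p\<close> norm, including the supremum for \<open>p = \<infinity>\<close>.
  Only \<open>p \<ge> 1\<close> is used.\<close>

definition Lp_norm :: "'b measure \<Rightarrow> ennreal \<Rightarrow> ('b \<Rightarrow> ennreal) \<Rightarrow> ennreal" where
  "Lp_norm M p u = (if p = \<infinity> then esssup M u
     else ennreal_powr (\<integral>\<^sup>+x. ennreal_powr (u x) (enn2real p) \<partial>M) (1 / enn2real p))"

definition FL_norm ::
  "ennreal \<Rightarrow> (real^'d \<Rightarrow> real) \<Rightarrow> (real^'d) set \<Rightarrow> ((real^'d \<Rightarrow> complex) \<Rightarrow> complex) \<Rightarrow> ennreal" where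
  "FL_norm q \<omega> \<Gamma> g =
     Lp_norm (lebesgue_on \<Gamma>) q (\<lambda>\<xi>. ennreal (cmod (fourier_fun g \<xi> * of_real (\<omega> \<xi>))))"

definition M_norm ::
  "(real^'d \<Rightarrow> complex) \<Rightarrow> ennreal \<Rightarrow> ennreal \<Rightarrow> (real^'d \<Rightarrow> real) \<Rightarrow> (real^'d) set \<Rightarrow>
     ((real^'d \<Rightarrow> complex) \<Rightarrow> complex) \<Rightarrow> ennreal" where
  "M_norm \<phi> p q \<omega> \<Gamma> g =
     Lp_norm (lebesgue_on \<Gamma>) q (\<lambda>\<xi>.
       Lp_norm lebesgue p (\<lambda>x. ennreal (cmod (stft \<phi> g x \<xi> * of_real (\<omega> \<xi>)))))"

definition FL_discrete_norm ::
  "ennreal \<Rightarrow> (real^'d \<Rightarrow> real) \<Rightarrow> (real^'d) set \<Rightarrow> ((real^'d \<Rightarrow> complex) \<Rightarrow> complex) \<Rightarrow> ennreal" where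
  "FL_discrete_norm q \<omega> H g =
     Lp_norm (count_space H) q (\<lambda>\<xi>. ennreal (cmod (fourier_fun g \<xi> * of_real (\<omega> \<xi>))))"

section \<open>Continuous wave-front sets\<close>

text \<open>The library notion \<^const>\<open>conic\<close> forces nonempty cones to contain the origin.\<close>

definition open_cone :: "(real^'d) set \<Rightarrow> bool" where
  "open_cone \<Gamma> \<longleftrightarrow> open \<Gamma> \<and> 0 \<notin> \<Gamma> \<and> (\<forall>\<xi>\<in>\<Gamma>. \<forall>t>0. t *\<^sub>R \<xi> \<in> \<Gamma>)"

definition WF_FL ::
  "ennreal \<Rightarrow> (real^'d \<Rightarrow> real) \<Rightarrow> (real^'d) set \<Rightarrow> ((real^'d \<Rightarrow> complex) \<Rightarrow> complex) \<Rightarrow>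
     ((real^'d) \<times> (real^'d)) set" where
  "WF_FL q \<omega> X f = {(x0, \<xi>0). x0 \<in> X \<and> \<xi>0 \<noteq> 0 \<and>
     (\<forall>\<kappa> \<Gamma>. \<kappa> \<in> test_functions X \<and> \<kappa> x0 \<noteq> 0 \<and> open_cone \<Gamma> \<and> \<xi>0 \<in> \<Gamma> \<longrightarrow>
        FL_norm q \<omega> \<Gamma> (dmult \<kappa> f) = \<infinity>)}"

definition WF_M ::
  "(real^'d \<Rightarrow> complex) \<Rightarrow> ennreal \<Rightarrow> ennreal \<Rightarrow> (real^'d \<Rightarrow> real) \<Rightarrow> (real^'d) set \<Rightarrow>
     ((real^'d \<Rightarrow> complex) \<Rightarrow> complex) \<Rightarrow> ((real^'d) \<times> (real^'d)) set" where
  "WF_M \<phi> p q \<omega> X f = {(x0, \<xi>0). x0 \<in> X \<and> \<xi>0 \<noteq> 0 \<and>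
     (\<forall>\<kappa> \<Gamma>. \<kappa> \<in> test_functions X \<and> \<kappa> x0 \<noteq> 0 \<and> open_cone \<Gamma> \<and> \<xi>0 \<in> \<Gamma> \<longrightarrow>
        M_norm \<phi> p q \<omega> \<Gamma> (dmult \<kappa> f) = \<infinity>)}"

section \<open>Lattices\<close>

definition lattice_with_basis :: "('d \<Rightarrow> real^'d) \<Rightarrow> (real^'d) set \<Rightarrow> bool" where
  "lattice_with_basis e \<Lambda> \<longleftrightarrow>
     inj e \<and> independent (range e) \<and> span (range e) = UNIV \<and>
     (\<exists>x0. \<Lambda> = {x0 + (\<Sum>j\<in>UNIV. of_int (t j) *\<^sub>R e j) | t :: 'd \<Rightarrow> int. True})"

definition parallelepipeds :: "('d \<Rightarrow> real^'d) \<Rightarrow> (real^'d) set \<Rightarrow> (real^'d) set set" where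
  "parallelepipeds e \<Lambda> =
     {{a + (\<Sum>j\<in>UNIV. t j *\<^sub>R e j) | t. \<forall>j. 0 \<le> t j \<and> t j \<le> 1} | a.
        \<forall>S. a + (\<Sum>j\<in>S. e j) \<in> \<Lambda>}"

definition strongly_admissible ::
  "('d \<Rightarrow> real^'d) \<Rightarrow> (real^'d) set \<Rightarrow> ('d \<Rightarrow> real^'d) \<Rightarrow> (real^'d) set \<Rightarrow> bool" where
  "strongly_admissible e \<Lambda>1 \<epsilon> \<Lambda>2 \<longleftrightarrow>
     lattice_with_basis e \<Lambda>1 \<and> lattice_with_basis \<epsilon> \<Lambda>2 \<and>
     (\<exists>c. 0 < c \<and> c < 2 * pi \<and>
        (\<forall>j. e j \<bullet> \<epsilon> j = c) \<and> (\<forall>j k. j \<noteq> k \<longrightarrow> e j \<bullet> \<epsilon> k = 0))"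

section \<open>Discrete wave-front set of Fourier Lebesgue type\<close>

text \<open>The lattices and the parallelepiped may be chosen separately at each point \<open>x0\<close>, so
  \<open>\<Lambda>2\<close> and \<open>D\<close> are functions of \<open>x0\<close>.\<close>

definition DF_FL_choice ::
  "(real^'d) set \<Rightarrow> (real^'d \<Rightarrow> 'd \<Rightarrow> real^'d) \<Rightarrow> (real^'d \<Rightarrow> (real^'d) set) \<Rightarrow>
     (real^'d \<Rightarrow> 'd \<Rightarrow> real^'d) \<Rightarrow> (real^'d \<Rightarrow> (real^'d) set) \<Rightarrow> (real^'d \<Rightarrow> (real^'d) set) \<Rightarrow> bool" where
  "DF_FL_choice X e \<Lambda>1 \<epsilon> \<Lambda>2 D \<longleftrightarrow>
     (\<forall>x0\<in>X. strongly_admissible (e x0) (\<Lambda>1 x0) (\<epsilon> x0) (\<Lambda>2 x0) \<and>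
        D x0 \<in> parallelepipeds (e x0) (\<Lambda>1 x0) \<and> x0 \<in> interior (D x0))"

definition DF_FL ::
  "(real^'d \<Rightarrow> (real^'d) set) \<Rightarrow> (real^'d \<Rightarrow> (real^'d) set) \<Rightarrow> ennreal \<Rightarrow> (real^'d \<Rightarrow> real) \<Rightarrow>
     (real^'d) set \<Rightarrow> ((real^'d \<Rightarrow> complex) \<Rightarrow> complex) \<Rightarrow> ((real^'d) \<times> (real^'d)) set" where
  "DF_FL \<Lambda>2 D q \<omega> X f = {(x0, \<xi>0). x0 \<in> X \<and> \<xi>0 \<noteq> 0 \<and>
     (\<forall>\<kappa> \<Gamma>. \<kappa> \<in> test_functions (D x0 \<inter> X) \<and> \<kappa> x0 \<noteq> 0 \<and> open_cone \<Gamma> \<and> \<xi>0 \<in> \<Gamma> \<longrightarrow>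
        FL_discrete_norm q \<omega> (\<Gamma> \<inter> \<Lambda>2 x0) (dmult \<kappa> f) = \<infinity>)}"

section \<open>Gabor frames\<close>

definition L2 :: "(real^'d \<Rightarrow> complex) set" where
  "L2 = {g. g \<in> borel_measurable lebesgue \<and> integrable lebesgue (\<lambda>x. (cmod (g x))\<^sup>2)}"

definition L2_norm_sq :: "(real^'d \<Rightarrow> complex) \<Rightarrow> real" where
  "L2_norm_sq g = (\<integral>x. (cmod (g x))\<^sup>2 \<partial>lebesgue)"

definition L2_inner :: "(real^'d \<Rightarrow> complex) \<Rightarrow> (real^'d \<Rightarrow> complex) \<Rightarrow> complex" where
  "L2_inner g h = (\<integral>x. g x * cnj (h x) \<partial>lebesgue)"

definition is_frame :: "'i set \<Rightarrow> ('i \<Rightarrow> real^'d \<Rightarrow> complex) \<Rightarrow> bool" where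
  "is_frame I u \<longleftrightarrow> (\<forall>i\<in>I. u i \<in> L2) \<and>
     (\<exists>A>0. \<exists>B>0. \<forall>g\<in>L2. (\<lambda>i. (cmod (L2_inner g (u i)))\<^sup>2) summable_on I \<and>
        A * L2_norm_sq g \<le> (\<Sum>\<^sub>\<infinity>i\<in>I. (cmod (L2_inner g (u i)))\<^sup>2) \<and>
        (\<Sum>\<^sub>\<infinity>i\<in>I. (cmod (L2_inner g (u i)))\<^sup>2) \<le> B * L2_norm_sq g)"

text \<open>The expansion \<open>g = \<Sum>\<^sub>i (g, v\<^sub>i) u\<^sub>i\<close> is unconditionally convergent in \<open>L\<^sup>2\<close>.\<close>

definition dual_frames ::
  "'i set \<Rightarrow> ('i \<Rightarrow> real^'d \<Rightarrow> complex) \<Rightarrow> ('i \<Rightarrow> real^'d \<Rightarrow> complex) \<Rightarrow> bool" where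
  "dual_frames I u v \<longleftrightarrow> is_frame I u \<and> is_frame I v \<and>
     (\<forall>g\<in>L2. ((\<lambda>F. L2_norm_sq (\<lambda>x. g x - (\<Sum>i\<in>F. L2_inner g (v i) * u i x))) \<longlongrightarrow> 0)
        (finite_subsets_at_top I))"

text \<open>The Gabor systems are indexed by the lattice points \<open>y = x\<^sub>j\<close> and \<open>\<eta> = \<xi>\<^sub>k\<close> themselves
  instead of by labels \<open>j\<close> and \<open>k\<close>.\<close>

definition gabor :: "(real^'d \<Rightarrow> real) \<Rightarrow> real \<Rightarrow> real^'d \<Rightarrow> real^'d \<Rightarrow> real^'d \<Rightarrow> complex" where
  "gabor \<phi> s y \<eta> x = of_real (\<phi> ((1 / s) *\<^sub>R (x - s *\<^sub>R y))) * exp (\<i> * of_real (x \<bullet> \<eta>))"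

definition admissible_gabor_pair ::
  "(real^'d) set \<Rightarrow> (real^'d) set \<Rightarrow> (real^'d \<Rightarrow> real) \<Rightarrow> (real^'d \<Rightarrow> real) \<Rightarrow> bool" where
  "admissible_gabor_pair \<Lambda>1 \<Lambda>2 \<phi> \<psi> \<longleftrightarrow>
     (\<exists>e. lattice_with_basis e \<Lambda>1) \<and> (\<exists>\<epsilon>. lattice_with_basis \<epsilon> \<Lambda>2) \<and>
     (\<lambda>x. of_real (\<phi> x)) \<in> test_functions UNIV \<and> (\<forall>x. 0 \<le> \<phi> x) \<and>
     (\<lambda>x. of_real (\<psi> x)) \<in> test_functions UNIV \<and> (\<forall>x. 0 \<le> \<psi> x) \<and>
     (\<forall>s. 0 < s \<and> s \<le> 1 \<longrightarrow>
        dual_frames (\<Lambda>1 \<times> \<Lambda>2) (\<lambda>(y, \<eta>). gabor \<phi> s y \<eta>) (\<lambda>(y, \<eta>). gabor \<psi> s y \<eta>))"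

section \<open>Discrete wave-front set of modulation space type\<close>

text \<open>The support of \<^term>\<open>gabor \<phi> s y \<eta>\<close> does not depend on \<open>\<eta>\<close>.\<close>

definition gabor_near ::
  "(real^'d) set \<Rightarrow> (real^'d) set \<Rightarrow> (real^'d \<Rightarrow> real) \<Rightarrow> (real^'d \<Rightarrow> real) \<Rightarrow> real^'d \<Rightarrow> real \<Rightarrow>
     (real^'d) set" where
  "gabor_near \<Lambda>1 \<Lambda>2 \<phi> \<psi> x0 s =
     {y \<in> \<Lambda>1. \<exists>\<eta>\<in>\<Lambda>2. x0 \<in> supp (gabor \<phi> s y \<eta>) \<or> x0 \<in> supp (gabor \<psi> s y \<eta>)}"

text \<open>With bilinear duality brackets, the extension of \<open>(f, h)\<close> to distributions \<open>f\<close> and test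
  functions \<open>h\<close> is \<open>f\<close> evaluated at the conjugate of \<open>h\<close>.\<close>

definition gabor_coeff ::
  "complex \<Rightarrow> (real^'d \<Rightarrow> real) \<Rightarrow> ((real^'d \<Rightarrow> complex) \<Rightarrow> complex) \<Rightarrow> real \<Rightarrow>
     real^'d \<Rightarrow> real^'d \<Rightarrow> complex" where
  "gabor_coeff C \<psi> f s y \<eta> = C * f (\<lambda>x. cnj (gabor \<psi> s y \<eta> x))"

definition DF_M ::
  "(real^'d) set \<Rightarrow> (real^'d) set \<Rightarrow> (real^'d \<Rightarrow> real) \<Rightarrow> (real^'d \<Rightarrow> real) \<Rightarrow> complex \<Rightarrow>
     ennreal \<Rightarrow> ennreal \<Rightarrow> (real^'d \<Rightarrow> real) \<Rightarrow> (real^'d) set \<Rightarrow>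
     ((real^'d \<Rightarrow> complex) \<Rightarrow> complex) \<Rightarrow> ((real^'d) \<times> (real^'d)) set" where
  "DF_M \<Lambda>1 \<Lambda>2 \<phi> \<psi> C p q \<omega> X f = {(x0, \<xi>0). x0 \<in> X \<and> \<xi>0 \<noteq> 0 \<and>
     (\<forall>s \<Gamma>. 0 < s \<and> s \<le> 1 \<and>
        (\<forall>y\<in>gabor_near \<Lambda>1 \<Lambda>2 \<phi> \<psi> x0 s. \<forall>\<eta>\<in>\<Lambda>2. supp (gabor \<psi> s y \<eta>) \<subseteq> X) \<and>
        open_cone \<Gamma> \<and> \<xi>0 \<in> \<Gamma> \<longrightarrow>
        Lp_norm (count_space (\<Gamma> \<inter> \<Lambda>2)) q (\<lambda>\<eta>.
          Lp_norm (count_space (gabor_near \<Lambda>1 \<Lambda>2 \<phi> \<psi> x0 s)) p (\<lambda>y.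
            ennreal (cmod (gabor_coeff C \<psi> f s y \<eta> * of_real (\<omega> \<eta>))))) = \<infinity>)}"

end

theory Submission
  imports Defs "HOL-Probability.Probability" "HOL-Real_Asymp.Real_Asymp"
begin

subsection \<open>Iterated partial derivatives\<close>

text \<open>Inside X x (R^d without 0), all four sets have the same complement: the pairs at which f
  is \<open>locally_regular\<close>. That notion asks for a neighbourhood U of x0, a separated set S
  of frequencies and finitely many windows \<open>\<psi> j\<close> with two properties. Every
  product of a test function on U with a smooth m can be rebuilt from the windows and the characters
  \<open>ch k\<close>, k in S (\<open>expands\<close>). And the values of f at the products of
  \<open>\<psi> j\<close> and \<open>ch k\<close>, weighted by \<omega>, are q-summable over those k
  in S that lie in some conical neighbourhood of \<xi>0.

  Regularity makes every norm finite. Rebuild \<kappa> m \<open>ch \<xi>\<close> and apply f: the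
  result is a sum over j and k of f(\<open>\<psi> j\<close> \<open>ch k\<close>) times the Fourier
  integral of \<open>\<alpha> j\<close> m at \<xi> - k, which decays faster than any power of |\<xi>
  - k| (\<open>fourier_decay\<close>). For k in the good cone, moderateness moves the weight from
  \<xi> to k at the price of a power of |\<xi> - k|. For k outside it and \<xi> in a narrower cone,
  |\<xi> - k| controls both |\<xi>| and |k| (\<open>open_cone_shrink\<close>), so the polynomial
  growth of f and of \<omega> is absorbed by the decay. This is \<open>regular_estimate\<close>: a
  majorant that sums a(k) (1 + |\<xi> - k|)^(-2N) with a in l^q. By \<open>amalgam_finite\<close>
  such majorants are q-integrable over a cone and q-summable over every separated set. The estimate
  depends on m only through bounds for finitely many derivatives on a fixed ball. Hence m = 1 treats
  the Fourier Lebesgue norms, continuous and discrete, and the Gabor coefficients at a small scale,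
  while a conjugated translate of a Schwartz window gives the short-time Fourier transform with
  decay in the translation x, so that the L^p norm in x costs only a constant, for each p.

  Conversely, a finite norm produces an expansion. On a parallelepiped D of a strongly admissible
  pair, products of \<kappa> with the characters of the dual lattice work, because c < 2 pi makes D
  fit into the interior of a period cell (\<open>fourier_series\<close>,
  \<open>expands_parallelepiped\<close>). This settles the discrete Fourier Lebesgue case. A finite
  integral over a cone gives, by averaging over all translates of a lattice, one translate with a
  finite sum (\<open>finite_lattice_sum\<close>). A finite modulation norm reduces to that case:
  averaging the short-time transform over a box of translations replaces the window by an extra
  smooth cut-off (\<open>averaged_window\<close>). For a Gabor pair the expansion is the dual frame
  identity itself. Near x0 only finitely many translates contribute, and pairing the identity with
  smooth functions makes it pointwise (\<open>gabor_expansion\<close>).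

  The analysis below this rests on two tools. Cut-off smooth functions are absolutely convergent
  series of characters times one fixed test function (\<open>local_representation\<close>), and
  distributions commute with such series (\<open>distribution_series\<close>). So f can be moved
  under integrals and limits, which identifies the Fourier transform of \<kappa> f with f evaluated
  at \<kappa> \<open>ch \<xi>\<close> (\<open>fourier_fun_dmult\<close>).\<close>

abbreviation pd :: "'d \<Rightarrow> (real^'d \<Rightarrow> complex) \<Rightarrow> real^'d \<Rightarrow> complex" where
  "pd j u \<equiv> (\<lambda>x. frechet_derivative u (at x) (axis j 1))"

lemma iter_partial_append: "iter_partial (js @ ks) u = iter_partial js (iter_partial ks u)"
  by (induction js) auto

lemma iter_partial_snoc: "iter_partial (js @ [j]) u = iter_partial js (pd j u)"
  by (simp add: iter_partial_append)

text \<open>A finite-order form of \<open>smooth\<close> whose recursion removes the derivative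
  applied first. An induction on the order, with the function arbitrary, then needs only the formula
  for one partial derivative.\<close>

primrec Ck :: "nat \<Rightarrow> (real^'d \<Rightarrow> complex) \<Rightarrow> bool" where
  "Ck 0 u \<longleftrightarrow> (\<forall>x. u differentiable at x)"
| "Ck (Suc n) u \<longleftrightarrow> (\<forall>x. u differentiable at x) \<and> (\<forall>j. Ck n (pd j u))"

lemma Ck_iff: "Ck n u \<longleftrightarrow> (\<forall>js x. length js \<le> n \<longrightarrow> iter_partial js u differentiable at x)"
proof (induction n arbitrary: u)
  case (Suc n)
  show ?case
  proof
    assume *: "Ck (Suc n) u"
    show "\<forall>js x. length js \<le> Suc n \<longrightarrow> iter_partial js u differentiable at x"
    proof (intro allI impI)
      fix js :: "'a list" and x assume "length js \<le> Suc n"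
      \<comment> \<open>The list is split at its right end, where the derivative applied first is
        stored.\<close>
      then show "iter_partial js u differentiable at x"
        using * Suc by (cases js rule: rev_cases) (auto simp: iter_partial_snoc)
    qed
  next
    assume *: "\<forall>js x. length js \<le> Suc n \<longrightarrow> iter_partial js u differentiable at x"
    have "iter_partial js (pd j u) differentiable at x" if "length js \<le> n" for js j x
      using *[rule_format, of "js @ [j]" x] that by (simp add: iter_partial_snoc)
    then show "Ck (Suc n) u"
      using Suc *[rule_format, of "[]"] by auto
  qed
qed auto

lemma smooth_iff_Ck: "smooth u \<longleftrightarrow> (\<forall>n. Ck n u)"
  unfolding smooth_def Ck_iff by auto

lemma smooth_differentiable: "smooth u \<Longrightarrow> u differentiable at x"
  unfolding smooth_def by (metis iter_partial.simps(1))

lemma smooth_iter_partial: "smooth u \<Longrightarrow> smooth (iter_partial js u)"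
  unfolding smooth_def by (metis iter_partial_append)

lemma smooth_pd: "smooth u \<Longrightarrow> smooth (pd j u)"
  using smooth_iter_partial[of u "[j]"] by simp

lemma smooth_continuous_on: "smooth u \<Longrightarrow> continuous_on S u"
  by (meson continuous_at_imp_continuous_on differentiable_imp_continuous_within smooth_differentiable)

lemma smooth_measurable: "smooth u \<Longrightarrow> u \<in> borel_measurable borel"
  by (intro borel_measurable_continuous_onI smooth_continuous_on)

lemma has_derivative_partials:
  assumes "u differentiable at x"
  shows "(u has_derivative (\<lambda>h. \<Sum>j\<in>UNIV. (h $ j) *\<^sub>R pd j u x)) (at x)"
proof -
  have d: "(u has_derivative frechet_derivative u (at x)) (at x)"
    using assms frechet_derivative_works by blast
  then interpret l: linear "frechet_derivative u (at x)"
    by (rule has_derivative_linear)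
  have "frechet_derivative u (at x) h = (\<Sum>j\<in>UNIV. (h $ j) *\<^sub>R pd j u x)" for h
  proof -
    have "h = (\<Sum>j\<in>UNIV. (h $ j) *\<^sub>R axis j 1)"
      by (simp add: vec_eq_iff axis_def if_distrib cong: if_cong)
    then have "frechet_derivative u (at x) h = frechet_derivative u (at x) (\<Sum>j\<in>UNIV. (h $ j) *\<^sub>R axis j 1)"
      by simp
    then show ?thesis by (simp add: l.sum l.scaleR)
  qed
  then have "frechet_derivative u (at x) = (\<lambda>h. \<Sum>j\<in>UNIV. (h $ j) *\<^sub>R pd j u x)" by (rule ext)
  then show ?thesis using d by (simp only:)
qed

lemma pd_eqI:
  assumes "(u has_derivative u') (at x)" shows "pd j u x = u' (axis j 1)"
  using frechet_derivative_at[OF assms] by simp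

lemma pd_const: "pd j (\<lambda>x. c) = (\<lambda>x. 0)"
  using pd_eqI[OF has_derivative_const] by blast

lemma pd_add:
  assumes "u differentiable at x" "v differentiable at x"
  shows "pd j (\<lambda>x. u x + v x) x = pd j u x + pd j v x"
proof -
  have a: "(u has_derivative frechet_derivative u (at x)) (at x)" "(v has_derivative frechet_derivative v (at x)) (at x)"
    using assms frechet_derivative_works by blast+
  from pd_eqI[OF has_derivative_add[OF a], of j] show ?thesis by simp
qed

lemma pd_mult:
  assumes "u differentiable at x" "v differentiable at x"
  shows "pd j (\<lambda>x. u x * v x) x = pd j u x * v x + u x * pd j v x"
proof -
  have a: "(u has_derivative frechet_derivative u (at x)) (at x)" "(v has_derivative frechet_derivative v (at x)) (at x)"
    using assms frechet_derivative_works by blast+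
  from pd_eqI[OF has_derivative_mult[OF a], of j] show ?thesis by simp
qed

lemma pd_cnj:
  assumes "u differentiable at x"
  shows "pd j (\<lambda>x. cnj (u x)) x = cnj (pd j u x)"
proof -
  have a: "(u has_derivative frechet_derivative u (at x)) (at x)"
    using assms frechet_derivative_works by blast+
  from pd_eqI[OF has_derivative_cnj[OF a], of j] show ?thesis by simp
qed

lemma pd_affine:
  assumes "u differentiable at (r *\<^sub>R x + b)"
  shows "pd j (\<lambda>x. u (r *\<^sub>R x + b)) x = of_real r * pd j u (r *\<^sub>R x + b)"
    and "(\<lambda>x. u (r *\<^sub>R x + b)) differentiable at x"
proof -
  have d: "(u has_derivative frechet_derivative u (at (r *\<^sub>R x + b))) (at (r *\<^sub>R x + b))"
    using assms frechet_derivative_works by blast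
  have g: "((\<lambda>x. r *\<^sub>R x + b) has_derivative (\<lambda>h. r *\<^sub>R h)) (at x)"
    by (auto intro!: derivative_eq_intros)
  have c: "((\<lambda>x. u (r *\<^sub>R x + b)) has_derivative (\<lambda>h. frechet_derivative u (at (r *\<^sub>R x + b)) (r *\<^sub>R h))) (at x)"
    using has_derivative_compose[OF g d] .
  show "pd j (\<lambda>x. u (r *\<^sub>R x + b)) x = of_real r * pd j u (r *\<^sub>R x + b)"
    using pd_eqI[OF c, of j] linear_cmul[OF has_derivative_linear[OF d]]
    by (simp add: scaleR_conv_of_real)
  show "(\<lambda>x. u (r *\<^sub>R x + b)) differentiable at x"
    using c differentiableI by blast
qed

section \<open>Closure properties of finite-order smoothness\<close>

lemma Ck_mono: "Ck n u \<Longrightarrow> m \<le> n \<Longrightarrow> Ck m u"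
  by (auto simp: Ck_iff)

lemma Ck_diff: "Ck n u \<Longrightarrow> u differentiable at x"
  by (cases n) auto

lemma Ck_const: "Ck n (\<lambda>x. c)"
  by (induction n arbitrary: c) (auto simp: pd_const)

lemma Ck_add: "Ck n u \<Longrightarrow> Ck n v \<Longrightarrow> Ck n (\<lambda>x. u x + v x)"
  by (induction n arbitrary: u v) (auto simp: pd_add)

lemma Ck_mult: "Ck n u \<Longrightarrow> Ck n v \<Longrightarrow> Ck n (\<lambda>x. u x * v x)"
proof (induction n arbitrary: u v)
  case (Suc n)
  then have u: "Ck n u" "Ck n v" using Ck_mono by (meson le_Suc_eq order_refl)+
  show ?case using Suc u
    by (auto simp: pd_mult intro!: Ck_add)
qed auto

lemma differentiable_cnj: "u differentiable at x \<Longrightarrow> (\<lambda>x. cnj (u x)) differentiable at x"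
  unfolding differentiable_def by (blast intro: has_derivative_cnj)

lemma Ck_cnj: "Ck n u \<Longrightarrow> Ck n (\<lambda>x. cnj (u x))"
  by (induction n arbitrary: u) (auto simp: pd_cnj differentiable_cnj)

lemma Ck_affine: "Ck n u \<Longrightarrow> Ck n (\<lambda>x. u (r *\<^sub>R x + b))"
proof (induction n arbitrary: u)
  case 0
  then show ?case using pd_affine(2)[of u r _ b] by simp
next
  case (Suc n)
  have "pd j (\<lambda>x. u (r *\<^sub>R x + b)) = (\<lambda>x. of_real r * pd j u (r *\<^sub>R x + b))" for j
    using Suc.prems by (intro ext pd_affine(1)) simp
  moreover have "Ck n (\<lambda>x. of_real r * pd j u (r *\<^sub>R x + b))" for j
    using Suc by (intro Ck_mult Ck_const Suc.IH) simp
  ultimately show ?case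
    using Suc.prems pd_affine(2)[of u r _ b] by simp
qed

lemma smooth_const [simp]: "smooth (\<lambda>x. c)"
  by (simp add: smooth_iff_Ck Ck_const)

lemma smooth_add: "smooth u \<Longrightarrow> smooth v \<Longrightarrow> smooth (\<lambda>x. u x + v x)"
  by (simp add: smooth_iff_Ck Ck_add)

lemma smooth_mult: "smooth u \<Longrightarrow> smooth v \<Longrightarrow> smooth (\<lambda>x. u x * v x)"
  by (simp add: smooth_iff_Ck Ck_mult)

lemma smooth_cnj: "smooth u \<Longrightarrow> smooth (\<lambda>x. cnj (u x))"
  by (simp add: smooth_iff_Ck Ck_cnj)

lemma smooth_affine: "smooth u \<Longrightarrow> smooth (\<lambda>x. u (r *\<^sub>R x + b))"
  by (simp add: smooth_iff_Ck Ck_affine)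

lemma smooth_shift: "smooth u \<Longrightarrow> smooth (\<lambda>y. u (y - x))"
  using smooth_affine[of u 1 "-x"] by simp

lemma smooth_sum: "(\<And>i. i \<in> I \<Longrightarrow> smooth (u i)) \<Longrightarrow> smooth (\<lambda>x. \<Sum>i\<in>I. u i x)"
  by (induction I rule: infinite_finite_induct) (simp_all add: smooth_add)

lemma smooth_coord: "smooth (\<lambda>x::real^'d. complex_of_real (x $ j))"
proof -
  have d: "((\<lambda>x::real^'d. complex_of_real (x $ j)) has_derivative (\<lambda>h. complex_of_real (h $ j))) (at x)" for x
    by (intro bounded_linear_imp_has_derivative bounded_linear_compose[OF bounded_linear_of_real] bounded_linear_vec_nth)
  have "pd i (\<lambda>x::real^'d. complex_of_real (x $ j)) = (\<lambda>x. complex_of_real (axis i 1 $ j))" for i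
    using pd_eqI[OF d] by auto
  then have "Ck n (\<lambda>x::real^'d. complex_of_real (x $ j))" for n
    using d by (cases n) (auto simp: Ck_const differentiable_def simp del: axis_nth)
  then show ?thesis by (simp add: smooth_iff_Ck)
qed

section \<open>Algebra, size and support of iterated partial derivatives\<close>

lemma iter_partial_add:
  assumes "smooth u" "smooth v"
  shows "iter_partial js (\<lambda>x. u x + v x) = (\<lambda>x. iter_partial js u x + iter_partial js v x)"
  using assms
proof (induction js arbitrary: u v rule: rev_induct)
  case (snoc j js)
  have "pd j (\<lambda>x. u x + v x) = (\<lambda>x. pd j u x + pd j v x)"
    using snoc.prems by (auto simp: pd_add smooth_differentiable)
  then show ?case
    using snoc by (simp add: iter_partial_snoc smooth_pd)
qed simp

lemma iter_partial_mult_const: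
  assumes "smooth u"
  shows "iter_partial js (\<lambda>x. c * u x) = (\<lambda>x. c * iter_partial js u x)"
  using assms
proof (induction js arbitrary: u rule: rev_induct)
  case (snoc j js)
  have "pd j (\<lambda>x. c * u x) = (\<lambda>x. c * pd j u x)"
    using snoc.prems pd_mult[of "\<lambda>x. c" _ u j] by (auto simp: smooth_differentiable pd_const)
  then show ?case
    using snoc by (simp add: iter_partial_snoc smooth_pd)
qed simp

lemma iter_partial_cnj:
  assumes "smooth u"
  shows "iter_partial js (\<lambda>x. cnj (u x)) = (\<lambda>x. cnj (iter_partial js u x))"
  using assms
proof (induction js arbitrary: u rule: rev_induct)
  case (snoc j js)
  have "pd j (\<lambda>x. cnj (u x)) = (\<lambda>x. cnj (pd j u x))"
    using snoc.prems by (auto simp: smooth_differentiable pd_cnj)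
  then show ?case
    using snoc by (simp add: iter_partial_snoc smooth_pd)
qed simp

lemma iter_partial_shift:
  assumes "smooth u"
  shows "iter_partial js (\<lambda>y. u (y - x)) = (\<lambda>y. iter_partial js u (y - x))"
  using assms
proof (induction js arbitrary: u rule: rev_induct)
  case (snoc j js)
  have "pd j (\<lambda>y. u (y - x)) = (\<lambda>y. pd j u (y - x))"
    using snoc.prems pd_affine[of u 1 _ "-x"] by (auto simp: smooth_differentiable)
  then show ?case
    using snoc.IH[OF smooth_pd[OF snoc.prems]] by (simp only: iter_partial_snoc)
qed simp

text \<open>Each derivative doubles the number of terms in the Leibniz rule, hence the power of 2.
  The bounds are taken at the single point x, so that factors controlled only on a ball can be
  treated.\<close>

lemma iter_partial_mult_bound:
  assumes "smooth u" "smooth v"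
    and "\<forall>ks. length ks \<le> length js \<longrightarrow> cmod (iter_partial ks u x) \<le> A"
    and "\<forall>ks. length ks \<le> length js \<longrightarrow> cmod (iter_partial ks v x) \<le> B"
  shows "cmod (iter_partial js (\<lambda>x. u x * v x) x) \<le> 2 ^ length js * A * B"
  using assms
proof (induction js arbitrary: u v rule: rev_induct)
  case Nil
  then have *: "cmod (u x) \<le> A" "cmod (v x) \<le> B" by (metis iter_partial.simps(1) order_refl)+
  then have "0 \<le> A" using norm_ge_zero order_trans by blast
  then show ?case using * by (auto simp: norm_mult intro!: mult_mono)
next
  case (snoc j js)
  have eq: "pd j (\<lambda>x. u x * v x) = (\<lambda>x. pd j u x * v x + u x * pd j v x)"
    using snoc.prems by (auto simp: pd_mult smooth_differentiable)
  have sm: "smooth (pd j u)" "smooth (pd j v)" using snoc.prems smooth_pd by blast+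
  have pu: "cmod (iter_partial ks (pd j u) x) \<le> A" if "length ks \<le> length js" for ks
    using snoc.prems(3)[rule_format, of "ks @ [j]"] that by (simp add: iter_partial_snoc)
  have pv: "cmod (iter_partial ks (pd j v) x) \<le> B" if "length ks \<le> length js" for ks
    using snoc.prems(4)[rule_format, of "ks @ [j]"] that by (simp add: iter_partial_snoc)
  have "cmod (iter_partial js (\<lambda>x. pd j u x * v x) x) \<le> 2 ^ length js * A * B"
    by (rule snoc.IH[of "pd j u" v]) (use sm pu snoc.prems(2,4) in simp_all)
  moreover have "cmod (iter_partial js (\<lambda>x. u x * pd j v x) x) \<le> 2 ^ length js * A * B"
    by (rule snoc.IH[of u "pd j v"]) (use sm pv snoc.prems(1,3) in simp_all)
  moreover have "iter_partial (js @ [j]) (\<lambda>x. u x * v x) x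
     = iter_partial js (\<lambda>x. pd j u x * v x) x + iter_partial js (\<lambda>x. u x * pd j v x) x"
    unfolding iter_partial_snoc eq
    by (subst iter_partial_add[OF smooth_mult[OF sm(1) snoc.prems(2)] smooth_mult[OF snoc.prems(1) sm(2)]]) simp
  ultimately show ?case
    using norm_triangle_ineq[of "iter_partial js (\<lambda>x. pd j u x * v x) x" "iter_partial js (\<lambda>x. u x * pd j v x) x"]
    by simp
qed

text \<open>The complement of the support is open, so there every derivative is that of a locally
  vanishing function.\<close>

lemma iter_partial_outside:
  assumes "x \<notin> supp u" shows "iter_partial js u x = 0"
proof -
  have "\<forall>x\<in>- supp u. iter_partial js u x = 0"
  proof (induction js)
    case Nil
    have "{x. u x \<noteq> 0} \<subseteq> supp u" unfolding supp_def by (rule closure_subset)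
    then show ?case by auto
  next
    case (Cons j js)
    have "open (- supp u)" unfolding supp_def by (intro open_Compl closed_closure)
    have d: "(iter_partial js u has_derivative (\<lambda>h. 0)) (at x)" if "x \<in> - supp u" for x
      by (rule has_derivative_transform_within_open[OF has_derivative_const \<open>open (- supp u)\<close> that])
        (use Cons in auto)
    show ?case
    proof
      fix x assume x: "x \<in> - supp u"
      from pd_eqI[OF d[OF x], of j] show "iter_partial (j # js) u x = 0" by (simp only: iter_partial.simps)
    qed
  qed
  then show ?thesis using assms by auto
qed

subsection \<open>Characters\<close>

text \<open>The kernel of the Fourier transform as a function of x. With this sign, f evaluated at
  \<kappa> \<open>ch \<xi>\<close> is the Fourier transform of \<kappa> f at \<xi> up to the
  normalising constant.\<close>

definition ch :: "real^'d \<Rightarrow> real^'d \<Rightarrow> complex" where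
  "ch \<xi> x = exp (- \<i> * of_real (x \<bullet> \<xi>))"

lemma ch_add: "ch (\<xi> + \<eta>) x = ch \<xi> x * ch \<eta> x"
proof -
  have "- \<i> * of_real (x \<bullet> (\<xi> + \<eta>)) = - \<i> * complex_of_real (x \<bullet> \<xi>) + - \<i> * complex_of_real (x \<bullet> \<eta>)"
    by (simp add: inner_add_right distrib_left)
  then show ?thesis unfolding ch_def by (simp only: exp_add)
qed

lemma norm_ch [simp]: "cmod (ch \<xi> x) = 1"
  by (simp add: ch_def)

lemma ch_0 [simp]: "ch 0 x = 1"
  by (simp add: ch_def)

lemma ch_minus: "ch (- \<xi>) x = exp (\<i> * of_real (x \<bullet> \<xi>))"
  by (simp add: ch_def)

lemma cnj_ch: "cnj (ch \<xi> x) = ch (- \<xi>) x"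
  by (simp add: ch_def exp_cnj)

lemma ch_mult_minus: "ch \<xi> x * ch (- \<xi>) x = 1" "ch (- \<xi>) x * ch \<xi> x = 1"
  by (simp_all flip: ch_add)

lemma ch_nonzero [simp]: "ch \<xi> x \<noteq> 0"
  by (simp add: ch_def)

lemma ch_swap: "ch \<xi> x = ch x \<xi>"
  by (simp add: ch_def inner_commute)

lemma continuous_ch [continuous_intros]:
  assumes "continuous_on S a" "continuous_on S b" shows "continuous_on S (\<lambda>t. ch (a t) (b t))"
  unfolding ch_def by (intro continuous_intros assms)

lemma measurable_ch [measurable]: "(\<lambda>(\<xi>, x). ch \<xi> x) \<in> borel_measurable borel"
  unfolding case_prod_unfold by (intro borel_measurable_continuous_onI continuous_intros)

lemma has_derivative_ch: "(ch \<xi> has_derivative (\<lambda>h. - \<i> * of_real (h \<bullet> \<xi>) * ch \<xi> x)) (at x)"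
proof -
  have "((\<lambda>x. - \<i> * complex_of_real (x \<bullet> \<xi>)) has_derivative (\<lambda>h. - \<i> * of_real (h \<bullet> \<xi>))) (at x)"
    by (intro bounded_linear_imp_has_derivative bounded_linear_const_mult bounded_linear_compose[OF bounded_linear_of_real]
        bounded_linear_inner_left)
  from has_derivative_compose[OF this DERIV_exp[THEN has_field_derivative_imp_has_derivative]]
  show ?thesis unfolding ch_def[abs_def] by (simp add: mult_ac)
qed

lemma pd_ch: "pd j (ch \<xi>) = (\<lambda>x. (- \<i> * of_real (\<xi> $ j)) * ch \<xi> x)"
  by (rule ext, subst pd_eqI[OF has_derivative_ch]) (simp add: inner_axis')

lemma smooth_ch [simp]: "smooth (ch \<xi>)"
proof -
  have "Ck n (ch \<xi>)" for n
  proof (induction n)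
    case 0 show ?case using has_derivative_ch by (auto simp: differentiable_def)
  next
    case (Suc n)
    have "Ck n (pd j (ch \<xi>))" for j
      unfolding pd_ch by (intro Ck_mult Ck_const Suc)
    then show ?case using has_derivative_ch by (auto simp: differentiable_def)
  qed
  then show ?thesis by (simp add: smooth_iff_Ck)
qed

lemma iter_partial_ch: "iter_partial js (ch \<xi>) = (\<lambda>x. (\<Prod>j\<leftarrow>js. - \<i> * of_real (\<xi> $ j)) * ch \<xi> x)"
proof (induction js)
  case (Cons j js)
  have "pd j (\<lambda>x. c * ch \<xi> x) = (\<lambda>x. c * ((- \<i> * of_real (\<xi> $ j)) * ch \<xi> x))" for c
    using iter_partial_mult_const[of "ch \<xi>" "[j]" c] pd_ch[of \<xi> j] by simp
  then show ?case by (simp only: iter_partial.simps Cons.IH) (simp add: mult_ac)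
qed simp

lemma norm_iter_partial_ch: "cmod (iter_partial js (ch \<xi>) x) \<le> norm \<xi> ^ length js"
proof -
  have "cmod (\<Prod>j\<leftarrow>js. - \<i> * of_real (\<xi> $ j)) \<le> norm \<xi> ^ length js"
    by (induction js) (auto simp: norm_mult component_le_norm_cart intro!: mult_mono)
  then show ?thesis by (simp add: iter_partial_ch norm_mult)
qed

subsection \<open>Test functions\<close>

lemma supp_I: "u x \<noteq> 0 \<Longrightarrow> x \<in> supp u"
  unfolding supp_def by (rule subsetD[OF closure_subset]) simp

lemma supp_outside: "x \<notin> supp u \<Longrightarrow> u x = 0"
  using supp_I by blast

lemma supp_subsetI: "closed S \<Longrightarrow> (\<And>x. x \<notin> S \<Longrightarrow> u x = 0) \<Longrightarrow> supp u \<subseteq> S"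
  unfolding supp_def by (intro closure_minimal) auto

lemma closed_supp: "closed (supp u)"
  unfolding supp_def by simp

lemma tf_smooth: "u \<in> test_functions X \<Longrightarrow> smooth u"
  and tf_compact: "u \<in> test_functions X \<Longrightarrow> compact (supp u)"
  and tf_supp: "u \<in> test_functions X \<Longrightarrow> supp u \<subseteq> X"
  unfolding test_functions_def by auto

lemma tf_outside: "u \<in> test_functions X \<Longrightarrow> x \<notin> X \<Longrightarrow> u x = 0"
  using supp_I[of u x] tf_supp[of u X] by auto

lemma tf_mono: "u \<in> test_functions X \<Longrightarrow> X \<subseteq> Y \<Longrightarrow> u \<in> test_functions Y"
  unfolding test_functions_def by auto

lemma tf_supp_subset: "u \<in> test_functions X \<Longrightarrow> supp u \<subseteq> Y \<Longrightarrow> u \<in> test_functions Y"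
  unfolding test_functions_def by auto

lemma tf_cong_supp:
  assumes "u \<in> test_functions X" "smooth v" "\<And>x. u x = 0 \<Longrightarrow> v x = 0"
  shows "v \<in> test_functions X"
proof -
  have "supp v \<subseteq> supp u" using assms(3) unfolding supp_def by (intro closure_mono) auto
  then show ?thesis
    using assms closed_supp[of v] unfolding test_functions_def
    by (metis (mono_tags, lifting) compact_Int_closed inf.absorb_iff2 mem_Collect_eq order_trans)
qed

lemma tf_mult: "u \<in> test_functions X \<Longrightarrow> smooth v \<Longrightarrow> (\<lambda>x. u x * v x) \<in> test_functions X"
  by (rule tf_cong_supp) (auto intro: smooth_mult tf_smooth)

lemma tf_mult_left: "u \<in> test_functions X \<Longrightarrow> smooth v \<Longrightarrow> (\<lambda>x. v x * u x) \<in> test_functions X"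
  by (rule tf_cong_supp[of u]) (auto intro: smooth_mult tf_smooth)

lemma tf_zero: "(\<lambda>x. 0) \<in> test_functions X"
  by (simp add: test_functions_def supp_def)

lemma tf_add:
  assumes "u \<in> test_functions X" "v \<in> test_functions X"
  shows "(\<lambda>x. u x + v x) \<in> test_functions X"
proof -
  have s: "supp (\<lambda>x. u x + v x) \<subseteq> supp u \<union> supp v"
    by (rule supp_subsetI) (simp_all add: closed_supp closed_Un supp_outside)
  have "compact (supp u \<union> supp v)" using assms tf_compact by blast
  then have "compact (supp (\<lambda>x. u x + v x))"
    using s closed_supp[of "\<lambda>x. u x + v x"] by (metis compact_Int_closed inf.absorb_iff2)
  then show ?thesis using s assms unfolding test_functions_def by (auto intro: smooth_add)
qed

lemma tf_sum: "(\<And>i. i \<in> I \<Longrightarrow> u i \<in> test_functions X) \<Longrightarrow> (\<lambda>x. \<Sum>i\<in>I. u i x) \<in> test_functions X"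
  by (induction I rule: infinite_finite_induct) (auto simp: tf_zero intro: tf_add)

lemma tf_cnj: "u \<in> test_functions X \<Longrightarrow> (\<lambda>x. cnj (u x)) \<in> test_functions X"
  by (rule tf_cong_supp[of u]) (auto intro: smooth_cnj tf_smooth)

lemma tf_iter_partial: "u \<in> test_functions X \<Longrightarrow> iter_partial js u \<in> test_functions X"
proof -
  assume u: "u \<in> test_functions X"
  have "supp (iter_partial js u) \<subseteq> supp u"
    by (rule supp_subsetI) (auto simp: closed_supp iter_partial_outside)
  then show ?thesis
    using u closed_supp[of "iter_partial js u"] smooth_iter_partial[of u js] unfolding test_functions_def
    by (metis (mono_tags, lifting) compact_Int_closed inf.absorb_iff2 mem_Collect_eq order_trans)
qed

lemma tf_bounded:
  assumes "u \<in> test_functions X"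
  shows "\<exists>B. \<forall>x. cmod (u x) \<le> B"
proof -
  have "compact (u ` supp u)"
    using assms by (intro compact_continuous_image smooth_continuous_on tf_smooth tf_compact)
  then obtain B where B: "\<And>x. x \<in> supp u \<Longrightarrow> cmod (u x) \<le> B"
    using compact_imp_bounded bounded_iff by (metis imageI)
  have "cmod (u x) \<le> max B 0" for x
    using B[of x] supp_I[of u x] by fastforce
  then show ?thesis by blast
qed

lemma finite_length_le: "finite {js::'d::finite list. length js \<le> N}"
  using finite_lists_length_le[of "UNIV :: 'd set" N] by simp

text \<open>Since the property is upward closed in the bound, the maximum of finitely many bounds
  serves all indices.\<close>

lemma finite_uniform_bound:
  assumes "finite I" "\<And>i. i \<in> I \<Longrightarrow> \<exists>B::real. P i B" "\<And>i B B'. P i B \<Longrightarrow> B \<le> B' \<Longrightarrow> P i B'"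
  shows "\<exists>B\<ge>0. \<forall>i\<in>I. P i B"
  using assms(1,2)
proof (induction I)
  case (insert i I)
  then obtain B where "B \<ge> 0" "\<forall>i\<in>I. P i B" by auto
  moreover obtain B' where "P i B'" using insert.prems by auto
  ultimately show ?case using assms(3) by (intro exI[of _ "max B B'"]) (auto simp: max.coboundedI1)
qed auto

lemma tf_derivs_bounded:
  assumes "u \<in> test_functions X"
  shows "\<exists>B\<ge>0. \<forall>ks x. length ks \<le> N \<longrightarrow> cmod (iter_partial ks u x) \<le> B"
proof -
  have "\<exists>B\<ge>0. \<forall>ks\<in>{ks. length ks \<le> N}. \<forall>x. cmod (iter_partial ks u x) \<le> B"
    by (rule finite_uniform_bound[OF finite_length_le tf_bounded[OF tf_iter_partial[OF assms]]]) (auto intro: order_trans)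
  then show ?thesis by auto
qed

lemma smooth_derivs_bounded_on:
  assumes "smooth u" "compact K"
  shows "\<exists>B\<ge>0. \<forall>ks. length ks \<le> N \<longrightarrow> (\<forall>x\<in>K. cmod (iter_partial ks u x) \<le> B)"
proof -
  have *: "\<exists>B. \<forall>x\<in>K. cmod (iter_partial ks u x) \<le> B" for ks
  proof -
    have "compact (iter_partial ks u ` K)"
      by (intro compact_continuous_image smooth_continuous_on smooth_iter_partial assms)
    then show ?thesis using compact_imp_bounded bounded_iff by (metis imageI)
  qed
  have "\<exists>B\<ge>0. \<forall>ks\<in>{ks. length ks \<le> N}. \<forall>x\<in>K. cmod (iter_partial ks u x) \<le> B"
    by (rule finite_uniform_bound[OF finite_length_le *]) (auto intro: order_trans)
  then show ?thesis by auto
qed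

text \<open>Off the support of \<theta> the quotient is locally zero; on it \<kappa> does not
  vanish. The quotient rule yields a quotient of the same kind with denominator \<kappa>^2, and the
  support condition is inherited, so the induction runs over all \<theta> and \<kappa> at
  once.\<close>

lemma Ck_divide:
  assumes "smooth \<theta>" "smooth \<kappa>" "supp \<theta> \<subseteq> {x. \<kappa> x \<noteq> 0}"
  shows "Ck n (\<lambda>x. \<theta> x / \<kappa> x)"
  using assms
proof (induction n arbitrary: \<theta> \<kappa>)
  have z: "((\<lambda>x. \<theta> x / \<kappa> x) has_derivative (\<lambda>h. 0)) (at x)" if "x \<notin> supp \<theta>" for x and \<theta> \<kappa> :: "real^'a \<Rightarrow> complex"
  proof (rule has_derivative_transform_within_open[OF has_derivative_const])
    show "open (- supp \<theta>)" using closed_supp by blast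
    show "0 = \<theta> y / \<kappa> y" if "y \<in> - supp \<theta>" for y using that supp_I[of \<theta> y] by auto
  qed (use that in auto)
  have d: "(\<lambda>x. \<theta> x / \<kappa> x) differentiable at x"
    if "smooth \<theta>" "smooth \<kappa>" "supp \<theta> \<subseteq> {x. \<kappa> x \<noteq> 0}" for x and \<theta> \<kappa> :: "real^'a \<Rightarrow> complex"
  proof (cases "x \<in> supp \<theta>")
    case True
    then show ?thesis using that by (intro differentiable_divide smooth_differentiable) auto
  qed (use z differentiable_def in blast)
  {
    case 0
    then show ?case using d by simp
  next
    case (Suc n)
    have "pd j (\<lambda>x. \<theta> x / \<kappa> x) = (\<lambda>x. (pd j \<theta> x * \<kappa> x + (-1) * (\<theta> x * pd j \<kappa> x)) / (\<kappa> x * \<kappa> x))" for j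
    proof
      fix x
      show "pd j (\<lambda>x. \<theta> x / \<kappa> x) x = (pd j \<theta> x * \<kappa> x + (-1) * (\<theta> x * pd j \<kappa> x)) / (\<kappa> x * \<kappa> x)"
      proof (cases "x \<in> supp \<theta>")
        case True
        then have k: "\<kappa> x \<noteq> 0" using Suc.prems by auto
        \<comment> \<open>This identity holds everywhere, so the derivative of the quotient can be
          solved for from the product rule.\<close>
        have "\<theta> y = \<theta> y / \<kappa> y * \<kappa> y" for y
          using Suc.prems(3) supp_I[of \<theta> y] by (cases "\<kappa> y = 0") auto
        then have "pd j \<theta> x = pd j (\<lambda>y. \<theta> y / \<kappa> y * \<kappa> y) x" by simp
        also have "\<dots> = pd j (\<lambda>x. \<theta> x / \<kappa> x) x * \<kappa> x + \<theta> x / \<kappa> x * pd j \<kappa> x"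
          by (rule pd_mult[OF d[OF Suc.prems] smooth_differentiable[OF Suc.prems(2)]])
        finally show ?thesis using k by (simp add: field_simps)
      next
        case False
        have "pd j \<theta> x = 0" "\<theta> x = 0"
          using iter_partial_outside[OF False, of "[j]"] iter_partial_outside[OF False, of "[]"] by simp_all
        then show ?thesis using pd_eqI[OF z[OF False, of \<kappa>], of j] by simp
      qed
    qed
    moreover have "Ck n (\<lambda>x. (pd j \<theta> x * \<kappa> x + (-1) * (\<theta> x * pd j \<kappa> x)) / (\<kappa> x * \<kappa> x))" for j
    proof (rule Suc.IH)
      show "smooth (\<lambda>x. pd j \<theta> x * \<kappa> x + (-1) * (\<theta> x * pd j \<kappa> x))"
        using Suc.prems by (intro smooth_add smooth_mult smooth_const smooth_pd)
      show "smooth (\<lambda>x. \<kappa> x * \<kappa> x)" using Suc.prems by (intro smooth_mult)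
      have "supp (\<lambda>x. pd j \<theta> x * \<kappa> x + (-1) * (\<theta> x * pd j \<kappa> x)) \<subseteq> supp \<theta>"
      proof (rule supp_subsetI[OF closed_supp])
        fix x assume "x \<notin> supp \<theta>"
        then have "pd j \<theta> x = 0" "\<theta> x = 0"
          using iter_partial_outside[of x \<theta> "[j]"] iter_partial_outside[of x \<theta> "[]"] by simp_all
        then show "pd j \<theta> x * \<kappa> x + (-1) * (\<theta> x * pd j \<kappa> x) = 0" by simp
      qed
      then show "supp (\<lambda>x. pd j \<theta> x * \<kappa> x + (-1) * (\<theta> x * pd j \<kappa> x)) \<subseteq> {x. \<kappa> x * \<kappa> x \<noteq> 0}"
        using Suc.prems by auto
    qed
    ultimately show ?case using d[OF Suc.prems] by simp
  }
qed

lemma tf_divide: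
  assumes "\<theta> \<in> test_functions X" "smooth \<kappa>" "supp \<theta> \<subseteq> {x. \<kappa> x \<noteq> 0}"
  shows "(\<lambda>x. \<theta> x / \<kappa> x) \<in> test_functions X"
  by (rule tf_cong_supp[OF assms(1)]) (use assms in \<open>auto simp: smooth_iff_Ck intro: Ck_divide tf_smooth\<close>)

text \<open>The functions t^(-n) exp(-1/t), extended by 0. As a family in n they are closed under
  differentiation up to linear combinations, which is the usual reason why exp(-1/t) is smooth at
  0.\<close>

definition flat_exp :: "nat \<Rightarrow> real \<Rightarrow> real" where
  "flat_exp n t = (if t > 0 then (1 / t) ^ n * exp (- 1 / t) else 0)"

lemma flat_exp_tendsto_0: "((\<lambda>t. (1 / t) ^ n * exp (- 1 / t)) \<longlongrightarrow> 0) (at_right (0::real))"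
proof -
  have "((\<lambda>t::real. (inverse t) ^ n / exp (inverse t)) \<longlongrightarrow> 0) (at_right 0)"
    by (rule filterlim_compose[OF tendsto_power_div_exp_0 filterlim_inverse_at_top_right])
  then show ?thesis by (simp add: exp_minus inverse_eq_divide)
qed

lemma flat_exp_deriv: "(flat_exp n has_real_derivative (- real n * flat_exp (Suc n) t + flat_exp (Suc (Suc n)) t)) (at t)"
proof -
  consider "t > 0" | "t < 0" | "t = 0" by linarith
  then show ?thesis
  proof cases
    case 1
    have D: "((\<lambda>t. 1 / t) has_real_derivative - (1 / t)\<^sup>2) (at t)"
      using 1 by (auto intro!: derivative_eq_intros simp: power2_eq_square)
    have D1: "((\<lambda>t. (1 / t) ^ n) has_real_derivative - (real n * (1 / t) ^ Suc n)) (at t)"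
      by (rule DERIV_cong[OF DERIV_power[OF D]]) (cases n, auto simp: power2_eq_square)
    have D2: "((\<lambda>t. exp (- 1 / t)) has_real_derivative exp (- 1 / t) * (1 / t)\<^sup>2) (at t)"
      using 1 by (auto intro!: derivative_eq_intros simp: power2_eq_square)
    have "((\<lambda>t. (1 / t) ^ n * exp (- 1 / t)) has_real_derivative (- real n * flat_exp (Suc n) t + flat_exp (Suc (Suc n)) t)) (at t)"
      by (rule DERIV_cong[OF DERIV_mult[OF D1 D2]]) (use 1 in \<open>simp add: flat_exp_def power2_eq_square mult_ac\<close>)
    then show ?thesis
      by (rule has_field_derivative_transform_within_open[where S="{0<..}"]) (use 1 in \<open>auto simp: flat_exp_def\<close>)
  next
    case 2
    have "((\<lambda>t. 0) has_real_derivative (- real n * flat_exp (Suc n) t + flat_exp (Suc (Suc n)) t)) (at t)"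
      using 2 unfolding flat_exp_def by auto
    then show ?thesis
      by (rule has_field_derivative_transform_within_open[where S="{..<0}"]) (use 2 in \<open>auto simp: flat_exp_def\<close>)
  next
    case 3
    \<comment> \<open>At 0 the right difference quotient is \<open>flat_exp (Suc n)\<close>, which
      tends to 0; the left one vanishes identically.\<close>
    have "((\<lambda>h. flat_exp n h / h) \<longlongrightarrow> 0) (at_right 0)"
      using flat_exp_tendsto_0[of "Suc n"]
      by (rule Lim_transform_eventually) (auto simp: flat_exp_def eventually_at_right_less intro!: eventually_at_rightI[of 0 1])
    moreover have "((\<lambda>h. flat_exp n h / h) \<longlongrightarrow> 0) (at_left 0)"
      by (rule Lim_transform_eventually[OF tendsto_const]) (auto simp: flat_exp_def intro!: eventually_at_leftI[of "-1" 0])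
    ultimately have "((\<lambda>h. flat_exp n h / h) \<longlongrightarrow> 0) (at 0)"
      by (simp add: filterlim_split_at)
    then show ?thesis using 3 by (simp add: DERIV_def flat_exp_def)
  qed
qed

text \<open>The smooth factor P absorbs the inner derivatives of 1 - |x|^2, so these products form a
  class that is closed, up to sums, under partial differentiation.\<close>

lemma Ck_bump:
  fixes P :: "real^'d \<Rightarrow> complex"
  assumes "smooth P"
  shows "Ck k (\<lambda>x. P x * of_real (flat_exp n (1 - x \<bullet> x)))"
proof -
  define b where "b n x = complex_of_real (flat_exp n (1 - x \<bullet> x))" for n and x :: "real^'d"
  have d: "(b n has_derivative (\<lambda>h. of_real ((- real n * flat_exp (Suc n) (1 - x \<bullet> x) + flat_exp (Suc (Suc n)) (1 - x \<bullet> x)) * (- 2 * (x \<bullet> h))))) (at x)" for n x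
  proof -
    have q: "((\<lambda>x. 1 - x \<bullet> x) has_derivative (\<lambda>h. - 2 * (x \<bullet> h))) (at x)"
      by (auto intro!: derivative_eq_intros simp: inner_commute)
    show ?thesis unfolding b_def
      by (rule has_derivative_of_real[OF has_derivative_compose[OF q flat_exp_deriv[THEN has_field_derivative_imp_has_derivative]]])
  qed
  have pdb: "pd j (b n) x = (- of_nat n * (- 2 * of_real (x $ j))) * b (Suc n) x + (- 2 * of_real (x $ j)) * b (Suc (Suc n)) x" for j n x
    by (subst pd_eqI[OF d]) (simp add: b_def inner_axis algebra_simps)
  have db: "b n differentiable at x" for n x using d differentiable_def by blast
  have "Ck k (\<lambda>x. P x * b n x)" using assms
  proof (induction k arbitrary: P n)
    case 0
    then show ?case by (simp add: db smooth_differentiable)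
  next
    case (Suc k)
    have "pd j (\<lambda>x. P x * b n x) = (\<lambda>x. pd j P x * b n x + ((P x * (- of_nat n * (- 2 * of_real (x $ j)))) * b (Suc n) x
        + (P x * (- 2 * of_real (x $ j))) * b (Suc (Suc n)) x))" for j
      by (rule ext, subst pd_mult[OF smooth_differentiable[OF Suc.prems] db]) (simp add: pdb algebra_simps)
    moreover have "Ck k (\<lambda>x. pd j P x * b n x + ((P x * (- of_nat n * (- 2 * of_real (x $ j)))) * b (Suc n) x
        + (P x * (- 2 * of_real (x $ j))) * b (Suc (Suc n)) x))" for j
      using Suc.prems by (intro Ck_add Suc.IH smooth_pd smooth_mult smooth_const smooth_coord)
    ultimately show ?case using db smooth_differentiable[OF Suc.prems] by simp
  qed
  then show ?thesis unfolding b_def .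
qed

lemma bump_function:
  fixes x0 :: "real^'d"
  assumes "r > 0"
  obtains b :: "real^'d \<Rightarrow> real" where "(\<lambda>x. of_real (b x)) \<in> test_functions (cball x0 r)"
    "\<And>x. 0 \<le> b x" "\<And>x. dist x0 x < r \<Longrightarrow> b x > 0"
proof
  define b where "b x = flat_exp 0 (1 - ((1/r) *\<^sub>R x + (-1/r) *\<^sub>R x0) \<bullet> ((1/r) *\<^sub>R x + (-1/r) *\<^sub>R x0))" for x
  have n: "(1/r) *\<^sub>R x + (-1/r) *\<^sub>R x0 = (1/r) *\<^sub>R (x - x0)" for x by (simp add: algebra_simps)
  have q: "((1/r) *\<^sub>R x + (-1/r) *\<^sub>R x0) \<bullet> ((1/r) *\<^sub>R x + (-1/r) *\<^sub>R x0) = (dist x0 x / r)\<^sup>2" for x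
    unfolding n by (simp add: power2_norm_eq_inner[symmetric] dist_norm norm_minus_commute power_divide power2_eq_square)
  show "0 \<le> b x" for x by (simp add: b_def flat_exp_def)
  show "b x > 0" if "dist x0 x < r" for x
  proof -
    have "(dist x0 x / r)\<^sup>2 < 1" using that assms by (simp add: power_less_one_iff)
    then show ?thesis unfolding b_def q by (simp add: flat_exp_def)
  qed
  have "b x = 0" if "x \<notin> cball x0 r" for x
  proof -
    have "(dist x0 x / r)\<^sup>2 \<ge> 1" using that assms by (intro one_le_power) simp
    then show ?thesis unfolding b_def q by (simp add: flat_exp_def)
  qed
  then have s: "supp (\<lambda>x. complex_of_real (b x)) \<subseteq> cball x0 r" by (intro supp_subsetI) auto
  have "smooth (\<lambda>x :: real^'d. complex_of_real (flat_exp 0 (1 - x \<bullet> x)))"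
    using Ck_bump[where 'd = 'd, OF smooth_const[of 1], of _ 0] by (simp add: smooth_iff_Ck)
  then have "smooth (\<lambda>x. complex_of_real (b x))"
    unfolding b_def by (rule smooth_affine)
  moreover have "compact (supp (\<lambda>x. complex_of_real (b x)))"
    using s closed_supp compact_cball by (metis compact_Int_closed inf.absorb_iff2)
  ultimately show "(\<lambda>x. complex_of_real (b x)) \<in> test_functions (cball x0 r)"
    using s by (simp add: test_functions_def)
qed

subsection \<open>Integrals of test functions\<close>

text \<open>Takes the place of the bracket (1 + |x|^2)^(1/2), to which it is comparable. It is
  exactly submultiplicative, so weight and decay estimates become products of powers.\<close>

definition jb :: "'a::real_normed_vector \<Rightarrow> real" where "jb x = 1 + norm x"

lemma jb_ge_1 [simp]: "1 \<le> jb x" and jb_pos [simp]: "0 < jb x" and jb_nonneg [simp]: "0 \<le> jb x"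
  using norm_ge_zero[of x] unfolding jb_def by linarith+

lemma jb_minus: "jb (- x) = jb x" by (simp add: jb_def)

lemma jb_commute: "jb (x - y) = jb (y - x)" by (simp add: jb_def norm_minus_commute)

lemma jb_mult: "jb (x + y) \<le> jb x * jb y"
proof -
  have "jb (x + y) \<le> 1 + norm x + norm y" unfolding jb_def using norm_triangle_ineq[of x y] by linarith
  also have "\<dots> \<le> jb x * jb y" unfolding jb_def by (simp add: algebra_simps)
  finally show ?thesis .
qed

lemma jb_le_mult: "jb x \<le> jb (x - y) * jb y"
  using jb_mult[of "x - y" y] by simp

lemma continuous_jb [continuous_intros]: "continuous_on S f \<Longrightarrow> continuous_on S (\<lambda>x. jb (f x))"
  unfolding jb_def by (intro continuous_intros)

lemma measurable_jb [measurable (raw)]: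
  "f \<in> borel_measurable M \<Longrightarrow> (\<lambda>x. jb (f x)) \<in> borel_measurable M"
  unfolding jb_def by measurable

lemma lborel_integral_shift:
  fixes f :: "'a::euclidean_space \<Rightarrow> 'b::{banach, second_countable_topology}"
  assumes "f \<in> borel_measurable borel"
  shows "(\<integral>x. f (c + x) \<partial>lborel) = (\<integral>x. f x \<partial>lborel)"
  by (subst (2) lborel_distr_plus[of c, symmetric], subst integral_distr) (use assms in auto)

lemma nn_integral_lborel_shift:
  fixes f :: "'a::euclidean_space \<Rightarrow> ennreal"
  assumes "f \<in> borel_measurable borel"
  shows "(\<integral>\<^sup>+x. f (c + x) \<partial>lborel) = (\<integral>\<^sup>+x. f x \<partial>lborel)"
  by (subst (2) lborel_distr_plus[of c, symmetric], subst nn_integral_distr) (use assms in auto)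

lemma integrable_lborel_shift:
  fixes f :: "'a::euclidean_space \<Rightarrow> 'b::{banach, second_countable_topology}"
  assumes "integrable lborel f"
  shows "integrable lborel (\<lambda>x. f (c + x))"
proof -
  have "integrable (distr lborel borel ((+) c)) f" using assms by (simp add: lborel_distr_plus)
  then show ?thesis by (subst (asm) integrable_distr_eq) (use assms in auto)
qed

lemma norm_integral_le:
  fixes f :: "'a \<Rightarrow> 'b::{banach, second_countable_topology}"
  assumes "integrable M f" "integrable M g" "\<And>x. x \<in> space M \<Longrightarrow> norm (f x) \<le> g x"
  shows "norm (\<integral>x. f x \<partial>M) \<le> (\<integral>x. g x \<partial>M)"
  using order_trans[OF integral_norm_bound Bochner_Integration.integral_mono[OF integrable_norm[OF assms(1)] assms(2,3)]] .

lemma integrable_indicator_cball: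
  "integrable lborel (\<lambda>x::'a::euclidean_space. indicator (cball a r) x * (c::real))"
  using emeasure_lborel_cball_finite[of a r] by (intro integrable_mult_left integrable_real_indicator) (auto simp: top.not_eq_extremum)

lemma tf_integrable:
  assumes "u \<in> test_functions X" shows "integrable lborel u"
proof -
  have "integrable lborel (\<lambda>x. indicator (supp u) x *\<^sub>R u x)"
    using assms by (intro borel_integrable_compact smooth_continuous_on tf_smooth tf_compact)
  moreover have "(\<lambda>x. indicator (supp u) x *\<^sub>R u x) = u"
    by (auto simp: indicator_def supp_outside)
  ultimately show ?thesis by simp
qed

section \<open>Second-order Taylor estimate and vanishing integrals of derivatives\<close>

lemma derivative_lipschitz:
  fixes v :: "real^'d \<Rightarrow> complex"
  assumes "convex S" "\<And>y. y \<in> S \<Longrightarrow> (v has_derivative (\<lambda>k. \<Sum>j\<in>UNIV. (k $ j) *\<^sub>R a j y)) (at y)"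
    and M: "\<And>j y. y \<in> S \<Longrightarrow> cmod (a j y) \<le> M" and "x \<in> S" "y \<in> S"
  shows "cmod (v x - v y) \<le> real CARD('d) * M * norm (x - y)"
proof (rule differentiable_bound[OF assms(1)])
  show "(v has_derivative (\<lambda>k. \<Sum>j\<in>UNIV. (k $ j) *\<^sub>R a j y)) (at y within S)" if "y \<in> S" for y
    using assms(2)[OF that] by (rule has_derivative_at_withinI)
  show "onorm (\<lambda>k. \<Sum>j\<in>UNIV. (k $ j) *\<^sub>R a j y) \<le> real CARD('d) * M" if "y \<in> S" for y
  proof (rule onorm_le)
    fix k :: "real^'d"
    have "cmod (\<Sum>j\<in>UNIV. (k $ j) *\<^sub>R a j y) \<le> (\<Sum>j\<in>(UNIV::'d set). norm k * M)"
      by (intro sum_norm_le) (use M[OF that] component_le_norm_cart in \<open>auto intro!: mult_mono\<close>)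
    then show "cmod (\<Sum>j\<in>UNIV. (k $ j) *\<^sub>R a j y) \<le> real CARD('d) * M * norm k"
      by (simp add: mult_ac)
  qed
qed fact+

text \<open>The mean value inequality is used twice: for u minus its linear part at x, whose
  derivatives are increments of the first partials, and then for those increments. The constant is
  crude but depends only on the dimension.\<close>

lemma taylor2:
  fixes u :: "real^'d \<Rightarrow> complex"
  assumes "smooth u" "convex S" and M: "\<And>i j y. y \<in> S \<Longrightarrow> cmod (iter_partial [i, j] u y) \<le> M"
    and "x \<in> S" "x + h \<in> S"
  shows "cmod (u (x + h) - u x - (\<Sum>j\<in>UNIV. (h $ j) *\<^sub>R pd j u x)) \<le> (real CARD('d))\<^sup>2 * M * (norm h)\<^sup>2"
proof -
  \<comment> \<open>On this convex set the first partials differ from their values at x by at most a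
    multiple of |h|.\<close>
  define T where "T = S \<inter> cball x (norm h)"
  have T: "convex T" "x \<in> T" "x + h \<in> T"
    unfolding T_def using assms by (auto intro: convex_Int simp: dist_norm)
  have M0: "0 \<le> M" using M[OF assms(4)] norm_ge_zero order_trans by blast
  define v where "v y = u y - (\<Sum>j\<in>UNIV. (y $ j) *\<^sub>R pd j u x)" for y
  have "cmod (v (x + h) - v x) \<le> real CARD('d) * (real CARD('d) * M * norm h) * norm (x + h - x)"
  proof (rule derivative_lipschitz[OF T(1) _ _ T(3) T(2)])
    fix y assume y: "y \<in> T"
    have "((\<lambda>y. \<Sum>j\<in>UNIV. (y $ j) *\<^sub>R pd j u x) has_derivative (\<lambda>k. \<Sum>j\<in>UNIV. (k $ j) *\<^sub>R pd j u x)) (at y)"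
      by (intro bounded_linear_imp_has_derivative bounded_linear_sum bounded_linear_scaleR_left[THEN bounded_linear_compose] bounded_linear_vec_nth)
    from has_derivative_diff[OF has_derivative_partials[OF smooth_differentiable[OF assms(1)]] this]
    show "(v has_derivative (\<lambda>k. \<Sum>j\<in>UNIV. (k $ j) *\<^sub>R (pd j u y - pd j u x))) (at y)"
      unfolding v_def by (simp add: sum_subtractf scaleR_diff_right)
    fix j
    have "cmod (pd j u y - pd j u x) \<le> real CARD('d) * M * norm (y - x)"
    proof (rule derivative_lipschitz[OF assms(2)])
      show "(pd j u has_derivative (\<lambda>k. \<Sum>i\<in>UNIV. (k $ i) *\<^sub>R pd i (pd j u) z)) (at z)" for z
        by (intro has_derivative_partials smooth_differentiable smooth_pd assms)
      show "cmod (pd i (pd j u) z) \<le> M" if "z \<in> S" for i z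
        using M[OF that, of i j] by simp
    qed (use y T in \<open>auto simp: T_def\<close>)
    also have "\<dots> \<le> real CARD('d) * M * norm h"
      using y M0 by (intro mult_left_mono) (auto simp: T_def dist_norm norm_minus_commute)
    finally show "cmod (pd j u y - pd j u x) \<le> real CARD('d) * M * norm h" .
  qed
  moreover have "v (x + h) - v x = u (x + h) - u x - (\<Sum>j\<in>UNIV. (h $ j) *\<^sub>R pd j u x)"
    by (simp add: v_def scaleR_add_left sum.distrib)
  ultimately show ?thesis by (simp add: power2_eq_square mult_ac)
qed

lemma has_derivative_quadratic:
  fixes f :: "'a::real_normed_vector \<Rightarrow> 'b::real_normed_vector"
  assumes "bounded_linear L" "\<And>h. norm h \<le> 1 \<Longrightarrow> norm (f (y + h) - f y - L h) \<le> K * (norm h)\<^sup>2"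
  shows "(f has_derivative L) (at y)"
  unfolding has_derivative_at_alt
proof (intro conjI assms(1) allI impI)
  fix e :: real assume e: "e > 0"
  define d where "d = min 1 (e / (\<bar>K\<bar> + 1))"
  have d: "d > 0" unfolding d_def using e by auto
  show "\<exists>d>0. \<forall>z. norm (z - y) < d \<longrightarrow> norm (f z - f y - L (z - y)) \<le> e * norm (z - y)"
  proof (intro exI[of _ d] conjI d allI impI)
    fix z assume z: "norm (z - y) < d"
    have "norm (f (y + (z - y)) - f y - L (z - y)) \<le> K * (norm (z - y))\<^sup>2"
      by (rule assms(2)) (use z in \<open>auto simp: d_def\<close>)
    also have "\<dots> \<le> (\<bar>K\<bar> + 1) * (norm (z - y))\<^sup>2" by (intro mult_right_mono) auto
    also have "\<dots> \<le> (\<bar>K\<bar> + 1) * (e / (\<bar>K\<bar> + 1) * norm (z - y))"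
      unfolding power2_eq_square using z by (intro mult_left_mono mult_right_mono) (auto simp: d_def)
    also have "\<dots> = e * norm (z - y)" by simp
    finally show "norm (f z - f y - L (z - y)) \<le> e * norm (z - y)" by simp
  qed
qed

lemma smooth_measurable_compose:
  "smooth u \<Longrightarrow> f \<in> borel_measurable M \<Longrightarrow> (\<lambda>t. u (f t)) \<in> borel_measurable M"
  using measurable_compose[OF _ smooth_measurable] by blast

text \<open>By translation invariance every difference quotient of u integrates to 0. By Taylor's
  estimate the quotients converge uniformly to the partial derivative, and their supports stay in
  one ball.\<close>

lemma integral_pd_eq_0:
  fixes u :: "real^'d \<Rightarrow> complex"
  assumes "u \<in> test_functions X" shows "(\<integral>x. pd j u x \<partial>lborel) = 0"
proof -
  note sm = tf_smooth[OF assms]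
  obtain M where M: "M \<ge> 0" "\<And>ks x. length ks \<le> 2 \<Longrightarrow> cmod (iter_partial ks u x) \<le> M"
    using tf_derivs_bounded[OF assms, of 2] by blast
  obtain R where R: "R > 0" "supp u \<subseteq> cball 0 R"
    using compact_imp_bounded[OF tf_compact[OF assms]] bounded_pos by (metis mem_cball_0 subsetI)
  define e :: "real^'d" where "e = axis j 1"
  have e: "norm e = 1" by (simp add: e_def)
  \<comment> \<open>Step sizes at most 1 keep the shifted supports in the ball of radius R +
    1.\<close>
  define s where "s n = 1 / (real n + 1)" for n
  have s: "s n > 0" "s n \<le> 1" for n by (auto simp: s_def)
  define g where "g n x = (1 / s n) *\<^sub>R (u (s n *\<^sub>R e + x) - u x)" for n x
  have close: "cmod (g n x - pd j u x) \<le> (real CARD('d))\<^sup>2 * M * s n" for n x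
  proof -
    have "cmod (u (x + s n *\<^sub>R e) - u x - (\<Sum>i\<in>UNIV. ((s n *\<^sub>R e) $ i) *\<^sub>R pd i u x)) \<le> (real CARD('d))\<^sup>2 * M * (norm (s n *\<^sub>R e))\<^sup>2"
      by (rule taylor2[OF sm convex_UNIV]) (auto intro: M(2) simp del: iter_partial.simps)
    moreover have "(\<Sum>i\<in>UNIV. ((s n *\<^sub>R e) $ i) *\<^sub>R pd i u x) = s n *\<^sub>R pd j u x"
    proof -
      have "(\<Sum>i\<in>UNIV. ((s n *\<^sub>R e) $ i) *\<^sub>R pd i u x) = (\<Sum>i\<in>UNIV. if i = j then s n *\<^sub>R pd j u x else 0)"
        by (rule sum.cong) (auto simp: e_def axis_def)
      then show ?thesis by simp
    qed
    ultimately have "cmod (s n *\<^sub>R (g n x - pd j u x)) \<le> (real CARD('d))\<^sup>2 * M * (s n)\<^sup>2"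
      using e s[of n] by (simp add: g_def scaleR_diff_right add.commute)
    then have "s n * cmod (g n x - pd j u x) \<le> s n * ((real CARD('d))\<^sup>2 * M * s n)"
      using s[of n] by (simp add: power2_eq_square mult_ac)
    then show ?thesis using s[of n] by (meson mult_le_cancel_left_pos)
  qed
  have mg [measurable]: "g n \<in> borel_measurable borel" for n
    unfolding g_def[abs_def]
    by (intro borel_measurable_scaleR borel_measurable_diff borel_measurable_const smooth_measurable_compose[OF sm]) measurable
  have mp [measurable]: "pd j u \<in> borel_measurable borel"
    by (intro smooth_measurable smooth_pd sm)
  have lim: "(\<lambda>n. \<integral>x. g n x \<partial>lborel) \<longlonglongrightarrow> (\<integral>x. pd j u x \<partial>lborel)"
  proof (rule integral_dominated_convergence)
    show "AE x in lborel. (\<lambda>n. g n x) \<longlonglongrightarrow> pd j u x"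
    proof (rule AE_I2, rule LIM_zero_cancel, rule Lim_null_comparison)
      fix x
      show "\<forall>\<^sub>F n in sequentially. cmod (g n x - pd j u x) \<le> (real CARD('d))\<^sup>2 * M * s n"
        using close by simp
      have "s \<longlonglongrightarrow> 0" unfolding s_def by real_asymp
      then show "(\<lambda>n. (real CARD('d))\<^sup>2 * M * s n) \<longlonglongrightarrow> 0"
        by (rule tendsto_mult_right_zero)
    qed
    define B where "B = M + (real CARD('d))\<^sup>2 * M"
    show "integrable lborel (\<lambda>x. indicator (cball (0::real^'d) (R + 1)) x *\<^sub>R B)"
      using integrable_indicator_cball by (simp del: indicator_simps)
    show "AE x in lborel. cmod (g n x) \<le> indicator (cball 0 (R + 1)) x *\<^sub>R B" for n
    proof (rule AE_I2)
      fix x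
      show "cmod (g n x) \<le> indicator (cball 0 (R + 1)) x *\<^sub>R B"
      proof (cases "x \<in> cball 0 (R + 1)")
        case True
        have "cmod (g n x) \<le> cmod (pd j u x) + cmod (g n x - pd j u x)"
          using norm_triangle_sub by blast
        also have "\<dots> \<le> M + (real CARD('d))\<^sup>2 * M * s n" using close M(2)[of "[j]"] by (intro add_mono) auto
        also have "\<dots> \<le> B" unfolding B_def using M(1) s[of n] by (simp add: mult_left_le)
        finally show ?thesis using True by simp
      next
        case False
        have "norm x \<le> norm (s n *\<^sub>R e + x) + norm (s n *\<^sub>R e)"
          using norm_triangle_ineq4[of "s n *\<^sub>R e + x" "s n *\<^sub>R e"] by simp
        then have "norm (s n *\<^sub>R e + x) > R" "norm x > R" using False e s[of n] by auto
        then have "s n *\<^sub>R e + x \<notin> supp u" "x \<notin> supp u" using R by (auto simp: subset_iff)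
        then show ?thesis using False by (simp add: g_def supp_outside)
      qed
    qed
  qed (use mg mp in auto)
  have "(\<integral>x. g n x \<partial>lborel) = 0" for n
  proof -
    have i: "integrable lborel u" by (rule tf_integrable[OF assms])
    have "u \<in> borel_measurable borel" by (intro smooth_measurable sm)
    then have "(\<integral>x. u (s n *\<^sub>R e + x) \<partial>lborel) = (\<integral>x. u x \<partial>lborel)" by (rule lborel_integral_shift)
    moreover have "integrable lborel (\<lambda>x. u (s n *\<^sub>R e + x))" using i by (rule integrable_lborel_shift)
    ultimately show ?thesis unfolding g_def using i by (simp add: Bochner_Integration.integral_diff)
  qed
  then have "(\<lambda>n. \<integral>x. g n x \<partial>lborel) = (\<lambda>n. 0)" by simp
  then show ?thesis using lim LIMSEQ_unique[OF tendsto_const] by metis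
qed

section \<open>Rapid decay of Fourier integrals, and integrable powers\<close>

lemma jb_power_le:
  fixes \<eta> :: "real^'d"
  obtains i where "jb \<eta> ^ N \<le> (1 + real CARD('d)) ^ N * max 1 (\<bar>\<eta> $ i\<bar> ^ N)"
proof -
  \<comment> \<open>A largest coordinate is comparable with the whole norm, so N derivatives in this
    one direction give decay of order N in |\<eta>|.\<close>
  have "Max (range (\<lambda>j. \<bar>\<eta> $ j\<bar>)) \<in> range (\<lambda>j. \<bar>\<eta> $ j\<bar>)" by (rule Max_in) auto
  then obtain i where m: "Max (range (\<lambda>j. \<bar>\<eta> $ j\<bar>)) = \<bar>\<eta> $ i\<bar>" by (rule imageE)
  have i: "\<bar>\<eta> $ j\<bar> \<le> \<bar>\<eta> $ i\<bar>" for j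
    unfolding m[symmetric] by (rule Max_ge) auto
  have "norm \<eta> \<le> (\<Sum>j\<in>UNIV. \<bar>\<eta> $ j\<bar>)" by (rule norm_le_l1_cart)
  also have "\<dots> \<le> (\<Sum>j\<in>(UNIV::'d set). \<bar>\<eta> $ i\<bar>)" by (rule sum_mono[OF i])
  finally have "jb \<eta> \<le> 1 + CARD('d) * \<bar>\<eta> $ i\<bar>" by (simp add: jb_def)
  also have "\<dots> \<le> (1 + real CARD('d)) * max 1 \<bar>\<eta> $ i\<bar>"
    by (simp add: distrib_right add_mono mult_left_mono)
  finally have "jb \<eta> ^ N \<le> ((1 + real CARD('d)) * max 1 \<bar>\<eta> $ i\<bar>) ^ N" by (intro power_mono) auto
  also have "\<dots> = (1 + real CARD('d)) ^ N * max 1 (\<bar>\<eta> $ i\<bar> ^ N)"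
  proof -
    have "max 1 \<bar>\<eta> $ i\<bar> ^ N = max 1 (\<bar>\<eta> $ i\<bar> ^ N)"
      using power_le_one[of "\<bar>\<eta> $ i\<bar>" N] one_le_power[of "\<bar>\<eta> $ i\<bar>" N]
      by (cases "\<bar>\<eta> $ i\<bar> \<le> 1") (simp_all add: max_absorb1 max_absorb2)
    then show ?thesis by (simp add: power_mult_distrib)
  qed
  finally show ?thesis using that by blast
qed

lemma integral_pd_ch:
  fixes w :: "real^'d \<Rightarrow> complex"
  assumes w: "w \<in> test_functions UNIV"
  shows "(\<integral>x. pd j w x * ch \<eta> x \<partial>lborel) = (\<i> * of_real (\<eta> $ j)) * (\<integral>x. w x * ch \<eta> x \<partial>lborel)"
proof -
    have w': "pd j w \<in> test_functions UNIV" using tf_iter_partial[OF w, of "[j]"] by simp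
    have "pd j (\<lambda>x. w x * ch \<eta> x) = (\<lambda>x. pd j w x * ch \<eta> x + (- \<i> * of_real (\<eta> $ j)) * (w x * ch \<eta> x))"
    proof
      fix x
      show "pd j (\<lambda>x. w x * ch \<eta> x) x = pd j w x * ch \<eta> x + (- \<i> * of_real (\<eta> $ j)) * (w x * ch \<eta> x)"
        using pd_mult[where u = w and v = "ch \<eta>" and x = x and j = j] fun_cong[OF pd_ch[of \<eta> j], of x]
          smooth_differentiable[OF tf_smooth[OF w]] smooth_differentiable[OF smooth_ch[of \<eta>]] by (simp add: algebra_simps)
    qed
    then have "0 = (\<integral>x. pd j w x * ch \<eta> x + (- \<i> * of_real (\<eta> $ j)) * (w x * ch \<eta> x) \<partial>lborel)"
      using integral_pd_eq_0[OF tf_mult[OF w smooth_ch, of \<eta>], of j] by simp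
    also have "\<dots> = (\<integral>x. pd j w x * ch \<eta> x \<partial>lborel) + (- \<i> * of_real (\<eta> $ j)) * (\<integral>x. w x * ch \<eta> x \<partial>lborel)"
      using tf_integrable[OF tf_mult[OF w' smooth_ch, of \<eta>]] tf_integrable[OF tf_mult[OF w smooth_ch, of \<eta>]]
      by (simp only: Bochner_Integration.integral_add integrable_mult_right integral_mult_right_zero)
    finally show ?thesis by (simp add: add_eq_0_iff)
qed

lemma norm_integral_pd_ch:
  fixes v :: "real^'d \<Rightarrow> complex"
  assumes v: "v \<in> test_functions UNIV"
  shows "cmod (\<integral>x. iter_partial (replicate n j) v x * ch \<eta> x \<partial>lborel) = \<bar>\<eta> $ j\<bar> ^ n * cmod (\<integral>x. v x * ch \<eta> x \<partial>lborel)"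
proof (induction n)
  case (Suc n)
  show ?case
    using integral_pd_ch[OF tf_iter_partial[OF v, of "replicate n j"], of j \<eta>] Suc
    by (simp add: norm_mult)
qed simp

text \<open>N-fold integration by parts in the direction of a largest coordinate of \<eta>. The
  constants depend on \<alpha> and N alone, and m enters only through derivative bounds on a ball
  containing the support of \<alpha>. This uniformity is what later allows whole families of windows
  for m.\<close>

lemma fourier_decay:
  fixes \<alpha> :: "real^'d \<Rightarrow> complex"
  assumes "\<alpha> \<in> test_functions X"
  obtains C R where "C \<ge> 0" "R > 0"
    "\<And>m B \<eta>. smooth m \<Longrightarrow> (\<And>ks x. length ks \<le> N \<Longrightarrow> x \<in> cball 0 R \<Longrightarrow> cmod (iter_partial ks m x) \<le> B)
      \<Longrightarrow> cmod (\<integral>x. \<alpha> x * m x * ch \<eta> x \<partial>lborel) \<le> C * B / jb \<eta> ^ N"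
proof -
  obtain A where A: "A \<ge> 0" "\<And>ks x. length ks \<le> N \<Longrightarrow> cmod (iter_partial ks \<alpha> x) \<le> A"
    using tf_derivs_bounded[OF assms, of N] by blast
  obtain R where R: "R > 0" "supp \<alpha> \<subseteq> cball 0 R"
    using compact_imp_bounded[OF tf_compact[OF assms]] bounded_pos by (metis mem_cball_0 subsetI)
  define V where "V = measure lborel (cball (0::real^'d) R)"
  define C where "C = (1 + real CARD('d)) ^ N * (2 ^ N * A * V)"
  have C: "C \<ge> 0" unfolding C_def V_def using A(1) by simp
  show ?thesis
  proof (rule that[OF C R(1)])
    fix m :: "real^'d \<Rightarrow> complex" and B \<eta>
    assume m: "smooth m" and B: "\<And>ks x. length ks \<le> N \<Longrightarrow> x \<in> cball 0 R \<Longrightarrow> cmod (iter_partial ks m x) \<le> B"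
    have "cmod (m 0) \<le> B" using B[of "[]" 0] R(1) by simp
    then have B0: "B \<ge> 0" using norm_ge_zero order_trans by blast
    define v where "v x = \<alpha> x * m x" for x
    have v: "v \<in> test_functions UNIV"
      unfolding v_def using tf_mono[OF tf_mult[OF assms m]] by simp
    have vb: "cmod (iter_partial ks v x) \<le> indicator (cball 0 R) x * (2 ^ N * A * B)" if "length ks \<le> N" for ks x
    proof (cases "x \<in> cball 0 R")
      case True
      have "cmod (iter_partial ks v x) \<le> 2 ^ length ks * A * B"
        unfolding v_def
        by (rule iter_partial_mult_bound[OF tf_smooth[OF assms] m]) (use that A(2) B[OF _ True] in \<open>meson order_trans\<close>)+
      also have "\<dots> \<le> 2 ^ N * A * B" using that A(1) B0 by (intro mult_right_mono power_increasing) auto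
      finally show ?thesis using True by simp
    next
      case False
      have "supp v \<subseteq> supp \<alpha>" by (rule supp_subsetI[OF closed_supp]) (simp add: v_def supp_outside)
      then have "x \<notin> supp v" using False R by auto
      then show ?thesis using False by (simp add: iter_partial_outside)
    qed
    have vol: "cmod (\<integral>x. iter_partial ks v x * ch \<eta> x \<partial>lborel) \<le> 2 ^ N * A * B * V" if "length ks \<le> N" for ks
    proof -
      have "cmod (\<integral>x. iter_partial ks v x * ch \<eta> x \<partial>lborel) \<le> (\<integral>x. indicator (cball (0::real^'d) R) x * (2 ^ N * A * B) \<partial>lborel)"
      proof (rule norm_integral_le)
        show "integrable lborel (\<lambda>x. indicator (cball (0::real^'d) R) x * (2 ^ N * A * B))"
          by (rule integrable_indicator_cball)
      qed (use vb[OF that] in \<open>auto simp: norm_mult intro!: tf_integrable tf_mult tf_iter_partial v\<close>)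
      also have "\<dots> = 2 ^ N * A * B * V" unfolding V_def by simp
      finally show ?thesis .
    qed
    obtain i where i: "jb \<eta> ^ N \<le> (1 + real CARD('d)) ^ N * max 1 (\<bar>\<eta> $ i\<bar> ^ N)" by (rule jb_power_le)
    define I where "I = cmod (\<integral>x. v x * ch \<eta> x \<partial>lborel)"
    have "I \<le> 2 ^ N * A * B * V" using vol[of "[]"] by (simp add: I_def)
    moreover have "\<bar>\<eta> $ i\<bar> ^ N * I \<le> 2 ^ N * A * B * V"
      using vol[of "replicate N i"] norm_integral_pd_ch[OF v, of N i \<eta>] by (simp add: I_def)
    ultimately have "max 1 (\<bar>\<eta> $ i\<bar> ^ N) * I \<le> 2 ^ N * A * B * V" by (simp add: max_def)
    then have "(1 + real CARD('d)) ^ N * (max 1 (\<bar>\<eta> $ i\<bar> ^ N) * I) \<le> C * B"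
      unfolding C_def by (simp add: mult_ac mult_left_mono)
    moreover have "jb \<eta> ^ N * I \<le> (1 + real CARD('d)) ^ N * (max 1 (\<bar>\<eta> $ i\<bar> ^ N) * I)"
      using mult_right_mono[OF i, of I] by (simp add: I_def mult.assoc)
    ultimately have "jb \<eta> ^ N * I \<le> C * B" by linarith
    then show "cmod (\<integral>x. \<alpha> x * m x * ch \<eta> x \<partial>lborel) \<le> C * B / jb \<eta> ^ N"
      unfolding I_def v_def by (simp add: pos_le_divide_eq mult.commute)
  qed
qed

text \<open>With n the integer part of |x|, the integrand is at most (n + 1)^(-d-2), and x lies in a
  ball whose volume is a multiple of (n + 1)^d. The exponent d + 2 is chosen so that this crude
  comparison leaves the convergent series of 1/(n + 1)^2.\<close>

lemma nn_integral_jb: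
  "(\<integral>\<^sup>+(x::'a::euclidean_space). ennreal (1 / jb x ^ (DIM('a) + 2)) \<partial>lborel) < \<infinity>"
proof -
  define c where "c n = 1 / (real n + 1) ^ (DIM('a) + 2)" for n
  have "ennreal (1 / jb x ^ (DIM('a) + 2)) \<le> (\<Sum>n. ennreal (c n) * indicator (cball 0 (real n + 1)) x)" for x :: 'a
  proof -
    define n where "n = nat \<lfloor>norm x\<rfloor>"
    have n: "real n \<le> norm x" "norm x < real n + 1" unfolding n_def using floor_correct[of "norm x"] norm_ge_zero[of x] by (simp_all only: of_nat_nat zero_le_floor, linarith+)
    have "1 / jb x ^ (DIM('a) + 2) \<le> c n"
      unfolding c_def jb_def using n(1) by (intro divide_left_mono power_mono mult_pos_pos zero_less_power) simp_all
    then have "ennreal (1 / jb x ^ (DIM('a) + 2)) \<le> (\<Sum>n\<in>{n}. ennreal (c n) * indicator (cball 0 (real n + 1)) x)"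
    proof -
      have "x \<in> cball 0 (real n + 1)" using n(2) by (simp only: mem_cball_0 less_imp_le)
      then show ?thesis using \<open>_ \<le> c n\<close> by (simp only: sum.insert_if sum.empty finite.emptyI empty_iff if_False indicator_simps mult_1_right add_0_right ennreal_leI)
    qed
    also have "\<dots> \<le> (\<Sum>n. ennreal (c n) * indicator (cball 0 (real n + 1)) x)"
      by (rule sum_le_suminf) simp_all
    finally show ?thesis .
  qed
  then have "(\<integral>\<^sup>+(x::'a). ennreal (1 / jb x ^ (DIM('a) + 2)) \<partial>lborel) \<le>
      (\<integral>\<^sup>+(x::'a). (\<Sum>n. ennreal (c n) * indicator (cball 0 (real n + 1)) x) \<partial>lborel)"
    by (rule nn_integral_mono)
  also have "\<dots> = (\<Sum>n. ennreal (c n) * emeasure lborel (cball (0::'a) (real n + 1)))"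
  proof (subst nn_integral_suminf)
    show "(\<lambda>x. ennreal (c n) * indicator (cball (0::'a) (real n + 1)) x) \<in> borel_measurable lborel" for n
      by (intro borel_measurable_times_ennreal borel_measurable_indicator borel_measurable_const) simp
  qed (simp add: nn_integral_cmult_indicator)
  also have "\<dots> = (\<Sum>n. ennreal (unit_ball_vol (DIM('a)) * (1 / (real (Suc n)) ^ 2)))"
  proof (rule suminf_cong)
    fix n
    have "c n * (unit_ball_vol (DIM('a)) * (real n + 1) ^ DIM('a)) = unit_ball_vol (DIM('a)) * (1 / (real (Suc n)) ^ 2)"
      unfolding c_def power_add by (simp add: add.commute)
    moreover have "c n \<ge> 0" by (simp add: c_def)
    ultimately show "ennreal (c n) * emeasure lborel (cball (0::'a) (real n + 1)) = ennreal (unit_ball_vol (DIM('a)) * (1 / (real (Suc n)) ^ 2))"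
      by (subst emeasure_cball) (simp, simp only: ennreal_mult'[symmetric])
  qed
  also have "\<dots> < \<infinity>"
  proof -
    have "summable (\<lambda>n. 1 / real n ^ 2)" using inverse_power_summable[of 2, where 'a = real] by (simp only: inverse_eq_divide order_refl simp_thms)
    with summable_Suc_iff[of "\<lambda>n. 1 / real n ^ 2"] have "summable (\<lambda>n. 1 / real (Suc n) ^ 2)" by (rule iffD2)
    then have "summable (\<lambda>n. unit_ball_vol (DIM('a)) * (1 / (real (Suc n)) ^ 2))" by (rule summable_mult)
    then have "(\<Sum>n. ennreal (unit_ball_vol (DIM('a)) * (1 / (real (Suc n)) ^ 2))) \<noteq> top"
      by (rule ennreal_suminf_neq_top) (simp add: unit_ball_vol_nonneg)
    then show ?thesis unfolding infinity_ennreal_def by (rule top.not_eq_extremum[THEN iffD1])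
  qed
  finally show ?thesis .
qed

lemma jb_power_mono: "N \<le> M \<Longrightarrow> 1 / jb x ^ M \<le> 1 / jb x ^ N"
  by (intro divide_left_mono power_increasing mult_pos_pos zero_less_power) auto

lemma nn_integral_jb_shift:
  fixes c :: "'a::euclidean_space"
  shows "(\<integral>\<^sup>+x. ennreal (1 / jb (c - x) ^ N) \<partial>lborel) = (\<integral>\<^sup>+(x::'a). ennreal (1 / jb x ^ N) \<partial>lborel)"
  using nn_integral_lborel_shift[of "\<lambda>x. ennreal (1 / jb x ^ N)" "- c"]
  by (simp add: jb_commute[of c])

lemma integrable_jb:
  assumes "DIM('a::euclidean_space) + 2 \<le> N"
  shows "integrable lborel (\<lambda>x::'a. 1 / jb x ^ N)"
proof (rule integrableI_bounded)
  have "(\<integral>\<^sup>+(x::'a). ennreal (norm (1 / jb x ^ N)) \<partial>lborel) \<le> (\<integral>\<^sup>+(x::'a). ennreal (1 / jb x ^ (DIM('a) + 2)) \<partial>lborel)"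
  proof (intro nn_integral_mono ennreal_leI)
    fix x :: 'a
    show "norm (1 / jb x ^ N) \<le> 1 / jb x ^ (DIM('a) + 2)" using jb_power_mono[OF assms, of x] by simp
  qed
  also note nn_integral_jb
  finally show "(\<integral>\<^sup>+(x::'a). ennreal (norm (1 / jb x ^ N)) \<partial>lborel) < \<infinity>" .
qed measurable

subsection \<open>Sums over separated sets\<close>

text \<open>The factor 2 makes the open balls of radius r about the points disjoint. Countability is
  recorded because sums over S are exchanged with integrals.\<close>

definition separated :: "'a::euclidean_space set \<Rightarrow> bool" where
  "separated S \<longleftrightarrow> countable S \<and> (\<exists>r>0. \<forall>x\<in>S. \<forall>y\<in>S. x \<noteq> y \<longrightarrow> 2 * r \<le> dist x y)"

text \<open>Each term is comparable with the average of the same function over the r-ball about k.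
  The balls are disjoint, so the sum is dominated by a translation invariant integral, uniformly in
  \<xi>.\<close>

lemma separated_sum:
  assumes "separated (S :: 'a::euclidean_space set)"
  obtains C where "C \<ge> 0"
    "\<And>\<xi> N. DIM('a) + 2 \<le> N \<Longrightarrow> (\<integral>\<^sup>+k. ennreal (1 / jb (\<xi> - k) ^ N) \<partial>count_space S) \<le> ennreal C"
proof -
  obtain r where r: "r > 0" "\<And>x y. x \<in> S \<Longrightarrow> y \<in> S \<Longrightarrow> x \<noteq> y \<Longrightarrow> 2 * r \<le> dist x y" and cS: "countable S"
    using assms unfolding separated_def by blast
  define n where "n = DIM('a) + 2"
  define V where "V = unit_ball_vol (DIM('a)) * r ^ DIM('a)"
  have V: "V > 0" "emeasure lborel (ball (k::'a) r) = ennreal V" for k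
    unfolding V_def using r(1) by (auto simp: emeasure_ball)
  define I where "I = (\<integral>\<^sup>+(x::'a). ennreal (1 / jb x ^ n) \<partial>lborel)"
  have I: "I < \<infinity>" unfolding I_def n_def by (rule nn_integral_jb)
  have *: "(\<integral>\<^sup>+k. ennreal (1 / jb (\<xi> - k) ^ n) \<partial>count_space S) \<le> ennreal ((1 + r) ^ n / V) * I" for \<xi>
  proof -
    have "ennreal (1 / jb (\<xi> - k) ^ n) \<le> (\<integral>\<^sup>+x. ennreal ((1 + r) ^ n / V / jb (\<xi> - x) ^ n) * indicator (ball k r) x \<partial>lborel)" for k
    proof -
      have "ennreal (1 / jb (\<xi> - k) ^ n) = (\<integral>\<^sup>+x. ennreal (1 / V / jb (\<xi> - k) ^ n) * indicator (ball k r) x \<partial>lborel)"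
        using V by (simp add: nn_integral_cmult_indicator flip: ennreal_mult)
      also have "\<dots> \<le> (\<integral>\<^sup>+x. ennreal ((1 + r) ^ n / V / jb (\<xi> - x) ^ n) * indicator (ball k r) x \<partial>lborel)"
      proof (intro nn_integral_mono)
        fix x
        show "ennreal (1 / V / jb (\<xi> - k) ^ n) * indicator (ball k r) x \<le> ennreal ((1 + r) ^ n / V / jb (\<xi> - x) ^ n) * indicator (ball k r) x"
        proof (cases "x \<in> ball k r")
          case True
          have "jb (\<xi> - x) \<le> jb (\<xi> - k) * jb (k - x)" using jb_mult[of "\<xi> - k" "k - x"] by simp
          also have "\<dots> \<le> jb (\<xi> - k) * (1 + r)"
            using True by (intro mult_left_mono) (auto simp: jb_def dist_norm)
          finally have "jb (\<xi> - x) ^ n \<le> (jb (\<xi> - k) * (1 + r)) ^ n" by (intro power_mono) auto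
          then have "jb (\<xi> - x) ^ n \<le> (1 + r) ^ n * jb (\<xi> - k) ^ n" by (simp add: power_mult_distrib mult.commute)
          then have "1 / V / jb (\<xi> - k) ^ n \<le> (1 + r) ^ n / V / jb (\<xi> - x) ^ n"
            using V(1) by (simp add: field_simps)
          then show ?thesis using True by (simp add: ennreal_leI)
        qed simp
      qed
      finally show ?thesis .
    qed
    then have "(\<integral>\<^sup>+k. ennreal (1 / jb (\<xi> - k) ^ n) \<partial>count_space S) \<le>
        (\<integral>\<^sup>+k. \<integral>\<^sup>+x. ennreal ((1 + r) ^ n / V / jb (\<xi> - x) ^ n) * indicator (ball k r) x \<partial>lborel \<partial>count_space S)"
      by (intro nn_integral_mono)
    also have "\<dots> = (\<integral>\<^sup>+x. \<integral>\<^sup>+k. ennreal ((1 + r) ^ n / V / jb (\<xi> - x) ^ n) * indicator (ball k r) x \<partial>count_space S \<partial>lborel)"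
    proof (rule nn_integral_count_space_nn_integral[OF cS, symmetric])
      fix k
      have "(\<lambda>x. ennreal ((1 + r) ^ n / V / jb (\<xi> - x) ^ n)) \<in> borel_measurable lborel" by measurable
      then show "(\<lambda>x. ennreal ((1 + r) ^ n / V / jb (\<xi> - x) ^ n) * indicator (ball k r) x) \<in> borel_measurable lborel"
        by (intro borel_measurable_times_ennreal borel_measurable_indicator) auto
    qed
    also have "\<dots> \<le> (\<integral>\<^sup>+x. ennreal ((1 + r) ^ n / V / jb (\<xi> - x) ^ n) \<partial>lborel)"
    proof (intro nn_integral_mono)
      fix x
      \<comment> \<open>Disjointness of the balls: at most one k has x in its ball.\<close>
      have one: "(\<integral>\<^sup>+k. indicator (ball k r) x \<partial>count_space S) \<le> 1"
      proof (cases "\<exists>k\<in>S. x \<in> ball k r")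
        case True
        then obtain k0 where k0: "k0 \<in> S" "dist k0 x < r" by auto
        have "(\<integral>\<^sup>+k. indicator (ball k r) x \<partial>count_space S) \<le> (\<integral>\<^sup>+k. indicator {k0} k \<partial>count_space S)"
        proof (intro nn_integral_mono)
          fix k assume k: "k \<in> space (count_space S)"
          show "indicator (ball k r) x \<le> (indicator {k0} k :: ennreal)"
          proof (cases "k = k0")
            case False
            then have "2 * r \<le> dist k k0" using r(2) k k0(1) by simp
            then have "dist k x \<ge> r" using k0(2) dist_triangle2[of k k0 x] by linarith
            then show ?thesis by simp
          qed (simp add: indicator_def)
        qed
        also have "\<dots> = 1" using k0(1) by simp
        finally show ?thesis .
      next
        case False
        then have "(\<integral>\<^sup>+k. indicator (ball k r) x \<partial>count_space S) = (\<integral>\<^sup>+k. 0 \<partial>count_space S)"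
          by (intro nn_integral_cong) (auto simp: indicator_def)
        then show ?thesis by simp
      qed
      have "(\<integral>\<^sup>+k. ennreal ((1 + r) ^ n / V / jb (\<xi> - x) ^ n) * indicator (ball k r) x \<partial>count_space S)
          = ennreal ((1 + r) ^ n / V / jb (\<xi> - x) ^ n) * (\<integral>\<^sup>+k. indicator (ball k r) x \<partial>count_space S)"
        by (rule nn_integral_cmult) simp
      also have "\<dots> \<le> ennreal ((1 + r) ^ n / V / jb (\<xi> - x) ^ n) * 1"
        using one by (intro mult_left_mono) auto
      finally show "(\<integral>\<^sup>+k. ennreal ((1 + r) ^ n / V / jb (\<xi> - x) ^ n) * indicator (ball k r) x \<partial>count_space S)
          \<le> ennreal ((1 + r) ^ n / V / jb (\<xi> - x) ^ n)" by simp
    qed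
    also have "\<dots> = (\<integral>\<^sup>+x. ennreal ((1 + r) ^ n / V) * ennreal (1 / jb (\<xi> - x) ^ n) \<partial>lborel)"
      using r(1) V(1) by (intro nn_integral_cong) (simp flip: ennreal_mult)
    also have "\<dots> = ennreal ((1 + r) ^ n / V) * (\<integral>\<^sup>+x. ennreal (1 / jb (\<xi> - x) ^ n) \<partial>lborel)"
      by (rule nn_integral_cmult) measurable
    finally show ?thesis unfolding nn_integral_jb_shift I_def .
  qed
  define C where "C = enn2real (ennreal ((1 + r) ^ n / V) * I)"
  show ?thesis
  proof (rule that[of C])
    fix \<xi> N assume N: "DIM('a) + 2 \<le> N"
    have "(\<integral>\<^sup>+k. ennreal (1 / jb (\<xi> - k) ^ N) \<partial>count_space S) \<le> (\<integral>\<^sup>+k. ennreal (1 / jb (\<xi> - k) ^ n) \<partial>count_space S)"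
      using N unfolding n_def by (intro nn_integral_mono ennreal_leI jb_power_mono)
    also note *
    also have "ennreal ((1 + r) ^ n / V) * I = ennreal C"
      unfolding C_def using I by (intro ennreal_enn2real[symmetric]) (auto simp: ennreal_mult_less_top)
    finally show "(\<integral>\<^sup>+k. ennreal (1 / jb (\<xi> - k) ^ N) \<partial>count_space S) \<le> ennreal C" .
  qed (simp add: C_def)
qed

lemma separated_integrable:
  assumes "separated (S :: 'a::euclidean_space set)" "DIM('a) + 2 \<le> N"
  shows "integrable (count_space S) (\<lambda>k. 1 / jb (\<xi> - k) ^ N)" "integrable (count_space S) (\<lambda>k. 1 / jb k ^ N)"
proof -
  obtain C where "C \<ge> 0" "\<And>\<xi> N. DIM('a) + 2 \<le> N \<Longrightarrow> (\<integral>\<^sup>+k. ennreal (1 / jb (\<xi> - k) ^ N) \<partial>count_space S) \<le> ennreal C"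
    using separated_sum[OF assms(1)] by blast
  then have *: "(\<integral>\<^sup>+k. ennreal (1 / jb (\<xi> - k) ^ N) \<partial>count_space S) < \<infinity>" for \<xi>
    using assms(2) by (metis ennreal_less_top infinity_ennreal_def order_le_less_trans)
  have **: "integrable (count_space S) (\<lambda>k. 1 / jb (\<xi> - k) ^ N)" for \<xi>
    using * by (intro integrableI_bounded) auto
  show "integrable (count_space S) (\<lambda>k. 1 / jb (\<xi> - k) ^ N)" using ** .
  show "integrable (count_space S) (\<lambda>k. 1 / jb k ^ N)" using **[of 0] by (simp add: jb_minus)
qed

lemma integral_separated_le:
  assumes "\<And>k. k \<in> S \<Longrightarrow> 0 \<le> g k" "C \<ge> 0" "(\<integral>\<^sup>+k. ennreal (g k) \<partial>count_space S) \<le> ennreal C"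
  shows "(\<integral>k. g k \<partial>count_space S) \<le> C"
  using assms by (intro integral_real_bounded) auto

subsection \<open>Smoothness of parameter integrals\<close>

text \<open>The candidates for the derivatives are the integrals of the iterated partials.
  Integrating Taylor's estimate against an integrable bound for the next two orders gives a
  quadratic remainder, and so differentiability at every order by one argument.\<close>

lemma smooth_parameter_integral:
  fixes G :: "'b \<Rightarrow> real^'d \<Rightarrow> complex"
  assumes sm: "\<And>t. t \<in> space M \<Longrightarrow> smooth (G t)"
    and meas: "\<And>ks y. (\<lambda>t. iter_partial ks (G t) y) \<in> borel_measurable M"
    and bnd: "\<And>ks R. \<exists>B. integrable M B \<and> (\<forall>t\<in>space M. \<forall>y\<in>cball 0 R. cmod (iter_partial ks (G t) y) \<le> B t)"
  shows "smooth (\<lambda>y. \<integral>t. G t y \<partial>M)"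
    and "iter_partial ks (\<lambda>y. \<integral>t. G t y \<partial>M) = (\<lambda>y. \<integral>t. iter_partial ks (G t) y \<partial>M)"
proof -
  define I where "I ks y = (\<integral>t. iter_partial ks (G t) y \<partial>M)" for ks y
  have int: "integrable M (\<lambda>t. iter_partial ks (G t) y)" for ks y
  proof -
    obtain B where B: "integrable M B" "\<forall>t\<in>space M. \<forall>y\<in>cball 0 (norm y). cmod (iter_partial ks (G t) y) \<le> B t"
      using bnd by blast
    show ?thesis
      by (rule Bochner_Integration.integrable_bound[OF B(1) meas], rule AE_I2) (use B(2) in force)
  qed
  have hd: "(I ks has_derivative (\<lambda>h. \<Sum>j\<in>UNIV. (h $ j) *\<^sub>R I (j # ks) y)) (at y)" for ks y
  proof -
    \<comment> \<open>Contains y + h for all increments with |h| at most 1.\<close>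
    define R where "R = norm y + 1"
    have "\<forall>js. \<exists>B. integrable M B \<and> (\<forall>t\<in>space M. \<forall>y\<in>cball 0 R. cmod (iter_partial (js @ ks) (G t) y) \<le> B t)"
      using bnd by blast
    then obtain B where B: "\<And>js. integrable M (B js)"
        "\<And>js t y. t \<in> space M \<Longrightarrow> y \<in> cball 0 R \<Longrightarrow> cmod (iter_partial (js @ ks) (G t) y) \<le> B js t"
      by metis
    \<comment> \<open>One integrable function that dominates all second-order partials of the ks-th
      derivative on the ball.\<close>
    define A where "A t = (\<Sum>i\<in>UNIV. \<Sum>j\<in>UNIV. \<bar>B [i, j] t\<bar>)" for t
    have A: "integrable M A" unfolding A_def by (intro Bochner_Integration.integrable_sum integrable_abs B(1))
    have A2: "cmod (iter_partial [i, j] (iter_partial ks (G t)) z) \<le> A t" if "t \<in> space M" "z \<in> cball 0 R" for i j t z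
    proof -
      have "cmod (iter_partial [i, j] (iter_partial ks (G t)) z) \<le> \<bar>B [i, j] t\<bar>"
        using B(2)[OF that, of "[i, j]"] by (simp add: iter_partial_append)
      also have "\<dots> \<le> (\<Sum>j\<in>UNIV. \<bar>B [i, j] t\<bar>)" by (rule member_le_sum) auto
      also have "\<dots> \<le> A t" unfolding A_def by (rule member_le_sum) (auto intro: sum_nonneg)
      finally show ?thesis .
    qed
    show ?thesis
    proof (rule has_derivative_quadratic)
      show "bounded_linear (\<lambda>h. \<Sum>j\<in>UNIV. (h $ j) *\<^sub>R I (j # ks) y)"
        by (intro bounded_linear_sum bounded_linear_scaleR_left[THEN bounded_linear_compose] bounded_linear_vec_nth)
      fix h :: "real^'d" assume h: "norm h \<le> 1"
      define Q where "Q t = iter_partial ks (G t) (y + h) - iter_partial ks (G t) y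
        - (\<Sum>j\<in>UNIV. (h $ j) *\<^sub>R iter_partial (j # ks) (G t) y)" for t
      have hb: "has_bochner_integral M Q (I ks (y + h) - I ks y - (\<Sum>j\<in>UNIV. (h $ j) *\<^sub>R I (j # ks) y))"
        unfolding Q_def I_def
        by (intro has_bochner_integral_diff has_bochner_integral_sum has_bochner_integral_scaleR_right has_bochner_integral_integrable int)
      note Q = has_bochner_integral_integral_eq[OF hb, symmetric]
      have yh: "norm (y + h) \<le> R" unfolding R_def using norm_triangle_ineq[of y h] h by linarith
      have "cmod (\<integral>t. Q t \<partial>M) \<le> (\<integral>t. (real CARD('d))\<^sup>2 * A t * (norm h)\<^sup>2 \<partial>M)"
      proof (rule norm_integral_le)
        show "integrable M Q" using hb by (rule integrable.intros)
        show "integrable M (\<lambda>t. (real CARD('d))\<^sup>2 * A t * (norm h)\<^sup>2)" using A by simp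
        fix t assume t: "t \<in> space M"
        have "cmod (iter_partial ks (G t) (y + h) - iter_partial ks (G t) y
          - (\<Sum>j\<in>UNIV. (h $ j) *\<^sub>R pd j (iter_partial ks (G t)) y)) \<le> (real CARD('d))\<^sup>2 * A t * (norm h)\<^sup>2"
          by (rule taylor2[OF smooth_iter_partial[OF sm[OF t]] convex_cball[of 0 R] A2[OF t]]) (use yh in \<open>auto simp: R_def\<close>)
        then show "cmod (Q t) \<le> (real CARD('d))\<^sup>2 * A t * (norm h)\<^sup>2" unfolding Q_def by simp
      qed
      then show "cmod (I ks (y + h) - I ks y - (\<Sum>j\<in>UNIV. (h $ j) *\<^sub>R I (j # ks) y)) \<le> ((real CARD('d))\<^sup>2 * (\<integral>t. A t \<partial>M)) * (norm h)\<^sup>2"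
        unfolding Q by simp
    qed
  qed
  have pdI: "pd j (I ks) = I (j # ks)" for j ks
  proof
    fix y
    have "(\<Sum>i\<in>UNIV. (axis j 1 $ i) *\<^sub>R I (i # ks) y) = (\<Sum>i\<in>UNIV. if i = j then I (j # ks) y else 0)"
      by (rule sum.cong) (auto simp: axis_def)
    with pd_eqI[OF hd[of ks y], where j = j] show "pd j (I ks) y = I (j # ks) y" by (simp only: sum.delta finite UNIV_I if_True)
  qed
  have it: "iter_partial ks (I []) = I ks" for ks
  proof (induction ks)
    case (Cons j ks)
    have "iter_partial (j # ks) (I []) = pd j (I ks)" by (simp only: iter_partial.simps Cons)
    then show ?case using pdI by (rule trans)
  qed simp
  have I0: "I [] = (\<lambda>y. \<integral>t. G t y \<partial>M)" by (simp add: I_def fun_eq_iff)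
  have "I ks differentiable at y" for ks y
    using hd unfolding differentiable_def by blast
  then have "smooth (I [])" unfolding smooth_def it by blast
  then show "smooth (\<lambda>y. \<integral>t. G t y \<partial>M)" unfolding I0 .
  show "iter_partial ks (\<lambda>y. \<integral>t. G t y \<partial>M) = (\<lambda>y. \<integral>t. iter_partial ks (G t) y \<partial>M)"
    using it[of ks] unfolding I0 by (simp only: I_def[abs_def])
qed

subsection \<open>Fourier series\<close>

text \<open>If r t0 were positive, the powers of T would concentrate the integral at t0. A small
  ball contributes at least a multiple of \<rho>'^n; the part where r may be negative contributes at
  most a multiple of \<rho>^n in absolute value, with \<rho> < \<rho>'. For large n the integral
  could not vanish.\<close>

lemma peak_function_argument:
  fixes r T :: "'a::euclidean_space \<Rightarrow> real"
  assumes Q: "compact Q" "t0 \<in> interior Q" and cr: "continuous_on Q r" and cT: "continuous_on Q T"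
    and T0: "\<And>t. t \<in> Q \<Longrightarrow> 0 \<le> T t" and T1: "T t0 = 1" and Tl: "\<And>t. t \<in> Q \<Longrightarrow> t \<noteq> t0 \<Longrightarrow> T t < 1"
    and int0: "\<And>n. (\<integral>t. indicator Q t *\<^sub>R (r t * T t ^ n) \<partial>lborel) = 0"
  shows "r t0 \<le> 0"
proof (rule ccontr)
  assume "\<not> r t0 \<le> 0"
  then have r0: "r t0 > 0" by simp
  have iQ: "t0 \<in> interior Q" by fact
  have ev: "\<exists>d>0. ball t0 d \<subseteq> Q \<and> (\<forall>t\<in>ball t0 d. f t > l)"
    if "continuous_on Q f" "f t0 > l" for f :: "'a \<Rightarrow> real" and l
  proof -
    have "continuous_on (interior Q) f" using that(1) interior_subset continuous_on_subset by blast
    then have "isCont f t0" using iQ continuous_on_interior by (metis interior_interior)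
    then have "\<forall>\<^sub>F t in at t0. f t > l" using that(2) by (simp add: isCont_def order_tendstoD(1))
    then have "\<forall>\<^sub>F t in nhds t0. f t > l" using that(2) by (auto simp: eventually_at_filter elim: eventually_mono)
    moreover have "\<forall>\<^sub>F t in nhds t0. t \<in> interior Q" using iQ by (intro eventually_nhds_in_open) auto
    ultimately have "\<forall>\<^sub>F t in nhds t0. f t > l \<and> t \<in> interior Q" by (rule eventually_conj)
    then obtain d where "d > 0" "\<And>t. dist t t0 < d \<Longrightarrow> f t > l \<and> t \<in> interior Q"
      unfolding eventually_nhds_metric by blast
    then show ?thesis using interior_subset[of Q] by (intro exI[of _ d]) (auto simp: dist_commute)
  qed
  define b where "b = r t0 / 2"
  have b: "b > 0" "r t0 > b" using r0 by (auto simp: b_def)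
  obtain d where d: "d > 0" "ball t0 d \<subseteq> Q" "\<And>t. t \<in> ball t0 d \<Longrightarrow> r t > b"
    using ev[OF cr b(2)] by blast
  define K where "K = Q - ball t0 d"
  have K: "compact K" unfolding K_def by (intro compact_diff Q open_ball)
  \<comment> \<open>Away from t0 compactness keeps T below a constant smaller than its peak value
    1.\<close>
  have "\<exists>\<rho>. 0 \<le> \<rho> \<and> \<rho> < 1 \<and> (\<forall>t\<in>K. T t \<le> \<rho>)"
  proof (cases "K = {}")
    case True then show ?thesis by (intro exI[of _ 0]) auto
  next
    case False
    have "continuous_on K T" using cT by (rule continuous_on_subset) (auto simp: K_def)
    then obtain s where s: "s \<in> K" "\<And>t. t \<in> K \<Longrightarrow> T t \<le> T s"
      using continuous_attains_sup[OF K False] by blast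
    have "s \<in> Q" "s \<noteq> t0" using s(1) d(1) by (auto simp: K_def)
    then show ?thesis using s T0 Tl by (intro exI[of _ "T s"]) auto
  qed
  then obtain \<rho> where \<rho>: "0 \<le> \<rho>" "\<rho> < 1" "\<And>t. t \<in> K \<Longrightarrow> T t \<le> \<rho>" by blast
  \<comment> \<open>Strictly between the bound off the ball and the peak value, so that T exceeds it
    on a neighbourhood of t0.\<close>
  define \<rho>' where "\<rho>' = (1 + \<rho>) / 2"
  have \<rho>': "\<rho> < \<rho>'" "\<rho>' < T t0" "\<rho>' > 0" using \<rho> T1 by (auto simp: \<rho>'_def)
  obtain d2 where d2: "d2 > 0" "ball t0 d2 \<subseteq> Q" "\<And>t. t \<in> ball t0 d2 \<Longrightarrow> T t > \<rho>'"
    using ev[OF cT \<rho>'(2)] by blast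
  define B where "B = ball t0 (min d d2)"
  have B: "B \<subseteq> ball t0 d" "B \<subseteq> Q" "\<And>t. t \<in> B \<Longrightarrow> T t > \<rho>'" using d d2 by (auto simp: B_def)
  have "bounded (r ` Q)" by (intro compact_imp_bounded compact_continuous_image cr Q)
  then obtain M where M: "M > 0" "\<And>t. t \<in> Q \<Longrightarrow> \<bar>r t\<bar> \<le> M" unfolding bounded_pos by auto
  have fB: "emeasure lborel B < \<infinity>" unfolding B_def by (rule emeasure_lborel_ball_finite)
  have fQ: "emeasure lborel Q < \<infinity>" using Q(1) by (rule emeasure_compact_finite)
  define vB vQ where "vB = measure lborel B" and "vQ = measure lborel Q"
  have sB: "B \<in> sets lborel" and sQ: "Q \<in> sets lborel" using Q(1) by (auto simp: B_def compact_imp_closed)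
  have vB: "vB > 0" unfolding vB_def B_def using d(1) d2(1) content_ball_pos by simp
  have vQ: "vQ \<ge> 0" unfolding vQ_def by simp
  have main: "b * vB * \<rho>' ^ n \<le> M * vQ * \<rho> ^ n" for n
  proof -
    have iB: "integrable lborel (\<lambda>t. indicator B t * (b * \<rho>' ^ n))"
      using sB fB by (intro integrable_mult_left integrable_real_indicator)
    have iQ: "integrable lborel (\<lambda>t. indicator Q t * (M * \<rho> ^ n))"
      using sQ fQ by (intro integrable_mult_left integrable_real_indicator)
    have i2: "integrable lborel (\<lambda>t. indicator Q t *\<^sub>R (r t * T t ^ n))"
      by (intro borel_integrable_compact Q(1) continuous_intros cr cT)
    have "(\<integral>t. indicator B t * (b * \<rho>' ^ n) - indicator Q t * (M * \<rho> ^ n) \<partial>lborel)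
        \<le> (\<integral>t. indicator Q t *\<^sub>R (r t * T t ^ n) \<partial>lborel)"
    proof (rule Bochner_Integration.integral_mono[OF Bochner_Integration.integrable_diff[OF iB iQ] i2])
      fix t
      show "indicator B t * (b * \<rho>' ^ n) - indicator Q t * (M * \<rho> ^ n) \<le> indicator Q t *\<^sub>R (r t * T t ^ n)"
      proof (cases "t \<in> B")
        case True
        have "b * \<rho>' ^ n \<le> r t * T t ^ n"
        proof (rule mult_mono)
          show "b \<le> r t" using True B(1) d(3) by (simp add: less_imp_le subset_iff)
          then show "0 \<le> r t" using b by linarith
          show "\<rho>' ^ n \<le> T t ^ n" using True B(3) \<rho>'(3) by (intro power_mono less_imp_le)
          show "0 \<le> \<rho>' ^ n" using \<rho>'(3) by simp
        qed
        moreover have "0 \<le> M * \<rho> ^ n" using M \<rho> by simp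
        ultimately show ?thesis using True B(2) by (auto simp: indicator_def)
      next
        case tB: False
        show ?thesis
        proof (cases "t \<in> Q")
          case True
          show ?thesis
          proof (cases "t \<in> ball t0 d")
            case tb: True
            have "0 \<le> r t * T t ^ n" using d(3)[OF tb] b(1) T0[OF True] by simp
            moreover have "0 \<le> M * \<rho> ^ n" using M \<rho> by simp
            ultimately show ?thesis using tB True by (simp add: indicator_def)
          next
            case False
            then have "t \<in> K" using True by (simp add: K_def)
            then have "\<bar>r t * T t ^ n\<bar> \<le> M * \<rho> ^ n"
              unfolding abs_mult power_abs using M(2)[OF True] \<rho>(3) T0[OF True] M(1)
              by (intro mult_mono power_mono) auto
            then show ?thesis using tB True by (simp add: indicator_def)
          qed
        next
          case False
          then show ?thesis using tB by simp
        qed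
      qed
    qed
    also have "\<dots> = 0" by (rule int0)
    finally have "(\<integral>t. indicator B t * (b * \<rho>' ^ n) - indicator Q t * (M * \<rho> ^ n) \<partial>lborel) \<le> 0" .
    moreover have "(\<integral>t. indicator B t * (b * \<rho>' ^ n) - indicator Q t * (M * \<rho> ^ n) \<partial>lborel) = vB * (b * \<rho>' ^ n) - vQ * (M * \<rho> ^ n)"
      using sB sQ by (subst Bochner_Integration.integral_diff[OF iB iQ]) (simp add: vB_def vQ_def)
    ultimately show ?thesis by (simp add: mult_ac)
  qed
  have "(\<lambda>n. M * vQ * (\<rho> / \<rho>') ^ n) \<longlonglongrightarrow> M * vQ * 0"
    using \<rho> \<rho>' by (intro tendsto_mult tendsto_const LIMSEQ_realpow_zero) auto
  moreover have "b * vB \<le> M * vQ * (\<rho> / \<rho>') ^ n" for n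
    using main[of n] \<rho>'(3) by (simp add: power_divide pos_le_divide_eq)
  ultimately have "b * vB \<le> M * vQ * 0"
    by (intro LIMSEQ_le_const) auto
  then show False using b(1) vB by (simp add: mult_le_0_iff)
qed

section \<open>Orthogonality and completeness of characters on a cube\<close>

lemma product_sigma_finite_interval_measure:
  "product_sigma_finite (\<lambda>_::'a. interval_measure (\<lambda>x. x))"
  by (intro product_sigma_finite.intro sigma_finite_interval_measure) auto

text \<open>Lebesgue measure is the image of a product of one-dimensional measures under the
  coordinate isomorphism, which splits the integral.\<close>

lemma lborel_integral_prod_Basis:
  fixes f :: "'a::euclidean_space \<Rightarrow> real \<Rightarrow> complex"
  assumes i: "\<And>b. b \<in> Basis \<Longrightarrow> integrable lborel (f b)"
  shows "(\<integral>x. (\<Prod>b\<in>Basis. f b (x \<bullet> b)) \<partial>lborel) = (\<Prod>b\<in>Basis. \<integral>x. f b x \<partial>lborel)"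
proof -
  interpret p: product_sigma_finite "\<lambda>_::'a. interval_measure (\<lambda>x. x)"
    by (rule product_sigma_finite_interval_measure)
  have m: "f b \<in> borel_measurable borel" if "b \<in> Basis" for b
    using borel_measurable_integrable[OF i[OF that]] by simp
  have m2: "(\<lambda>x::'a. \<Prod>b\<in>Basis. f b (x \<bullet> b)) \<in> borel_measurable borel"
  proof (rule borel_measurable_prod)
    fix b :: 'a assume b: "b \<in> Basis"
    show "(\<lambda>x. f b (x \<bullet> b)) \<in> borel_measurable borel"
      by (rule measurable_compose[OF _ m[OF b]]) measurable
  qed
  have "(\<integral>x. (\<Prod>b\<in>Basis. f b (x \<bullet> b)) \<partial>lborel) =
      (\<integral>g. (\<Prod>b\<in>Basis. f b ((\<Sum>b\<in>Basis. g b *\<^sub>R b) \<bullet> b)) \<partial>(\<Pi>\<^sub>M b\<in>(Basis::'a set). interval_measure (\<lambda>x. x)))"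
    unfolding lborel_def by (rule integral_distr) (use m2 in \<open>simp_all\<close>)
  also have "\<dots> = (\<integral>g. (\<Prod>b\<in>Basis. f b (g b)) \<partial>(\<Pi>\<^sub>M b\<in>(Basis::'a set). interval_measure (\<lambda>x. x)))"
    by (intro Bochner_Integration.integral_cong prod.cong refl) simp
  also have "\<dots> = (\<Prod>b\<in>Basis. \<integral>x. f b x \<partial>interval_measure (\<lambda>x. x))"
    by (rule p.product_integral_prod) (use i in \<open>simp_all add: lborel_eq_real\<close>)
  finally show ?thesis by (simp add: lborel_eq_real)
qed

definition int_vec :: "real^'d \<Rightarrow> bool" where "int_vec k \<longleftrightarrow> (\<forall>j. k $ j \<in> \<int>)"

lemma int_vec_Basis: "int_vec k \<Longrightarrow> b \<in> Basis \<Longrightarrow> k \<bullet> b \<in> \<int>"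
  unfolding int_vec_def Basis_vec_def by (auto simp: inner_axis)

lemma int_vec_add: "int_vec k \<Longrightarrow> int_vec l \<Longrightarrow> int_vec (k + l)"
  and int_vec_diff: "int_vec k \<Longrightarrow> int_vec l \<Longrightarrow> int_vec (k - l)"
  and int_vec_uminus: "int_vec k \<Longrightarrow> int_vec (- k)"
  and int_vec_0: "int_vec 0"
  unfolding int_vec_def by auto

lemma Basis_int_vec: "b \<in> Basis \<Longrightarrow> int_vec (b :: real^'d)"
  unfolding int_vec_def Basis_vec_def by (auto simp: axis_def)

lemma integral_exp_period:
  assumes "c > 0" "m \<in> \<int>"
  shows "(\<integral>s. indicator {a..a + 2 * pi / c} s *\<^sub>R exp (- \<i> * of_real (c * m * s)) \<partial>lborel)
    = (if m = 0 then of_real (2 * pi / c) else 0)"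
proof (cases "m = 0")
  case True
  have "(\<integral>s. indicator {a..a + 2 * pi / c} s *\<^sub>R (1::complex) \<partial>lborel) = of_real (2 * pi / c)"
    using assms(1) by (subst integral_FTC_Icc[where F = of_real]) (auto intro!: derivative_eq_intros)
  then show ?thesis using True by simp
next
  case False
  define z where "z = - \<i> * of_real (c * m)"
  have z: "z \<noteq> 0" using False assms(1) by (simp add: z_def)
  have d: "((\<lambda>s. exp (z * of_real s) / z) has_vector_derivative exp (z * of_real s)) (at s within S)" for s S
    using z by (auto intro!: derivative_eq_intros has_vector_derivative_real_field)
  have e: "exp (- \<i> * of_real (c * m * s)) = exp (z * of_real s)" for s by (simp add: z_def mult_ac)
  have "(\<integral>s. indicator {a..a + 2 * pi / c} s *\<^sub>R exp (z * of_real s) \<partial>lborel)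
      = exp (z * of_real (a + 2 * pi / c)) / z - exp (z * of_real a) / z"
    by (rule integral_FTC_Icc) (use assms(1) d in \<open>auto intro!: continuous_intros\<close>)
  also have "exp (z * of_real (a + 2 * pi / c)) = exp (z * of_real a) * exp (z * of_real (2 * pi / c))"
    by (simp add: distrib_left exp_add)
  also have "exp (z * of_real (2 * pi / c)) = 1"
  proof -
    obtain n where "m = of_int n" using assms(2) Ints_cases by blast
    then have "z * of_real (2 * pi / c) = of_int (2 * (- n)) * (of_real pi * \<i>)"
      using assms(1) by (simp add: z_def field_simps)
    then show ?thesis using exp_integer_2pi[of "of_int (- n)"] by (simp add: mult_ac)
  qed
  finally show ?thesis using False unfolding e by simp
qed

text \<open>Orthogonality of characters on a period cube: the integral is a product over the
  coordinates, and any coordinate with nonzero integer frequency contributes a factor 0.\<close>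

lemma integral_ch_period:
  fixes q :: "real^'d"
  assumes "c > 0" "int_vec k"
  shows "(\<integral>t. indicator (cbox q (q + (2 * pi / c) *\<^sub>R One)) t *\<^sub>R ch (c *\<^sub>R k) t \<partial>lborel)
    = (if k = 0 then of_real ((2 * pi / c) ^ CARD('d)) else 0)"
proof -
  define f where "f b s = indicator {q \<bullet> b..q \<bullet> b + 2 * pi / c} s *\<^sub>R exp (- \<i> * of_real (c * (k \<bullet> b) * s))" for b :: "real^'d" and s
  have "indicator (cbox q (q + (2 * pi / c) *\<^sub>R One)) t *\<^sub>R ch (c *\<^sub>R k) t = (\<Prod>b\<in>Basis. f b (t \<bullet> b))" for t
  proof -
    have "(\<Prod>b\<in>Basis. f b (t \<bullet> b)) = (\<Prod>b\<in>Basis. complex_of_real (indicator {q \<bullet> b..q \<bullet> b + 2 * pi / c} (t \<bullet> b)))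
        * (\<Prod>b\<in>Basis. exp (- \<i> * of_real (c * (k \<bullet> b) * (t \<bullet> b))))"
      unfolding f_def scaleR_conv_of_real by (rule prod.distrib)
    also have "(\<Prod>b\<in>Basis. exp (- \<i> * of_real (c * (k \<bullet> b) * (t \<bullet> b)))) = ch (c *\<^sub>R k) t"
      unfolding ch_def
      by (subst exp_sum[symmetric], simp, subst (2) euclidean_inner) (simp add: sum_distrib_left mult_ac)
    also have "(\<Prod>b\<in>Basis. complex_of_real (indicator {q \<bullet> b..q \<bullet> b + 2 * pi / c} (t \<bullet> b)))
        = of_real (indicator (cbox q (q + (2 * pi / c) *\<^sub>R One)) t)"
    proof (cases "t \<in> cbox q (q + (2 * pi / c) *\<^sub>R One)")
      case True
      then show ?thesis by (auto simp: mem_box inner_add_left intro!: prod.neutral)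
    next
      case False
      then obtain b where b: "b \<in> Basis" "t \<bullet> b \<notin> {q \<bullet> b..q \<bullet> b + 2 * pi / c}"
        by (auto simp: mem_box inner_add_left)
      then have "(\<Prod>b\<in>Basis. complex_of_real (indicator {q \<bullet> b..q \<bullet> b + 2 * pi / c} (t \<bullet> b))) = 0"
        by (intro prod_zero) (auto intro!: bexI[of _ b])
      then show ?thesis using False by simp
    qed
    finally show ?thesis by (simp add: scaleR_conv_of_real)
  qed
  then have "(\<integral>t. indicator (cbox q (q + (2 * pi / c) *\<^sub>R One)) t *\<^sub>R ch (c *\<^sub>R k) t \<partial>lborel) = (\<integral>t. (\<Prod>b\<in>Basis. f b (t \<bullet> b)) \<partial>lborel)"
    by simp
  also have "\<dots> = (\<Prod>b\<in>Basis. \<integral>s. f b s \<partial>lborel)"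
    unfolding f_def by (intro lborel_integral_prod_Basis borel_integrable_compact continuous_intros compact_Icc)
  also have "\<dots> = (\<Prod>b\<in>(Basis::(real^'d) set). if k \<bullet> b = 0 then of_real (2 * pi / c) else 0)"
    unfolding f_def using integral_exp_period[OF assms(1) int_vec_Basis[OF assms(2)]] by (intro prod.cong refl)
  also have "\<dots> = (if k = 0 then of_real ((2 * pi / c) ^ CARD('d)) else 0)"
  proof (cases "k = 0")
    case True
    then show ?thesis by simp
  next
    case False
    then obtain b where b: "b \<in> Basis" "k \<bullet> b \<noteq> 0" using euclidean_all_zero_iff by blast
    have "(\<Prod>b\<in>(Basis::(real^'d) set). if k \<bullet> b = 0 then complex_of_real (2 * pi / c) else 0) = 0"
      by (rule prod_zero) (use b in \<open>auto intro!: bexI[of _ b]\<close>)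
    then show ?thesis using False by simp
  qed
  finally show ?thesis .
qed

text \<open>The product of the factors (1 + cos(c (t - t0)_b))/2 is a trigonometric polynomial with
  a strict peak at t0 on the closed cube. Orthogonality to all characters passes to w times its
  powers, and the peak argument applies. No periodicity of w is assumed, and the conclusion concerns
  interior points.\<close>

lemma trig_uniqueness:
  fixes w :: "real^'d \<Rightarrow> complex"
  assumes c: "c > 0" and w: "continuous_on UNIV w"
    and orth: "\<And>k. int_vec k \<Longrightarrow> (\<integral>t. indicator (cbox q (q + (2 * pi / c) *\<^sub>R One)) t *\<^sub>R (w t * ch (c *\<^sub>R k) t) \<partial>lborel) = 0"
    and t0: "t0 \<in> box q (q + (2 * pi / c) *\<^sub>R One)"
  shows "w t0 = 0"
proof -
  define Q where "Q = cbox q (q + (2 * pi / c) *\<^sub>R One)"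
  \<comment> \<open>Multipliers g for which w g is still orthogonal to every character; this class
    is stable under multiplication by trigonometric polynomials.\<close>
  define Z where "Z g \<longleftrightarrow> continuous_on UNIV g \<and> (\<forall>k. int_vec k \<longrightarrow> (\<integral>t. indicator Q t *\<^sub>R (w t * g t * ch (c *\<^sub>R k) t) \<partial>lborel) = 0)" for g
  have int: "integrable lborel (\<lambda>t. indicator Q t *\<^sub>R g t)" if "continuous_on UNIV g" for g :: "real^'d \<Rightarrow> complex"
    using that unfolding Q_def by (intro borel_integrable_compact compact_cbox) (rule continuous_on_subset, auto)
  define T1 where "T1 b t = (1 + cos (c * ((t - t0) \<bullet> b))) / 2" for b t :: "real^'d"
  define T where "T t = (\<Prod>b\<in>Basis. T1 b t)" for t
  have Z1: "Z (\<lambda>t. 1)" unfolding Z_def using orth by (simp add: Q_def)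
  have ZT1: "Z (\<lambda>t. g t * of_real (T1 b t))" if g: "Z g" and b: "b \<in> Basis" for g b
  proof -
    have cg: "continuous_on UNIV g" using g by (simp add: Z_def)
    have T1: "complex_of_real (T1 b t) = 1 / 2 + (cnj (ch (- c *\<^sub>R b) t0) / 4) * ch (- c *\<^sub>R b) t + (cnj (ch (c *\<^sub>R b) t0) / 4) * ch (c *\<^sub>R b) t" for t
    proof -
      have "complex_of_real (cos (c * ((t - t0) \<bullet> b))) = (exp (\<i> * of_real (c * ((t - t0) \<bullet> b))) + exp (- \<i> * of_real (c * ((t - t0) \<bullet> b)))) / 2"
        by (simp add: cos_of_real[symmetric] cos_exp_eq)
      also have "exp (\<i> * of_real (c * ((t - t0) \<bullet> b))) = cnj (ch (- c *\<^sub>R b) t0) * ch (- c *\<^sub>R b) t"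
        by (subst cnj_ch, unfold ch_def exp_add[symmetric]) (simp add: inner_diff_left algebra_simps)
      also have "exp (- \<i> * of_real (c * ((t - t0) \<bullet> b))) = cnj (ch (c *\<^sub>R b) t0) * ch (c *\<^sub>R b) t"
        by (subst cnj_ch, unfold ch_def exp_add[symmetric]) (simp add: inner_diff_left algebra_simps)
      finally show ?thesis by (simp add: T1_def add_divide_distrib)
    qed
    show ?thesis unfolding Z_def
    proof (intro conjI allI impI)
      show "continuous_on UNIV (\<lambda>t. g t * complex_of_real (T1 b t))"
        unfolding T1_def by (intro continuous_intros cg) auto
      fix k :: "real^'d" assume k: "int_vec k"
      define c1 c2 where "c1 = cnj (ch (- c *\<^sub>R b) t0) / 4" and "c2 = cnj (ch (c *\<^sub>R b) t0) / 4"
      define J where "J k t = indicator Q t *\<^sub>R (w t * g t * ch (c *\<^sub>R k) t)" for k t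
      have J0: "(\<integral>t. J k t \<partial>lborel) = 0" if "int_vec k" for k using g that unfolding Z_def J_def by blast
      have Ji: "integrable lborel (J k)" for k unfolding J_def by (intro int continuous_intros w cg)
      have e1: "ch (c *\<^sub>R (k - b)) t = ch (c *\<^sub>R k) t * ch (- c *\<^sub>R b) t" for t
        using ch_add[of "c *\<^sub>R k" "- c *\<^sub>R b" t] by (simp add: algebra_simps)
      have e2: "ch (c *\<^sub>R (k + b)) t = ch (c *\<^sub>R k) t * ch (c *\<^sub>R b) t" for t
        using ch_add[of "c *\<^sub>R k" "c *\<^sub>R b" t] by (simp add: algebra_simps)
      have eq: "indicator Q t *\<^sub>R (w t * (g t * complex_of_real (T1 b t)) * ch (c *\<^sub>R k) t)
          = (1 / 2) * J k t + c1 * J (k - b) t + c2 * J (k + b) t" for t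
        unfolding T1 c1_def[symmetric] c2_def[symmetric] J_def e1 e2 by (simp add: algebra_simps scaleR_conv_of_real)
      show "(\<integral>t. indicator Q t *\<^sub>R (w t * (g t * complex_of_real (T1 b t)) * ch (c *\<^sub>R k) t) \<partial>lborel) = 0"
        unfolding eq using Ji J0[OF k] J0[OF int_vec_diff[OF k Basis_int_vec[OF b]]] J0[OF int_vec_add[OF k Basis_int_vec[OF b]]]
        by (simp add: Bochner_Integration.integral_add Bochner_Integration.integrable_add integrable_mult_right)
    qed
  qed
  have ZT: "Z (\<lambda>t. g t * of_real (T t))" if "Z g" for g
  proof -
    have "Z (\<lambda>t. g t * of_real (\<Prod>b\<in>A. T1 b t))" if "finite A" "A \<subseteq> Basis" for A
      using that
    proof (induction A rule: finite_induct)
      case empty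
      then show ?case using \<open>Z g\<close> by simp
    next
      case (insert b A)
      then have "Z (\<lambda>t. (g t * of_real (\<Prod>b\<in>A. T1 b t)) * of_real (T1 b t))" by (intro ZT1) auto
      then show ?case using insert.hyps by (simp add: mult_ac)
    qed
    from this[OF finite_Basis order_refl] show ?thesis unfolding T_def .
  qed
  have ZTn: "Z (\<lambda>t. of_real (T t ^ n))" for n
  proof (induction n)
    case 0 then show ?case using Z1 by simp
  next
    case (Suc n)
    from ZT[OF this] show ?case by (simp add: mult.commute)
  qed
  \<comment> \<open>Normalised so that r t0 = |w t0|^2, whence the sign given by the peak argument
    forces w t0 = 0.\<close>
  define r where "r t = Re (cnj (w t0) * w t)" for t
  have "r t0 \<le> 0"
  proof (rule peak_function_argument[where r = r and ?t0.0 = t0 and Q = Q and T = T])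
    show "compact Q" unfolding Q_def by (rule compact_cbox)
    show "t0 \<in> interior Q" unfolding Q_def using t0 by (simp only: interior_cbox)
    show "continuous_on Q r" unfolding r_def
      by (intro continuous_intros continuous_on_subset[OF w]) auto
    show "continuous_on Q T" unfolding T_def T1_def by (intro continuous_intros) auto
    show "T t0 = 1" unfolding T_def T1_def by simp
    have T1p: "0 \<le> T1 b t" "T1 b t \<le> 1" for b t
    proof -
      have *: "-1 \<le> z \<Longrightarrow> 0 \<le> (1 + z) / 2" "z \<le> 1 \<Longrightarrow> (1 + z) / 2 \<le> 1" for z :: real
        by simp_all
      show "0 \<le> T1 b t" "T1 b t \<le> 1" unfolding T1_def by (rule *, rule cos_ge_minus_one cos_le_one)+
    qed
    show "0 \<le> T t" if "t \<in> Q" for t unfolding T_def by (intro prod_nonneg T1p)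
    show "T t < 1" if t: "t \<in> Q" "t \<noteq> t0" for t
    proof -
      obtain b where b: "b \<in> Basis" "(t - t0) \<bullet> b \<noteq> 0"
        using t(2) euclidean_all_zero_iff[of "t - t0"] by auto
      \<comment> \<open>Since t0 is interior, a coordinate of t - t0 is smaller than one period in
        absolute value, so its cosine is 1 only if it vanishes.\<close>
      have "q \<bullet> b < t0 \<bullet> b" "t0 \<bullet> b < q \<bullet> b + 2 * pi / c" "q \<bullet> b \<le> t \<bullet> b" "t \<bullet> b \<le> q \<bullet> b + 2 * pi / c"
        using t0 t(1) b(1) by (auto simp: Q_def mem_box inner_add_left)
      then have "\<bar>(t - t0) \<bullet> b\<bar> < 2 * pi / c" by (simp add: inner_diff_left)
      then have ab: "\<bar>c * ((t - t0) \<bullet> b)\<bar> < 2 * pi" using c by (simp add: abs_mult field_simps)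
      have "cos (c * ((t - t0) \<bullet> b)) \<noteq> 1"
      proof
        assume "cos (c * ((t - t0) \<bullet> b)) = 1"
        then obtain n :: int where n: "c * ((t - t0) \<bullet> b) = of_int n * 2 * pi"
          unfolding cos_one_2pi_int by blast
        with ab have "\<bar>of_int n\<bar> * (2 * pi) < 1 * (2 * pi)" by (simp add: abs_mult)
        then have "\<bar>of_int n\<bar> < (1::real)" by (rule mult_right_less_imp_less) simp
        then have "n = 0" by linarith
        then show False using n b(2) c by simp
      qed
      then have "cos (c * ((t - t0) \<bullet> b)) < 1" using cos_le_one order_le_less by blast
      then have lt: "T1 b t < 1" unfolding T1_def by simp
      have "T t = T1 b t * (\<Prod>b\<in>Basis - {b}. T1 b t)" unfolding T_def by (rule prod.remove) (use b in auto)
      also have "\<dots> \<le> T1 b t * 1" using T1p by (intro mult_left_mono prod_le_1) auto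
      finally show ?thesis using lt by simp
    qed
    fix n
    have "(\<integral>t. indicator Q t *\<^sub>R (r t * T t ^ n) \<partial>lborel) = (\<integral>t. Re (cnj (w t0) * (indicator Q t *\<^sub>R (w t * of_real (T t ^ n)))) \<partial>lborel)"
      by (intro Bochner_Integration.integral_cong refl) (simp add: r_def algebra_simps flip: of_real_power)
    also have "\<dots> = Re (\<integral>t. cnj (w t0) * (indicator Q t *\<^sub>R (w t * of_real (T t ^ n))) \<partial>lborel)"
    proof (rule integral_Re)
      have "continuous_on UNIV (\<lambda>t. w t * complex_of_real (T t ^ n))"
        using ZTn[of n] w unfolding Z_def by (intro continuous_on_mult) auto
      then show "integrable lborel (\<lambda>t. cnj (w t0) * (indicator Q t *\<^sub>R (w t * of_real (T t ^ n))))"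
        by (intro integrable_mult_right int)
    qed
    also have "(\<integral>t. cnj (w t0) * (indicator Q t *\<^sub>R (w t * of_real (T t ^ n))) \<partial>lborel) = 0"
    proof -
      have "(\<integral>t. indicator Q t *\<^sub>R (w t * of_real (T t ^ n) * ch (c *\<^sub>R 0) t) \<partial>lborel) = 0"
        using ZTn[of n] int_vec_0 unfolding Z_def by blast
      then have "(\<integral>t. indicator Q t *\<^sub>R (w t * of_real (T t ^ n)) \<partial>lborel) = 0"
        by (simp only: scaleR_zero_right ch_0 mult_1_right)
      then show ?thesis by (simp only: integral_mult_right_zero mult_zero_right)
    qed
    finally show "(\<integral>t. indicator Q t *\<^sub>R (r t * T t ^ n) \<partial>lborel) = 0" by simp
  qed
  moreover have "r t0 = (cmod (w t0))\<^sup>2" unfolding cmod_power2 by (simp add: r_def power2_eq_square)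
  ultimately show ?thesis by simp
qed

section \<open>Exchange of sums and integrals, and linear changes of variables\<close>

lemma fubini_count_space:
  fixes g :: "'k \<Rightarrow> 'a::euclidean_space \<Rightarrow> complex"
  assumes S: "countable S" and i: "\<And>k. k \<in> S \<Longrightarrow> integrable lborel (g k)"
    and n: "integrable (count_space S) (\<lambda>k. \<integral>t. cmod (g k t) \<partial>lborel)"
  shows "(\<integral>t. \<integral>k. g k t \<partial>count_space S \<partial>lborel) = (\<integral>k. \<integral>t. g k t \<partial>lborel \<partial>count_space S)"
    and "integrable lborel (\<lambda>t. \<integral>k. g k t \<partial>count_space S)"
proof -
  interpret P: pair_sigma_finite "count_space S" "lborel :: 'a measure"
    by (intro pair_sigma_finite.intro sigma_finite_measure_count_space_countable S lborel.sigma_finite_measure_axioms)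
  have m: "case_prod g \<in> borel_measurable (count_space S \<Otimes>\<^sub>M lborel)"
    by (rule measurable_pair_measure_countable1[OF S]) (use i in \<open>simp add: borel_measurable_integrable\<close>)
  have I: "integrable (count_space S \<Otimes>\<^sub>M lborel) (case_prod g)"
    by (rule P.Fubini_integrable[OF m]) (use n i in \<open>simp_all add: AE_count_space\<close>)
  show "(\<integral>t. \<integral>k. g k t \<partial>count_space S \<partial>lborel) = (\<integral>k. \<integral>t. g k t \<partial>lborel \<partial>count_space S)"
    by (rule P.Fubini_integral[OF I])
  show "integrable lborel (\<lambda>t. \<integral>k. g k t \<partial>count_space S)"
    by (rule P.integrable_snd[OF I])
qed

lemma nn_integral_lborel_reflect:
  fixes f :: "'a::euclidean_space \<Rightarrow> ennreal"
  assumes "f \<in> borel_measurable borel"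
  shows "(\<integral>\<^sup>+x. f (c - x) \<partial>lborel) = (\<integral>\<^sup>+x. f x \<partial>lborel)"
proof -
  have m: "(\<lambda>x. c + (-1) *\<^sub>R x) \<in> measurable lborel (borel :: 'a measure)" by measurable
  have "lborel = density (distr lborel borel (\<lambda>x::'a. c + (-1) *\<^sub>R x)) (\<lambda>_. 1)"
    using lborel_affine[of "-1" c] by simp
  then have "(\<integral>\<^sup>+x. f x \<partial>lborel) = (\<integral>\<^sup>+x. f x \<partial>distr lborel borel (\<lambda>x::'a. c + (-1) *\<^sub>R x))"
    by (metis density_1)
  also have "\<dots> = (\<integral>\<^sup>+x. f (c + (-1) *\<^sub>R x) \<partial>lborel)"
    by (rule nn_integral_distr[OF m]) (use assms in simp)
  finally show ?thesis by simp
qed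

text \<open>Uniqueness of Haar measure: comparing with the unit cube as a reference set, Fubini and two
  translations show that the image of Lebesgue measure is a multiple of it. The library's
  change of variables theorem needs a wellordered index type.\<close>

lemma lborel_integral_linear:
  fixes T T' :: "'a::euclidean_space \<Rightarrow> 'a"
  assumes T: "linear T" "linear T'" "\<And>x. T (T' x) = x" "\<And>x. T' (T x) = x"
  obtains H :: real where
    "\<And>f :: 'a \<Rightarrow> complex. f \<in> borel_measurable borel \<Longrightarrow> (\<integral>t. f (T t) \<partial>lborel) = of_real H * (\<integral>x. f x \<partial>lborel)"
proof -
  define C :: "'a set" where "C = cbox 0 One"
  define Hn where "Hn = (\<integral>\<^sup>+t. indicator C (T t) \<partial>lborel)"
  have mT [measurable]: "T \<in> borel_measurable borel"
    by (intro borel_measurable_continuous_onI linear_continuous_on linear_conv_bounded_linear[THEN iffD1] T)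
  have mC: "(\<lambda>x. indicator C x :: ennreal) \<in> borel_measurable borel" unfolding C_def by simp
  have C1: "(\<integral>\<^sup>+y. indicator C y \<partial>lborel) = 1"
    unfolding C_def by (simp add: nn_integral_indicator emeasure_lborel_cbox_eq)
  have nn: "(\<integral>\<^sup>+t. f (T t) \<partial>lborel) = Hn * (\<integral>\<^sup>+x. f x \<partial>lborel)" if f: "f \<in> borel_measurable borel" for f :: "'a \<Rightarrow> ennreal"
  proof -
    have "(\<integral>\<^sup>+t. f (T t) \<partial>lborel) = (\<integral>\<^sup>+t. \<integral>\<^sup>+y. f (T t) * indicator C (T t + y) \<partial>lborel \<partial>lborel)"
    proof (intro nn_integral_cong)
      fix t
      have "(\<lambda>y. indicator C (T t + y) :: ennreal) \<in> borel_measurable lborel"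
        by (rule measurable_compose[OF _ mC]) measurable
      then show "f (T t) = (\<integral>\<^sup>+y. f (T t) * indicator C (T t + y) \<partial>lborel)"
        by (subst nn_integral_cmult) (simp_all add: nn_integral_lborel_shift[OF mC] C1)
    qed
    also have "\<dots> = (\<integral>\<^sup>+y. \<integral>\<^sup>+t. f (T t) * indicator C (T t + y) \<partial>lborel \<partial>lborel)"
    proof (rule lborel_pair.Fubini'[symmetric])
      show "(\<lambda>(t, y). f (T t) * indicator C (T t + y)) \<in> borel_measurable (lborel \<Otimes>\<^sub>M lborel)"
        unfolding case_prod_unfold
      proof (rule borel_measurable_times_ennreal)
        show "(\<lambda>p. f (T (fst p))) \<in> borel_measurable (lborel \<Otimes>\<^sub>M (lborel :: 'a measure))"
          by (rule measurable_compose[OF _ f]) measurable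
        show "(\<lambda>p. indicator C (T (fst p) + snd p) :: ennreal) \<in> borel_measurable (lborel \<Otimes>\<^sub>M lborel)"
          by (rule measurable_compose[OF _ mC]) measurable
      qed
    qed
    \<comment> \<open>For fixed y, the inner variable t is translated by \<open>T' y\<close>, which
      changes \<open>T t\<close> by y.\<close>
    also have "\<dots> = (\<integral>\<^sup>+y. \<integral>\<^sup>+t. f (T t - y) * indicator C (T t) \<partial>lborel \<partial>lborel)"
    proof (rule nn_integral_cong)
      fix y
      have "(\<lambda>t. f (T t) * indicator C (T t + y)) \<in> borel_measurable borel"
      proof (rule borel_measurable_times_ennreal)
        show "(\<lambda>t. f (T t)) \<in> borel_measurable borel" by (rule measurable_compose[OF mT f])
        show "(\<lambda>t. indicator C (T t + y) :: ennreal) \<in> borel_measurable borel"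
          by (rule measurable_compose[OF _ mC]) measurable
      qed
      from nn_integral_lborel_shift[OF this, of "- T' y"]
      show "(\<integral>\<^sup>+t. f (T t) * indicator C (T t + y) \<partial>lborel) = (\<integral>\<^sup>+t. f (T t - y) * indicator C (T t) \<partial>lborel)"
        by (simp add: linear_add[OF T(1)] linear_neg[OF T(1)] linear_diff[OF T(1)] T(3))
    qed
    also have "\<dots> = (\<integral>\<^sup>+t. \<integral>\<^sup>+y. f (T t - y) * indicator C (T t) \<partial>lborel \<partial>lborel)"
    proof (rule lborel_pair.Fubini'[symmetric])
      show "(\<lambda>(y, t). f (T t - y) * indicator C (T t)) \<in> borel_measurable (lborel \<Otimes>\<^sub>M lborel)"
        unfolding case_prod_unfold
      proof (rule borel_measurable_times_ennreal)
        show "(\<lambda>p. f (T (snd p) - fst p)) \<in> borel_measurable (lborel \<Otimes>\<^sub>M (lborel :: 'a measure))"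
          by (rule measurable_compose[OF _ f]) measurable
        show "(\<lambda>p. indicator C (T (snd p)) :: ennreal) \<in> borel_measurable (lborel \<Otimes>\<^sub>M (lborel :: 'a measure))"
          by (rule measurable_compose[OF _ mC]) measurable
      qed
    qed
    also have "\<dots> = (\<integral>\<^sup>+t. (\<integral>\<^sup>+x. f x \<partial>lborel) * indicator C (T t) \<partial>lborel)"
    proof (intro nn_integral_cong)
      fix t
      have "(\<lambda>y. f (T t - y)) \<in> borel_measurable lborel" by (rule measurable_compose[OF _ f]) measurable
      then show "(\<integral>\<^sup>+y. f (T t - y) * indicator C (T t) \<partial>lborel) = (\<integral>\<^sup>+x. f x \<partial>lborel) * indicator C (T t)"
        by (simp add: nn_integral_multc nn_integral_lborel_reflect[OF f])
    qed
    also have "\<dots> = Hn * (\<integral>\<^sup>+x. f x \<partial>lborel)"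
      unfolding Hn_def by (subst nn_integral_cmult) (auto intro: measurable_compose[OF mT mC] simp: mult.commute)
    finally show ?thesis .
  qed
  \<comment> \<open>The factor is the measure of a compact set, the preimage of the unit cube, hence
    finite.\<close>
  have "Hn = emeasure lborel (T' ` C)"
  proof -
    have "indicator C (T t) = (indicator (T' ` C) t :: ennreal)" for t
      using T(3,4) by (auto simp: indicator_def image_iff)
    moreover have "compact (T' ` C)"
      unfolding C_def by (intro compact_continuous_image linear_continuous_on linear_conv_bounded_linear[THEN iffD1] T compact_cbox)
    ultimately show ?thesis unfolding Hn_def by (simp add: nn_integral_indicator compact_imp_closed)
  qed
  moreover have "compact (T' ` C)"
    unfolding C_def by (intro compact_continuous_image linear_continuous_on linear_conv_bounded_linear[THEN iffD1] T compact_cbox)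
  ultimately have "Hn < \<infinity>" using emeasure_compact_finite by metis
  then obtain H where H: "Hn = ennreal H" "H \<ge> 0" by (cases Hn) auto
  have d: "distr lborel borel T = density lborel (\<lambda>_. ennreal H)"
  proof (rule measure_eqI)
    fix A assume "A \<in> sets (distr lborel borel T)"
    then have A: "A \<in> sets borel" by simp
    have "emeasure (distr lborel borel T) A = (\<integral>\<^sup>+x. indicator A x \<partial>distr lborel borel T)" using A by simp
    also have "\<dots> = (\<integral>\<^sup>+t. indicator A (T t) \<partial>lborel)" by (rule nn_integral_distr) (use A mT in auto)
    also have "\<dots> = Hn * (\<integral>\<^sup>+x. indicator A x \<partial>lborel)" by (rule nn) (use A in auto)
    also have "\<dots> = emeasure (density lborel (\<lambda>_. ennreal H)) A"
      using A H by (simp add: emeasure_density nn_integral_cmult_indicator)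
    finally show "emeasure (distr lborel borel T) A = emeasure (density lborel (\<lambda>_. ennreal H)) A" .
  qed simp
  show ?thesis
  proof (rule that)
    fix f :: "'a \<Rightarrow> complex" assume f: "f \<in> borel_measurable borel"
    have "(\<integral>t. f (T t) \<partial>lborel) = (\<integral>x. f x \<partial>distr lborel borel T)"
      by (rule integral_distr[symmetric]) (use f mT in auto)
    also have "\<dots> = (\<integral>x. H *\<^sub>R f x \<partial>lborel)" unfolding d by (rule integral_density) (use f H in auto)
    finally show "(\<integral>t. f (T t) \<partial>lborel) = of_real H * (\<integral>x. f x \<partial>lborel)"
      by (simp add: scaleR_conv_of_real)
  qed
qed

section \<open>Superpositions of characters with rapidly decreasing coefficients\<close>

lemma measurable_iter_partial_ch:
  "(\<lambda>k. iter_partial ks (ch k) x) \<in> borel_measurable (borel :: (real^'d) measure)"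
proof -
  have "(\<lambda>k::real^'d. \<Prod>j\<leftarrow>ks. - \<i> * complex_of_real (k $ j)) \<in> borel_measurable borel"
  proof (induction ks)
    case (Cons j ks)
    have "(\<lambda>k::real^'d. - \<i> * complex_of_real (k $ j)) \<in> borel_measurable borel"
      by (intro borel_measurable_continuous_onI continuous_intros)
    from borel_measurable_times[OF this Cons] show ?case by simp
  qed simp
  moreover have "(\<lambda>k. ch k x) \<in> borel_measurable borel"
    by (intro borel_measurable_continuous_onI continuous_intros)
  ultimately show ?thesis unfolding iter_partial_ch by (rule borel_measurable_times)
qed

lemma norm_le_jb: "norm x ^ n \<le> jb x ^ n"
  by (intro power_mono) (auto simp: jb_def)

text \<open>Every derivative of a character costs one power of its frequency, so integrability
  against all powers of \<open>jb\<close> gives smoothness with explicit bounds. The measure is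
  general so as to cover both series over separated sets and Lebesgue integrals.\<close>

lemma fourier_integral_smooth:
  fixes b :: "real^'d \<Rightarrow> complex"
  assumes bm: "b \<in> borel_measurable M" and idm: "(\<lambda>k. k) \<in> borel_measurable M"
    and int: "\<And>n. integrable M (\<lambda>k. cmod (b k) * jb k ^ n)"
  shows "smooth (\<lambda>x. \<integral>k. b k * ch k x \<partial>M)"
    and "cmod (iter_partial ks (\<lambda>x. \<integral>k. b k * ch k x \<partial>M) x) \<le> (\<integral>k. cmod (b k) * jb k ^ length ks \<partial>M)"
proof -
  have it: "iter_partial ks (\<lambda>x. b k * ch k x) = (\<lambda>x. b k * iter_partial ks (ch k) x)" for ks k
    by (rule iter_partial_mult_const) simp
  have le: "cmod (b k * iter_partial ks (ch k) y) \<le> cmod (b k) * jb k ^ length ks" for k y ks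
    unfolding norm_mult using order_trans[OF norm_iter_partial_ch norm_le_jb] by (intro mult_left_mono) auto
  have m: "(\<lambda>k. iter_partial ks (\<lambda>x. b k * ch k x) y) \<in> borel_measurable M" for ks y
    unfolding it by (intro borel_measurable_times bm measurable_compose[OF idm measurable_iter_partial_ch])
  note S = smooth_parameter_integral[where G = "\<lambda>k x. b k * ch k x" and M = M]
  have sm: "smooth (\<lambda>x. b k * ch k x)" for k by (intro smooth_mult smooth_const smooth_ch)
  have bd: "\<exists>B. integrable M B \<and> (\<forall>t\<in>space M. \<forall>y\<in>cball 0 R. cmod (iter_partial ks (\<lambda>x. b t * ch t x) y) \<le> B t)" for ks R
    using int le unfolding it by blast
  show "smooth (\<lambda>x. \<integral>k. b k * ch k x \<partial>M)" by (rule S(1)[OF sm m bd])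
  have eq: "iter_partial ks (\<lambda>x. \<integral>k. b k * ch k x \<partial>M) = (\<lambda>y. \<integral>k. iter_partial ks (\<lambda>x. b k * ch k x) y \<partial>M)"
    by (rule S(2)[OF sm m bd])
  have i: "integrable M (\<lambda>k. iter_partial ks (\<lambda>x. b k * ch k x) x)"
    by (rule Bochner_Integration.integrable_bound[OF int[of "length ks"] m], rule AE_I2)
      (use le in \<open>simp add: it\<close>)
  show "cmod (iter_partial ks (\<lambda>x. \<integral>k. b k * ch k x \<partial>M) x) \<le> (\<integral>k. cmod (b k) * jb k ^ length ks \<partial>M)"
    unfolding eq by (rule norm_integral_le[OF i int]) (use le in \<open>simp add: it\<close>)
qed

lemma fourier_decay_tf:
  fixes \<alpha> :: "real^'d \<Rightarrow> complex"
  assumes "\<alpha> \<in> test_functions X"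
  obtains C where "C \<ge> 0" "\<And>\<eta>. cmod (\<integral>x. \<alpha> x * ch \<eta> x \<partial>lborel) \<le> C / jb \<eta> ^ N"
proof -
  obtain C R where C: "C \<ge> 0" "R > 0"
    "\<And>m B \<eta>. smooth m \<Longrightarrow> (\<And>ks x. length ks \<le> N \<Longrightarrow> x \<in> cball 0 R \<Longrightarrow> cmod (iter_partial ks m x) \<le> B)
      \<Longrightarrow> cmod (\<integral>x. \<alpha> x * m x * ch \<eta> x \<partial>lborel) \<le> C * B / jb \<eta> ^ N"
    using fourier_decay[OF assms, of N] by blast
  obtain B where B: "B \<ge> 0" "\<And>ks x. length ks \<le> N \<Longrightarrow> x \<in> cball (0::real^'d) R \<Longrightarrow> cmod (iter_partial ks (\<lambda>x. 1) x) \<le> B"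
    using smooth_derivs_bounded_on[OF smooth_const compact_cball, of N 0 R 1] by blast
  show ?thesis
  proof (rule that[of "C * B"])
    show "cmod (\<integral>x. \<alpha> x * ch \<eta> x \<partial>lborel) \<le> C * B / jb \<eta> ^ N" for \<eta>
      using C(3)[OF smooth_const B(2), of \<eta>] by simp
  qed (use C B in simp)
qed

text \<open>Decay of order n + d + 2 leaves a summable factor after multiplication by the n-th power
  of \<open>jb\<close>.\<close>

lemma decay_integrable:
  assumes S: "separated (S :: (real^'d) set)" and b: "\<And>n. \<exists>C. \<forall>k\<in>S. cmod (b k) \<le> C / jb k ^ n"
  shows "integrable (count_space S) (\<lambda>k. cmod (b k) * jb k ^ n)"
proof -
  obtain C where C: "\<forall>k\<in>S. cmod (b k) \<le> C / jb k ^ (n + (CARD('d) + 2))" using b by blast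
  have i: "integrable (count_space S) (\<lambda>k. C * (1 / jb k ^ (CARD('d) + 2)))"
    by (intro integrable_mult_right separated_integrable(2)[OF S]) simp
  show ?thesis
  proof (rule Bochner_Integration.integrable_bound[OF i])
    show "AE k in count_space S. norm (cmod (b k) * jb k ^ n) \<le> norm (C * (1 / jb k ^ (CARD('d) + 2)))"
    proof (rule AE_I2)
      fix k assume "k \<in> space (count_space S)"
      then have "cmod (b k) * jb k ^ n \<le> C / jb k ^ (n + (CARD('d) + 2)) * jb k ^ n"
        using C by (intro mult_right_mono) auto
      also have "\<dots> = C * (1 / jb k ^ (CARD('d) + 2))"
        unfolding power_add[of _ n] by (simp add: field_simps)
      finally have "cmod (b k) * jb k ^ n \<le> \<bar>C * (1 / jb k ^ (CARD('d) + 2))\<bar>" by (rule order_trans[OF _ abs_ge_self])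
      moreover have "0 \<le> cmod (b k) * jb k ^ n" by simp
      ultimately show "norm (cmod (b k) * jb k ^ n) \<le> norm (C * (1 / jb k ^ (CARD('d) + 2)))"
        by (simp only: real_norm_def abs_of_nonneg)
    qed
  qed simp
qed

section \<open>Fourier series on a parallelepiped\<close>

definition dual_lattice :: "('d \<Rightarrow> real^'d) \<Rightarrow> real^'d \<Rightarrow> (real^'d) set" where
  "dual_lattice \<epsilon> \<xi>0 = {\<xi>0 + (\<Sum>j\<in>UNIV. (k $ j) *\<^sub>R \<epsilon> j) | k. int_vec k}"

lemma countable_int_vec: "countable {k :: real^'d. int_vec k}"
proof -
  have "{k :: real^'d. int_vec k} \<subseteq> (\<lambda>f :: 'd \<Rightarrow> int. \<chi> j. of_int (f j)) ` UNIV"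
  proof
    fix k :: "real^'d" assume "k \<in> {k. int_vec k}"
    then have "k = (\<chi> j. of_int \<lfloor>k $ j\<rfloor>)" by (auto simp: int_vec_def vec_eq_iff)
    then show "k \<in> (\<lambda>f :: 'd \<Rightarrow> int. \<chi> j. of_int (f j)) ` UNIV" by (intro image_eqI[where x = "\<lambda>j. \<lfloor>k $ j\<rfloor>"]) auto
  qed
  then show ?thesis by (rule countable_subset) (intro countable_image countableI_type)
qed

lemma integral_count_space_singleton_support:
  fixes f :: "'a \<Rightarrow> 'b::{banach, second_countable_topology}"
  assumes "a \<in> S" "\<And>k. k \<in> S \<Longrightarrow> k \<noteq> a \<Longrightarrow> f k = 0"
  shows "(\<integral>k. f k \<partial>count_space S) = f a"
proof -
  have s: "{k \<in> S. f k \<noteq> 0} \<subseteq> {a}" using assms by auto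
  have "(\<integral>k. f k \<partial>count_space S) = (\<Sum>k | k \<in> S \<and> f k \<noteq> 0. f k)"
    by (rule lebesgue_integral_count_space_finite_support) (rule finite_subset[OF s], simp)
  also have "\<dots> = (\<Sum>k\<in>{a}. f k)"
    by (rule sum.mono_neutral_left) (use s assms(1) in auto)
  finally show ?thesis by simp
qed

lemma inner_dual_basis:
  assumes "\<And>i j. e i \<bullet> \<epsilon> j = (if i = j then c else 0)"
  shows "e i \<bullet> (\<Sum>j\<in>UNIV. (k $ j) *\<^sub>R \<epsilon> j) = c * k $ i"
    and "(\<Sum>j\<in>UNIV. (t $ j) *\<^sub>R e j) \<bullet> \<epsilon> i = c * t $ i"
    and "(\<Sum>j\<in>UNIV. (t $ j) *\<^sub>R e j) \<bullet> (\<Sum>j\<in>UNIV. (k $ j) *\<^sub>R \<epsilon> j) = c * (t \<bullet> k)"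
proof -
  show *: "e i \<bullet> (\<Sum>j\<in>UNIV. (k $ j) *\<^sub>R \<epsilon> j) = c * k $ i" for i
    by (simp add: inner_sum_right assms if_distrib[of "\<lambda>x. _ * x"] mult.commute cong: if_cong)
  show "(\<Sum>j\<in>UNIV. (t $ j) *\<^sub>R e j) \<bullet> \<epsilon> i = c * t $ i"
    by (simp add: inner_sum_left assms if_distrib[of "\<lambda>x. _ * x"] mult.commute cong: if_cong)
  show "(\<Sum>j\<in>UNIV. (t $ j) *\<^sub>R e j) \<bullet> (\<Sum>j\<in>UNIV. (k $ j) *\<^sub>R \<epsilon> j) = c * (t \<bullet> k)"
    by (simp only: inner_sum_left inner_scaleR_left *) (simp add: inner_vec_def sum_distrib_left mult_ac)
qed

text \<open>Pairing the difference of two distinct points with a suitable \<open>e i\<close> gives a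
  nonzero integer multiple of c, so Cauchy-Schwarz bounds the distance from below by c divided by a
  common bound for the edge lengths.\<close>

lemma separated_dual_lattice:
  fixes e \<epsilon> :: "'d \<Rightarrow> real^'d"
  assumes d: "\<And>i j. e i \<bullet> \<epsilon> j = (if i = j then c else 0)" and c: "c > 0"
  shows "separated (dual_lattice \<epsilon> \<xi>0)"
proof -
  define M where "M = 1 + (\<Sum>j\<in>UNIV. norm (e j))"
  have M0: "M > 0" unfolding M_def using sum_nonneg[of UNIV "\<lambda>j. norm (e j)"] by simp
  have M: "norm (e j) \<le> M" for j
  proof -
    have "norm (e j) \<le> (\<Sum>j\<in>UNIV. norm (e j))" by (rule member_le_sum) auto
    then show "norm (e j) \<le> M" unfolding M_def by simp
  qed
  have "c / M \<le> dist x y" if x: "x \<in> dual_lattice \<epsilon> \<xi>0" and y: "y \<in> dual_lattice \<epsilon> \<xi>0" and ne: "x \<noteq> y" for x y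
  proof -
    obtain k where k: "int_vec k" "x = \<xi>0 + (\<Sum>j\<in>UNIV. (k $ j) *\<^sub>R \<epsilon> j)" using x unfolding dual_lattice_def by blast
    obtain l where l: "int_vec l" "y = \<xi>0 + (\<Sum>j\<in>UNIV. (l $ j) *\<^sub>R \<epsilon> j)" using y unfolding dual_lattice_def by blast
    have "k \<noteq> l" using ne k l by auto
    then obtain i where i: "k $ i \<noteq> l $ i" by (auto simp: vec_eq_iff)
    have "k $ i - l $ i \<in> \<int>" using k l by (simp add: int_vec_def)
    then have 1: "1 \<le> \<bar>k $ i - l $ i\<bar>" using i Ints_nonzero_abs_ge1 by force
    have "x - y = (\<Sum>j\<in>UNIV. ((k - l) $ j) *\<^sub>R \<epsilon> j)"
      by (simp add: k l scaleR_diff_left sum_subtractf)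
    then have "e i \<bullet> (x - y) = c * (k - l) $ i" using inner_dual_basis(1)[OF d] by metis
    then have "c * \<bar>k $ i - l $ i\<bar> = \<bar>e i \<bullet> (x - y)\<bar>" using c by (simp add: abs_mult)
    also have "\<dots> \<le> norm (e i) * norm (x - y)" by (rule Cauchy_Schwarz_ineq2)
    also have "\<dots> \<le> M * norm (x - y)" using M by (intro mult_right_mono) auto
    finally have "c * 1 \<le> M * norm (x - y)" using mult_left_mono[OF 1, of c] c by linarith
    then show ?thesis using M0 by (simp add: dist_norm pos_divide_le_eq mult.commute)
  qed
  moreover have "countable (dual_lattice \<epsilon> \<xi>0)"
  proof -
    have "dual_lattice \<epsilon> \<xi>0 = (\<lambda>k. \<xi>0 + (\<Sum>j\<in>UNIV. (k $ j) *\<^sub>R \<epsilon> j)) ` {k. int_vec k}"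
      unfolding dual_lattice_def by blast
    then show ?thesis using countable_int_vec by (simp only:) (rule countable_image[OF countable_int_vec])
  qed
  ultimately show ?thesis unfolding separated_def
    using c M0 by (intro conjI exI[of _ "c / M / 2"]) auto
qed

text \<open>In the coordinates x = a + T t the parallelepiped is the unit cube, and up to phases the
  lattice characters are exp(-i c <t, k>) with integer k, of period L = 2 pi / c > 1. The unit cube
  therefore lies in the interior of a period cube Q, in which \<alpha> is extended by 0. Series and
  function have the same Fourier coefficients on Q, hence agree at interior points by
  \<open>trig_uniqueness\<close>. The constant V does not depend on \<alpha>.\<close>

lemma fourier_series:
  fixes e \<epsilon> :: "'d \<Rightarrow> real^'d"
  assumes d: "\<And>i j. e i \<bullet> \<epsilon> j = (if i = j then c else 0)" and c: "0 < c" "c < 2 * pi"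
  obtains V :: complex where
    "\<And>\<alpha> x. \<alpha> \<in> test_functions {a + (\<Sum>j\<in>UNIV. t j *\<^sub>R e j) | t. \<forall>j. 0 \<le> t j \<and> t j \<le> 1}
      \<Longrightarrow> x \<in> {a + (\<Sum>j\<in>UNIV. t j *\<^sub>R e j) | t. \<forall>j. 0 \<le> t j \<and> t j \<le> 1}
      \<Longrightarrow> \<alpha> x = V * (\<integral>k. (\<integral>y. \<alpha> y * ch (- k) y \<partial>lborel) * ch k x \<partial>count_space (dual_lattice \<epsilon> \<xi>0))"
proof -
  define D where "D = {a + (\<Sum>j\<in>UNIV. t j *\<^sub>R e j) | t. \<forall>j. 0 \<le> t j \<and> t j \<le> 1}"
  define S where "S = dual_lattice \<epsilon> \<xi>0"
  have sS: "separated S" unfolding S_def by (rule separated_dual_lattice[OF d c(1)])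
  have cS: "countable S" using sS by (simp add: separated_def)
  define T where "T t = (\<Sum>j\<in>UNIV. (t $ j) *\<^sub>R e j)" for t :: "real^'d"
  define T' where "T' x = (\<chi> j. (x \<bullet> \<epsilon> j) / c)" for x :: "real^'d"
  define F where "F k = (\<Sum>j\<in>UNIV. (k $ j) *\<^sub>R \<epsilon> j)" for k :: "real^'d"
  have TF: "T t \<bullet> F k = c * (t \<bullet> k)" for t k unfolding T_def F_def by (rule inner_dual_basis(3)[OF d])
  have linT: "linear T" unfolding T_def
    by (intro linear_compose_sum ballI linearI) (simp_all add: scaleR_add_left)
  have linT': "linear T'" unfolding T'_def
    by (intro linearI) (simp_all add: vec_eq_iff inner_add_left add_divide_distrib)
  have T'T: "T' (T t) = t" for t
    unfolding T'_def T_def using c(1) by (simp add: vec_eq_iff inner_dual_basis(2)[OF d])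
  have "inj T" using T'T by (metis injI)
  then have "surj T" using linear_injective_imp_surjective linT by blast
  then have TT': "T (T' x) = x" for x using T'T by (metis surjD)
  have chF: "ch (F k) (T t) = ch (c *\<^sub>R k) t" for k t unfolding ch_def by (simp add: TF)
  have chadd: "ch k (x + y) = ch k x * ch k y" for k x y :: "real^'d"
    using ch_add[of x y k] by (simp add: ch_swap)
  obtain H where H: "\<And>f :: real^'d \<Rightarrow> complex. f \<in> borel_measurable borel \<Longrightarrow> (\<integral>t. f (T t) \<partial>lborel) = of_real H * (\<integral>x. f x \<partial>lborel)"
    using lborel_integral_linear[OF linT linT' TT' T'T] by blast
  define L where "L = 2 * pi / c"
  have L: "L > 1" using c by (simp add: L_def)
  \<comment> \<open>Balances the two normalisations: L^d is the volume of the period cube and H the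
    factor of the substitution x = T t.\<close>
  define V where "V = complex_of_real (H / L ^ CARD('d))"
  \<comment> \<open>Places Q symmetrically about the unit cube, with a margin (L - 1)/2 on each
    side.\<close>
  define q :: "real^'d" where "q = (- (L - 1) / 2) *\<^sub>R One"
  define Q where "Q = cbox q (q + L *\<^sub>R One)"
  have inQ: "t \<in> box q (q + L *\<^sub>R One)" if "\<And>j. 0 \<le> t $ j \<and> t $ j \<le> 1" for t
  proof -
    have "q \<bullet> b < t \<bullet> b \<and> t \<bullet> b < q \<bullet> b + L" if b: "b \<in> Basis" for b
    proof -
      obtain j where j: "b = axis j 1" using b by (auto simp: Basis_vec_def)
      have "q \<bullet> b = - (L - 1) / 2" unfolding q_def using b by simp
      moreover have "t \<bullet> b = t $ j" unfolding j by (simp add: inner_axis)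
      ultimately show ?thesis using \<open>\<And>j. 0 \<le> t $ j \<and> t $ j \<le> 1\<close>[of j] L by (simp add: field_simps)
    qed
    then show ?thesis by (auto simp: mem_box inner_add_left)
  qed
  show ?thesis
  proof (rule that)
    fix \<alpha> x assume a0: "\<alpha> \<in> test_functions {a + (\<Sum>j\<in>UNIV. t j *\<^sub>R e j) | t. \<forall>j. 0 \<le> t j \<and> t j \<le> 1}"
      and x0: "x \<in> {a + (\<Sum>j\<in>UNIV. t j *\<^sub>R e j) | t. \<forall>j. 0 \<le> t j \<and> t j \<le> 1}"
    have \<alpha>: "\<alpha> \<in> test_functions D" using a0 by (simp add: D_def)
    obtain tx where tx: "x = a + (\<Sum>j\<in>UNIV. tx j *\<^sub>R e j)" "\<And>j. 0 \<le> tx j \<and> tx j \<le> 1" using x0 by blast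
    define t0 :: "real^'d" where "t0 = (\<chi> j. tx j)"
    have t0: "x = a + T t0" "t0 \<in> box q (q + L *\<^sub>R One)"
      using tx by (auto simp: t0_def T_def intro!: inQ)
    define b where "b k = (\<integral>y. \<alpha> y * ch (- k) y \<partial>lborel)" for k
    have bdec: "\<exists>C. \<forall>k\<in>S. cmod (b k) \<le> C / jb k ^ n" for n
    proof -
      obtain C where "\<And>\<eta>. cmod (\<integral>x. \<alpha> x * ch \<eta> x \<partial>lborel) \<le> C / jb \<eta> ^ n"
        using fourier_decay_tf[OF \<alpha>] by blast
      then have "cmod (b k) \<le> C / jb k ^ n" for k unfolding b_def by (metis jb_minus)
      then show ?thesis by blast
    qed
    define s where "s x = (\<integral>k. b k * ch k x \<partial>count_space S)" for x
    have ss: "smooth s" unfolding s_def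
      by (rule fourier_integral_smooth(1)[OF _ _ decay_integrable[OF sS bdec]]) simp_all
    have bi: "integrable (count_space S) (\<lambda>k. cmod (b k))" using decay_integrable[OF sS bdec, of 0] by simp
    have cT: "continuous_on UNIV (\<lambda>t. a + T t)"
      by (intro continuous_intros linear_continuous_on linear_conv_bounded_linear[THEN iffD1] linT)
    \<comment> \<open>The character of -\<xi>0 removes the offset of the shifted lattice, so that
      only integer frequencies remain in the variable t.\<close>
    define w where "w t = (V * s (a + T t) - \<alpha> (a + T t)) * ch (- \<xi>0) (a + T t)" for t
    have ca: "continuous_on UNIV (\<lambda>t. \<alpha> (a + T t))" "continuous_on UNIV (\<lambda>t. s (a + T t))" "continuous_on UNIV (\<lambda>t. ch k (a + T t))" for k
      by (rule continuous_on_compose2[OF smooth_continuous_on[where S=UNIV] cT], auto intro: ss tf_smooth[OF \<alpha>])+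
    have int: "integrable lborel (\<lambda>t. indicator Q t *\<^sub>R g t)" if "continuous_on UNIV g" for g :: "real^'d \<Rightarrow> complex"
      using that unfolding Q_def by (intro borel_integrable_compact compact_cbox) (rule continuous_on_subset, auto)
    have "w t0 = 0"
    proof (rule trig_uniqueness[OF c(1)])
      show "continuous_on UNIV w" unfolding w_def by (intro continuous_intros ca)
      show "t0 \<in> box q (q + (2 * pi / c) *\<^sub>R One)" using t0(2) by (simp add: L_def)
      fix l0 :: "real^'d" assume l0: "int_vec l0"
      \<comment> \<open>Testing w with the frequency l0 amounts to extracting the coefficient at the
        lattice point \<xi>0 + F l.\<close>
      define l where "l = - l0"
      have l: "int_vec l" "l0 = - l" using l0 by (auto simp: l_def int_vec_uminus)
      define \<xi> where "\<xi> = \<xi>0 + F l"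
      have \<xi>S: "\<xi> \<in> S" unfolding S_def dual_lattice_def \<xi>_def F_def using l by blast
      define A1 where "A1 = (\<integral>t. indicator Q t *\<^sub>R (s (a + T t) * ch (- \<xi>) (a + T t)) \<partial>lborel)"
      define A2 where "A2 = (\<integral>t. indicator Q t *\<^sub>R (\<alpha> (a + T t) * ch (- \<xi>) (a + T t)) \<partial>lborel)"
      have A2: "A2 = of_real H * b \<xi>"
      proof -
        have "indicator Q t *\<^sub>R (\<alpha> (a + T t) * ch (- \<xi>) (a + T t)) = \<alpha> (a + T t) * ch (- \<xi>) (a + T t)" for t
        proof (cases "\<alpha> (a + T t) = 0")
          case False
          then have "a + T t \<in> D" using tf_outside[OF \<alpha>] by blast
          then obtain u where u: "a + T t = a + (\<Sum>j\<in>UNIV. u j *\<^sub>R e j)" "\<And>j. 0 \<le> u j \<and> u j \<le> 1" unfolding D_def by blast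
          then have "T t = T (\<chi> j. u j)" by (simp add: T_def)
          then have "t = (\<chi> j. u j)" using T'T by metis
          then have "t \<in> box q (q + L *\<^sub>R One)" using u(2) by (intro inQ) simp
          then have "t \<in> Q" unfolding Q_def using box_subset_cbox by blast
          then show ?thesis by simp
        qed simp
        then have "A2 = (\<integral>t. \<alpha> (a + T t) * ch (- \<xi>) (a + T t) \<partial>lborel)" unfolding A2_def by simp
        also have "\<dots> = of_real H * (\<integral>x. \<alpha> (a + x) * ch (- \<xi>) (a + x) \<partial>lborel)"
          by (rule H) (intro borel_measurable_continuous_onI continuous_intros continuous_on_compose2[OF smooth_continuous_on[OF tf_smooth[OF \<alpha>], of UNIV]], auto)
        also have "(\<integral>x. \<alpha> (a + x) * ch (- \<xi>) (a + x) \<partial>lborel) = b \<xi>"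
          unfolding b_def using lborel_integral_shift[of "\<lambda>x. \<alpha> x * ch (- \<xi>) x" a]
          by (simp add: smooth_measurable smooth_mult tf_smooth[OF \<alpha>])
        finally show ?thesis .
      qed
      \<comment> \<open>The series is integrated term by term; by orthogonality only k = \<xi>
        survives.\<close>
      have A1: "A1 = of_real (L ^ CARD('d)) * b \<xi>"
      proof -
        define g where "g k t = indicator Q t *\<^sub>R (b k * ch k (a + T t) * ch (- \<xi>) (a + T t))" for k t
        have "A1 = (\<integral>t. \<integral>k. g k t \<partial>count_space S \<partial>lborel)"
          unfolding A1_def s_def g_def by (simp add: mult.assoc flip: integral_mult_left_zero)
        also have "\<dots> = (\<integral>k. \<integral>t. g k t \<partial>lborel \<partial>count_space S)"
        proof (rule fubini_count_space(1)[OF cS])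
          show "integrable lborel (g k)" for k unfolding g_def by (intro int continuous_intros ca)
          have "(\<integral>t. cmod (g k t) \<partial>lborel) = cmod (b k) * measure lborel Q" for k
            unfolding g_def by (simp add: norm_mult Q_def)
          then show "integrable (count_space S) (\<lambda>k. \<integral>t. cmod (g k t) \<partial>lborel)" using bi by simp
        qed
        also have "\<dots> = (\<integral>k. (if k = \<xi> then of_real (L ^ CARD('d)) * b \<xi> else 0) \<partial>count_space S)"
        proof (rule Bochner_Integration.integral_cong[OF refl])
          fix k assume "k \<in> space (count_space S)"
          then obtain m where m: "int_vec m" "k = \<xi>0 + F m" unfolding S_def dual_lattice_def F_def by auto
          have "k - \<xi> = F (m - l)" unfolding m \<xi>_def by (simp add: F_def scaleR_diff_left sum_subtractf)
          then have "ch k (a + T t) * ch (- \<xi>) (a + T t) = ch (k - \<xi>) a * ch (c *\<^sub>R (m - l)) t" for t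
            by (metis ch_add chF chadd diff_conv_add_uminus)
          then have "g k t = (b k * ch (k - \<xi>) a) * (indicator Q t *\<^sub>R ch (c *\<^sub>R (m - l)) t)" for t
            unfolding g_def by (simp add: mult.assoc scaleR_conv_of_real)
          then have "(\<integral>t. g k t \<partial>lborel) = (b k * ch (k - \<xi>) a) * (\<integral>t. indicator Q t *\<^sub>R ch (c *\<^sub>R (m - l)) t \<partial>lborel)"
            by (simp only: integral_mult_right_zero)
          also have "\<dots> = (b k * ch (k - \<xi>) a) * (if m - l = 0 then of_real (L ^ CARD('d)) else 0)"
            unfolding Q_def L_def by (subst integral_ch_period[OF c(1) int_vec_diff[OF m(1) l(1)]]) (rule refl)
          also have "\<dots> = (if k = \<xi> then of_real (L ^ CARD('d)) * b \<xi> else 0)"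
          proof (cases "m = l")
            case True
            then have "k = \<xi>" by (simp add: m \<xi>_def)
            then show ?thesis using True by simp
          next
            case False
            have "k \<noteq> \<xi>"
            proof
              assume "k = \<xi>"
              then have "F m = F l" by (simp add: m \<xi>_def)
              then have "c * (t \<bullet> m) = c * (t \<bullet> l)" for t using TF by metis
              then have "t \<bullet> m = t \<bullet> l" for t using c(1) by simp
              then show False using False vector_eq_ldot by blast
            qed
            then show ?thesis using False by simp
          qed
          finally show "(\<integral>t. g k t \<partial>lborel) = (if k = \<xi> then of_real (L ^ CARD('d)) * b \<xi> else 0)" .
        qed
        also have "\<dots> = (\<Sum>k\<in>{\<xi>}. of_real (L ^ CARD('d)) * b \<xi>)"
          by (subst integral_count_space_singleton_support[OF \<xi>S]) simp_all
        finally show ?thesis by simp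
      qed
      have "V * A1 - A2 = 0" unfolding A1 A2 V_def using L by simp
      moreover have "indicator Q t *\<^sub>R (w t * ch (c *\<^sub>R l0) t) = cnj (ch (- F l) a) *
          (V * (indicator Q t *\<^sub>R (s (a + T t) * ch (- \<xi>) (a + T t))) - indicator Q t *\<^sub>R (\<alpha> (a + T t) * ch (- \<xi>) (a + T t)))" for t
      proof -
        have "- \<xi> = - \<xi>0 + - F l" by (simp add: \<xi>_def)
        moreover have "- F l = F l0" by (simp add: F_def l(2) sum_negf)
        ultimately have "ch (- \<xi>) (a + T t) = ch (- \<xi>0) (a + T t) * (ch (- F l) a * ch (c *\<^sub>R l0) t)"
          by (metis ch_add chF chadd)
        then have *: "cnj (ch (- F l) a) * ch (- \<xi>) (a + T t) = ch (- \<xi>0) (a + T t) * ch (c *\<^sub>R l0) t"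
          using ch_mult_minus(1)[of "F l" a] by (simp add: cnj_ch mult_ac)
        show ?thesis unfolding w_def mult.assoc *[symmetric] by (simp add: algebra_simps scaleR_conv_of_real)
      qed
      moreover have "integrable lborel (\<lambda>t. indicator Q t *\<^sub>R (s (a + T t) * ch (- \<xi>) (a + T t)))"
        "integrable lborel (\<lambda>t. indicator Q t *\<^sub>R (\<alpha> (a + T t) * ch (- \<xi>) (a + T t)))"
        by (intro int continuous_intros ca)+
      ultimately have "(\<integral>t. indicator Q t *\<^sub>R (w t * ch (c *\<^sub>R l0) t) \<partial>lborel) = cnj (ch (- F l) a) * (V * A1 - A2)"
        unfolding A1_def A2_def
        by (simp only: Bochner_Integration.integral_diff integrable_mult_right integral_mult_right_zero)
      also note \<open>V * A1 - A2 = 0\<close>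
      finally have "(\<integral>t. indicator Q t *\<^sub>R (w t * ch (c *\<^sub>R l0) t) \<partial>lborel) = 0" by simp
      then show "(\<integral>t. indicator (cbox q (q + (2 * pi / c) *\<^sub>R One)) t *\<^sub>R (w t * ch (c *\<^sub>R l0) t) \<partial>lborel) = 0"
        by (simp add: Q_def L_def)
    qed
    then show "\<alpha> x = V * (\<integral>k. (\<integral>y. \<alpha> y * ch (- k) y \<partial>lborel) * ch k x \<partial>count_space (dual_lattice \<epsilon> \<xi>0))"
      unfolding w_def t0(1)[symmetric] by (simp add: s_def b_def S_def)
  qed
qed

subsection \<open>Distributions\<close>

lemma distribution_add:
  "f \<in> distributions X \<Longrightarrow> u \<in> test_functions X \<Longrightarrow> v \<in> test_functions X \<Longrightarrow> f (\<lambda>x. u x + v x) = f u + f v"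
  and distribution_scale:
  "f \<in> distributions X \<Longrightarrow> u \<in> test_functions X \<Longrightarrow> f (\<lambda>x. c * u x) = c * f u"
  unfolding distributions_def by blast+

lemma distribution_sum:
  assumes "f \<in> distributions X" "finite I" "\<And>i. i \<in> I \<Longrightarrow> u i \<in> test_functions X"
  shows "f (\<lambda>x. \<Sum>i\<in>I. u i x) = (\<Sum>i\<in>I. f (u i))"
  using assms(2,3)
proof (induction I)
  case empty
  show ?case using distribution_scale[OF assms(1) tf_zero, of 0] by simp
next
  case (insert i I)
  have "f (\<lambda>x. u i x + (\<Sum>i\<in>I. u i x)) = f (u i) + f (\<lambda>x. \<Sum>i\<in>I. u i x)"
  proof (rule distribution_add[OF assms(1)])
    show "u i \<in> test_functions X" by (rule insert.prems) simp
    show "(\<lambda>x. \<Sum>i\<in>I. u i x) \<in> test_functions X" by (rule tf_sum) (rule insert.prems, simp)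
  qed
  moreover have "f (\<lambda>x. \<Sum>i\<in>I. u i x) = (\<Sum>i\<in>I. f (u i))"
    by (rule insert.IH) (rule insert.prems, simp)
  ultimately show ?case using insert.hyps by simp
qed

text \<open>There are finitely many derivative lists of length at most N, so the sum of suprema may
  be replaced by one common bound B, the number of lists being absorbed into C.\<close>

lemma distribution_bound:
  assumes "f \<in> distributions X" "compact K" "K \<subseteq> X"
  obtains C N where "C \<ge> 0" "\<forall>u\<in>test_functions K. \<forall>B.
    (\<forall>ks x. length ks \<le> N \<longrightarrow> cmod (iter_partial ks u x) \<le> B) \<longrightarrow> cmod (f u) \<le> C * B"
proof -
  have "\<exists>C N. \<forall>u\<in>test_functions K. cmod (f u) \<le> C * (\<Sum>js | length js \<le> N. SUP x. cmod (iter_partial js u x))"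
    using assms unfolding distributions_def by (simp only: mem_Collect_eq)
  then obtain C N where "\<forall>u\<in>test_functions K. cmod (f u) \<le> C * (\<Sum>js | length js \<le> N. SUP x. cmod (iter_partial js u x))"
    by (elim exE)
  note C = bspec[OF this]
  define m where "m = card {js :: 'a list. length js \<le> N}"
  show ?thesis
  proof (rule that[of "\<bar>C\<bar> * real m" N], simp, intro ballI allI impI)
    fix u B assume u: "u \<in> test_functions K" and "\<forall>ks x. length ks \<le> N \<longrightarrow> cmod (iter_partial ks u x) \<le> B"
    then have B: "\<And>ks x. length ks \<le> N \<Longrightarrow> cmod (iter_partial ks u x) \<le> B" by blast
    have S: "0 \<le> (SUP x. cmod (iter_partial js u x))" "(SUP x. cmod (iter_partial js u x)) \<le> B" if "length js \<le> N" for js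
    proof -
      have "bdd_above (range (\<lambda>x. cmod (iter_partial js u x)))" by (rule bdd_aboveI2[of _ _ B]) (rule B[OF that])
      then show "0 \<le> (SUP x. cmod (iter_partial js u x))" by (rule cSUP_upper2[of _ _ 0]) simp_all
      show "(SUP x. cmod (iter_partial js u x)) \<le> B" by (rule cSUP_least) (simp, rule B[OF that])
    qed
    have "cmod (f u) \<le> C * (\<Sum>js | length js \<le> N. SUP x. cmod (iter_partial js u x))" by (rule C[OF u])
    also have "\<dots> \<le> \<bar>C\<bar> * (\<Sum>js | length js \<le> N. SUP x. cmod (iter_partial js u x))"
      by (intro mult_right_mono sum_nonneg S(1)) auto
    also have "\<dots> \<le> \<bar>C\<bar> * (\<Sum>js\<in>{js :: 'a list. length js \<le> N}. B)"
      by (intro mult_left_mono sum_mono S(2)) auto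
    finally show "cmod (f u) \<le> \<bar>C\<bar> * real m * B" by (simp add: m_def mult.assoc)
  qed
qed

lemma test_function_mult_bound:
  fixes \<psi> :: "real^'d \<Rightarrow> complex"
  assumes "\<psi> \<in> test_functions X"
  obtains C where "C \<ge> 0" "\<forall>v B. smooth v \<longrightarrow> (\<forall>ks x. length ks \<le> N \<longrightarrow> cmod (iter_partial ks v x) \<le> B) \<longrightarrow>
    (\<forall>ks x. length ks \<le> N \<longrightarrow> cmod (iter_partial ks (\<lambda>x. \<psi> x * v x) x) \<le> C * B)"
proof -
  obtain A where A: "A \<ge> 0" "\<And>ks x. length ks \<le> N \<Longrightarrow> cmod (iter_partial ks \<psi> x) \<le> A"
    using tf_derivs_bounded[OF assms, of N] by blast
  show ?thesis
  proof (rule that[of "2 ^ N * A"])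
    show "0 \<le> 2 ^ N * A" using A(1) by simp
  next
    show "\<forall>v B. smooth v \<longrightarrow> (\<forall>ks x. length ks \<le> N \<longrightarrow> cmod (iter_partial ks v x) \<le> B) \<longrightarrow>
      (\<forall>ks x. length ks \<le> N \<longrightarrow> cmod (iter_partial ks (\<lambda>x. \<psi> x * v x) x) \<le> 2 ^ N * A * B)"
    proof (intro allI impI)
    fix v :: "real^'d \<Rightarrow> complex" and B and ks :: "'d list" and x
    assume v: "smooth v" and B': "\<forall>ks x. length ks \<le> N \<longrightarrow> cmod (iter_partial ks v x) \<le> B" and ks: "length ks \<le> N"
    note B = B'[rule_format]
    have "cmod (v x) \<le> B" using B[of "[]"] by simp
    then have B0: "B \<ge> 0" using norm_ge_zero order_trans by blast
    have "cmod (iter_partial ks (\<lambda>x. \<psi> x * v x) x) \<le> 2 ^ length ks * A * B"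
      by (rule iter_partial_mult_bound[OF tf_smooth[OF assms] v]) (use ks A(2) B in \<open>meson order_trans\<close>)+
    also have "\<dots> \<le> 2 ^ N * A * B" using ks A(1) B0 by (intro mult_right_mono power_increasing) auto
    finally show "cmod (iter_partial ks (\<lambda>x. \<psi> x * v x) x) \<le> 2 ^ N * A * B" .
    qed
  qed
qed

text \<open>A distribution has finite order N on the support of \<psi>, and N derivatives of
  \<open>ch k\<close> cost at most \<open>jb k ^ N\<close>. This is the polynomial growth of the
  Fourier transform of a compactly supported distribution.\<close>

lemma distribution_growth:
  assumes "f \<in> distributions X" "\<psi> \<in> test_functions X"
  obtains C N where "C \<ge> 0" "\<And>k. cmod (f (\<lambda>x. \<psi> x * ch k x)) \<le> C * jb k ^ N"
proof -
  obtain C N where C0: "C \<ge> 0" "\<forall>u\<in>test_functions (supp \<psi>). \<forall>B.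
    (\<forall>ks x. length ks \<le> N \<longrightarrow> cmod (iter_partial ks u x) \<le> B) \<longrightarrow> cmod (f u) \<le> C * B"
    by (rule distribution_bound[OF assms(1) tf_compact[OF assms(2)] tf_supp[OF assms(2)]])
  note C = C0(1) C0(2)[rule_format]
  obtain A where A0: "A \<ge> 0" "\<forall>v B. smooth v \<longrightarrow> (\<forall>ks x. length ks \<le> N \<longrightarrow> cmod (iter_partial ks v x) \<le> B) \<longrightarrow>
    (\<forall>ks x. length ks \<le> N \<longrightarrow> cmod (iter_partial ks (\<lambda>x. \<psi> x * v x) x) \<le> A * B)"
    by (rule test_function_mult_bound[OF assms(2)])
  note A = A0(1) A0(2)[rule_format]
  have t: "\<psi> \<in> test_functions (supp \<psi>)" using tf_supp_subset[OF assms(2) order_refl] .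
  have "cmod (f (\<lambda>x. \<psi> x * ch k x)) \<le> C * (A * jb k ^ N)" for k
  proof (rule C(2)[OF tf_mult[OF t smooth_ch]])
    fix ks :: "'a list" and x assume "length ks \<le> N"
    show "cmod (iter_partial ks (\<lambda>x. \<psi> x * ch k x) x) \<le> A * jb k ^ N"
    proof (rule A(2)[OF smooth_ch])
      show "length ks \<le> N" by fact
      fix ks :: "'a list" and x assume ks: "length ks \<le> N"
      have "cmod (iter_partial ks (ch k) x) \<le> jb k ^ length ks"
        using order_trans[OF norm_iter_partial_ch norm_le_jb] .
      also have "\<dots> \<le> jb k ^ N" using ks by (intro power_increasing) auto
      finally show "cmod (iter_partial ks (ch k) x) \<le> jb k ^ N" .
    qed
  qed
  then show ?thesis using that[of "C * A" N] C(1) A(1) by (simp add: mult.assoc)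
qed

lemma integral_count_space_finite_subset:
  fixes g :: "'a \<Rightarrow> 'b::{banach, second_countable_topology}"
  assumes "finite F" "F \<subseteq> S"
  shows "(\<integral>k. (if k \<in> F then g k else 0) \<partial>count_space S) = (\<Sum>k\<in>F. g k)"
proof -
  have s: "{k \<in> S. (if k \<in> F then g k else 0) \<noteq> 0} \<subseteq> F" by auto
  have "(\<integral>k. (if k \<in> F then g k else 0) \<partial>count_space S) = (\<Sum>k | k \<in> S \<and> (if k \<in> F then g k else 0) \<noteq> 0. (if k \<in> F then g k else 0))"
    by (rule lebesgue_integral_count_space_finite_support) (rule finite_subset[OF s assms(1)])
  also have "\<dots> = (\<Sum>k\<in>F. (if k \<in> F then g k else 0))"
    by (rule sum.mono_neutral_left) (use s assms in auto)
  also have "\<dots> = (\<Sum>k\<in>F. g k)" by (rule sum.cong) auto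
  finally show ?thesis .
qed

text \<open>Linearity handles finite partial sums. The remainder is \<psi> times a smooth function
  whose derivatives up to the order of f are bounded by a weighted l^1 tail of b, and this tail
  tends to 0.\<close>

lemma distribution_series:
  fixes b :: "real^'d \<Rightarrow> complex"
  assumes f: "f \<in> distributions X" and \<psi>: "\<psi> \<in> test_functions X" and S: "countable S"
    and b: "\<And>n. integrable (count_space S) (\<lambda>k. cmod (b k) * jb k ^ n)"
  shows "f (\<lambda>x. \<psi> x * (\<integral>k. b k * ch k x \<partial>count_space S)) = (\<integral>k. b k * f (\<lambda>x. \<psi> x * ch k x) \<partial>count_space S)"
    and "integrable (count_space S) (\<lambda>k. b k * f (\<lambda>x. \<psi> x * ch k x))"
proof -
  obtain C N where C0: "C \<ge> 0" "\<forall>u\<in>test_functions (supp \<psi>). \<forall>B.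
    (\<forall>ks x. length ks \<le> N \<longrightarrow> cmod (iter_partial ks u x) \<le> B) \<longrightarrow> cmod (f u) \<le> C * B"
    by (rule distribution_bound[OF f tf_compact[OF \<psi>] tf_supp[OF \<psi>]])
  note C = C0(1) C0(2)[rule_format]
  obtain A where A0: "A \<ge> 0" "\<forall>v B. smooth v \<longrightarrow> (\<forall>ks x. length ks \<le> N \<longrightarrow> cmod (iter_partial ks v x) \<le> B) \<longrightarrow>
    (\<forall>ks x. length ks \<le> N \<longrightarrow> cmod (iter_partial ks (\<lambda>x. \<psi> x * v x) x) \<le> A * B)"
    by (rule test_function_mult_bound[OF \<psi>])
  note A = A0(1) A0(2)[rule_format]
  have t: "\<psi> \<in> test_functions (supp \<psi>)" using tf_supp_subset[OF \<psi> order_refl] .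
  define F where "F k = f (\<lambda>x. \<psi> x * ch k x)" for k
  obtain C' M where F: "C' \<ge> 0" "\<And>k. cmod (F k) \<le> C' * jb k ^ M"
    unfolding F_def using distribution_growth[OF f \<psi>] by metis
  have le: "cmod (b k * F k) \<le> C' * (cmod (b k) * jb k ^ M)" for k
  proof -
    have "cmod (b k * F k) \<le> cmod (b k) * (C' * jb k ^ M)" unfolding norm_mult by (intro mult_left_mono F) auto
    then show ?thesis by (simp only: mult_ac)
  qed
  have i: "integrable (count_space S) (\<lambda>k. C' * (cmod (b k) * jb k ^ M))" by (intro integrable_mult_right b)
  show I: "integrable (count_space S) (\<lambda>k. b k * f (\<lambda>x. \<psi> x * ch k x))"
    unfolding F_def[symmetric]
  proof (rule Bochner_Integration.integrable_bound[OF i])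
    show "AE k in count_space S. norm (b k * F k) \<le> norm (C' * (cmod (b k) * jb k ^ M))"
      unfolding real_norm_def by (rule AE_I2, rule order_trans[OF le abs_ge_self])
  qed simp
  \<comment> \<open>Finite sets exhausting S, obtained from an enumeration.\<close>
  define E where "E n = {k \<in> S. to_nat_on S k < n}" for n
  have E: "finite (E n)" "E n \<subseteq> S" for n
  proof -
    have "inj_on (to_nat_on S) (E n)" using inj_on_to_nat_on[OF S] by (rule inj_on_subset) (auto simp: E_def)
    moreover have "to_nat_on S ` E n \<subseteq> {..<n}" by (auto simp: E_def)
    ultimately show "finite (E n)" by (metis finite_lessThan finite_subset finite_imageD)
  qed (auto simp: E_def)
  have Ev: "\<forall>\<^sub>F n in sequentially. k \<in> E n" if "k \<in> S" for k
    using that unfolding E_def by (auto intro: eventually_sequentiallyI[of "Suc (to_nat_on S k)"])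
  \<comment> \<open>Head and tail of the coefficients, both dominated by b.\<close>
  define b1 b2 where "b1 n k = (if k \<in> E n then b k else 0)" and "b2 n k = (if k \<in> E n then 0 else b k)" for n k
  have bb: "b k = b1 n k + b2 n k" for n k by (simp add: b1_def b2_def)
  have bi: "integrable (count_space S) (\<lambda>k. cmod (b' k) * jb k ^ n)" if "\<And>k. cmod (b' k) \<le> cmod (b k)" for b' :: "real^'d \<Rightarrow> complex" and n
  proof (rule Bochner_Integration.integrable_bound[OF b[of n]])
    show "AE k in count_space S. norm (cmod (b' k) * jb k ^ n) \<le> norm (cmod (b k) * jb k ^ n)"
      by (rule AE_I2) (simp add: mult_right_mono[OF that])
  qed simp
  have b2: "cmod (b2 n k) \<le> cmod (b k)" "cmod (b1 n k) \<le> cmod (b k)" for n k by (simp_all add: b1_def b2_def)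
  have ci: "integrable (count_space S) (\<lambda>k. b' k * ch k x)" if "\<And>k. cmod (b' k) \<le> cmod (b k)" for b' :: "real^'d \<Rightarrow> complex" and x
  proof (rule Bochner_Integration.integrable_bound[OF b[of 0]])
    show "AE k in count_space S. norm (b' k * ch k x) \<le> norm (cmod (b k) * jb k ^ 0)"
      by (rule AE_I2) (simp add: norm_mult that)
  qed simp
  define s where "s n x = (\<integral>k. b2 n k * ch k x \<partial>count_space S)" for n x
  have ss: "smooth (s n)" for n
    unfolding s_def by (rule fourier_integral_smooth(1)[OF _ _ bi[OF b2(1)]]) simp_all
  have sb: "cmod (iter_partial ks (s n) x) \<le> (\<integral>k. cmod (b2 n k) * jb k ^ N \<partial>count_space S)" if "length ks \<le> N" for ks n x
  proof -
    have "cmod (iter_partial ks (s n) x) \<le> (\<integral>k. cmod (b2 n k) * jb k ^ length ks \<partial>count_space S)"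
      unfolding s_def by (rule fourier_integral_smooth(2)[OF _ _ bi[OF b2(1)]]) simp_all
    also have "\<dots> \<le> (\<integral>k. cmod (b2 n k) * jb k ^ N \<partial>count_space S)"
      by (rule Bochner_Integration.integral_mono[OF bi[OF b2(1)] bi[OF b2(1)]])
        (use that in \<open>auto intro!: mult_left_mono power_increasing\<close>)
    finally show ?thesis .
  qed
  have split: "f (\<lambda>x. \<psi> x * (\<integral>k. b k * ch k x \<partial>count_space S)) = (\<Sum>k\<in>E n. b k * F k) + f (\<lambda>x. \<psi> x * s n x)" for n
  proof -
    have "(\<integral>k. b k * ch k x \<partial>count_space S) = (\<Sum>k\<in>E n. b k * ch k x) + s n x" for x
    proof -
      have "(\<integral>k. b k * ch k x \<partial>count_space S) = (\<integral>k. b1 n k * ch k x + b2 n k * ch k x \<partial>count_space S)"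
        by (intro Bochner_Integration.integral_cong refl) (simp add: bb[of _ n] distrib_right)
      also have "\<dots> = (\<integral>k. b1 n k * ch k x \<partial>count_space S) + s n x"
        unfolding s_def by (rule Bochner_Integration.integral_add) (rule ci[OF b2(2)] ci[OF b2(1)])+
      also have "(\<integral>k. b1 n k * ch k x \<partial>count_space S) = (\<integral>k. (if k \<in> E n then b k * ch k x else 0) \<partial>count_space S)"
        by (intro Bochner_Integration.integral_cong refl) (simp add: b1_def)
      also have "\<dots> = (\<Sum>k\<in>E n. b k * ch k x)" by (rule integral_count_space_finite_subset[OF E])
      finally show ?thesis .
    qed
    then have "(\<lambda>x. \<psi> x * (\<integral>k. b k * ch k x \<partial>count_space S)) = (\<lambda>x. (\<Sum>k\<in>E n. b k * (\<psi> x * ch k x)) + \<psi> x * s n x)"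
      by (simp add: fun_eq_iff distrib_left sum_distrib_left mult_ac)
    moreover have "f (\<lambda>x. (\<Sum>k\<in>E n. b k * (\<psi> x * ch k x)) + \<psi> x * s n x) = f (\<lambda>x. \<Sum>k\<in>E n. b k * (\<psi> x * ch k x)) + f (\<lambda>x. \<psi> x * s n x)"
      by (rule distribution_add[OF f]) (intro tf_sum tf_mult_left tf_mult \<psi> smooth_ch smooth_const ss)+
    moreover have "f (\<lambda>x. \<Sum>k\<in>E n. b k * (\<psi> x * ch k x)) = (\<Sum>k\<in>E n. f (\<lambda>x. b k * (\<psi> x * ch k x)))"
      by (rule distribution_sum[OF f E(1)]) (intro tf_mult_left tf_mult \<psi> smooth_ch smooth_const)
    moreover have "f (\<lambda>x. b k * (\<psi> x * ch k x)) = b k * F k" for k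
      unfolding F_def by (rule distribution_scale[OF f tf_mult[OF \<psi> smooth_ch]])
    ultimately show ?thesis by simp
  qed
  have "(\<lambda>n. \<Sum>k\<in>E n. b k * F k) \<longlonglongrightarrow> (\<integral>k. b k * F k \<partial>count_space S)"
  proof -
    have "(\<lambda>n. \<integral>k. (if k \<in> E n then b k * F k else 0) \<partial>count_space S) \<longlonglongrightarrow> (\<integral>k. b k * F k \<partial>count_space S)"
    proof (rule integral_dominated_convergence[OF _ _ i])
      show "AE k in count_space S. (\<lambda>n. if k \<in> E n then b k * F k else 0) \<longlonglongrightarrow> b k * F k"
      proof (rule AE_I2)
        fix k assume "k \<in> space (count_space S)"
        then have "\<forall>\<^sub>F n in sequentially. k \<in> E n" using Ev by simp
        then have "\<forall>\<^sub>F n in sequentially. b k * F k = (if k \<in> E n then b k * F k else 0)" by (rule eventually_mono) simp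
        then show "(\<lambda>n. if k \<in> E n then b k * F k else 0) \<longlonglongrightarrow> b k * F k" by (rule Lim_transform_eventually[OF tendsto_const])
      qed
      show "AE k in count_space S. cmod (if k \<in> E n then b k * F k else 0) \<le> C' * (cmod (b k) * jb k ^ M)" for n
        using le F(1) by (intro AE_I2) simp
    qed simp_all
    then show ?thesis unfolding integral_count_space_finite_subset[OF E] .
  qed
  moreover have "(\<lambda>n. f (\<lambda>x. \<psi> x * s n x)) \<longlonglongrightarrow> 0"
  proof (rule Lim_null_comparison)
    show "\<forall>\<^sub>F n in sequentially. cmod (f (\<lambda>x. \<psi> x * s n x)) \<le> C * (A * (\<integral>k. cmod (b2 n k) * jb k ^ N \<partial>count_space S))"
    proof (rule always_eventually, rule allI)
      fix n show "cmod (f (\<lambda>x. \<psi> x * s n x)) \<le> C * (A * (\<integral>k. cmod (b2 n k) * jb k ^ N \<partial>count_space S))"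
        by (rule C(2)[OF tf_mult[OF t ss]], rule A(2)[OF ss sb])
    qed
    have "(\<lambda>n. \<integral>k. cmod (b2 n k) * jb k ^ N \<partial>count_space S) \<longlonglongrightarrow> (\<integral>k. 0 \<partial>count_space S)"
    proof (rule integral_dominated_convergence[OF _ _ b[of N]])
      show "AE k in count_space S. (\<lambda>n. cmod (b2 n k) * jb k ^ N) \<longlonglongrightarrow> 0"
      proof (rule AE_I2)
        fix k assume "k \<in> space (count_space S)"
        then have "\<forall>\<^sub>F n in sequentially. k \<in> E n" using Ev by simp
        then have "\<forall>\<^sub>F n in sequentially. 0 = cmod (b2 n k) * jb k ^ N" by (rule eventually_mono) (simp add: b2_def)
        then show "(\<lambda>n. cmod (b2 n k) * jb k ^ N) \<longlonglongrightarrow> 0" by (rule Lim_transform_eventually[OF tendsto_const])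
      qed
      show "AE k in count_space S. norm (cmod (b2 n k) * jb k ^ N) \<le> cmod (b k) * jb k ^ N" for n
        using b2(1) by (intro AE_I2) (simp add: mult_right_mono)
    qed simp_all
    then have "(\<lambda>n. \<integral>k. cmod (b2 n k) * jb k ^ N \<partial>count_space S) \<longlonglongrightarrow> 0" by simp
    then show "(\<lambda>n. C * (A * (\<integral>k. cmod (b2 n k) * jb k ^ N \<partial>count_space S))) \<longlonglongrightarrow> 0"
      by (intro tendsto_mult_right_zero)
  qed
  ultimately have "(\<lambda>n. (\<Sum>k\<in>E n. b k * F k) + f (\<lambda>x. \<psi> x * s n x)) \<longlonglongrightarrow> (\<integral>k. b k * F k \<partial>count_space S) + 0"
    by (rule tendsto_add)
  then have "(\<lambda>n::nat. f (\<lambda>x. \<psi> x * (\<integral>k. b k * ch k x \<partial>count_space S))) \<longlonglongrightarrow> (\<integral>k. b k * F k \<partial>count_space S) + 0"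
    unfolding split[symmetric] .
  from LIMSEQ_unique[OF tendsto_const this]
  show "f (\<lambda>x. \<psi> x * (\<integral>k. b k * ch k x \<partial>count_space S)) = (\<integral>k. b k * f (\<lambda>x. \<psi> x * ch k x) \<partial>count_space S)"
    unfolding F_def by (simp only: add_0_right)
qed

section \<open>Local Fourier representation of cut-off smooth functions\<close>

lemma coeff_decay:
  assumes "\<alpha> \<in> test_functions X" "smooth m"
  shows "\<exists>C. \<forall>k\<in>S. cmod (\<integral>y. \<alpha> y * m y * ch (- k) y \<partial>lborel) \<le> C / jb k ^ n"
proof -
  obtain C where C: "\<And>\<eta>. cmod (\<integral>x. \<alpha> x * m x * ch \<eta> x \<partial>lborel) \<le> C / jb \<eta> ^ n"
    using fourier_decay_tf[OF tf_mult[OF assms], of n] by blast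
  have "cmod (\<integral>y. \<alpha> y * m y * ch (- k) y \<partial>lborel) \<le> C / jb k ^ n" for k
    using C[of "- k"] unfolding jb_minus .
  then show ?thesis by (intro exI[of _ C] ballI)
qed

lemma expansion_apply:
  assumes f: "f \<in> distributions X" and \<beta>: "\<beta> \<in> test_functions X" and S: "separated S"
    and \<alpha>: "\<alpha> \<in> test_functions Y" and m: "smooth m"
  shows "f (\<lambda>x. \<beta> x * (\<integral>k. (\<integral>y. \<alpha> y * m y * ch (- k) y \<partial>lborel) * ch k x \<partial>count_space S))
      = (\<integral>k. (\<integral>y. \<alpha> y * m y * ch (- k) y \<partial>lborel) * f (\<lambda>x. \<beta> x * ch k x) \<partial>count_space S)"
    and "integrable (count_space S) (\<lambda>k. (\<integral>y. \<alpha> y * m y * ch (- k) y \<partial>lborel) * f (\<lambda>x. \<beta> x * ch k x))"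
    and "smooth (\<lambda>x. \<integral>k. (\<integral>y. \<alpha> y * m y * ch (- k) y \<partial>lborel) * ch k x \<partial>count_space S)"
proof -
  have cS: "countable S" using S by (simp add: separated_def)
  note d = decay_integrable[OF S coeff_decay[OF \<alpha> m]]
  show "f (\<lambda>x. \<beta> x * (\<integral>k. (\<integral>y. \<alpha> y * m y * ch (- k) y \<partial>lborel) * ch k x \<partial>count_space S))
      = (\<integral>k. (\<integral>y. \<alpha> y * m y * ch (- k) y \<partial>lborel) * f (\<lambda>x. \<beta> x * ch k x) \<partial>count_space S)"
    by (rule distribution_series(1)[OF f \<beta> cS d])
  show "integrable (count_space S) (\<lambda>k. (\<integral>y. \<alpha> y * m y * ch (- k) y \<partial>lborel) * f (\<lambda>x. \<beta> x * ch k x))"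
    by (rule distribution_series(2)[OF f \<beta> cS d])
  show "smooth (\<lambda>x. \<integral>k. (\<integral>y. \<alpha> y * m y * ch (- k) y \<partial>lborel) * ch k x \<partial>count_space S)"
    by (rule fourier_integral_smooth(1)[OF _ _ d]) simp_all
qed

text \<open>A cube of side 2 R about the origin together with its biorthogonal basis. The pairing
  constant is 1, which is below 2 pi, so \<open>fourier_series\<close> applies to any function
  supported in the ball.\<close>

lemma box_lattice:
  fixes e \<epsilon> :: "'d \<Rightarrow> real^'d"
  assumes "R > 0"
  defines "e \<equiv> \<lambda>j. axis j (2 * R)" and "\<epsilon> \<equiv> \<lambda>j. axis j (1 / (2 * R))"
  shows "e i \<bullet> \<epsilon> j = (if i = j then 1 else 0)"
    and "cball 0 R \<subseteq> {(- R) *\<^sub>R One + (\<Sum>j\<in>UNIV. t j *\<^sub>R e j) | t. \<forall>j. 0 \<le> t j \<and> t j \<le> 1}"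
proof -
  show "e i \<bullet> \<epsilon> j = (if i = j then 1 else 0)"
    unfolding e_def \<epsilon>_def using assms(1) by (simp add: inner_axis_axis)
  show "cball 0 R \<subseteq> {(- R) *\<^sub>R One + (\<Sum>j\<in>UNIV. t j *\<^sub>R e j) | t. \<forall>j. 0 \<le> t j \<and> t j \<le> 1}"
  proof
    fix x :: "real^'d" assume "x \<in> cball 0 R"
    then have x: "\<bar>x $ j\<bar> \<le> R" for j using component_le_norm_cart[of x j] by simp
    define t where "t j = (x $ j + R) / (2 * R)" for j
    have "0 \<le> t j \<and> t j \<le> 1" for j using x[of j] assms(1) by (simp add: t_def field_simps abs_le_iff)
    moreover have "x = (- R) *\<^sub>R One + (\<Sum>j\<in>UNIV. t j *\<^sub>R e j)"
    proof (simp only: vec_eq_iff, rule allI)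
      fix i
      have One: "(One :: real^'d) $ i = 1"
        by (simp add: cart_eq_inner_axis)
      have "(\<Sum>j\<in>UNIV. t j *\<^sub>R e j) $ i = (\<Sum>j\<in>UNIV. if j = i then t i * (2 * R) else 0)"
        unfolding sum_component by (rule sum.cong) (auto simp: e_def axis_def)
      then show "x $ i = ((- R) *\<^sub>R One + (\<Sum>j\<in>UNIV. t j *\<^sub>R e j)) $ i"
        using assms(1) One by (simp add: t_def)
    qed
    ultimately show "x \<in> {(- R) *\<^sub>R One + (\<Sum>j\<in>UNIV. t j *\<^sub>R e j) | t. \<forall>j. 0 \<le> t j \<and> t j \<le> 1}" by blast
  qed
qed

lemma bounded_supp:
  assumes "u \<in> test_functions X"
  obtains R where "R > 0" "supp u \<subseteq> cball 0 R"
proof -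
  obtain R where "R > 0" "supp u \<subseteq> cball 0 R"
    using compact_imp_bounded[OF tf_compact[OF assms]] bounded_pos by (metis mem_cball_0 subsetI)
  then show ?thesis by (rule that)
qed

text \<open>A finite sum of bumps over a compact cover. Positivity on K is all that is asked,
  because the function will serve as a denominator there.\<close>

lemma positive_test_function:
  fixes K :: "(real^'d) set"
  assumes "open X" "compact K" "K \<subseteq> X"
  obtains b :: "real^'d \<Rightarrow> real" where "(\<lambda>x. of_real (b x)) \<in> test_functions X" "\<And>x. x \<in> K \<Longrightarrow> b x > 0"
proof -
  have "\<exists>b r. (\<lambda>y. complex_of_real (b y)) \<in> test_functions X \<and> (\<forall>y. 0 \<le> b y) \<and> 0 < r \<and> (\<forall>y\<in>ball x r. 0 < b y)" if "x \<in> K" for x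
  proof -
    have "x \<in> X" using that assms(3) by (rule set_rev_mp)
    from bspec[OF open_contains_cball[THEN iffD1, OF assms(1)] this]
    obtain r where r: "r > 0" "cball x r \<subseteq> X" by (elim exE conjE)
    obtain b :: "real^'d \<Rightarrow> real" where b: "(\<lambda>x. complex_of_real (b x)) \<in> test_functions (cball x r)"
        "\<And>y. 0 \<le> b y" "\<And>y. dist x y < r \<Longrightarrow> b y > 0"
      using bump_function[OF r(1), of x] by metis
    show ?thesis
    proof (rule exI[of _ b], rule exI[of _ r], intro conjI allI ballI)
      show "(\<lambda>y. complex_of_real (b y)) \<in> test_functions X" by (rule tf_mono[OF b(1) r(2)])
      show "0 < b y" if "y \<in> ball x r" for y by (rule b(3)) (use that in simp)
    qed (fact b(2) r(1))+
  qed
  then have "\<forall>x\<in>K. \<exists>b r. (\<lambda>y. complex_of_real (b y)) \<in> test_functions X \<and> (\<forall>y. 0 \<le> b y) \<and> 0 < r \<and> (\<forall>y\<in>ball x r. 0 < b y)"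
    by (rule ballI)
  from bchoice[OF this] obtain b where "\<forall>x\<in>K. \<exists>r. (\<lambda>y. complex_of_real (b x y)) \<in> test_functions X \<and> (\<forall>y. 0 \<le> b x y) \<and> 0 < r \<and> (\<forall>y\<in>ball x r. 0 < b x y)" ..
  from bchoice[OF this] obtain r where br: "\<forall>x\<in>K. (\<lambda>y. complex_of_real (b x y)) \<in> test_functions X \<and> (\<forall>y. 0 \<le> b x y) \<and> 0 < r x \<and> (\<forall>y\<in>ball x (r x). 0 < b x y)" ..
  have cov: "K \<subseteq> (\<Union>x\<in>K. ball x (r x))"
  proof
    fix x assume "x \<in> K"
    moreover have "x \<in> ball x (r x)" using br \<open>x \<in> K\<close> by simp
    ultimately show "x \<in> (\<Union>x\<in>K. ball x (r x))" by blast
  qed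
  obtain C where C: "C \<subseteq> K" "finite C" "K \<subseteq> (\<Union>x\<in>C. ball x (r x))"
    by (rule compactE_image[OF assms(2) _ cov]) simp
  show ?thesis
  proof (rule that[of "\<lambda>y. \<Sum>x\<in>C. b x y"])
    have "(\<lambda>y. \<Sum>x\<in>C. complex_of_real (b x y)) \<in> test_functions X"
    proof (rule tf_sum)
      fix z assume "z \<in> C"
      then have "z \<in> K" using C(1) by blast
      then show "(\<lambda>y. complex_of_real (b z y)) \<in> test_functions X" using br by blast
    qed
    then show "(\<lambda>y. complex_of_real (\<Sum>x\<in>C. b x y)) \<in> test_functions X" by simp
    fix y assume "y \<in> K"
    then obtain x where x: "x \<in> C" "y \<in> ball x (r x)" using C(3) by blast
    show "(\<Sum>x\<in>C. b x y) > 0"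
    proof (rule sum_pos2[OF C(2) x(1)])
      have "x \<in> K" using C(1) x(1) by blast
      then show "0 < b x y" using br x(2) by blast
      show "0 \<le> b z y" if "z \<in> C" for z using br that C(1) by blast
    qed
  qed
qed

text \<open>Choose \<beta> nonzero on the support of \<kappa>, expand (\<kappa>/\<beta>) m in a
  Fourier series on a cube containing the support of \<beta>, and multiply by \<beta>. The outer
  factor makes the identity hold on the whole space and turns every term into a test function on X,
  while m enters only through the coefficients. In this way assertions about f at \<kappa> m become
  assertions about numerical series.\<close>

lemma local_representation:
  fixes \<kappa> :: "real^'d \<Rightarrow> complex"
  assumes X: "open X" and \<kappa>: "\<kappa> \<in> test_functions X"
  obtains \<alpha> \<beta> and S :: "(real^'d) set" where "\<alpha> \<in> test_functions UNIV" "\<beta> \<in> test_functions X" "separated S"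
    "\<forall>m. smooth m \<longrightarrow> (\<lambda>x. \<kappa> x * m x) = (\<lambda>x. \<beta> x * (\<integral>k. (\<integral>y. \<alpha> y * m y * ch (- k) y \<partial>lborel) * ch k x \<partial>count_space S))"
proof -
  obtain b :: "real^'d \<Rightarrow> real" where b: "(\<lambda>x. complex_of_real (b x)) \<in> test_functions X" "\<And>x. x \<in> supp \<kappa> \<Longrightarrow> b x > 0"
    using positive_test_function[OF X tf_compact[OF \<kappa>] tf_supp[OF \<kappa>]] by metis
  define \<beta> where "\<beta> x = complex_of_real (b x)" for x
  have "\<beta> x \<noteq> 0" if "x \<in> supp \<kappa>" for x using b(2)[OF that] by (simp add: \<beta>_def)
  then have \<beta>: "\<beta> \<in> test_functions X" "supp \<kappa> \<subseteq> {x. \<beta> x \<noteq> 0}" using b(1) by (auto simp: \<beta>_def[abs_def])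
  obtain R where R: "R > 0" "supp \<beta> \<subseteq> cball 0 R" by (rule bounded_supp[OF \<beta>(1)])
  define e \<epsilon> where "e j = (axis j (2 * R) :: real^'d)" and "\<epsilon> j = (axis j (1 / (2 * R)) :: real^'d)" for j
  note box = box_lattice[OF R(1), where 'd = 'd, folded e_def \<epsilon>_def]
  define D where "D = {(- R) *\<^sub>R One + (\<Sum>j\<in>UNIV. t j *\<^sub>R e j) | t. \<forall>j. 0 \<le> t j \<and> t j \<le> 1}"
  have D: "supp \<beta> \<subseteq> D" using R(2) box(2) unfolding D_def by (rule order_trans)
  have exV: "\<exists>V. \<forall>\<alpha> x. \<alpha> \<in> test_functions D \<longrightarrow> x \<in> D \<longrightarrow> \<alpha> x = V * (\<integral>k. (\<integral>y. \<alpha> y * ch (- k) y \<partial>lborel) * ch k x \<partial>count_space (dual_lattice \<epsilon> 0))"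
  proof (rule fourier_series[OF box(1), where a = "(- R) *\<^sub>R One" and ?\<xi>0.0 = 0, folded D_def])
    fix V assume "\<And>\<alpha> x. \<alpha> \<in> test_functions D \<Longrightarrow> x \<in> D \<Longrightarrow>
      \<alpha> x = V * (\<integral>k. (\<integral>y. \<alpha> y * ch (- k) y \<partial>lborel) * ch k x \<partial>count_space (dual_lattice \<epsilon> 0))"
    then show "\<exists>V. \<forall>\<alpha> x. \<alpha> \<in> test_functions D \<longrightarrow> x \<in> D \<longrightarrow> \<alpha> x = V * (\<integral>k. (\<integral>y. \<alpha> y * ch (- k) y \<partial>lborel) * ch k x \<partial>count_space (dual_lattice \<epsilon> 0))"
      by (intro exI[of _ V] allI impI)
  qed (use pi_gt3 in simp_all)
  then obtain V where V: "\<And>\<alpha> x. \<alpha> \<in> test_functions D \<Longrightarrow> x \<in> D \<Longrightarrow> \<alpha> x = V * (\<integral>k. (\<integral>y. \<alpha> y * ch (- k) y \<partial>lborel) * ch k x \<partial>count_space (dual_lattice \<epsilon> 0))"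
    by blast
  define S where "S = dual_lattice \<epsilon> 0"
  have S: "separated S" unfolding S_def by (rule separated_dual_lattice[OF box(1)]) simp
  define \<alpha>0 where "\<alpha>0 x = \<kappa> x / \<beta> x" for x
  have \<alpha>0: "\<alpha>0 \<in> test_functions X" unfolding \<alpha>0_def by (rule tf_divide[OF \<kappa> tf_smooth[OF \<beta>(1)] \<beta>(2)])
  have "supp \<alpha>0 \<subseteq> supp \<beta>" by (rule supp_subsetI[OF closed_supp]) (simp add: \<alpha>0_def supp_outside)
  then have \<alpha>D: "\<alpha>0 \<in> test_functions D" using tf_supp_subset[OF \<alpha>0] D by blast
  \<comment> \<open>The normalising constant of the Fourier series is put into \<alpha>.\<close>
  define \<alpha> where "\<alpha> x = \<alpha>0 x * V" for x
  have \<alpha>: "\<alpha> \<in> test_functions UNIV" unfolding \<alpha>_def by (rule tf_mono[OF tf_mult[OF \<alpha>0 smooth_const]]) simp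
  have "\<kappa> x * m x = \<beta> x * (\<integral>k. (\<integral>y. \<alpha> y * m y * ch (- k) y \<partial>lborel) * ch k x \<partial>count_space S)" if m: "smooth m" for m x
  proof (cases "x \<in> D")
    case True
    have "\<alpha>0 x * m x = V * (\<integral>k. (\<integral>y. (\<alpha>0 y * m y) * ch (- k) y \<partial>lborel) * ch k x \<partial>count_space S)"
      unfolding S_def by (rule V[OF tf_mult[OF \<alpha>D m] True])
    also have "\<dots> = (\<integral>k. (\<integral>y. \<alpha> y * m y * ch (- k) y \<partial>lborel) * ch k x \<partial>count_space S)"
    proof -
      have "(\<integral>y. \<alpha> y * m y * ch (- k) y \<partial>lborel) = V * (\<integral>y. (\<alpha>0 y * m y) * ch (- k) y \<partial>lborel)" for k
        unfolding \<alpha>_def integral_mult_right_zero[symmetric] by (intro Bochner_Integration.integral_cong refl) simp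
      then show ?thesis by (simp only: mult.assoc integral_mult_right_zero)
    qed
    finally have "\<beta> x * (\<alpha>0 x * m x) = \<beta> x * (\<integral>k. (\<integral>y. \<alpha> y * m y * ch (- k) y \<partial>lborel) * ch k x \<partial>count_space S)"
      by (rule arg_cong)
    moreover have "\<beta> x * \<alpha>0 x = \<kappa> x"
      using \<beta>(2) supp_outside[of x \<kappa>] by (cases "\<beta> x = 0") (auto simp: \<alpha>0_def)
    ultimately show ?thesis by (simp flip: mult.assoc)
  next
    case False
    then have "\<beta> x = 0" using D supp_outside by blast
    moreover then have "\<kappa> x = 0" using \<beta>(2) supp_outside[of x \<kappa>] by blast
    ultimately show ?thesis by simp
  qed
  then show ?thesis using that[OF \<alpha> \<beta>(1) S] by (simp add: fun_eq_iff)
qed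

lemma uniform_integrable_bound:
  fixes G :: "'b \<Rightarrow> real^'d \<Rightarrow> complex"
  assumes bnd: "\<And>ks R. \<exists>B. integrable M B \<and> (\<forall>t\<in>space M. \<forall>y\<in>cball 0 R. cmod (iter_partial ks (G t) y) \<le> B t)"
  obtains B where "integrable M B" "\<forall>t\<in>space M. 0 \<le> B t"
    "\<forall>t\<in>space M. \<forall>ks. length ks \<le> N \<longrightarrow> (\<forall>y\<in>cball 0 R. cmod (iter_partial ks (G t) y) \<le> B t)"
proof -
  have "\<forall>ks. \<exists>B. integrable M B \<and> (\<forall>t\<in>space M. \<forall>y\<in>cball 0 R. cmod (iter_partial ks (G t) y) \<le> B t)"
    using bnd by blast
  then obtain B where B: "\<And>ks. integrable M (B ks)"
      "\<And>ks. \<forall>t\<in>space M. \<forall>y\<in>cball 0 R. cmod (iter_partial ks (G t) y) \<le> B ks t"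
    by metis
  define A where "A t = (\<Sum>ks | length ks \<le> N. \<bar>B ks t\<bar>)" for t
  show ?thesis
  proof (rule that[of A])
    show "integrable M A" unfolding A_def by (intro Bochner_Integration.integrable_sum integrable_abs B(1))
    show "\<forall>t\<in>space M. 0 \<le> A t" unfolding A_def by (intro ballI sum_nonneg) simp
    show "\<forall>t\<in>space M. \<forall>ks. length ks \<le> N \<longrightarrow> (\<forall>y\<in>cball 0 R. cmod (iter_partial ks (G t) y) \<le> A t)"
    proof (intro ballI allI impI)
      fix t and ks :: "'d list" and y assume t: "t \<in> space M" and ks: "length ks \<le> N" and y: "y \<in> cball (0 :: real^'d) R"
      have "cmod (iter_partial ks (G t) y) \<le> \<bar>B ks t\<bar>" using B(2) t y abs_ge_self order_trans by meson
      also have "\<dots> \<le> A t" unfolding A_def by (rule member_le_sum) (use ks finite_length_le in auto)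
      finally show "cmod (iter_partial ks (G t) y) \<le> A t" .
    qed
  qed
qed

text \<open>The bound of \<open>fourier_decay\<close> with object-level quantifiers, so that its
  constants can be chosen for a whole indexed family before m, B and \<eta> are given.\<close>

lemma fourier_decay':
  fixes \<alpha> :: "real^'d \<Rightarrow> complex"
  assumes "\<alpha> \<in> test_functions X"
  shows "\<exists>C R. C \<ge> 0 \<and> R > 0 \<and> (\<forall>m B. smooth m \<longrightarrow>
      (\<forall>ks. length ks \<le> N \<longrightarrow> (\<forall>x\<in>cball 0 R. cmod (iter_partial ks m x) \<le> B)) \<longrightarrow>
      (\<forall>\<eta>. cmod (\<integral>x. \<alpha> x * m x * ch \<eta> x \<partial>lborel) \<le> C * B / jb \<eta> ^ N))"
proof -
  obtain C R where C: "0 \<le> C" "0 < R" and d: "\<And>m B \<eta>. smooth m \<Longrightarrow> (\<And>ks x. length ks \<le> N \<Longrightarrow> x \<in> cball 0 R \<Longrightarrow> cmod (iter_partial ks m x) \<le> B)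
      \<Longrightarrow> cmod (\<integral>x. \<alpha> x * m x * ch \<eta> x \<partial>lborel) \<le> C * B / jb \<eta> ^ N"
    using fourier_decay[OF assms, of N] by blast
  show ?thesis
  proof (rule exI[of _ C], rule exI[of _ R], intro conjI C allI impI)
    fix m :: "real^'d \<Rightarrow> complex" and B \<eta>
    assume "smooth m" and B: "\<forall>ks. length ks \<le> N \<longrightarrow> (\<forall>x\<in>cball 0 R. cmod (iter_partial ks m x) \<le> B)"
    then show "cmod (\<integral>x. \<alpha> x * m x * ch \<eta> x \<partial>lborel) \<le> C * B / jb \<eta> ^ N" by (intro d) blast+
  qed
qed

text \<open>By the local representation, f at \<kappa> G(t) is a series of coefficients c(t, k)
  times fixed numbers F(k). The integral over t is exchanged with the integral over y inside each
  coefficient and then with the sum over k. The integrable derivative bounds of G supply absolute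
  convergence.\<close>

lemma distribution_parameter_integral:
  fixes G :: "real^'d \<Rightarrow> real^'d \<Rightarrow> complex"
  assumes f: "f \<in> distributions X" and X: "open X" and \<kappa>: "\<kappa> \<in> test_functions X"
    and sm: "\<And>t. smooth (G t)" and meas: "(\<lambda>(t, y). G t y) \<in> borel_measurable (lborel \<Otimes>\<^sub>M lborel)"
    and bnd: "\<And>ks R. \<exists>B. integrable lborel B \<and> (\<forall>t\<in>space lborel. \<forall>y\<in>cball 0 R. cmod (iter_partial ks (G t) y) \<le> B t)"
    and smI: "smooth (\<lambda>y. \<integral>t. G t y \<partial>lborel)"
  shows "integrable lborel (\<lambda>t. f (\<lambda>y. \<kappa> y * G t y))"
    and "f (\<lambda>y. \<kappa> y * (\<integral>t. G t y \<partial>lborel)) = (\<integral>t. f (\<lambda>y. \<kappa> y * G t y) \<partial>lborel)"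
proof -
  obtain \<alpha> \<beta> and S :: "(real^'d) set" where \<alpha>: "\<alpha> \<in> test_functions UNIV" and \<beta>: "\<beta> \<in> test_functions X" and S: "separated S"
    and r: "\<forall>m. smooth m \<longrightarrow> (\<lambda>x. \<kappa> x * m x) = (\<lambda>x. \<beta> x * (\<integral>k. (\<integral>y. \<alpha> y * m y * ch (- k) y \<partial>lborel) * ch k x \<partial>count_space S))"
    by (rule local_representation[OF X \<kappa>])
  define F where "F k = f (\<lambda>x. \<beta> x * ch k x)" for k
  have rep: "f (\<lambda>x. \<kappa> x * m x) = (\<integral>k. (\<integral>y. \<alpha> y * m y * ch (- k) y \<partial>lborel) * F k \<partial>count_space S)" if "smooth m" for m
    unfolding r[rule_format, OF that] F_def by (rule expansion_apply(1)[OF f \<beta> S \<alpha> that])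
  obtain C1 M where F: "C1 \<ge> 0" "\<And>k. cmod (F k) \<le> C1 * jb k ^ M"
    unfolding F_def using distribution_growth[OF f \<beta>] by metis
  \<comment> \<open>Decay of this order beats the growth of F and still leaves a summable power of
    \<open>jb\<close>.\<close>
  define n where "n = M + (CARD('d) + 2)"
  obtain C R where C: "C \<ge> 0" "R > 0" and dec: "\<forall>m B. smooth m \<longrightarrow>
      (\<forall>ks. length ks \<le> n \<longrightarrow> (\<forall>x\<in>cball 0 R. cmod (iter_partial ks m x) \<le> B)) \<longrightarrow>
      (\<forall>\<eta>. cmod (\<integral>x. \<alpha> x * m x * ch \<eta> x \<partial>lborel) \<le> C * B / jb \<eta> ^ n)"
    using fourier_decay'[OF \<alpha>, of n] by blast
  obtain B where B: "integrable lborel B" "\<forall>t\<in>space lborel. 0 \<le> B t"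
    "\<forall>t\<in>space lborel. \<forall>ks. length ks \<le> n \<longrightarrow> (\<forall>y\<in>cball 0 R. cmod (iter_partial ks (G t) y) \<le> B t)"
    by (rule uniform_integrable_bound[OF bnd])
  obtain R' where R': "R' > 0" "supp \<alpha> \<subseteq> cball 0 R'" by (rule bounded_supp[OF \<alpha>])
  obtain B' where B': "integrable lborel B'" "\<forall>t\<in>space lborel. \<forall>y\<in>cball 0 R'. cmod (iter_partial [] (G t) y) \<le> B' t"
    using bnd by blast
  define c where "c t k = (\<integral>y. \<alpha> y * G t y * ch (- k) y \<partial>lborel)" for t k
  have c: "cmod (c t k) \<le> C * B t / jb k ^ n" for t k
  proof -
    have "\<forall>ks. length ks \<le> n \<longrightarrow> (\<forall>y\<in>cball 0 R. cmod (iter_partial ks (G t) y) \<le> B t)" using B(3) by simp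
    from dec[rule_format, OF sm this[rule_format], of "- k"] show ?thesis unfolding c_def by (simp add: jb_minus)
  qed
  have mG: "(\<lambda>y. G t y) \<in> borel_measurable borel" for t by (rule smooth_measurable[OF sm])
  \<comment> \<open>Absolute integrability in (t, y): the bound for G is needed only on a ball
    containing the support of \<alpha>.\<close>
  have prod: "integrable (lborel \<Otimes>\<^sub>M lborel) (\<lambda>(t, y). \<alpha> y * G t y * ch (- k) y)" for k
  proof (rule lborel_pair.Fubini_integrable)
    have ma: "\<alpha> \<in> borel_measurable borel" "ch (- k) \<in> borel_measurable borel"
      by (intro smooth_measurable tf_smooth[OF \<alpha>] smooth_ch)+
    have a: "(\<lambda>p::(real^'d) \<times> (real^'d). \<alpha> (snd p)) \<in> borel_measurable (lborel \<Otimes>\<^sub>M lborel)"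
      "(\<lambda>p::(real^'d) \<times> (real^'d). ch (- k) (snd p)) \<in> borel_measurable (lborel \<Otimes>\<^sub>M lborel)"
      by (rule measurable_compose[OF _ ma(1)] measurable_compose[OF _ ma(2)], measurable)+
    have g: "(\<lambda>p. G (fst p) (snd p)) \<in> borel_measurable (lborel \<Otimes>\<^sub>M lborel)"
      using meas by (simp add: case_prod_unfold)
    show m: "(\<lambda>(t, y). \<alpha> y * G t y * ch (- k) y) \<in> borel_measurable (lborel \<Otimes>\<^sub>M lborel)"
      unfolding case_prod_unfold by (intro borel_measurable_times a g)
    have i1: "integrable lborel (\<lambda>y. \<alpha> y * G t y * ch (- k) y)" for t
      by (intro tf_integrable[OF tf_mult[OF tf_mult[OF \<alpha> sm] smooth_ch]])
    show "AE t in lborel. integrable lborel (\<lambda>y. case (t, y) of (t, y) \<Rightarrow> \<alpha> y * G t y * ch (- k) y)"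
      using i1 by simp
    have i2: "integrable lborel (\<lambda>y. cmod (\<alpha> y))" using tf_integrable[OF \<alpha>] by (rule integrable_norm)
    have i3: "integrable lborel (\<lambda>t. B' t * (\<integral>y. cmod (\<alpha> y) \<partial>lborel))" using B'(1) by (rule integrable_mult_left)
    show "integrable lborel (\<lambda>t. \<integral>y. norm (case (t, y) of (t, y) \<Rightarrow> \<alpha> y * G t y * ch (- k) y) \<partial>lborel)"
    proof (rule Bochner_Integration.integrable_bound[OF i3])
      show "(\<lambda>t. \<integral>y. norm (case (t, y) of (t, y) \<Rightarrow> \<alpha> y * G t y * ch (- k) y) \<partial>lborel) \<in> borel_measurable lborel"
        by (rule lborel.borel_measurable_lebesgue_integral) (use measurable_compose[OF m borel_measurable_norm] in \<open>simp add: case_prod_unfold\<close>)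
      show "AE t in lborel. norm (\<integral>y. norm (case (t, y) of (t, y) \<Rightarrow> \<alpha> y * G t y * ch (- k) y) \<partial>lborel) \<le> norm (B' t * (\<integral>y. cmod (\<alpha> y) \<partial>lborel))"
      proof (rule AE_I2)
        fix t
        have "(\<integral>y. norm (\<alpha> y * G t y * ch (- k) y) \<partial>lborel) \<le> (\<integral>y. B' t * cmod (\<alpha> y) \<partial>lborel)"
        proof (rule Bochner_Integration.integral_mono[OF integrable_norm[OF i1] integrable_mult_right[OF i2]])
          fix y
          show "norm (\<alpha> y * G t y * ch (- k) y) \<le> B' t * cmod (\<alpha> y)"
          proof (cases "y \<in> supp \<alpha>")
            case True
            then have "cmod (G t y) \<le> B' t" using B'(2) R'(2) by auto
            then have "cmod (G t y) * cmod (\<alpha> y) \<le> B' t * cmod (\<alpha> y)" by (rule mult_right_mono) simp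
            then show ?thesis by (simp add: norm_mult mult.commute)
          qed (simp add: supp_outside)
        qed
        also have "\<dots> = B' t * (\<integral>y. cmod (\<alpha> y) \<partial>lborel)" by (rule integral_mult_right_zero)
        finally have le: "(\<integral>y. norm (\<alpha> y * G t y * ch (- k) y) \<partial>lborel) \<le> B' t * (\<integral>y. cmod (\<alpha> y) \<partial>lborel)" .
        have "0 \<le> (\<integral>y. norm (\<alpha> y * G t y * ch (- k) y) \<partial>lborel)" by (rule Bochner_Integration.integral_nonneg) simp
        then show "norm (\<integral>y. norm (case (t, y) of (t, y) \<Rightarrow> \<alpha> y * G t y * ch (- k) y) \<partial>lborel) \<le> norm (B' t * (\<integral>y. cmod (\<alpha> y) \<partial>lborel))"
          unfolding case_prod_conv real_norm_def using le by linarith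
      qed
    qed
  qed
  have ci: "integrable lborel (\<lambda>t. c t k)" for k
    unfolding c_def using lborel_pair.integrable_fst'[OF prod[of k]] by simp
  have cI: "(\<integral>y. \<alpha> y * (\<integral>t. G t y \<partial>lborel) * ch (- k) y \<partial>lborel) = (\<integral>t. c t k \<partial>lborel)" for k
  proof -
    have "(\<integral>t. c t k \<partial>lborel) = (\<integral>y. \<integral>t. \<alpha> y * G t y * ch (- k) y \<partial>lborel \<partial>lborel)"
      unfolding c_def by (rule lborel_pair.Fubini_integral[OF prod, symmetric])
    then show ?thesis by (simp only: integral_mult_right_zero integral_mult_left_zero)
  qed
  have cS: "countable S" using S by (simp add: separated_def)
  have ni: "integrable (count_space S) (\<lambda>k. \<integral>t. cmod (c t k * F k) \<partial>lborel)"
  proof -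
    define I where "I = (\<integral>t. B t \<partial>lborel)"
    have i: "integrable (count_space S) (\<lambda>k. (C * C1 * I) * (1 / jb k ^ (CARD('d) + 2)))"
      by (intro integrable_mult_right separated_integrable(2)[OF S]) simp
    show ?thesis
    proof (rule Bochner_Integration.integrable_bound[OF i])
      show "AE k in count_space S. norm (\<integral>t. cmod (c t k * F k) \<partial>lborel) \<le> norm ((C * C1 * I) * (1 / jb k ^ (CARD('d) + 2)))"
      proof (rule AE_I2)
        fix k
        have "(\<integral>t. cmod (c t k * F k) \<partial>lborel) \<le> (\<integral>t. (C * C1 / jb k ^ (CARD('d) + 2)) * B t \<partial>lborel)"
        proof (rule Bochner_Integration.integral_mono[OF integrable_norm[OF integrable_mult_left[OF ci]] integrable_mult_right[OF B(1)]])
          fix t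
          have "cmod (c t k * F k) \<le> (C * B t / jb k ^ n) * (C1 * jb k ^ M)"
            unfolding norm_mult by (rule mult_mono[OF c F(2)]) (use C B(2) in auto)
          also have "\<dots> = (C * C1 / jb k ^ (CARD('d) + 2)) * B t"
            unfolding n_def power_add[of _ M] by (simp add: field_simps)
          finally show "cmod (c t k * F k) \<le> (C * C1 / jb k ^ (CARD('d) + 2)) * B t" .
        qed
        also have "\<dots> = (C * C1 * I) * (1 / jb k ^ (CARD('d) + 2))"
          unfolding integral_mult_right_zero I_def by simp
        finally have "(\<integral>t. cmod (c t k * F k) \<partial>lborel) \<le> (C * C1 * I) * (1 / jb k ^ (CARD('d) + 2))" .
        moreover have "0 \<le> (\<integral>t. cmod (c t k * F k) \<partial>lborel)" by (rule Bochner_Integration.integral_nonneg) simp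
        ultimately show "norm (\<integral>t. cmod (c t k * F k) \<partial>lborel) \<le> norm ((C * C1 * I) * (1 / jb k ^ (CARD('d) + 2)))"
          unfolding real_norm_def by linarith
      qed
    qed simp
  qed
  note fub = fubini_count_space[OF cS integrable_mult_left[OF ci] ni]
  show "integrable lborel (\<lambda>t. f (\<lambda>y. \<kappa> y * G t y))"
    unfolding rep[OF sm] c_def[symmetric] by (rule fub(2))
  show "f (\<lambda>y. \<kappa> y * (\<integral>t. G t y \<partial>lborel)) = (\<integral>t. f (\<lambda>y. \<kappa> y * G t y) \<partial>lborel)"
    unfolding rep[OF sm] rep[OF smI] c_def[symmetric] cI fub(1) by (simp only: integral_mult_left_zero)
qed

text \<open>In the local representation each coefficient converges by dominated convergence, and the
  uniform derivative bounds give a common summable majorant. Pointwise convergence of the functions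
  together with bounded derivatives is therefore enough.\<close>

lemma distribution_sequence:
  fixes G :: "nat \<Rightarrow> real^'d \<Rightarrow> complex"
  assumes f: "f \<in> distributions X" and X: "open X" and \<kappa>: "\<kappa> \<in> test_functions X"
    and sm: "\<And>i. smooth (G i)" and sm': "smooth g"
    and bnd: "\<And>N R. \<exists>B. \<forall>i ks. length ks \<le> N \<longrightarrow> (\<forall>y\<in>cball 0 R. cmod (iter_partial ks (G i) y) \<le> B)"
    and lim: "\<And>y. (\<lambda>i. G i y) \<longlonglongrightarrow> g y"
  shows "(\<lambda>i. f (\<lambda>y. \<kappa> y * G i y)) \<longlonglongrightarrow> f (\<lambda>y. \<kappa> y * g y)"
proof -
  obtain \<alpha> \<beta> and S :: "(real^'d) set" where \<alpha>: "\<alpha> \<in> test_functions UNIV" and \<beta>: "\<beta> \<in> test_functions X" and S: "separated S"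
    and r: "\<forall>m. smooth m \<longrightarrow> (\<lambda>x. \<kappa> x * m x) = (\<lambda>x. \<beta> x * (\<integral>k. (\<integral>y. \<alpha> y * m y * ch (- k) y \<partial>lborel) * ch k x \<partial>count_space S))"
    by (rule local_representation[OF X \<kappa>])
  define F where "F k = f (\<lambda>x. \<beta> x * ch k x)" for k
  have rep: "f (\<lambda>x. \<kappa> x * m x) = (\<integral>k. (\<integral>y. \<alpha> y * m y * ch (- k) y \<partial>lborel) * F k \<partial>count_space S)" if "smooth m" for m
    unfolding r[rule_format, OF that] F_def by (rule expansion_apply(1)[OF f \<beta> S \<alpha> that])
  obtain C1 M where F: "C1 \<ge> 0" "\<And>k. cmod (F k) \<le> C1 * jb k ^ M"
    unfolding F_def using distribution_growth[OF f \<beta>] by metis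
  define n where "n = M + (CARD('d) + 2)"
  obtain C R where C: "C \<ge> 0" "R > 0" and dec: "\<forall>m B. smooth m \<longrightarrow>
      (\<forall>ks. length ks \<le> n \<longrightarrow> (\<forall>x\<in>cball 0 R. cmod (iter_partial ks m x) \<le> B)) \<longrightarrow>
      (\<forall>\<eta>. cmod (\<integral>x. \<alpha> x * m x * ch \<eta> x \<partial>lborel) \<le> C * B / jb \<eta> ^ n)"
    using fourier_decay'[OF \<alpha>, of n] by blast
  obtain B where B: "\<forall>i ks. length ks \<le> n \<longrightarrow> (\<forall>y\<in>cball 0 R. cmod (iter_partial ks (G i) y) \<le> B)"
    using bnd by blast
  obtain R' where R': "R' > 0" "supp \<alpha> \<subseteq> cball 0 R'" by (rule bounded_supp[OF \<alpha>])
  obtain B' where "\<forall>i ks. length ks \<le> 0 \<longrightarrow> (\<forall>y\<in>cball 0 R'. cmod (iter_partial ks (G i) y) \<le> B')"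
    using bnd by blast
  then have B': "\<And>i y. y \<in> cball 0 R' \<Longrightarrow> cmod (G i y) \<le> B'" by (metis iter_partial.simps(1) le0 list.size(3))
  show ?thesis unfolding rep[OF sm] rep[OF sm']
  proof (rule integral_dominated_convergence)
    show "integrable (count_space S) (\<lambda>k. (C * C1 * B) * (1 / jb k ^ (CARD('d) + 2)))"
      by (intro integrable_mult_right separated_integrable(2)[OF S]) simp
    show "AE k in count_space S. cmod ((\<integral>y. \<alpha> y * G i y * ch (- k) y \<partial>lborel) * F k) \<le> (C * C1 * B) * (1 / jb k ^ (CARD('d) + 2))" for i
    proof (rule AE_I2)
      fix k
      have c: "cmod (\<integral>y. \<alpha> y * G i y * ch (- k) y \<partial>lborel) \<le> C * B / jb k ^ n"
        using dec[rule_format, OF sm, of i B "- k"] B by (simp add: jb_minus)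
      then have "0 \<le> C * B / jb k ^ n" using norm_ge_zero order_trans by blast
      then have "cmod ((\<integral>y. \<alpha> y * G i y * ch (- k) y \<partial>lborel) * F k) \<le> (C * B / jb k ^ n) * (C1 * jb k ^ M)"
        unfolding norm_mult by (intro mult_mono[OF c F(2)]) simp_all
      also have "\<dots> = (C * C1 * B) * (1 / jb k ^ (CARD('d) + 2))"
        unfolding n_def power_add[of _ M] by (simp add: field_simps)
      finally show "cmod ((\<integral>y. \<alpha> y * G i y * ch (- k) y \<partial>lborel) * F k) \<le> (C * C1 * B) * (1 / jb k ^ (CARD('d) + 2))" .
    qed
    show "AE k in count_space S. (\<lambda>i. (\<integral>y. \<alpha> y * G i y * ch (- k) y \<partial>lborel) * F k) \<longlonglongrightarrow> (\<integral>y. \<alpha> y * g y * ch (- k) y \<partial>lborel) * F k"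
    proof (rule AE_I2, rule tendsto_mult[OF _ tendsto_const])
      fix k
      show "(\<lambda>i. \<integral>y. \<alpha> y * G i y * ch (- k) y \<partial>lborel) \<longlonglongrightarrow> (\<integral>y. \<alpha> y * g y * ch (- k) y \<partial>lborel)"
      proof (rule integral_dominated_convergence)
        show "integrable lborel (\<lambda>y. B' * cmod (\<alpha> y))"
          by (intro integrable_mult_right integrable_norm tf_integrable[OF \<alpha>])
        show "AE y in lborel. (\<lambda>i. \<alpha> y * G i y * ch (- k) y) \<longlonglongrightarrow> \<alpha> y * g y * ch (- k) y"
          by (intro AE_I2 tendsto_mult tendsto_const lim)
        show "AE y in lborel. cmod (\<alpha> y * G i y * ch (- k) y) \<le> B' * cmod (\<alpha> y)" for i
        proof (rule AE_I2)
          fix y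
          show "cmod (\<alpha> y * G i y * ch (- k) y) \<le> B' * cmod (\<alpha> y)"
          proof (cases "y \<in> supp \<alpha>")
            case True
            then have "cmod (G i y) \<le> B'" using B' R'(2) by blast
            then have "cmod (G i y) * cmod (\<alpha> y) \<le> B' * cmod (\<alpha> y)" by (rule mult_right_mono) simp
            then show ?thesis by (simp add: norm_mult mult.commute)
          qed (simp add: supp_outside)
        qed
      qed (simp_all add: smooth_measurable smooth_mult sm sm' tf_smooth[OF \<alpha>])
    qed
  qed simp_all
qed

subsection \<open>Fourier and short-time Fourier transforms of distributions\<close>

lemma schwartz_smooth: "\<phi> \<in> schwartz \<Longrightarrow> smooth \<phi>"
  by (simp add: schwartz_def)

lemma tf_schwartz:
  fixes u :: "real^'d \<Rightarrow> complex"
  assumes "u \<in> test_functions X" shows "u \<in> schwartz"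
proof -
  have "bounded (range (\<lambda>x. (1 + norm x) ^ N *\<^sub>R iter_partial ks u x))" for N ks
  proof -
    obtain R where R: "R > 0" "supp u \<subseteq> cball 0 R" by (rule bounded_supp[OF assms])
    obtain B where B: "\<forall>x. cmod (iter_partial ks u x) \<le> B" using tf_bounded[OF tf_iter_partial[OF assms]] ..
    have "norm ((1 + norm x) ^ N *\<^sub>R iter_partial ks u x) \<le> (1 + R) ^ N * B" for x
    proof (cases "x \<in> supp u")
      case True
      then have "norm x \<le> R" using R(2) by auto
      then have "(1 + norm x) ^ N * cmod (iter_partial ks u x) \<le> (1 + R) ^ N * B"
        using B R(1) by (intro mult_mono power_mono) auto
      then show ?thesis by simp
    next
      case False
      have "0 \<le> B" using B norm_ge_zero order_trans by blast
      then show ?thesis using False R(1) by (simp add: iter_partial_outside)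
    qed
    then show ?thesis unfolding bounded_iff by auto
  qed
  then show ?thesis unfolding schwartz_def using tf_smooth[OF assms] by blast
qed

lemma schwartz_decay:
  assumes "\<phi> \<in> schwartz"
  shows "\<exists>B\<ge>0. \<forall>ks. length ks \<le> N \<longrightarrow> (\<forall>x. cmod (iter_partial ks \<phi> x) \<le> B / jb x ^ n)"
proof -
  have "\<exists>B. \<forall>x. cmod (iter_partial ks \<phi> x) \<le> B / jb x ^ n" for ks
  proof -
    have "bounded (range (\<lambda>x. (1 + norm x) ^ n *\<^sub>R iter_partial ks \<phi> x))"
      using assms unfolding schwartz_def by blast
    then obtain B where "\<forall>y\<in>range (\<lambda>x. (1 + norm x) ^ n *\<^sub>R iter_partial ks \<phi> x). norm y \<le> B"
      unfolding bounded_iff ..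
    then have "jb x ^ n * cmod (iter_partial ks \<phi> x) \<le> B" for x
      by (simp add: jb_def)
    then show ?thesis by (intro exI[of _ B] allI) (simp add: pos_le_divide_eq mult.commute)
  qed
  then have "\<exists>B\<ge>0. \<forall>ks\<in>{ks. length ks \<le> N}. \<forall>x. cmod (iter_partial ks \<phi> x) \<le> B / jb x ^ n"
  proof (intro finite_uniform_bound[OF finite_length_le])
    fix ks and B B' :: real assume "\<forall>x. cmod (iter_partial ks \<phi> x) \<le> B / jb x ^ n" "B \<le> B'"
    then show "\<forall>x. cmod (iter_partial ks \<phi> x) \<le> B' / jb x ^ n"
      using divide_right_mono[of B B'] by (meson jb_nonneg order_trans zero_le_power)
  qed
  then show ?thesis by simp
qed

lemma schwartz_integrable:
  fixes \<phi> :: "real^'d \<Rightarrow> complex"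
  assumes "\<phi> \<in> schwartz" shows "integrable lborel (\<lambda>x. cmod (\<phi> x) * jb x ^ n)"
proof -
  obtain B where B: "B \<ge> 0" "\<forall>ks. length ks \<le> 0 \<longrightarrow> (\<forall>x. cmod (iter_partial ks \<phi> x) \<le> B / jb x ^ (n + (CARD('d) + 2)))"
    using schwartz_decay[OF assms, of 0 "n + (CARD('d) + 2)"] by blast
  have i: "integrable lborel (\<lambda>x::real^'d. B * (1 / jb x ^ (CARD('d) + 2)))"
    by (intro integrable_mult_right integrable_jb) simp
  show ?thesis
  proof (rule Bochner_Integration.integrable_bound[OF i])
    have "\<phi> \<in> borel_measurable borel" by (intro smooth_measurable schwartz_smooth assms)
    then show "(\<lambda>x. cmod (\<phi> x) * jb x ^ n) \<in> borel_measurable lborel" by measurable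
    show "AE x in lborel. norm (cmod (\<phi> x) * jb x ^ n) \<le> norm (B * (1 / jb x ^ (CARD('d) + 2)))"
    proof (rule AE_I2)
      fix x
      have "cmod (\<phi> x) \<le> B / jb x ^ (n + (CARD('d) + 2))" using B(2)[rule_format, of "[]" x] by simp
      then have "cmod (\<phi> x) * jb x ^ n \<le> B / jb x ^ (n + (CARD('d) + 2)) * jb x ^ n"
        by (rule mult_right_mono) simp
      also have "\<dots> = B * (1 / jb x ^ (CARD('d) + 2))" unfolding power_add[of _ n] by (simp add: field_simps)
      finally have "cmod (\<phi> x) * jb x ^ n \<le> \<bar>B * (1 / jb x ^ (CARD('d) + 2))\<bar>" by (rule order_trans[OF _ abs_ge_self])
      moreover have "0 \<le> cmod (\<phi> x) * jb x ^ n" by simp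
      ultimately show "norm (cmod (\<phi> x) * jb x ^ n) \<le> norm (B * (1 / jb x ^ (CARD('d) + 2)))"
        by (simp only: real_norm_def abs_of_nonneg)
    qed
  qed
qed

text \<open>Two continuous densities that differ at a point are separated by a bump supported near
  it.\<close>

lemma represents_unique:
  fixes h1 h2 :: "real^'d \<Rightarrow> complex"
  assumes "continuous_on UNIV h1" "continuous_on UNIV h2" "represents h1 u" "represents h2 u"
  shows "h1 = h2"
proof (rule ccontr)
  assume "h1 \<noteq> h2"
  then obtain x0 where x0: "h1 x0 \<noteq> h2 x0" by blast
  \<comment> \<open>The constant factor makes h x0 a positive number, so the real part of h stays
    positive near x0.\<close>
  define h where "h x = cnj (h1 x0 - h2 x0) * (h1 x - h2 x)" for x
  have ch: "continuous_on UNIV h" unfolding h_def by (intro continuous_intros assms)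
  have "h x0 = of_real ((cmod (h1 x0 - h2 x0))\<^sup>2)" unfolding h_def by (simp only: complex_norm_square mult.commute)
  then have "Re (h x0) > 0" using x0 by simp
  moreover have cR: "isCont (\<lambda>x. Re (h x)) x0"
    using ch continuous_on_eq_continuous_at[of UNIV h] by (intro isCont_Re) simp
  ultimately have "\<forall>\<^sub>F x in nhds x0. Re (h x) > 0"
    unfolding isCont_def using order_tendstoD(1) tendsto_at_iff_tendsto_nhds[of "\<lambda>x. Re (h x)" x0] by blast
  then obtain r where r: "r > 0" "\<And>x. dist x x0 < r \<Longrightarrow> Re (h x) > 0"
    unfolding eventually_nhds_metric by blast
  have "r / 2 > 0" using r by simp
  then obtain b :: "real^'d \<Rightarrow> real" where b: "(\<lambda>x. complex_of_real (b x)) \<in> test_functions (cball x0 (r / 2))"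
      "\<And>y. 0 \<le> b y" "\<And>y. dist x0 y < r / 2 \<Longrightarrow> b y > 0"
    using bump_function by metis
  define \<phi> where "\<phi> x = complex_of_real (b x)" for x
  have \<phi>: "\<phi> \<in> schwartz" unfolding \<phi>_def by (rule tf_schwartz[OF b(1)])
  have i: "integrable lborel (\<lambda>x. h1 x * \<phi> x)" "integrable lborel (\<lambda>x. h2 x * \<phi> x)"
    "(\<integral>x. h1 x * \<phi> x \<partial>lborel) = (\<integral>x. h2 x * \<phi> x \<partial>lborel)"
    using assms(3,4) \<phi> unfolding represents_def by auto
  have eq: "h x * \<phi> x = cnj (h1 x0 - h2 x0) * (h1 x * \<phi> x - h2 x * \<phi> x)" for x
    unfolding h_def by (simp add: algebra_simps)
  have ih: "integrable lborel (\<lambda>x. h x * \<phi> x)"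
    unfolding eq by (intro integrable_mult_right Bochner_Integration.integrable_diff i)
  have "(\<integral>x. h x * \<phi> x \<partial>lborel) = 0"
    unfolding eq integral_mult_right_zero Bochner_Integration.integral_diff[OF i(1,2)] i(3) by simp
  then have "(\<integral>x. Re (h x * \<phi> x) \<partial>lborel) = 0" using integral_Re[OF ih] by simp
  moreover have Reh: "Re (h x * \<phi> x) = Re (h x) * b x" for x unfolding \<phi>_def by simp
  moreover have nn: "0 \<le> Re (h x) * b x" for x
  proof (cases "dist x x0 < r")
    case True
    then show ?thesis using r(2)[OF True] b(2)[of x] by simp
  next
    case False
    then have "x \<notin> cball x0 (r / 2)" using r(1) by (simp add: dist_commute)
    then have "complex_of_real (b x) = 0" by (rule tf_outside[OF b(1)])
    then show ?thesis by simp
  qed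
  ultimately have "(\<integral>x. Re (h x) * b x \<partial>lborel) = 0" by simp
  moreover have "integrable lborel (\<lambda>x. Re (h x) * b x)" using integrable_Re[OF ih] unfolding Reh .
  ultimately have "AE x in lborel. Re (h x) * b x = 0"
    using integral_nonneg_eq_0_iff_AE[of lborel "\<lambda>x. Re (h x) * b x"] nn by simp
  moreover have "Re (h x) * b x \<noteq> 0" if "x \<in> ball x0 (r / 2)" for x
    using r(2)[of x] b(3)[of x] that r(1) by (simp add: dist_commute)
  ultimately have "AE x in lborel. x \<notin> ball x0 (r / 2)" by (auto elim: eventually_mono)
  then have "emeasure lborel (ball x0 (r / 2)) = 0"
    by (subst (asm) AE_iff_measurable[of "ball x0 (r / 2)"]) auto
  moreover have "measure lborel (ball x0 (r / 2)) > 0" using content_ball_pos[of "r / 2" x0] r(1) by simp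
  ultimately show False by (simp add: measure_def)
qed

section \<open>Transforms of cut-off distributions as pairings with characters\<close>

abbreviation fc :: "'d itself \<Rightarrow> complex" where
  "fc T \<equiv> of_real ((2 * pi) powr (- real CARD('d) / 2))"

lemma measurable_ch_pair:
  "(\<lambda>p. ch (fst p) (snd p)) \<in> borel_measurable (lborel \<Otimes>\<^sub>M (lborel :: (real^'d) measure))"
proof -
  have "continuous_on UNIV (\<lambda>p :: (real^'d) \<times> (real^'d). ch (fst p) (snd p))" by (intro continuous_intros)
  then have "(\<lambda>p :: (real^'d) \<times> (real^'d). ch (fst p) (snd p)) \<in> borel_measurable borel"
    by (rule borel_measurable_continuous_onI)
  then show ?thesis by (simp add: lborel_prod)
qed

text \<open>Sequential continuity from \<open>distribution_sequence\<close>; a convergent sequence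
  of parameters is bounded, so the derivative bounds are uniform along it.\<close>

lemma continuous_distribution_family:
  fixes G :: "'t::metric_space \<Rightarrow> real^'d \<Rightarrow> complex"
  assumes f: "f \<in> distributions X" and X: "open X" and \<kappa>: "\<kappa> \<in> test_functions X"
    and sm: "\<And>t. smooth (G t)"
    and bnd: "\<And>N K. bounded K \<Longrightarrow> \<exists>B. \<forall>t\<in>K. \<forall>ks. length ks \<le> N \<longrightarrow> (\<forall>y. cmod (iter_partial ks (G t) y) \<le> B)"
    and cont: "\<And>y. continuous_on UNIV (\<lambda>t. G t y)"
  shows "continuous_on UNIV (\<lambda>t. f (\<lambda>y. \<kappa> y * G t y))"
  unfolding continuous_on_sequentially
proof (intro allI ballI impI, elim conjE)
  fix x :: "nat \<Rightarrow> 't" and a assume x: "x \<longlonglongrightarrow> a"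
  have b: "bounded (range x)" using x convergent_imp_bounded by blast
  have "(\<lambda>i. f (\<lambda>y. \<kappa> y * G (x i) y)) \<longlonglongrightarrow> f (\<lambda>y. \<kappa> y * G a y)"
  proof (rule distribution_sequence[OF f X \<kappa> sm sm])
    show "\<exists>B. \<forall>i ks. length ks \<le> N \<longrightarrow> (\<forall>y\<in>cball 0 R. cmod (iter_partial ks (G (x i)) y) \<le> B)" for N R
    proof -
      obtain B where "\<forall>t\<in>range x. \<forall>ks. length ks \<le> N \<longrightarrow> (\<forall>y. cmod (iter_partial ks (G t) y) \<le> B)"
        using bnd[OF b, of N] ..
      then show ?thesis by (intro exI[of _ B]) simp
    qed
    show "(\<lambda>i. G (x i) y) \<longlonglongrightarrow> G a y" for y
      using cont[of y] x unfolding continuous_on_sequentially by (simp add: comp_def)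
  qed
  then show "((\<lambda>t. f (\<lambda>y. \<kappa> y * G t y)) \<circ> x) \<longlonglongrightarrow> f (\<lambda>y. \<kappa> y * G a y)" by (simp add: comp_def)
qed

lemma norm_iter_partial_ch_le:
  assumes "length ks \<le> N" shows "cmod (iter_partial ks (ch \<xi>) y) \<le> jb \<xi> ^ N"
  using order_trans[OF norm_iter_partial_ch norm_le_jb] power_increasing[OF assms jb_ge_1] order_trans by blast

lemma ch_bounded_family:
  assumes "bounded K"
  shows "\<exists>B. \<forall>\<xi>\<in>K. \<forall>ks. length ks \<le> N \<longrightarrow> (\<forall>y. cmod (iter_partial ks (ch \<xi>) y) \<le> B)"
proof -
  obtain R where R: "R > 0" "\<forall>\<xi>\<in>K. norm \<xi> \<le> R" using assms unfolding bounded_pos by metis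
  have "cmod (iter_partial ks (ch \<xi>) y) \<le> (1 + R) ^ N" if "\<xi> \<in> K" "length ks \<le> N" for \<xi> ks y
  proof -
    have "jb \<xi> ^ N \<le> (1 + R) ^ N" using R that by (intro power_mono) (auto simp: jb_def)
    then show ?thesis using norm_iter_partial_ch_le[OF that(2), of \<xi> y] by linarith
  qed
  then show ?thesis by (intro exI[of _ "(1 + R) ^ N"]) simp
qed

lemma continuous_distribution_ch:
  assumes "f \<in> distributions X" "open X" "\<kappa> \<in> test_functions X"
  shows "continuous_on UNIV (\<lambda>\<xi>. f (\<lambda>y. \<kappa> y * ch \<xi> y))"
  by (rule continuous_distribution_family[OF assms smooth_ch ch_bounded_family])
    (auto intro!: continuous_intros)

text \<open>Moving f under the integral that defines the Fourier transform of a Schwartz function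
  shows that this continuous function represents the transform. By uniqueness it is the one selected
  in \<open>fourier_fun\<close>, and from here on the transform is handled through this
  formula.\<close>

lemma fourier_fun_dmult:
  fixes \<kappa> :: "real^'d \<Rightarrow> complex"
  assumes f: "f \<in> distributions X" and X: "open X" and \<kappa>: "\<kappa> \<in> test_functions X"
  shows "fourier_fun (dmult \<kappa> f) = (\<lambda>\<xi>. fc TYPE('d) * f (\<lambda>x. \<kappa> x * ch \<xi> x))"
proof -
  define h where "h \<xi> = fc TYPE('d) * f (\<lambda>x. \<kappa> x * ch \<xi> x)" for \<xi>
  have c: "continuous_on UNIV h"
    unfolding h_def by (intro continuous_intros continuous_distribution_ch[OF f X \<kappa>])
  have "represents h (dfourier (dmult \<kappa> f))"
    unfolding represents_def
  proof
    fix \<phi> :: "real^'d \<Rightarrow> complex" assume \<phi>: "\<phi> \<in> schwartz"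
    \<comment> \<open>The integrand of the Fourier transform of \<phi> as a family of smooth
      functions of y; rapid decay of \<phi> dominates the powers of t produced by
      differentiation.\<close>
    define G where "G t y = \<phi> t * ch t y" for t y
    have m\<phi>: "\<phi> \<in> borel_measurable borel" by (intro smooth_measurable schwartz_smooth \<phi>)
    have sm: "smooth (G t)" for t unfolding G_def by (intro smooth_mult smooth_const smooth_ch)
    have itG: "iter_partial ks (G t) = (\<lambda>y. \<phi> t * iter_partial ks (ch t) y)" for ks t
      unfolding G_def by (rule iter_partial_mult_const[OF smooth_ch])
    have meas: "(\<lambda>(t, y). G t y) \<in> borel_measurable (lborel \<Otimes>\<^sub>M lborel)"
    proof -
      have "(\<lambda>p :: (real^'d) \<times> (real^'d). \<phi> (fst p)) \<in> borel_measurable (lborel \<Otimes>\<^sub>M lborel)"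
        by (rule measurable_compose[OF _ m\<phi>]) measurable
      then show ?thesis unfolding G_def case_prod_unfold by (intro borel_measurable_times measurable_ch_pair)
    qed
    have bnd: "\<exists>B. integrable lborel B \<and> (\<forall>t\<in>space lborel. \<forall>y\<in>cball 0 R. cmod (iter_partial ks (G t) y) \<le> B t)" for ks R
    proof (rule exI[of _ "\<lambda>t. cmod (\<phi> t) * jb t ^ length ks"], intro conjI ballI)
      show "integrable lborel (\<lambda>t. cmod (\<phi> t) * jb t ^ length ks)" by (rule schwartz_integrable[OF \<phi>])
      show "cmod (iter_partial ks (G t) y) \<le> cmod (\<phi> t) * jb t ^ length ks" for t y
        unfolding itG norm_mult by (intro mult_left_mono norm_iter_partial_ch_le) auto
    qed
    have smI: "smooth (\<lambda>y. \<integral>t. G t y \<partial>lborel)"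
      unfolding G_def by (rule fourier_integral_smooth(1)[OF _ _ schwartz_integrable[OF \<phi>]]) (use m\<phi> in simp_all)
    note P = distribution_parameter_integral[OF f X \<kappa> sm meas bnd smI]
    have fG: "f (\<lambda>y. \<kappa> y * G t y) = \<phi> t * f (\<lambda>y. \<kappa> y * ch t y)" for t
    proof -
      have "(\<lambda>y. \<kappa> y * G t y) = (\<lambda>y. \<phi> t * (\<kappa> y * ch t y))" by (simp add: G_def fun_eq_iff mult_ac)
      then show ?thesis using distribution_scale[OF f tf_mult[OF \<kappa> smooth_ch]] by simp
    qed
    have hG: "h t * \<phi> t = fc TYPE('d) * f (\<lambda>y. \<kappa> y * G t y)" for t
      unfolding fG h_def by (simp add: mult_ac)
    have "dfourier (dmult \<kappa> f) \<phi> = f (\<lambda>x. \<kappa> x * fourier \<phi> x)" by (simp add: dfourier_def dmult_def)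
    also have "(\<lambda>x. \<kappa> x * fourier \<phi> x) = (\<lambda>x. fc TYPE('d) * (\<kappa> x * (\<integral>t. G t x \<partial>lborel)))"
      unfolding fourier_def G_def by (simp add: fun_eq_iff ch_def inner_commute)
    also have "f \<dots> = fc TYPE('d) * f (\<lambda>x. \<kappa> x * (\<integral>t. G t x \<partial>lborel))"
      by (rule distribution_scale[OF f tf_mult[OF \<kappa> smI]])
    also have "\<dots> = (\<integral>t. h t * \<phi> t \<partial>lborel)"
      unfolding hG integral_mult_right_zero P(2) by (rule refl)
    finally have "dfourier (dmult \<kappa> f) \<phi> = (\<integral>t. h t * \<phi> t \<partial>lborel)" .
    moreover have "integrable lborel (\<lambda>t. h t * \<phi> t)" unfolding hG by (intro integrable_mult_right P(1))
    ultimately show "integrable lborel (\<lambda>x. h x * \<phi> x) \<and> dfourier (dmult \<kappa> f) \<phi> = (\<integral>x. h x * \<phi> x \<partial>lborel)"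
      by (rule conjI[rotated])
  qed
  then have "fourier_fun (dmult \<kappa> f) = h"
    unfolding fourier_fun_def using c represents_unique by (intro the_equality) blast+
  then show ?thesis unfolding h_def[abs_def] .
qed

lemma stft_dmult:
  fixes \<kappa> :: "real^'d \<Rightarrow> complex"
  assumes f: "f \<in> distributions X" and X: "open X" and \<kappa>: "\<kappa> \<in> test_functions X" and w: "smooth w"
  shows "stft w (dmult \<kappa> f) x \<xi> = fc TYPE('d) * f (\<lambda>y. \<kappa> y * (cnj (w (y - x)) * ch \<xi> y))"
proof -
  have "dmult (\<lambda>y. cnj (w (y - x))) (dmult \<kappa> f) = dmult (\<lambda>y. \<kappa> y * cnj (w (y - x))) f"
    by (simp add: dmult_def fun_eq_iff mult.assoc)
  then show ?thesis
    unfolding stft_def by (simp add: fourier_fun_dmult[OF f X tf_mult[OF \<kappa> smooth_cnj[OF smooth_shift[OF w]]]] mult.assoc)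
qed

lemma iter_partial_window:
  assumes "smooth w"
  shows "iter_partial ks (\<lambda>y. cnj (w (y - x))) = (\<lambda>y. cnj (iter_partial ks w (y - x)))"
  unfolding iter_partial_cnj[OF smooth_shift[OF assms]] iter_partial_shift[OF assms] by (rule refl)

text \<open>Continuity is joint in translation and frequency; measurability of the mixed norms rests
  on it.\<close>

lemma continuous_stft:
  fixes \<kappa> :: "real^'d \<Rightarrow> complex"
  assumes f: "f \<in> distributions X" and X: "open X" and \<kappa>: "\<kappa> \<in> test_functions X" and w: "w \<in> schwartz"
  shows "continuous_on UNIV (\<lambda>p. stft w (dmult \<kappa> f) (fst p) (snd p))"
proof -
  note sw = schwartz_smooth[OF w]
  have "continuous_on UNIV (\<lambda>p. f (\<lambda>y. \<kappa> y * (cnj (w (y - fst p)) * ch (snd p) y)))"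
  proof (rule continuous_distribution_family[OF f X \<kappa>])
    show "smooth (\<lambda>y. cnj (w (y - fst p)) * ch (snd p) y)" for p
      by (intro smooth_mult smooth_cnj smooth_shift sw smooth_ch)
    fix N and K :: "((real^'d) \<times> (real^'d)) set" assume K: "bounded K"
    obtain B where B: "B \<ge> 0" "\<forall>ks. length ks \<le> N \<longrightarrow> (\<forall>x. cmod (iter_partial ks w x) \<le> B / jb x ^ 0)"
      using schwartz_decay[OF w, of N 0] by blast
    obtain A where A: "\<forall>\<xi>\<in>snd ` K. \<forall>ks. length ks \<le> N \<longrightarrow> (\<forall>y. cmod (iter_partial ks (ch \<xi>) y) \<le> A)"
      using ch_bounded_family[OF bounded_snd[OF K], of N] ..
    show "\<exists>B. \<forall>p\<in>K. \<forall>ks. length ks \<le> N \<longrightarrow> (\<forall>y. cmod (iter_partial ks (\<lambda>y. cnj (w (y - fst p)) * ch (snd p) y) y) \<le> B)"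
    proof (rule exI[of _ "2 ^ N * \<bar>B\<bar> * \<bar>A\<bar>"], intro ballI allI impI)
      fix p and ks :: "'d list" and y assume p: "p \<in> K" and ks: "length ks \<le> N"
      have "cmod (iter_partial ks (\<lambda>y. cnj (w (y - fst p)) * ch (snd p) y) y) \<le> 2 ^ length ks * \<bar>B\<bar> * \<bar>A\<bar>"
      proof (rule iter_partial_mult_bound[OF smooth_cnj[OF smooth_shift[OF sw]] smooth_ch])
        show "\<forall>js. length js \<le> length ks \<longrightarrow> cmod (iter_partial js (\<lambda>y. cnj (w (y - fst p))) y) \<le> \<bar>B\<bar>"
        proof (intro allI impI)
          fix js :: "'d list" assume "length js \<le> length ks"
          then have "cmod (iter_partial js w (y - fst p)) \<le> B" using B(2) ks by simp
          then show "cmod (iter_partial js (\<lambda>y. cnj (w (y - fst p))) y) \<le> \<bar>B\<bar>"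
            unfolding iter_partial_window[OF sw] complex_mod_cnj by linarith
        qed
        show "\<forall>js. length js \<le> length ks \<longrightarrow> cmod (iter_partial js (ch (snd p)) y) \<le> \<bar>A\<bar>"
        proof (intro allI impI)
          fix js :: "'d list" assume "length js \<le> length ks"
          then have "cmod (iter_partial js (ch (snd p)) y) \<le> A" using A p ks by simp
          then show "cmod (iter_partial js (ch (snd p)) y) \<le> \<bar>A\<bar>" by linarith
        qed
      qed
      also have "\<dots> \<le> 2 ^ N * \<bar>B\<bar> * \<bar>A\<bar>" using ks by (intro mult_right_mono power_increasing) auto
      finally show "cmod (iter_partial ks (\<lambda>y. cnj (w (y - fst p)) * ch (snd p) y) y) \<le> 2 ^ N * \<bar>B\<bar> * \<bar>A\<bar>" .
    qed
  next
    fix y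
    show "continuous_on UNIV (\<lambda>p. cnj (w (y - fst p)) * ch (snd p) y)"
      by (intro continuous_intros continuous_on_compose2[OF smooth_continuous_on[OF sw, of UNIV]]) auto
  qed
  then show ?thesis unfolding stft_dmult[OF f X \<kappa> sw] by (intro continuous_intros)
qed

text \<open>Integrating the short-time transform over translations t in a box replaces the window by
  its average m. The Fourier transform of \<kappa> m f thus becomes an integral of the short-time
  transform over a bounded set, which an L^p norm in t controls.\<close>

lemma averaged_window:
  fixes \<kappa> w :: "real^'d \<Rightarrow> complex" and a b :: "real^'d"
  assumes f: "f \<in> distributions X" and X: "open X" and \<kappa>: "\<kappa> \<in> test_functions X" and w: "w \<in> schwartz"
  defines "m \<equiv> \<lambda>y. \<integral>t. indicator (cbox a b) t *\<^sub>R cnj (w (y - t)) \<partial>lborel"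
  shows "smooth m"
    and "integrable lborel (\<lambda>t. indicator (cbox a b) t *\<^sub>R stft w (dmult \<kappa> f) t \<xi>)"
    and "fc TYPE('d) * f (\<lambda>y. \<kappa> y * m y * ch \<xi> y) = (\<integral>t. indicator (cbox a b) t *\<^sub>R stft w (dmult \<kappa> f) t \<xi> \<partial>lborel)"
proof -
  note sw = schwartz_smooth[OF w]
  define H where "H t y = indicator (cbox a b) t *\<^sub>R cnj (w (y - t))" for t y
  have H: "H t = (\<lambda>y. complex_of_real (indicator (cbox a b) t) * cnj (w (y - t)))" for t
    by (simp add: H_def[abs_def] scaleR_conv_of_real)
  have smw: "smooth (\<lambda>y. cnj (w (y - t)))" for t by (intro smooth_cnj smooth_shift sw)
  have smH: "smooth (H t)" for t unfolding H by (intro smooth_mult smooth_const smw)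
  have itH: "iter_partial ks (H t) y = complex_of_real (indicator (cbox a b) t) * cnj (iter_partial ks w (y - t))" for ks t y
    unfolding H iter_partial_mult_const[OF smw] iter_partial_window[OF sw] by (rule refl)
  have mi: "(\<lambda>t. complex_of_real (indicator (cbox a b) t)) \<in> borel_measurable borel" by measurable
  have mH: "(\<lambda>t. iter_partial ks (H t) y) \<in> borel_measurable lborel" for ks y
  proof -
    have "continuous_on UNIV (\<lambda>t. cnj (iter_partial ks w (y - t)))"
      by (intro continuous_intros continuous_on_compose2[OF smooth_continuous_on[OF smooth_iter_partial[OF sw], of UNIV]]) auto
    then have "(\<lambda>t. cnj (iter_partial ks w (y - t))) \<in> borel_measurable borel" by (rule borel_measurable_continuous_onI)
    from borel_measurable_times[OF mi this] show ?thesis unfolding itH measurable_lborel2 .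
  qed
  have wB: "\<exists>B\<ge>0. \<forall>x. cmod (iter_partial ks w x) \<le> B" for ks
    using schwartz_decay[OF w, of "length ks" 0] by fastforce
  have iQ: "integrable lborel (\<lambda>t. B * indicator (cbox a b) t)" for B :: real
    by (intro integrable_mult_right integrable_real_indicator emeasure_lborel_cbox_finite) simp
  have bH: "\<exists>B. integrable lborel B \<and> (\<forall>t\<in>space lborel. \<forall>y\<in>cball 0 R. cmod (iter_partial ks (H t) y) \<le> B t)" for ks R
  proof -
    obtain B where B: "B \<ge> 0" "\<forall>x. cmod (iter_partial ks w x) \<le> B" using wB by blast
    have "cmod (iter_partial ks (H t) y) \<le> B * indicator (cbox a b) t" for t y
      unfolding itH using B(2) by (simp add: norm_mult indicator_def)
    then show ?thesis using iQ[of B] by blast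
  qed
  have mI: "m = (\<lambda>y. \<integral>t. H t y \<partial>lborel)" unfolding m_def H_def ..
  show smm: "smooth m" unfolding mI by (rule smooth_parameter_integral(1)[OF smH mH bH])
  define G where "G t y = H t y * ch \<xi> y" for t y
  have smG: "smooth (G t)" for t unfolding G_def by (intro smooth_mult smooth_ch smH)
  have GI: "(\<integral>t. G t y \<partial>lborel) = m y * ch \<xi> y" for y
    unfolding G_def mI by (rule integral_mult_left_zero)
  have meas: "(\<lambda>(t, y). G t y) \<in> borel_measurable (lborel \<Otimes>\<^sub>M lborel)"
  proof -
    have 1: "(\<lambda>p :: (real^'d) \<times> (real^'d). complex_of_real (indicator (cbox a b) (fst p))) \<in> borel_measurable (lborel \<Otimes>\<^sub>M lborel)"
      by (rule measurable_compose[OF _ mi]) measurable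
    have "continuous_on UNIV (\<lambda>p :: (real^'d) \<times> (real^'d). cnj (w (snd p - fst p)) * ch \<xi> (snd p))"
      by (intro continuous_intros continuous_on_compose2[OF smooth_continuous_on[OF sw, of UNIV]]) auto
    then have "(\<lambda>p :: (real^'d) \<times> (real^'d). cnj (w (snd p - fst p)) * ch \<xi> (snd p)) \<in> borel_measurable borel"
      by (rule borel_measurable_continuous_onI)
    then have 2: "(\<lambda>p :: (real^'d) \<times> (real^'d). cnj (w (snd p - fst p)) * ch \<xi> (snd p)) \<in> borel_measurable (lborel \<Otimes>\<^sub>M lborel)"
      by (simp add: lborel_prod)
    show ?thesis unfolding G_def H case_prod_unfold mult.assoc by (rule borel_measurable_times[OF 1 2])
  qed
  have bG: "\<exists>B. integrable lborel B \<and> (\<forall>t\<in>space lborel. \<forall>y\<in>cball 0 R. cmod (iter_partial ks (G t) y) \<le> B t)" for ks R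
  proof -
    obtain B where B: "B \<ge> 0" "\<forall>js. length js \<le> length ks \<longrightarrow> (\<forall>x. cmod (iter_partial js w x) \<le> B / jb x ^ 0)"
      using schwartz_decay[OF w, of "length ks" 0] by blast
    have "cmod (iter_partial ks (G t) y) \<le> (2 ^ length ks * (jb \<xi> ^ length ks) * B) * indicator (cbox a b) t" for t y
    proof -
      have "cmod (iter_partial ks (\<lambda>y. H t y * ch \<xi> y) y) \<le> 2 ^ length ks * (B * indicator (cbox a b) t) * jb \<xi> ^ length ks"
      proof (rule iter_partial_mult_bound[OF smH smooth_ch]; intro allI impI)
        show "cmod (iter_partial js (H t) y) \<le> B * indicator (cbox a b) t" if "length js \<le> length ks" for js
          unfolding itH using B(2)[rule_format, OF that] by (simp add: norm_mult indicator_def)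
        show "cmod (iter_partial js (ch \<xi>) y) \<le> jb \<xi> ^ length ks" if "length js \<le> length ks" for js
          by (rule norm_iter_partial_ch_le[OF that])
      qed
      then show ?thesis unfolding G_def by (simp add: mult_ac)
    qed
    then show ?thesis using iQ[of "2 ^ length ks * (jb \<xi> ^ length ks) * B"] by blast
  qed
  have smGI: "smooth (\<lambda>y. \<integral>t. G t y \<partial>lborel)" unfolding GI by (intro smooth_mult smm smooth_ch)
  note P = distribution_parameter_integral[OF f X \<kappa> smG meas bG smGI]
  have S: "indicator (cbox a b) t *\<^sub>R stft w (dmult \<kappa> f) t \<xi> = fc TYPE('d) * f (\<lambda>y. \<kappa> y * G t y)" for t
  proof -
    have "(\<lambda>y. \<kappa> y * G t y) = (\<lambda>y. complex_of_real (indicator (cbox a b) t) * (\<kappa> y * (cnj (w (y - t)) * ch \<xi> y)))"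
      by (simp add: G_def H fun_eq_iff mult_ac)
    moreover have "f \<dots> = complex_of_real (indicator (cbox a b) t) * f (\<lambda>y. \<kappa> y * (cnj (w (y - t)) * ch \<xi> y))"
      by (rule distribution_scale[OF f tf_mult[OF \<kappa> smooth_mult[OF smw smooth_ch]]])
    ultimately show ?thesis unfolding stft_dmult[OF f X \<kappa> sw] by (simp add: scaleR_conv_of_real mult_ac)
  qed
  show "integrable lborel (\<lambda>t. indicator (cbox a b) t *\<^sub>R stft w (dmult \<kappa> f) t \<xi>)"
    unfolding S by (intro integrable_mult_right P(1))
  show "fc TYPE('d) * f (\<lambda>y. \<kappa> y * m y * ch \<xi> y) = (\<integral>t. indicator (cbox a b) t *\<^sub>R stft w (dmult \<kappa> f) t \<xi> \<partial>lborel)"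
    unfolding S integral_mult_right_zero P(2)[symmetric] GI mult.assoc by (rule refl)
qed

subsection \<open>Weights\<close>

lemma polynomial_growth:
  assumes "real_polynomial_function v"
  shows "\<exists>C N. C \<ge> 0 \<and> (\<forall>x. \<bar>v x\<bar> \<le> C * jb x ^ N)"
  using assms
proof (induction rule: real_polynomial_function.induct)
  case (linear f)
  interpret bounded_linear f by fact
  obtain K where K: "\<And>x. norm (f x) \<le> norm x * K" "K \<ge> 0" using nonneg_bounded by blast
  have "\<bar>f x\<bar> \<le> K * jb x ^ 1" for x
  proof -
    have "norm x * K \<le> jb x * K" using K(2) by (intro mult_right_mono) (auto simp: jb_def)
    then show ?thesis using K(1)[of x] by (simp add: mult.commute)
  qed
  then show ?case using K(2) by blast
next
  case (const c)
  have "\<bar>c\<bar> \<le> \<bar>c\<bar> * jb x ^ 0" for x :: 'a by simp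
  then show ?case using abs_ge_zero by blast
next
  case (add f g)
  then obtain C N D M where f: "C \<ge> 0" "\<forall>x. \<bar>f x\<bar> \<le> C * jb x ^ N" and g: "D \<ge> 0" "\<forall>x. \<bar>g x\<bar> \<le> D * jb x ^ M" by blast
  have "\<bar>f x + g x\<bar> \<le> (C + D) * jb x ^ (N + M)" for x
  proof -
    have "C * jb x ^ N \<le> C * jb x ^ (N + M)" "D * jb x ^ M \<le> D * jb x ^ (N + M)"
      using f g by (auto intro!: mult_left_mono power_increasing)
    then show ?thesis using f(2)[rule_format, of x] g(2)[rule_format, of x] by (simp add: distrib_right)
  qed
  then show ?case using f(1) g(1) add_nonneg_nonneg by blast
next
  case (mult f g)
  then obtain C N D M where f: "C \<ge> 0" "\<forall>x. \<bar>f x\<bar> \<le> C * jb x ^ N" and g: "D \<ge> 0" "\<forall>x. \<bar>g x\<bar> \<le> D * jb x ^ M" by blast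
  have "\<bar>f x * g x\<bar> \<le> (C * D) * jb x ^ (N + M)" for x
  proof -
    have "\<bar>f x\<bar> * \<bar>g x\<bar> \<le> (C * jb x ^ N) * (D * jb x ^ M)"
      using f g by (intro mult_mono) auto
    then show ?thesis by (simp add: abs_mult power_add mult_ac)
  qed
  then show ?case using f(1) g(1) mult_nonneg_nonneg by blast
qed

lemma borel_measurable_lebesgue_AE:
  fixes g g' :: "'a::euclidean_space \<Rightarrow> real"
  assumes "g' \<in> borel_measurable lborel" "AE x in lborel. g x = g' x"
  shows "g \<in> borel_measurable lebesgue"
proof (rule borel_measurableI_greater)
  fix y
  obtain N where N: "N \<in> null_sets lborel" "{x \<in> space lborel. g x \<noteq> g' x} \<subseteq> N"
    using assms(2) by (auto elim!: AE_E simp: null_sets_def)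
  have "{x \<in> space lebesgue. y < g x} = ({x \<in> space lborel. y < g' x} - N) \<union> ({x. y < g x} \<inter> N)"
  proof -
    have eq: "g x = g' x" if "x \<notin> N" for x using N(2) that by auto
    show ?thesis
    proof (rule set_eqI)
      fix x show "x \<in> {x \<in> space lebesgue. y < g x} \<longleftrightarrow> x \<in> ({x \<in> space lborel. y < g' x} - N) \<union> ({x. y < g x} \<inter> N)"
        using eq[of x] by (cases "x \<in> N") auto
    qed
  qed
  moreover have "{x \<in> space lborel. y < g' x} \<in> sets lborel" using assms(1) by measurable
  then have "{x \<in> space lborel. y < g' x} - N \<in> sets lebesgue"
    using N(1) by (intro sets.Diff sets_completionI_sets) auto
  moreover have "{x. y < g x} \<inter> N \<in> sets lebesgue"
    using null_sets_completion_subset[of "{x. y < g x} \<inter> N" N lborel] null_sets_completionI[OF N(1)] by auto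
  ultimately show "{x \<in> space lebesgue. y < g x} \<in> sets lebesgue" by (simp only: sets.Un)
qed

text \<open>Slices of a Borel representative of \<Omega> are Borel, and for almost every x the slice
  agrees almost everywhere with \<omega>.\<close>

lemma weight_measurable:
  fixes \<Omega> :: "'a::euclidean_space \<times> 'a \<Rightarrow> real"
  assumes "\<Omega> \<in> borel_measurable lebesgue" "\<And>x \<xi>. \<Omega> (x, \<xi>) = \<omega> \<xi>"
  shows "\<omega> \<in> borel_measurable lebesgue"
proof -
  obtain g where g: "g \<in> borel_measurable lborel" "AE p in lborel. \<Omega> p = g p"
    using completion_ex_borel_measurable_real[OF assms(1)] by blast
  have "AE p in (lborel \<Otimes>\<^sub>M lborel). \<Omega> p = g p" using g(2) unfolding lborel_prod .
  then have "AE x in lborel. AE \<xi> in lborel. \<Omega> (x, \<xi>) = g (x, \<xi>)" by (rule lborel_pair.AE_pair)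
  moreover have "ae_filter (lborel :: 'a measure) \<noteq> bot" by (simp add: ae_filter_eq_bot_iff)
  \<comment> \<open>Almost all slices are good and Lebesgue measure is not zero, so a good slice
    exists; every slice of \<Omega> equals \<omega>.\<close>
  ultimately obtain x where x: "AE \<xi> in lborel. \<Omega> (x, \<xi>) = g (x, \<xi>)" using eventually_happens by blast
  have "(\<lambda>\<xi>. g (x, \<xi>)) \<in> borel_measurable lborel"
    by (rule measurable_compose[of "\<lambda>\<xi>. (x, \<xi>)" lborel "borel"]) (use g(1) in \<open>simp_all add: borel_prod[symmetric]\<close>)
  then show ?thesis using x by (intro borel_measurable_lebesgue_AE) (simp_all add: assms(2))
qed

text \<open>Split \<xi> as \<eta> + (\<xi> - \<eta>) in the second variable and bound the polynomial
  by a power of \<open>jb\<close>. The constant is enlarged by 1 to be positive.\<close>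

lemma weight_moderate:
  fixes \<Omega> :: "'a::euclidean_space \<times> 'a \<Rightarrow> real"
  assumes "\<Omega> \<in> moderate_weights" "\<And>x \<xi>. \<Omega> (x, \<xi>) = \<omega> \<xi>"
  obtains C M where "\<And>\<xi>. 0 < \<omega> \<xi>" "C > 0" "\<And>\<xi> \<eta>. \<omega> \<xi> \<le> C * jb (\<xi> - \<eta>) ^ M * \<omega> \<eta>" "\<omega> \<in> borel_measurable lebesgue"
proof -
  obtain v C where m: "\<Omega> \<in> borel_measurable lebesgue" and pos: "\<forall>x. 0 < \<Omega> x" and v: "real_polynomial_function v" "\<forall>x. 0 < v x"
    and le: "\<forall>x y. \<Omega> (x + y) \<le> C * \<Omega> x * v y" using assms(1) unfolding moderate_weights_def by blast
  have p: "0 < \<omega> \<xi>" for \<xi> using pos[rule_format, of "(0, \<xi>)"] assms(2) by simp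
  obtain D M where D: "D \<ge> 0" "\<forall>x. \<bar>v x\<bar> \<le> D * jb x ^ M" using polynomial_growth[OF v(1)] by blast
  have "\<omega> \<xi> \<le> (\<bar>C\<bar> * D + 1) * jb (\<xi> - \<eta>) ^ M * \<omega> \<eta>" for \<xi> \<eta>
  proof -
    have "\<omega> \<xi> \<le> C * \<omega> \<eta> * v (0, \<xi> - \<eta>)"
      using le[rule_format, of "(0, \<eta>)" "(0, \<xi> - \<eta>)"] assms(2) by simp
    also have "\<dots> \<le> \<bar>C\<bar> * \<omega> \<eta> * \<bar>v (0, \<xi> - \<eta>)\<bar>"
      using p[of \<eta>] by (metis abs_ge_self abs_mult abs_of_pos)
    also have "\<dots> \<le> \<bar>C\<bar> * \<omega> \<eta> * (D * jb (0 :: 'a, \<xi> - \<eta>) ^ M)"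
      using D(2) p[of \<eta>] by (intro mult_left_mono) auto
    also have "jb (0 :: 'a, \<xi> - \<eta>) = jb (\<xi> - \<eta>)" by (simp add: jb_def norm_Pair)
    also have "\<bar>C\<bar> * \<omega> \<eta> * (D * jb (\<xi> - \<eta>) ^ M) \<le> (\<bar>C\<bar> * D + 1) * jb (\<xi> - \<eta>) ^ M * \<omega> \<eta>"
      using p[of \<eta>] by (simp add: algebra_simps)
    finally show ?thesis .
  qed
  moreover have "\<bar>C\<bar> * D + 1 > 0" using D(1) by (simp add: add_nonneg_pos)
  ultimately show ?thesis using that[OF p] weight_measurable[OF m assms(2)] by blast
qed

subsection \<open>Finiteness of norms\<close>

lemma ennreal_powr_ennreal: "0 \<le> a \<Longrightarrow> ennreal_powr (ennreal a) r = ennreal (a powr r)"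
  by (simp add: ennreal_powr_def)

lemma ennreal_powr_mono:
  assumes "a \<le> b" "0 \<le> r" shows "ennreal_powr a r \<le> ennreal_powr b r"
proof (cases "b = \<infinity>")
  case False
  then have "b < \<infinity>" by (simp add: less_top)
  then have "a < \<infinity>" "b < \<infinity>" using assms(1) by auto
  then show ?thesis using assms unfolding ennreal_powr_def
    by (auto intro!: ennreal_leI powr_mono2 enn2real_mono simp: less_top)
qed (simp add: ennreal_powr_def)

lemma ennreal_powr_less_top: "ennreal_powr a r < \<infinity> \<longleftrightarrow> a < \<infinity>"
  by (auto simp: ennreal_powr_def less_top)

lemma Lp_norm_less_top:
  "Lp_norm M q u < \<infinity> \<longleftrightarrow> (if q = \<infinity> then esssup M u < \<infinity> else (\<integral>\<^sup>+x. ennreal_powr (u x) (enn2real q) \<partial>M) < \<infinity>)"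
  unfolding Lp_norm_def using ennreal_powr_less_top by auto

lemma Lp_norm_mono:
  assumes "u \<in> borel_measurable M" "\<And>x. x \<in> space M \<Longrightarrow> u x \<le> v x" "Lp_norm M q v < \<infinity>"
  shows "Lp_norm M q u < \<infinity>"
proof (cases "q = \<infinity>")
  case True
  have v: "esssup M v < \<infinity>" using assms(3) unfolding Lp_norm_less_top if_P[OF True] .
  have "esssup M u \<le> esssup M v"
  proof (rule esssup_I[OF assms(1)])
    show "AE x in M. u x \<le> esssup M v"
      using esssup_AE[of v M] AE_space by eventually_elim (use assms(2) order_trans in blast)
  qed
  then have "esssup M u < \<infinity>" using v by (rule order_le_less_trans)
  then show ?thesis unfolding Lp_norm_less_top if_P[OF True] .
next
  case False
  have "(\<integral>\<^sup>+x. ennreal_powr (u x) (enn2real q) \<partial>M) \<le> (\<integral>\<^sup>+x. ennreal_powr (v x) (enn2real q) \<partial>M)"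
    by (intro nn_integral_mono ennreal_powr_mono assms(2)) auto
  also have "\<dots> < \<infinity>" using assms(3) unfolding Lp_norm_less_top if_not_P[OF False] .
  finally show ?thesis unfolding Lp_norm_less_top if_not_P[OF False] .
qed

lemma Lp_norm_count_space:
  assumes "\<And>k. k \<in> S \<Longrightarrow> 0 \<le> a k"
  shows "Lp_norm (count_space S) q (\<lambda>k. ennreal (a k)) < \<infinity> \<longleftrightarrow>
    (if q = \<infinity> then \<exists>B\<ge>0. \<forall>k\<in>S. a k \<le> B else (\<integral>\<^sup>+k. ennreal (a k powr enn2real q) \<partial>count_space S) < \<infinity>)"
proof (cases "q = \<infinity>")
  case True
  have "esssup (count_space S) (\<lambda>k. ennreal (a k)) < \<infinity> \<longleftrightarrow> (\<exists>B\<ge>0. \<forall>k\<in>S. a k \<le> B)"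
  proof
    assume *: "esssup (count_space S) (\<lambda>k. ennreal (a k)) < \<infinity>"
    then obtain B where B: "esssup (count_space S) (\<lambda>k. ennreal (a k)) = ennreal B" "B \<ge> 0" by (auto simp: less_top_ennreal)
    have "AE k in count_space S. ennreal (a k) \<le> ennreal B" using esssup_AE[where M = "count_space S" and f = "\<lambda>k. ennreal (a k)"] unfolding B(1) .
    then have "\<forall>k\<in>S. a k \<le> B" using B(2) by (simp add: AE_count_space ennreal_le_iff)
    then show "\<exists>B\<ge>0. \<forall>k\<in>S. a k \<le> B" using B(2) by blast
  next
    assume "\<exists>B\<ge>0. \<forall>k\<in>S. a k \<le> B"
    then obtain B where B: "\<forall>k\<in>S. a k \<le> B" by blast
    have "esssup (count_space S) (\<lambda>k. ennreal (a k)) \<le> ennreal B"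
      using B by (intro esssup_I) (auto simp: AE_count_space intro: ennreal_leI)
    also have "\<dots> < \<infinity>" by simp
    finally show "esssup (count_space S) (\<lambda>k. ennreal (a k)) < \<infinity>" .
  qed
  then show ?thesis unfolding Lp_norm_less_top if_P[OF True] .
next
  case False
  have "(\<integral>\<^sup>+k. ennreal_powr (ennreal (a k)) (enn2real q) \<partial>count_space S) = (\<integral>\<^sup>+k. ennreal (a k powr enn2real q) \<partial>count_space S)"
    using assms by (intro nn_integral_cong) (simp add: ennreal_powr_ennreal)
  then show ?thesis unfolding Lp_norm_less_top if_not_P[OF False] by (simp only:)
qed

lemma enn2real_ge_1:
  assumes "1 \<le> q" "q \<noteq> \<infinity>" shows "1 \<le> enn2real q"
  using assms by (cases q) (auto simp flip: ennreal_1)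

text \<open>Instead of Young's inequality: one factor \<open>\<langle>\<xi> - k\<rangle>\<^sup>-\<^sup>N\<close> turns the sum into a supremum, and the
  \<open>q\<close>-th power of a supremum is bounded by the sum of the \<open>q\<close>-th powers.\<close>

lemma amalgam_finite:
  fixes S :: "'a::euclidean_space set" and a :: "'a \<Rightarrow> real"
  defines "N \<equiv> DIM('a) + 2"
  assumes S: "separated S" and a: "\<And>k. 0 \<le> a k" and fin: "Lp_norm (count_space S) q (\<lambda>k. ennreal (a k)) < \<infinity>"
    and q: "1 \<le> q" and mM: "\<And>k. k \<in> S \<Longrightarrow> (\<lambda>\<xi>. ennreal (1 / jb (\<xi> - k) ^ N)) \<in> borel_measurable M"
    and D: "\<And>k. k \<in> S \<Longrightarrow> (\<integral>\<^sup>+\<xi>. ennreal (1 / jb (\<xi> - k) ^ N) \<partial>M) \<le> ennreal D"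
    and mu: "u \<in> borel_measurable M"
    and u: "\<And>\<xi>. \<xi> \<in> space M \<Longrightarrow> u \<xi> \<le> ennreal K * (\<integral>\<^sup>+k. ennreal (a k / jb (\<xi> - k) ^ (2 * N)) \<partial>count_space S)"
  shows "Lp_norm M q u < \<infinity>"
proof -
  have cS: "countable S" using S by (simp add: separated_def)
  obtain C where C: "C \<ge> 0" "\<And>\<xi> n. DIM('a) + 2 \<le> n \<Longrightarrow> (\<integral>\<^sup>+k. ennreal (1 / jb (\<xi> - k) ^ n) \<partial>count_space S) \<le> ennreal C"
    using separated_sum[OF S] by metis
  \<comment> \<open>Both constants are raised to at least 1, which keeps the power of
    \<open>K'\<close> nonzero when it multiplies an infinite sum.\<close>
  define K' where "K' = max K 1 * max C 1"
  have K': "K' \<ge> 1" unfolding K'_def using mult_mono[of 1 "max K 1" 1 "max C 1"] by simp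
  have bound: "u \<xi> \<le> ennreal (K' * t)" if \<xi>: "\<xi> \<in> space M" and t: "t \<ge> 0" "\<And>k. k \<in> S \<Longrightarrow> a k / jb (\<xi> - k) ^ N \<le> t" for \<xi> t
  proof -
    have "(\<integral>\<^sup>+k. ennreal (a k / jb (\<xi> - k) ^ (2 * N)) \<partial>count_space S) \<le> (\<integral>\<^sup>+k. ennreal t * ennreal (1 / jb (\<xi> - k) ^ N) \<partial>count_space S)"
    proof (intro nn_integral_mono)
      fix k assume "k \<in> space (count_space S)"
      then have "a k / jb (\<xi> - k) ^ N * (1 / jb (\<xi> - k) ^ N) \<le> t * (1 / jb (\<xi> - k) ^ N)"
        using t by (intro mult_right_mono) auto
      then show "ennreal (a k / jb (\<xi> - k) ^ (2 * N)) \<le> ennreal t * ennreal (1 / jb (\<xi> - k) ^ N)"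
        using t(1) by (subst ennreal_mult[symmetric]) (auto intro!: ennreal_leI simp: mult_2 power_add)
    qed
    also have "\<dots> = ennreal t * (\<integral>\<^sup>+k. ennreal (1 / jb (\<xi> - k) ^ N) \<partial>count_space S)" by (rule nn_integral_cmult) simp
    also have "\<dots> \<le> ennreal t * ennreal C" by (intro mult_left_mono C(2)) (simp_all add: N_def)
    finally have "u \<xi> \<le> ennreal K * (ennreal t * ennreal C)"
      using u[OF \<xi>] by (meson mult_left_mono order_trans zero_le)
    also have "\<dots> \<le> ennreal (max K 1) * (ennreal t * ennreal (max C 1))"
      by (intro mult_mono ennreal_leI) auto
    also have "\<dots> = ennreal (K' * t)" using t(1) unfolding K'_def by (simp add: ennreal_mult[symmetric] mult_ac)
    finally show ?thesis .
  qed
  show ?thesis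
  proof (cases "q = \<infinity>")
    case True
    obtain B where B: "B \<ge> 0" "\<forall>k\<in>S. a k \<le> B" using fin True Lp_norm_count_space[of S a q] a by auto
    have "u \<xi> \<le> ennreal (K' * B)" if "\<xi> \<in> space M" for \<xi>
    proof (rule bound[OF that B(1)])
      fix k assume "k \<in> S"
      have "a k / jb (\<xi> - k) ^ N \<le> a k / 1" using a by (intro divide_left_mono one_le_power) auto
      then show "a k / jb (\<xi> - k) ^ N \<le> B" using B(2) \<open>k \<in> S\<close> by auto
    qed
    then have "esssup M u \<le> ennreal (K' * B)" by (intro esssup_I[OF mu] AE_I2)
    also have "\<dots> < \<infinity>" by simp
    finally show ?thesis unfolding Lp_norm_less_top if_P[OF True] .
  next
    case False
    define r where "r = enn2real q"
    have r: "r \<ge> 1" unfolding r_def by (rule enn2real_ge_1[OF q False])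
    have afin: "(\<integral>\<^sup>+k. ennreal (a k powr r) \<partial>count_space S) < \<infinity>"
      using fin False Lp_norm_count_space[of S a q] a unfolding r_def by auto
    \<comment> \<open>The sum of q-th powers that replaces the q-th power of the supremum; its
      integral in \<xi> is computed term by term.\<close>
    define P where "P \<xi> = (\<integral>\<^sup>+k. ennreal (a k powr r) * ennreal (1 / jb (\<xi> - k) ^ N) \<partial>count_space S)" for \<xi>
    have le: "ennreal_powr (u \<xi>) r \<le> ennreal (K' powr r) * P \<xi>" if \<xi>: "\<xi> \<in> space M" for \<xi>
    proof (cases "P \<xi> = \<infinity>")
      case True
      have "ennreal (K' powr r) \<noteq> 0" using K' by simp
      then show ?thesis using True by (simp add: ennreal_mult_top)
    next
      case False
      then obtain p where p: "P \<xi> = ennreal p" "p \<ge> 0" by (cases "P \<xi>") auto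
      have "u \<xi> \<le> ennreal (K' * p powr (1 / r))"
      proof (rule bound[OF \<xi>])
        fix k assume k: "k \<in> S"
        have "ennreal (a k powr r) * ennreal (1 / jb (\<xi> - k) ^ N) \<le> P \<xi>"
          unfolding P_def by (rule nn_integral_ge_point[OF k])
        then have 1: "a k powr r * (1 / jb (\<xi> - k) ^ N) \<le> p"
          unfolding p(1) using p(2) by (simp add: ennreal_mult[symmetric] ennreal_le_iff)
        define s where "s = 1 / jb (\<xi> - k) ^ N"
        have s: "0 < s" "s \<le> 1" unfolding s_def by (auto intro!: one_le_power)
        have "(a k * s) powr r = a k powr r * s powr r" by (rule powr_mult)
        \<comment> \<open>Raising s <= 1 to a power r >= 1 only decreases it, so one factor of decay
          survives for every exponent q.\<close>
        also have "\<dots> \<le> a k powr r * s powr 1" using s r by (intro mult_left_mono powr_mono') auto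
        also have "\<dots> \<le> p" using 1 s by (simp add: s_def)
        finally have "((a k * s) powr r) powr (1 / r) \<le> p powr (1 / r)" using r by (intro powr_mono2) auto
        then show "a k / jb (\<xi> - k) ^ N \<le> p powr (1 / r)"
          using r a[of k] s by (simp add: powr_powr s_def)
      qed simp
      then have "ennreal_powr (u \<xi>) r \<le> ennreal_powr (ennreal (K' * p powr (1 / r))) r"
        using r by (intro ennreal_powr_mono) auto
      also have "\<dots> = ennreal ((K' * p powr (1 / r)) powr r)" using K' by (intro ennreal_powr_ennreal) auto
      also have "(K' * p powr (1 / r)) powr r = K' powr r * p"
        using K' p(2) r by (simp add: powr_mult powr_powr)
      finally show ?thesis using p by (simp add: ennreal_mult)
    qed
    have "(\<integral>\<^sup>+\<xi>. ennreal_powr (u \<xi>) r \<partial>M) \<le> (\<integral>\<^sup>+\<xi>. ennreal (K' powr r) * P \<xi> \<partial>M)"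
      by (intro nn_integral_mono le)
    also have "\<dots> = (\<integral>\<^sup>+\<xi>. \<integral>\<^sup>+k. ennreal (K' powr r) * (ennreal (a k powr r) * ennreal (1 / jb (\<xi> - k) ^ N)) \<partial>count_space S \<partial>M)"
      unfolding P_def by (intro nn_integral_cong nn_integral_cmult[symmetric]) simp
    also have "\<dots> = (\<integral>\<^sup>+k. \<integral>\<^sup>+\<xi>. ennreal (K' powr r) * (ennreal (a k powr r) * ennreal (1 / jb (\<xi> - k) ^ N)) \<partial>M \<partial>count_space S)"
      by (rule nn_integral_count_space_nn_integral[OF cS]) (intro borel_measurable_times_ennreal borel_measurable_const mM)
    also have "\<dots> \<le> (\<integral>\<^sup>+k. (ennreal (K' powr r) * ennreal D) * ennreal (a k powr r) \<partial>count_space S)"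
    proof (intro nn_integral_mono)
      fix k assume "k \<in> space (count_space S)"
      then have k: "k \<in> S" by simp
      have "(\<integral>\<^sup>+\<xi>. ennreal (K' powr r) * (ennreal (a k powr r) * ennreal (1 / jb (\<xi> - k) ^ N)) \<partial>M)
          = (ennreal (K' powr r) * ennreal (a k powr r)) * (\<integral>\<^sup>+\<xi>. ennreal (1 / jb (\<xi> - k) ^ N) \<partial>M)"
        unfolding mult.assoc[symmetric] by (rule nn_integral_cmult[OF mM[OF k]])
      also have "\<dots> \<le> (ennreal (K' powr r) * ennreal (a k powr r)) * ennreal D"
        by (intro mult_left_mono D[OF k]) simp
      finally show "(\<integral>\<^sup>+\<xi>. ennreal (K' powr r) * (ennreal (a k powr r) * ennreal (1 / jb (\<xi> - k) ^ N)) \<partial>M)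
          \<le> (ennreal (K' powr r) * ennreal D) * ennreal (a k powr r)" by (simp only: mult_ac)
    qed
    also have "\<dots> = (ennreal (K' powr r) * ennreal D) * (\<integral>\<^sup>+k. ennreal (a k powr r) \<partial>count_space S)"
      by (rule nn_integral_cmult) simp
    also have "\<dots> < \<infinity>" using afin by (simp add: ennreal_mult_less_top)
    finally show ?thesis unfolding Lp_norm_less_top if_not_P[OF False] r_def .
  qed
qed

subsection \<open>Regularity at a point and a direction\<close>

text \<open>\<Gamma> contains a ball of radius d about the unit direction of \<xi>0, and the
  narrower cone consists of the directions within d/2. If |\<xi> - k| were below (d/2) |\<xi>| for
  such \<xi>, then k/|\<xi>| would fall into that ball and k into \<Gamma>.\<close>

lemma open_cone_shrink:
  fixes \<Gamma> :: "(real^'d) set"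
  assumes \<Gamma>: "open_cone \<Gamma>" "\<xi>0 \<in> \<Gamma>"
  shows "\<exists>\<Gamma>1 c. open_cone \<Gamma>1 \<and> \<xi>0 \<in> \<Gamma>1 \<and> c > 0 \<and> (\<forall>\<xi>\<in>\<Gamma>1. \<forall>k. k \<notin> \<Gamma> \<longrightarrow> c * norm \<xi> \<le> norm (\<xi> - k))"
proof -
  have o: "open \<Gamma>" "0 \<notin> \<Gamma>" and sc: "\<And>\<xi> t. \<xi> \<in> \<Gamma> \<Longrightarrow> t > 0 \<Longrightarrow> t *\<^sub>R \<xi> \<in> \<Gamma>"
    using \<Gamma>(1) unfolding open_cone_def by blast+
  have \<xi>0: "\<xi>0 \<noteq> 0" using \<Gamma>(2) o(2) by blast
  have "sgn \<xi>0 \<in> \<Gamma>" unfolding sgn_div_norm using \<xi>0 by (intro sc \<Gamma>) simp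
  then obtain d where d: "d > 0" "ball (sgn \<xi>0) d \<subseteq> \<Gamma>" using o(1) openE by blast
  define r where "r = d / 2"
  have r: "r > 0" using d by (simp add: r_def)
  define \<Gamma>1 where "\<Gamma>1 = - {0} \<inter> sgn -` ball (sgn \<xi>0) r"
  have "continuous_on (- {0}) (sgn :: real^'d \<Rightarrow> real^'d)"
    unfolding sgn_div_norm[abs_def] by (intro continuous_intros) auto
  then have "open \<Gamma>1" unfolding \<Gamma>1_def by (intro continuous_open_preimage) auto
  moreover have "t *\<^sub>R \<xi> \<in> \<Gamma>1" if "\<xi> \<in> \<Gamma>1" "t > 0" for \<xi> t
    using that by (auto simp: \<Gamma>1_def sgn_scaleR)
  ultimately have c: "open_cone \<Gamma>1" unfolding open_cone_def by (auto simp: \<Gamma>1_def)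
  have "r * norm \<xi> \<le> norm (\<xi> - k)" if \<xi>: "\<xi> \<in> \<Gamma>1" and k: "k \<notin> \<Gamma>" for \<xi> k
  proof (rule ccontr)
    assume "\<not> r * norm \<xi> \<le> norm (\<xi> - k)"
    then have lt: "norm (\<xi> - k) < r * norm \<xi>" by simp
    have n: "norm \<xi> > 0" and s: "norm (sgn \<xi>0 - sgn \<xi>) < r" using \<xi> by (auto simp: \<Gamma>1_def dist_norm)
    have "sgn \<xi>0 - (1 / norm \<xi>) *\<^sub>R k = (sgn \<xi>0 - sgn \<xi>) + (1 / norm \<xi>) *\<^sub>R (\<xi> - k)"
      by (simp add: sgn_div_norm scaleR_diff_right inverse_eq_divide)
    then have "norm (sgn \<xi>0 - (1 / norm \<xi>) *\<^sub>R k) \<le> norm (sgn \<xi>0 - sgn \<xi>) + norm ((1 / norm \<xi>) *\<^sub>R (\<xi> - k))"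
      using norm_triangle_ineq by metis
    also have "norm ((1 / norm \<xi>) *\<^sub>R (\<xi> - k)) < r" using lt n by (simp add: pos_divide_less_eq)
    finally have "norm (sgn \<xi>0 - (1 / norm \<xi>) *\<^sub>R k) < d" using s by (simp add: r_def)
    then have "(1 / norm \<xi>) *\<^sub>R k \<in> \<Gamma>" using d(2) by (auto simp: dist_norm)
    then have "norm \<xi> *\<^sub>R ((1 / norm \<xi>) *\<^sub>R k) \<in> \<Gamma>" using n by (rule sc)
    then show False using n k by simp
  qed
  moreover have "\<xi>0 \<in> \<Gamma>1" using \<xi>0 r by (simp add: \<Gamma>1_def)
  ultimately show ?thesis using c r by blast
qed

text \<open>The reconstruction property common to Fourier series on a parallelepiped and to Gabor
  expansions. The functions \<open>\<alpha> j\<close> may depend on the cut-off \<kappa> but not on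
  m. Applying a distribution expresses its value at \<kappa> m through its values at
  \<open>\<psi> j\<close> times \<open>ch k\<close>.\<close>

definition expands ::
  "(real^'d) set \<Rightarrow> (real^'d) set \<Rightarrow> 'j set \<Rightarrow> ('j \<Rightarrow> real^'d \<Rightarrow> complex) \<Rightarrow> bool" where
  "expands U S J \<psi> \<longleftrightarrow> (\<forall>\<kappa>\<in>test_functions U. \<exists>\<alpha>. (\<forall>j\<in>J. \<alpha> j \<in> test_functions UNIV) \<and>
     (\<forall>m. smooth m \<longrightarrow> (\<lambda>x. \<kappa> x * m x) =
       (\<lambda>x. \<Sum>j\<in>J. \<psi> j x * (\<integral>k. (\<integral>y. \<alpha> j y * m y * ch (- k) y \<partial>lborel) * ch k x \<partial>count_space S))))"

text \<open>The common core of the four conditions. S may be any separated set, so that shifted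
  lattices are included, and the indices of the windows are points of R^d so that Gabor translates
  can index themselves.\<close>

definition locally_regular ::
  "((real^'d \<Rightarrow> complex) \<Rightarrow> complex) \<Rightarrow> (real^'d) set \<Rightarrow> ennreal \<Rightarrow> (real^'d \<Rightarrow> real) \<Rightarrow> real^'d \<Rightarrow> real^'d \<Rightarrow> bool" where
  "locally_regular f X q \<omega> x0 \<xi>0 \<longleftrightarrow>
     (\<exists>U S (J :: (real^'d) set) \<psi> \<Gamma>. open U \<and> x0 \<in> U \<and> U \<subseteq> X \<and> separated S \<and> finite J \<and>
        (\<forall>j\<in>J. \<psi> j \<in> test_functions X) \<and> expands U S J \<psi> \<and> open_cone \<Gamma> \<and> \<xi>0 \<in> \<Gamma> \<and>
        Lp_norm (count_space (\<Gamma> \<inter> S)) q (\<lambda>k. ennreal ((\<Sum>j\<in>J. cmod (f (\<lambda>x. \<psi> j x * ch k x))) * \<omega> k)) < \<infinity>)"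

lemma inverse_jb_le_1: "1 / jb x ^ n \<le> 1"
  using one_le_power[OF jb_ge_1, of x n] by simp

text \<open>The power \<open>jb k ^ -(d + 2)\<close> is bounded by 1 and summable over S, so it lies
  in l^q for every q. Inserting it outside the cone extends q-summability from the cone to all of
  S.\<close>

lemma Lp_norm_split_decay:
  fixes S :: "(real^'d) set"
  assumes S: "separated S" and q: "1 \<le> q" and A: "\<And>k. 0 \<le> A k"
    and fin: "Lp_norm (count_space (\<Gamma> \<inter> S)) q (\<lambda>k. ennreal (A k)) < \<infinity>"
  defines "a \<equiv> \<lambda>k. if k \<in> \<Gamma> then A k else 1 / jb k ^ (CARD('d) + 2)"
  shows "Lp_norm (count_space S) q (\<lambda>k. ennreal (a k)) < \<infinity>"
proof (cases "q = \<infinity>")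
  case True
  then obtain B where B: "B \<ge> 0" "\<forall>k\<in>\<Gamma> \<inter> S. A k \<le> B"
    using fin Lp_norm_count_space[of "\<Gamma> \<inter> S" A q] A by auto
  have "a k \<le> max B 1" if "k \<in> S" for k
  proof (cases "k \<in> \<Gamma>")
    case False
    have "1 / jb k ^ (CARD('d) + 2) \<le> max B 1" using inverse_jb_le_1[of k "CARD('d) + 2"] by linarith
    then show ?thesis using False unfolding a_def by (simp only: if_False)
  next
    case True
    then have "A k \<le> B" using B(2) that by blast
    then show ?thesis using True by (simp add: a_def)
  qed
  moreover have "0 \<le> max B 1" by simp
  ultimately have "\<exists>B\<ge>0. \<forall>k\<in>S. a k \<le> B" by blast
  moreover have "0 \<le> a k" for k unfolding a_def using A by simp
  ultimately show ?thesis using Lp_norm_count_space[of S a q] True by simp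
next
  case False
  define r where "r = enn2real q"
  have r: "1 \<le> r" unfolding r_def by (rule enn2real_ge_1[OF q False])
  have a0: "0 \<le> a k" for k unfolding a_def using A by simp
  have 1: "(\<integral>\<^sup>+k. ennreal (A k powr r) \<partial>count_space (\<Gamma> \<inter> S)) < \<infinity>"
    using fin Lp_norm_count_space[of "\<Gamma> \<inter> S" A q] A False unfolding r_def by auto
  obtain C where C: "C \<ge> 0" "\<And>\<xi> N. DIM(real^'d) + 2 \<le> N \<Longrightarrow> (\<integral>\<^sup>+k. ennreal (1 / jb (\<xi> - k) ^ N) \<partial>count_space S) \<le> ennreal C"
    using separated_sum[OF S] by metis
  have 2: "(\<integral>\<^sup>+k. ennreal (1 / jb k ^ (CARD('d) + 2)) \<partial>count_space S) < \<infinity>"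
  proof -
    have "(\<integral>\<^sup>+k. ennreal (1 / jb k ^ (CARD('d) + 2)) \<partial>count_space S) \<le> ennreal C"
      using C(2)[of "CARD('d) + 2" 0] by (simp add: jb_minus)
    also have "\<dots> < \<infinity>" by simp
    finally show ?thesis .
  qed
  have "(\<integral>\<^sup>+k. ennreal (a k powr r) \<partial>count_space S) \<le>
      (\<integral>\<^sup>+k. ennreal (A k powr r) * indicator \<Gamma> k + ennreal (1 / jb k ^ (CARD('d) + 2)) \<partial>count_space S)"
  proof (intro nn_integral_mono)
    fix k
    show "ennreal (a k powr r) \<le> ennreal (A k powr r) * indicator \<Gamma> k + ennreal (1 / jb k ^ (CARD('d) + 2))"
    proof (cases "k \<in> \<Gamma>")
      case False
      have "(1 / jb k ^ (CARD('d) + 2)) powr r \<le> (1 / jb k ^ (CARD('d) + 2)) powr 1"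
        by (rule powr_mono'[OF r _ inverse_jb_le_1]) simp
      then have "ennreal (a k powr r) \<le> ennreal (1 / jb k ^ (CARD('d) + 2))"
        using False unfolding a_def by (intro ennreal_leI) (simp only: if_False powr_one zero_le_divide_1_iff zero_le_power jb_nonneg)
      then show ?thesis by (simp only: indicator_simps(2)[OF False] mult_zero_right add_0_left)
    qed (simp add: a_def)
  qed
  also have "\<dots> = (\<integral>\<^sup>+k. ennreal (A k powr r) * indicator \<Gamma> k \<partial>count_space S) + (\<integral>\<^sup>+k. ennreal (1 / jb k ^ (CARD('d) + 2)) \<partial>count_space S)"
    by (rule nn_integral_add) simp_all
  also have "(\<integral>\<^sup>+k. ennreal (A k powr r) * indicator \<Gamma> k \<partial>count_space S) = (\<integral>\<^sup>+k. ennreal (A k powr r) * indicator \<Gamma> k \<partial>count_space (\<Gamma> \<inter> S))"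
    by (rule nn_integral_count_space_eq) auto
  also have "\<dots> = (\<integral>\<^sup>+k. ennreal (A k powr r) \<partial>count_space (\<Gamma> \<inter> S))"
    by (rule nn_integral_cong) simp
  finally have le: "(\<integral>\<^sup>+k. ennreal (a k powr r) \<partial>count_space S) \<le> (\<integral>\<^sup>+k. ennreal (A k powr r) \<partial>count_space (\<Gamma> \<inter> S)) + (\<integral>\<^sup>+k. ennreal (1 / jb k ^ (CARD('d) + 2)) \<partial>count_space S)" .
  have "(\<integral>\<^sup>+k. ennreal (a k powr r) \<partial>count_space S) < \<infinity>"
    by (rule order_le_less_trans[OF le]) (use 1 2 in simp)
  then show ?thesis using Lp_norm_count_space[of S a q] a0 False unfolding r_def by simp
qed

text \<open>The coefficient at k of the expansion of \<kappa> m \<open>ch \<xi>\<close> is the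
  Fourier integral of \<open>\<alpha> j\<close> m at \<xi> - k, hence rapidly decreasing in \<xi> -
  k. Inside \<Gamma> moderateness transfers the weight from \<xi> to k. Outside \<Gamma>, for \<xi>
  in the narrower cone, powers of \<open>jb (\<xi> - k)\<close> dominate every polynomial factor.
  The estimate is uniform in m through the derivative bound B.\<close>

lemma regular_estimate:
  fixes f :: "(real^'d \<Rightarrow> complex) \<Rightarrow> complex"
  assumes f: "f \<in> distributions X" and q: "1 \<le> q"
    and \<omega>: "\<And>\<xi>. 0 < \<omega> \<xi>" "Cw > 0" "\<And>\<xi> \<eta>. \<omega> \<xi> \<le> Cw * jb (\<xi> - \<eta>) ^ Mw * \<omega> \<eta>"
    and reg: "locally_regular f X q \<omega> x0 \<xi>0"
  shows "\<exists>U S \<Gamma>1 a. open U \<and> x0 \<in> U \<and> U \<subseteq> X \<and> separated S \<and> open_cone \<Gamma>1 \<and> \<xi>0 \<in> \<Gamma>1 \<and> (\<forall>k. 0 \<le> a k) \<and>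
    Lp_norm (count_space S) q (\<lambda>k. ennreal (a k)) < \<infinity> \<and>
    (\<forall>\<kappa>\<in>test_functions U. \<exists>C R n. C \<ge> 0 \<and> R > 0 \<and>
      (\<forall>m B. smooth m \<longrightarrow> (\<forall>ks. length ks \<le> n \<longrightarrow> (\<forall>x\<in>cball 0 R. cmod (iter_partial ks m x) \<le> B)) \<longrightarrow>
        (\<forall>\<xi>\<in>\<Gamma>1. ennreal (cmod (f (\<lambda>x. \<kappa> x * (m x * ch \<xi> x))) * \<omega> \<xi>) \<le>
          ennreal (C * B) * (\<integral>\<^sup>+k. ennreal (a k / jb (\<xi> - k) ^ (2 * (CARD('d) + 2))) \<partial>count_space S))))"
proof -
  obtain U S and J :: "(real^'d) set" and \<psi> \<Gamma> where U: "open U" "x0 \<in> U" "U \<subseteq> X" and S: "separated S" and J: "finite J"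
    and \<psi>: "\<forall>j\<in>J. \<psi> j \<in> test_functions X" and ex: "expands U S J \<psi>" and \<Gamma>: "open_cone \<Gamma>" "\<xi>0 \<in> \<Gamma>"
    and fin: "Lp_norm (count_space (\<Gamma> \<inter> S)) q (\<lambda>k. ennreal ((\<Sum>j\<in>J. cmod (f (\<lambda>x. \<psi> j x * ch k x))) * \<omega> k)) < \<infinity>"
    using reg unfolding locally_regular_def by (elim exE conjE)
  define N0 where "N0 = CARD('d) + 2"
  define F where "F j k = f (\<lambda>x. \<psi> j x * ch k x)" for j k
  define A where "A k = (\<Sum>j\<in>J. cmod (F j k))" for k
  have A0: "0 \<le> A k" for k unfolding A_def by (rule sum_nonneg) simp
  have "\<exists>C M. C \<ge> 0 \<and> (\<forall>k. A k \<le> C * jb k ^ M)"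
  proof -
    have "\<exists>C M. C \<ge> 0 \<and> (\<forall>k. (\<Sum>j\<in>I. cmod (F j k)) \<le> C * jb k ^ M)" if "finite I" "I \<subseteq> J" for I
      using that
    proof (induction I rule: finite_induct)
      case (insert j I)
      then obtain C M where C: "C \<ge> 0" "\<forall>k. (\<Sum>j\<in>I. cmod (F j k)) \<le> C * jb k ^ M" by auto
      have "\<psi> j \<in> test_functions X" using \<psi> insert.prems by simp
      then obtain D N where D: "D \<ge> 0" "\<And>k. cmod (F j k) \<le> D * jb k ^ N"
        unfolding F_def using distribution_growth[OF f] by metis
      have "(\<Sum>j\<in>insert j I. cmod (F j k)) \<le> (D + C) * jb k ^ (N + M)" for k
      proof -
        have "D * jb k ^ N \<le> D * jb k ^ (N + M)" "C * jb k ^ M \<le> C * jb k ^ (N + M)"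
          using C(1) D(1) by (auto intro!: mult_left_mono power_increasing)
        then show ?thesis using insert.hyps D(2)[of k] C(2)[rule_format, of k] by (simp add: distrib_right)
      qed
      moreover have "0 \<le> D + C" using C(1) D(1) by simp
      ultimately show ?case by blast
    qed (auto intro: exI[of _ 0])
    from this[OF J order_refl] show ?thesis unfolding A_def .
  qed
  then obtain C1 M where C1: "C1 \<ge> 0" "\<And>k. A k \<le> C1 * jb k ^ M" by blast
  \<comment> \<open>Weighted data where summability is known, and elsewhere an artificial sequence
    that belongs to every l^q.\<close>
  define a where "a k = (if k \<in> \<Gamma> then A k * \<omega> k else 1 / jb k ^ N0)" for k
  have a0: "0 \<le> a k" for k unfolding a_def using A0 \<omega>(1)[of k] by (simp add: less_imp_le)
  have afin: "Lp_norm (count_space S) q (\<lambda>k. ennreal (a k)) < \<infinity>"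
    unfolding a_def N0_def
    by (rule Lp_norm_split_decay[OF S q]) (use fin A0 \<omega>(1) in \<open>simp_all add: A_def F_def less_imp_le\<close>)
  obtain \<Gamma>1 c where \<Gamma>1: "open_cone \<Gamma>1" "\<xi>0 \<in> \<Gamma>1" and c: "c > 0" "\<forall>\<xi>\<in>\<Gamma>1. \<forall>k. k \<notin> \<Gamma> \<longrightarrow> c * norm \<xi> \<le> norm (\<xi> - k)"
    using open_cone_shrink[OF \<Gamma>] by (elim exE conjE)
  define K where "K = 1 + 1 / c"
  have K: "K \<ge> 1" using c(1) by (simp add: K_def)
  \<comment> \<open>For k off the cone, both \<xi> and k are controlled by the distance between
    them.\<close>
  have far: "jb \<xi> \<le> K * jb (\<xi> - k)" "jb k \<le> K * jb (\<xi> - k) ^ 2" if \<xi>: "\<xi> \<in> \<Gamma>1" and k: "k \<notin> \<Gamma>" for \<xi> k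
  proof -
    have "c * norm \<xi> \<le> norm (\<xi> - k)" using c(2) \<xi> k by blast
    then have "norm \<xi> \<le> norm (\<xi> - k) / c" using c(1) by (simp add: pos_le_divide_eq mult.commute)
    then have "jb \<xi> \<le> 1 + norm (\<xi> - k) / c" by (simp add: jb_def)
    also have "\<dots> \<le> (1 + 1 / c) * (1 + norm (\<xi> - k))" using c(1) by (simp add: field_simps)
    finally show 1: "jb \<xi> \<le> K * jb (\<xi> - k)" by (simp add: K_def jb_def)
    have "jb k \<le> jb (k - \<xi>) * jb \<xi>" by (rule jb_le_mult)
    also have "\<dots> \<le> jb (\<xi> - k) * (K * jb (\<xi> - k))" unfolding jb_commute[of k \<xi>] using 1 by (intro mult_left_mono) auto
    finally show "jb k \<le> K * jb (\<xi> - k) ^ 2" by (simp add: power2_eq_square mult_ac)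
  qed
  \<comment> \<open>Budget of decay: Mw for the weight, 2 (M + N0) for replacing the growth of A by
    \<open>a k\<close> off the cone, and 2 N0 kept for \<open>amalgam_finite\<close>.\<close>
  define n where "n = Mw + 2 * (M + N0) + 2 * N0"
  define K2 where "K2 = Cw + C1 * K ^ (M + N0) * (Cw * K ^ Mw * \<omega> 0)"
  have K2: "K2 \<ge> 0" unfolding K2_def using \<omega>(1)[of 0] \<omega>(2) C1(1) K by (intro add_nonneg_nonneg mult_nonneg_nonneg) auto
  have term_le: "A k * \<omega> \<xi> / jb (\<xi> - k) ^ n \<le> K2 * (a k / jb (\<xi> - k) ^ (2 * N0))" if \<xi>: "\<xi> \<in> \<Gamma>1" for \<xi> k
  proof -
    define z where "z = jb (\<xi> - k)"
    have z: "1 \<le> z" by (simp add: z_def)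
    have "A k * \<omega> \<xi> \<le> K2 * a k * z ^ (Mw + 2 * (M + N0))"
    proof (cases "k \<in> \<Gamma>")
      case True
      have "A k * \<omega> \<xi> \<le> A k * (Cw * z ^ Mw * \<omega> k)" unfolding z_def using A0 \<omega>(3) by (intro mult_left_mono) auto
      also have "\<dots> = Cw * a k * z ^ Mw" using True by (simp add: a_def)
      also have "\<dots> \<le> K2 * a k * z ^ (Mw + 2 * (M + N0))"
      proof (rule mult_mono)
        have "Cw \<le> K2" unfolding K2_def using \<omega>(1)[of 0] \<omega>(2) C1(1) K by simp
        then show "Cw * a k \<le> K2 * a k" using a0 by (rule mult_right_mono)
        show "z ^ Mw \<le> z ^ (Mw + 2 * (M + N0))" using z by (intro power_increasing) auto
      qed (use K2 a0 z in auto)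
      finally show ?thesis .
    next
      case False
      have f1: "jb \<xi> \<le> K * z" "jb k \<le> K * z ^ 2" using far[OF \<xi> False] by (simp_all add: z_def)
      have ak: "a k = 1 / jb k ^ N0" using False by (simp add: a_def)
      have "A k \<le> C1 * jb k ^ M" by (rule C1(2))
      \<comment> \<open>Inserts \<open>a k\<close> by paying N0 further powers of
        \<open>jb k\<close>.\<close>
      also have "jb k ^ M = jb k ^ (M + N0) * a k"
      proof -
        have "jb k \<noteq> 0" using jb_pos[of k] by linarith
        then show ?thesis unfolding ak power_add by simp
      qed
      also have "C1 * (jb k ^ (M + N0) * a k) \<le> C1 * ((K * z ^ 2) ^ (M + N0) * a k)"
        using C1(1) a0 f1(2) by (intro mult_left_mono mult_right_mono power_mono) auto
      finally have 1: "A k \<le> C1 * ((K * z ^ 2) ^ (M + N0) * a k)" .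
      have "\<omega> \<xi> \<le> Cw * jb \<xi> ^ Mw * \<omega> 0" using \<omega>(3)[of \<xi> 0] by simp
      also have "\<dots> \<le> Cw * (K * z) ^ Mw * \<omega> 0"
        using \<omega>(1)[of 0] \<omega>(2) f1(1) by (intro mult_right_mono mult_left_mono power_mono) auto
      finally have 2: "\<omega> \<xi> \<le> Cw * (K * z) ^ Mw * \<omega> 0" .
      have "A k * \<omega> \<xi> \<le> (C1 * ((K * z ^ 2) ^ (M + N0) * a k)) * (Cw * (K * z) ^ Mw * \<omega> 0)"
        by (rule mult_mono[OF 1 2]) (use A0 \<omega>(1)[of \<xi>] C1(1) K z a0 in auto)
      also have "\<dots> = (C1 * K ^ (M + N0) * (Cw * K ^ Mw * \<omega> 0)) * a k * z ^ (Mw + 2 * (M + N0))"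
        by (simp only: power_mult_distrib power_add[of z Mw] power_mult[symmetric] mult_ac)
      also have "\<dots> \<le> K2 * a k * z ^ (Mw + 2 * (M + N0))"
        unfolding K2_def using \<omega>(2) a0 z by (intro mult_right_mono) auto
      finally show ?thesis .
    qed
    then have "A k * \<omega> \<xi> / z ^ n \<le> K2 * a k * z ^ (Mw + 2 * (M + N0)) / z ^ n" using z by (intro divide_right_mono) auto
    also have "\<dots> = K2 * (a k / z ^ (2 * N0))"
      unfolding n_def power_add[of z "Mw + 2 * (M + N0)" "2 * N0"] using z by simp
    finally show ?thesis by (simp add: z_def)
  qed
  have est: "\<exists>C R n. C \<ge> 0 \<and> R > 0 \<and>
      (\<forall>m B. smooth m \<longrightarrow> (\<forall>ks. length ks \<le> n \<longrightarrow> (\<forall>x\<in>cball 0 R. cmod (iter_partial ks m x) \<le> B)) \<longrightarrow>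
        (\<forall>\<xi>\<in>\<Gamma>1. ennreal (cmod (f (\<lambda>x. \<kappa> x * (m x * ch \<xi> x))) * \<omega> \<xi>) \<le>
          ennreal (C * B) * (\<integral>\<^sup>+k. ennreal (a k / jb (\<xi> - k) ^ (2 * N0)) \<partial>count_space S)))"
    if \<kappa>: "\<kappa> \<in> test_functions U" for \<kappa>
  proof -
    from bspec[OF ex[unfolded expands_def] \<kappa>]
    obtain \<alpha> where \<alpha>: "\<forall>j\<in>J. \<alpha> j \<in> test_functions UNIV" and rep: "\<forall>m. smooth m \<longrightarrow> (\<lambda>x. \<kappa> x * m x) =
       (\<lambda>x. \<Sum>j\<in>J. \<psi> j x * (\<integral>k. (\<integral>y. \<alpha> j y * m y * ch (- k) y \<partial>lborel) * ch k x \<partial>count_space S))"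
      by (elim exE conjE)
    have "\<forall>j\<in>J. \<exists>C. \<exists>R. C \<ge> 0 \<and> R > 0 \<and> (\<forall>m B. smooth m \<longrightarrow>
      (\<forall>ks. length ks \<le> n \<longrightarrow> (\<forall>x\<in>cball 0 R. cmod (iter_partial ks m x) \<le> B)) \<longrightarrow>
      (\<forall>\<eta>. cmod (\<integral>x. \<alpha> j x * m x * ch \<eta> x \<partial>lborel) \<le> C * B / jb \<eta> ^ n))"
      by (intro ballI fourier_decay'[where X = UNIV]) (use \<alpha> in blast)
    from bchoice[OF this] obtain C where "\<forall>j\<in>J. \<exists>R. C j \<ge> 0 \<and> R > 0 \<and> (\<forall>m B. smooth m \<longrightarrow>
      (\<forall>ks. length ks \<le> n \<longrightarrow> (\<forall>x\<in>cball 0 R. cmod (iter_partial ks m x) \<le> B)) \<longrightarrow>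
      (\<forall>\<eta>. cmod (\<integral>x. \<alpha> j x * m x * ch \<eta> x \<partial>lborel) \<le> C j * B / jb \<eta> ^ n))" ..
    from bchoice[OF this] obtain R where CR: "\<forall>j\<in>J. C j \<ge> 0 \<and> R j > 0 \<and> (\<forall>m B. smooth m \<longrightarrow>
      (\<forall>ks. length ks \<le> n \<longrightarrow> (\<forall>x\<in>cball 0 (R j). cmod (iter_partial ks m x) \<le> B)) \<longrightarrow>
      (\<forall>\<eta>. cmod (\<integral>x. \<alpha> j x * m x * ch \<eta> x \<partial>lborel) \<le> C j * B / jb \<eta> ^ n))" ..
    define C' R' where "C' = (\<Sum>j\<in>J. C j)" and "R' = 1 + (\<Sum>j\<in>J. R j)"
    have C': "C' \<ge> 0" unfolding C'_def by (rule sum_nonneg) (use CR in blast)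
    have Cj: "C j \<le> C'" if "j \<in> J" for j unfolding C'_def by (rule member_le_sum[OF that]) (use CR J in auto)
    have "0 \<le> (\<Sum>j\<in>J. R j)" by (rule sum_nonneg) (use CR less_imp_le in blast)
    then have R': "R' > 0" by (simp add: R'_def)
    have Rj: "R j \<le> R'" if "j \<in> J" for j
    proof -
      have "R j \<le> (\<Sum>j\<in>J. R j)" by (rule member_le_sum[OF that]) (use CR J less_imp_le in auto)
      then show ?thesis by (simp add: R'_def)
    qed
    have main: "ennreal (cmod (f (\<lambda>x. \<kappa> x * (m x * ch \<xi> x))) * \<omega> \<xi>) \<le>
          ennreal (C' * K2 * B) * (\<integral>\<^sup>+k. ennreal (a k / jb (\<xi> - k) ^ (2 * N0)) \<partial>count_space S)"
      if m: "smooth m" and B: "\<forall>ks. length ks \<le> n \<longrightarrow> (\<forall>x\<in>cball 0 R'. cmod (iter_partial ks m x) \<le> B)" and \<xi>: "\<xi> \<in> \<Gamma>1" for m B \<xi>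
    proof -
      \<comment> \<open>The character is treated as part of the smooth factor in the expansion; in
        the decay estimate it is combined with the character of -k into one of frequency \<xi> -
        k.\<close>
      define M1 where "M1 x = m x * ch \<xi> x" for x
      have M1: "smooth M1" unfolding M1_def by (intro smooth_mult m smooth_ch)
      have "cmod (m 0) \<le> B" using B[rule_format, of "[]" 0] R' by simp
      then have B0: "B \<ge> 0" using norm_ge_zero order_trans by blast
      define d where "d j k = (\<integral>y. \<alpha> j y * M1 y * ch (- k) y \<partial>lborel)" for j k
      have d: "cmod (d j k) \<le> C' * B / jb (\<xi> - k) ^ n" if j: "j \<in> J" for j k
      proof -
        have "\<forall>ks. length ks \<le> n \<longrightarrow> (\<forall>x\<in>cball 0 (R j). cmod (iter_partial ks m x) \<le> B)"
          using B Rj[OF j] by auto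
        then have "cmod (\<integral>x. \<alpha> j x * m x * ch (\<xi> + - k) x \<partial>lborel) \<le> C j * B / jb (\<xi> + - k) ^ n"
          using CR j m by blast
        also have "\<dots> \<le> C' * B / jb (\<xi> + - k) ^ n"
          using Cj[OF j] B0 by (intro divide_right_mono mult_right_mono) auto
        finally show ?thesis unfolding d_def M1_def ch_add by (simp add: mult.assoc)
      qed
      have repf: "f (\<lambda>x. \<kappa> x * M1 x) = (\<Sum>j\<in>J. \<integral>k. d j k * F j k \<partial>count_space S)"
      proof -
        define s where "s j x = (\<integral>k. d j k * ch k x \<partial>count_space S)" for j x
        have s: "smooth (s j)" "f (\<lambda>x. \<psi> j x * s j x) = (\<integral>k. d j k * F j k \<partial>count_space S)" if j: "j \<in> J" for j
          unfolding s_def d_def F_def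
          by (rule expansion_apply(3)[OF f \<psi>[rule_format, OF j] S \<alpha>[rule_format, OF j] M1]
              expansion_apply(1)[OF f \<psi>[rule_format, OF j] S \<alpha>[rule_format, OF j] M1])+
        have "f (\<lambda>x. \<kappa> x * M1 x) = f (\<lambda>x. \<Sum>j\<in>J. \<psi> j x * s j x)"
          unfolding rep[rule_format, OF M1] s_def d_def by (rule refl)
        also have "\<dots> = (\<Sum>j\<in>J. f (\<lambda>x. \<psi> j x * s j x))"
          by (rule distribution_sum[OF f J]) (use \<psi> s(1) in \<open>blast intro: tf_mult\<close>)
        also have "\<dots> = (\<Sum>j\<in>J. \<integral>k. d j k * F j k \<partial>count_space S)" by (rule sum.cong[OF refl s(2)])
        finally show ?thesis .
      qed
      have int: "integrable (count_space S) (\<lambda>k. d j k * F j k)" if j: "j \<in> J" for j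
        unfolding d_def F_def by (rule expansion_apply(2)[OF f \<psi>[rule_format, OF j] S \<alpha>[rule_format, OF j] M1])
      have w0: "0 \<le> \<omega> \<xi>" using \<omega>(1)[of \<xi>] by simp
      have "ennreal (cmod (f (\<lambda>x. \<kappa> x * M1 x))) \<le> ennreal (\<Sum>j\<in>J. cmod (\<integral>k. d j k * F j k \<partial>count_space S))"
        unfolding repf by (intro ennreal_leI norm_sum)
      also have "\<dots> = (\<Sum>j\<in>J. ennreal (cmod (\<integral>k. d j k * F j k \<partial>count_space S)))" by (rule sum_ennreal[symmetric]) simp
      also have "\<dots> \<le> (\<Sum>j\<in>J. \<integral>\<^sup>+k. ennreal (cmod (d j k * F j k)) \<partial>count_space S)"
        by (intro sum_mono integral_norm_bound_ennreal int)
      also have "\<dots> = (\<integral>\<^sup>+k. (\<Sum>j\<in>J. ennreal (cmod (d j k * F j k))) \<partial>count_space S)"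
        by (rule nn_integral_sum[symmetric]) simp
      also have "\<dots> \<le> (\<integral>\<^sup>+k. ennreal (C' * B * A k / jb (\<xi> - k) ^ n) \<partial>count_space S)"
      proof (intro nn_integral_mono)
        fix k
        have "(\<Sum>j\<in>J. cmod (d j k * F j k)) \<le> (\<Sum>j\<in>J. C' * B / jb (\<xi> - k) ^ n * cmod (F j k))"
          unfolding norm_mult by (intro sum_mono mult_right_mono d) auto
        also have "\<dots> = C' * B * A k / jb (\<xi> - k) ^ n" unfolding A_def sum_distrib_left[symmetric] by simp
        finally show "(\<Sum>j\<in>J. ennreal (cmod (d j k * F j k))) \<le> ennreal (C' * B * A k / jb (\<xi> - k) ^ n)"
          by (subst sum_ennreal) (auto intro: ennreal_leI)
      qed
      finally have "ennreal (cmod (f (\<lambda>x. \<kappa> x * M1 x))) * ennreal (\<omega> \<xi>) \<le>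
          (\<integral>\<^sup>+k. ennreal (C' * B * A k / jb (\<xi> - k) ^ n) \<partial>count_space S) * ennreal (\<omega> \<xi>)"
        by (rule mult_right_mono) simp
      also have "\<dots> = (\<integral>\<^sup>+k. ennreal (C' * B * A k / jb (\<xi> - k) ^ n) * ennreal (\<omega> \<xi>) \<partial>count_space S)"
        by (rule nn_integral_multc[symmetric]) simp
      also have "\<dots> \<le> (\<integral>\<^sup>+k. ennreal (C' * K2 * B) * ennreal (a k / jb (\<xi> - k) ^ (2 * N0)) \<partial>count_space S)"
      proof (intro nn_integral_mono)
        fix k
        have "C' * B * A k / jb (\<xi> - k) ^ n * \<omega> \<xi> = (C' * B) * (A k * \<omega> \<xi> / jb (\<xi> - k) ^ n)" by simp
        also have "\<dots> \<le> (C' * B) * (K2 * (a k / jb (\<xi> - k) ^ (2 * N0)))"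
          using C' B0 by (intro mult_left_mono term_le[OF \<xi>]) auto
        also have "\<dots> = (C' * K2 * B) * (a k / jb (\<xi> - k) ^ (2 * N0))" by simp
        finally have "C' * B * A k / jb (\<xi> - k) ^ n * \<omega> \<xi> \<le> (C' * K2 * B) * (a k / jb (\<xi> - k) ^ (2 * N0))" .
        then show "ennreal (C' * B * A k / jb (\<xi> - k) ^ n) * ennreal (\<omega> \<xi>) \<le> ennreal (C' * K2 * B) * ennreal (a k / jb (\<xi> - k) ^ (2 * N0))"
          using w0 C' K2 B0 a0 A0 by (subst (1 2) ennreal_mult[symmetric]) (auto intro: ennreal_leI)
      qed
      also have "\<dots> = ennreal (C' * K2 * B) * (\<integral>\<^sup>+k. ennreal (a k / jb (\<xi> - k) ^ (2 * N0)) \<partial>count_space S)"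
        by (rule nn_integral_cmult) simp
      also have "ennreal (cmod (f (\<lambda>x. \<kappa> x * M1 x))) * ennreal (\<omega> \<xi>) = ennreal (cmod (f (\<lambda>x. \<kappa> x * M1 x)) * \<omega> \<xi>)"
        using w0 by (simp add: ennreal_mult)
      finally show ?thesis unfolding M1_def .
    qed
    show ?thesis
    proof (rule exI[of _ "C' * K2"], rule exI[of _ R'], rule exI[of _ n], intro conjI allI impI ballI)
      show "0 \<le> C' * K2" using C' K2 by simp
      show "0 < R'" by (rule R')
    next
      fix m :: "real^'d \<Rightarrow> complex" and B :: real and \<xi>
      assume "smooth m" "\<forall>ks. length ks \<le> n \<longrightarrow> (\<forall>x\<in>cball 0 R'. cmod (iter_partial ks m x) \<le> B)" "\<xi> \<in> \<Gamma>1"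
      then show "ennreal (cmod (f (\<lambda>x. \<kappa> x * (m x * ch \<xi> x))) * \<omega> \<xi>) \<le>
          ennreal (C' * K2 * B) * (\<integral>\<^sup>+k. ennreal (a k / jb (\<xi> - k) ^ (2 * N0)) \<partial>count_space S)"
        by (rule main)
    qed
  qed
  show ?thesis
    by (rule exI[of _ U], rule exI[of _ S], rule exI[of _ \<Gamma>1], rule exI[of _ a], fold N0_def)
      (intro conjI allI ballI U S \<Gamma>1 a0 afin est)
qed

subsection \<open>Regularity implies finiteness of the four norms\<close>

lemma amalgam_finite_lebesgue:
  fixes S \<Gamma> :: "(real^'d) set"
  assumes S: "separated S" and a: "\<And>k. 0 \<le> a k" and fin: "Lp_norm (count_space S) q (\<lambda>k. ennreal (a k)) < \<infinity>"
    and q: "1 \<le> q" and \<Gamma>: "open \<Gamma>" and mu: "u \<in> borel_measurable (lebesgue_on \<Gamma>)"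
    and u: "\<And>\<xi>. \<xi> \<in> \<Gamma> \<Longrightarrow> u \<xi> \<le> ennreal K * (\<integral>\<^sup>+k. ennreal (a k / jb (\<xi> - k) ^ (2 * (CARD('d) + 2))) \<partial>count_space S)"
  shows "Lp_norm (lebesgue_on \<Gamma>) q u < \<infinity>"
proof -
  have m: "(\<lambda>\<xi>. ennreal (1 / jb (\<xi> - k) ^ (CARD('d) + 2))) \<in> borel_measurable borel" for k :: "real^'d"
    unfolding jb_def by measurable
  have "(\<integral>\<^sup>+(x::real^'d). ennreal (1 / jb x ^ (CARD('d) + 2)) \<partial>lborel) < \<infinity>"
    using nn_integral_jb[where 'a = "real^'d"] by simp
  then obtain D where D: "(\<integral>\<^sup>+(x::real^'d). ennreal (1 / jb x ^ (CARD('d) + 2)) \<partial>lborel) = ennreal D"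
    by (cases "\<integral>\<^sup>+(x::real^'d). ennreal (1 / jb x ^ (CARD('d) + 2)) \<partial>lborel") auto
  show ?thesis
  proof (rule amalgam_finite[OF S a fin q])
    fix k :: "real^'d"
    show "(\<lambda>\<xi>. ennreal (1 / jb (\<xi> - k) ^ (DIM(real^'d) + 2))) \<in> borel_measurable (lebesgue_on \<Gamma>)"
      using m[of k] by (intro measurable_restrict_space1 measurable_completion) simp
    have "(\<integral>\<^sup>+\<xi>. ennreal (1 / jb (\<xi> - k) ^ (CARD('d) + 2)) \<partial>lebesgue_on \<Gamma>) =
        (\<integral>\<^sup>+\<xi>. ennreal (1 / jb (\<xi> - k) ^ (CARD('d) + 2)) * indicator \<Gamma> \<xi> \<partial>lebesgue)"
      using \<Gamma> by (intro nn_integral_restrict_space) auto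
    also have "\<dots> \<le> (\<integral>\<^sup>+\<xi>. ennreal (1 / jb (\<xi> - k) ^ (CARD('d) + 2)) \<partial>lebesgue)"
      by (intro nn_integral_mono) (simp add: indicator_def)
    also have "\<dots> = (\<integral>\<^sup>+\<xi>. ennreal (1 / jb (k - \<xi>) ^ (CARD('d) + 2)) \<partial>lborel)"
      unfolding jb_commute[of k] by (rule nn_integral_completion)
    also have "\<dots> = ennreal D" unfolding nn_integral_jb_shift by (rule D)
    finally show "(\<integral>\<^sup>+\<xi>. ennreal (1 / jb (\<xi> - k) ^ (DIM(real^'d) + 2)) \<partial>lebesgue_on \<Gamma>) \<le> ennreal D" by simp
  next
    show "u \<in> borel_measurable (lebesgue_on \<Gamma>)" by (rule mu)
    show "u \<xi> \<le> ennreal K * (\<integral>\<^sup>+k. ennreal (a k / jb (\<xi> - k) ^ (2 * (DIM(real^'d) + 2))) \<partial>count_space S)"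
      if "\<xi> \<in> space (lebesgue_on \<Gamma>)" for \<xi>
      using u[of \<xi>] that by simp
  qed
qed

lemma amalgam_finite_separated:
  fixes S \<Gamma> T :: "(real^'d) set"
  assumes S: "separated S" and a: "\<And>k. 0 \<le> a k" and fin: "Lp_norm (count_space S) q (\<lambda>k. ennreal (a k)) < \<infinity>"
    and q: "1 \<le> q" and T: "separated T"
    and u: "\<And>\<xi>. \<xi> \<in> \<Gamma> \<Longrightarrow> u \<xi> \<le> ennreal K * (\<integral>\<^sup>+k. ennreal (a k / jb (\<xi> - k) ^ (2 * (CARD('d) + 2))) \<partial>count_space S)"
  shows "Lp_norm (count_space (\<Gamma> \<inter> T)) q u < \<infinity>"
proof -
  obtain D where D: "\<And>\<xi> N. DIM(real^'d) + 2 \<le> N \<Longrightarrow> (\<integral>\<^sup>+k. ennreal (1 / jb (\<xi> - k) ^ N) \<partial>count_space T) \<le> ennreal D"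
    using separated_sum[OF T] by metis
  show ?thesis
  proof (rule amalgam_finite[OF S a fin q])
    fix k :: "real^'d"
    have "(\<integral>\<^sup>+\<xi>. ennreal (1 / jb (\<xi> - k) ^ (DIM(real^'d) + 2)) \<partial>count_space (\<Gamma> \<inter> T)) =
        (\<integral>\<^sup>+\<xi>. ennreal (1 / jb (k - \<xi>) ^ (DIM(real^'d) + 2)) * indicator \<Gamma> \<xi> \<partial>count_space (\<Gamma> \<inter> T))"
      unfolding jb_commute[of k] by (rule nn_integral_cong) simp
    also have "\<dots> = (\<integral>\<^sup>+\<xi>. ennreal (1 / jb (k - \<xi>) ^ (DIM(real^'d) + 2)) * indicator \<Gamma> \<xi> \<partial>count_space T)"
      by (rule nn_integral_count_space_eq) auto
    also have "\<dots> \<le> (\<integral>\<^sup>+\<xi>. ennreal (1 / jb (k - \<xi>) ^ (DIM(real^'d) + 2)) \<partial>count_space T)"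
      by (intro nn_integral_mono) (simp add: indicator_def)
    also have "\<dots> \<le> ennreal D" by (rule D) simp
    finally show "(\<integral>\<^sup>+\<xi>. ennreal (1 / jb (\<xi> - k) ^ (DIM(real^'d) + 2)) \<partial>count_space (\<Gamma> \<inter> T)) \<le> ennreal D" .
  next
    show "u \<xi> \<le> ennreal K * (\<integral>\<^sup>+k. ennreal (a k / jb (\<xi> - k) ^ (2 * (DIM(real^'d) + 2))) \<partial>count_space S)"
      if "\<xi> \<in> space (count_space (\<Gamma> \<inter> T))" for \<xi>
      using u[of \<xi>] that by simp
  qed simp_all
qed

section \<open>Lattices as separated sets, and inner norms in the translation variable\<close>

lemma separated_finite:
  fixes S :: "'a::euclidean_space set"
  assumes "separated S" "bounded B"
  shows "finite (S \<inter> B)"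
proof (rule ccontr)
  assume "infinite (S \<inter> B)"
  moreover have "bounded (S \<inter> B)" using assms(2) by (rule bounded_subset) simp
  ultimately obtain x where x: "x islimpt (S \<inter> B)" using bounded_infinite_imp_islimpt[OF order_refl] by blast
  obtain r where r: "r > 0" "\<forall>x\<in>S. \<forall>y\<in>S. x \<noteq> y \<longrightarrow> 2 * r \<le> dist x y" using assms(1) unfolding separated_def by blast
  have "\<forall>x\<in>S \<inter> B. \<forall>y\<in>S \<inter> B. dist y x < 2 * r \<longrightarrow> y = x" using r(2) by (metis IntE dist_commute not_le)
  then show False using discrete_imp_not_islimpt[of "2 * r" "S \<inter> B" x] r(1) x by simp
qed

text \<open>A linear map taking the basis to the unit vectors sends differences of distinct lattice
  points to vectors with an integer coordinate of absolute value at least 1. Its boundedness yields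
  the separation.\<close>

lemma lattice_separated:
  assumes "lattice_with_basis e \<Lambda>"
  shows "separated \<Lambda>"
proof -
  obtain x0 where inj: "inj e" and ind: "independent (range e)"
    and \<Lambda>: "\<Lambda> = {x0 + (\<Sum>j\<in>UNIV. of_int (t j) *\<^sub>R e j) | t. True}"
    using assms unfolding lattice_with_basis_def by blast
  obtain g where g: "linear g" "\<forall>v\<in>range e. g v = axis (inv e v) (1::real)"
    using linear_independent_extend[OF ind, of "\<lambda>v. axis (inv e v) (1::real)"] by blast
  have ge: "g (e j) = axis j 1" for j using g(2) inj by simp
  obtain K where K: "K > 0" "\<And>x. norm (g x) \<le> K * norm x" using linear_bounded_pos[OF g(1)] by blast
  have "1 / K \<le> dist x y" if x: "x \<in> \<Lambda>" and y: "y \<in> \<Lambda>" and ne: "x \<noteq> y" for x y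
  proof -
    obtain s t where st: "x = x0 + (\<Sum>j\<in>UNIV. of_int (s j) *\<^sub>R e j)" "y = x0 + (\<Sum>j\<in>UNIV. of_int (t j) *\<^sub>R e j)"
      using x y unfolding \<Lambda> by blast
    then obtain i where i: "s i \<noteq> t i" using ne by (metis (no_types, lifting) ext)
    have "x - y = (\<Sum>j\<in>UNIV. of_int (s j - t j) *\<^sub>R e j)" unfolding st by (simp add: sum_subtractf scaleR_diff_left)
    then have "g (x - y) = (\<Sum>j\<in>UNIV. of_int (s j - t j) *\<^sub>R axis j 1)"
      using g(1) by (simp add: linear_sum linear_scale ge)
    then have "g (x - y) $ i = of_int (s i - t i)"
      by (simp add: sum_component axis_def if_distrib[where f = "\<lambda>x. _ * x"] cong: if_cong)
    moreover have "1 \<le> \<bar>s i - t i\<bar>" using i by simp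
    ultimately have "1 \<le> \<bar>g (x - y) $ i\<bar>" by (metis of_int_1_le_iff of_int_abs)
    also have "\<dots> \<le> norm (g (x - y))" by (rule component_le_norm_cart)
    also have "\<dots> \<le> K * dist x y" unfolding dist_norm by (rule K(2))
    finally show ?thesis using K(1) by (simp add: pos_divide_le_eq mult.commute)
  qed
  moreover have "countable \<Lambda>"
  proof -
    have "\<Lambda> = range (\<lambda>t :: _ \<Rightarrow> int. x0 + (\<Sum>j\<in>UNIV. of_int (t j) *\<^sub>R e j))" unfolding \<Lambda> by blast
    then show ?thesis by simp
  qed
  ultimately show ?thesis unfolding separated_def using K(1) by (intro conjI exI[of _ "1 / (2 * K)"]) auto
qed

lemma ennreal_powr_measurable [measurable]: "(\<lambda>a. ennreal_powr a r) \<in> borel_measurable borel"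
  unfolding ennreal_powr_def by measurable

text \<open>As h takes values in [0, 1], h^r is at most h for r >= 1. An integrable profile
  therefore has L^p norm at most l + 1, with the same constant for all p.\<close>

lemma Lp_norm_le:
  assumes p: "1 \<le> p" and v: "v \<in> borel_measurable M" and h: "h \<in> borel_measurable M" "\<And>x. 0 \<le> h x" "\<And>x. h x \<le> 1"
    and l: "(\<integral>\<^sup>+x. ennreal (h x) \<partial>M) \<le> ennreal l" "0 \<le> l"
    and le: "\<And>x. v x \<le> ennreal (h x) * E"
  shows "Lp_norm M p v \<le> ennreal (l + 1) * E"
proof (cases "p = \<infinity>")
  case True
  have "v x \<le> ennreal (l + 1) * E" for x
    by (rule order_trans[OF le]) (use h(3)[of x] l(2) in \<open>intro mult_right_mono ennreal_leI, auto\<close>)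
  then have "esssup M v \<le> ennreal (l + 1) * E" by (intro esssup_I v) simp
  then show ?thesis unfolding Lp_norm_def if_P[OF True] .
next
  case False
  define r where "r = enn2real p"
  have r: "1 \<le> r" unfolding r_def by (rule enn2real_ge_1[OF p False])
  show ?thesis
  proof (cases E)
    case top
    have "ennreal (l + 1) \<noteq> 0" using l(2) by simp
    then have "ennreal (l + 1) * E = top" unfolding top by (simp add: ennreal_mult_top)
    then show ?thesis by simp
  next
    case (real e)
    have "(\<integral>\<^sup>+x. ennreal_powr (v x) r \<partial>M) \<le> (\<integral>\<^sup>+x. ennreal (e powr r) * ennreal (h x) \<partial>M)"
    proof (intro nn_integral_mono)
      fix x
      have "v x \<le> ennreal (h x * e)" using le[of x] h(2)[of x] real by (simp add: ennreal_mult)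
      then have "ennreal_powr (v x) r \<le> ennreal_powr (ennreal (h x * e)) r" using r by (intro ennreal_powr_mono) auto
      also have "\<dots> = ennreal ((h x * e) powr r)" using h(2) real by (intro ennreal_powr_ennreal) auto
      also have "\<dots> \<le> ennreal (e powr r * h x)"
      proof (rule ennreal_leI)
        have "h x powr r \<le> h x powr 1" by (rule powr_mono'[OF r h(2) h(3)])
        then have "h x powr r \<le> h x" using h(2)[of x] by simp
        then show "(h x * e) powr r \<le> e powr r * h x" using h(2)[of x] real
          by (simp add: powr_mult mult.commute[of "e powr r"] mult_right_mono)
      qed
      also have "\<dots> = ennreal (e powr r) * ennreal (h x)" using h(2) by (simp add: ennreal_mult)
      finally show "ennreal_powr (v x) r \<le> ennreal (e powr r) * ennreal (h x)" .
    qed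
    also have "\<dots> = ennreal (e powr r) * (\<integral>\<^sup>+x. ennreal (h x) \<partial>M)" using h(1) by (intro nn_integral_cmult) simp
    also have "\<dots> \<le> ennreal (e powr r) * ennreal l" by (intro mult_left_mono l) simp
    also have "\<dots> = ennreal (e powr r * l)" using l(2) by (simp add: ennreal_mult)
    finally have "ennreal_powr (\<integral>\<^sup>+x. ennreal_powr (v x) r \<partial>M) (1 / r) \<le> ennreal_powr (ennreal (e powr r * l)) (1 / r)"
      using r by (intro ennreal_powr_mono) auto
    also have "\<dots> = ennreal ((e powr r * l) powr (1 / r))" using l(2) by (intro ennreal_powr_ennreal) simp
    also have "\<dots> \<le> ennreal ((l + 1) * e)"
    proof (rule ennreal_leI)
      have "l powr (1 / r) \<le> (l + 1) powr (1 / r)" using l(2) r by (intro powr_mono2) auto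
      also have "\<dots> \<le> (l + 1) powr 1" using l(2) r by (intro powr_mono) auto
      finally have "l powr (1 / r) \<le> l + 1" using l(2) by simp
      moreover have "(e powr r * l) powr (1 / r) = e * l powr (1 / r)"
        using real r l(2) by (simp add: powr_mult powr_powr)
      ultimately show "(e powr r * l) powr (1 / r) \<le> (l + 1) * e" using real by (simp add: mult.commute mult_left_mono)
    qed
    finally show ?thesis unfolding Lp_norm_def if_not_P[OF False] r_def[symmetric] using real l(2) by (simp add: ennreal_mult)
  qed
qed

text \<open>A strict superlevel set of a continuous function is open, and a nonempty open set is not
  negligible.\<close>

lemma esssup_lebesgue_continuous:
  fixes h :: "'a::euclidean_space \<Rightarrow> real"
  assumes h: "continuous_on UNIV h"
  shows "esssup lebesgue (\<lambda>x. ennreal (h x)) = (SUP x. ennreal (h x))"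
proof (rule antisym)
  have "h \<in> borel_measurable borel" by (rule borel_measurable_continuous_onI[OF h])
  then have m: "(\<lambda>x. ennreal (h x)) \<in> borel_measurable lebesgue" by (intro measurable_completion) simp
  show "esssup lebesgue (\<lambda>x. ennreal (h x)) \<le> (SUP x. ennreal (h x))"
    by (intro esssup_I m AE_I2 SUP_upper) simp
  show "(SUP x. ennreal (h x)) \<le> esssup lebesgue (\<lambda>x. ennreal (h x))"
  proof (rule SUP_least, rule ccontr)
    fix x
    assume x: "\<not> ennreal (h x) \<le> esssup lebesgue (\<lambda>x. ennreal (h x))"
    define c where "c = esssup lebesgue (\<lambda>x. ennreal (h x))"
    have "continuous_on UNIV (\<lambda>x. ennreal (h x))" by (intro continuous_on_ennreal h)
    then have o: "open {x. c < ennreal (h x)}" by (intro open_Collect_less continuous_on_const)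
    have "AE x in lebesgue. ennreal (h x) \<le> c" unfolding c_def by (rule esssup_AE)
    then have "{x \<in> space lebesgue. \<not> ennreal (h x) \<le> c} \<in> null_sets lebesgue"
      using o by (intro AE_iff_null_sets[THEN iffD2]) (auto simp: not_le)
    then have "negligible {x. c < ennreal (h x)}" by (simp add: negligible_iff_null_sets not_le)
    then have "{x. c < ennreal (h x)} = {}" using o open_not_negligible by blast
    then have "x \<notin> {x. c < ennreal (h x)}" by blast
    then show False using x by (simp add: c_def)
  qed
qed

text \<open>For finite p this is measurability in Tonelli's theorem. For p infinite the essential
  supremum is a supremum of continuous functions, whose superlevel sets are unions of open sets. In
  both cases the merely Lebesgue measurable weight is pulled out of the inner norm.\<close>

lemma Lp_norm_slice_measurable:
  fixes V :: "real^'d \<Rightarrow> real^'d \<Rightarrow> complex"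
  assumes p: "1 \<le> p" and V: "continuous_on UNIV (\<lambda>z. V (fst z) (snd z))"
    and \<omega>: "\<omega> \<in> borel_measurable lebesgue" "\<And>\<xi>. 0 < \<omega> \<xi>"
  shows "(\<lambda>\<xi>. Lp_norm lebesgue p (\<lambda>x. ennreal (cmod (V x \<xi> * of_real (\<omega> \<xi>))))) \<in> borel_measurable lebesgue"
proof -
  have eq: "cmod (V x \<xi> * of_real (\<omega> \<xi>)) = cmod (V x \<xi>) * \<omega> \<xi>" for x \<xi>
    using \<omega>(2)[of \<xi>] by (simp add: norm_mult)
  have cont: "continuous_on UNIV (\<lambda>x. V x \<xi>)" "continuous_on UNIV (\<lambda>\<xi>. V x \<xi>)" for x \<xi>
  proof -
    show "continuous_on UNIV (\<lambda>x. V x \<xi>)"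
      using continuous_on_compose2[OF V, of UNIV "\<lambda>x. (x, \<xi>)"] by (simp add: continuous_on_Pair continuous_on_id)
    show "continuous_on UNIV (\<lambda>\<xi>. V x \<xi>)"
      using continuous_on_compose2[OF V, of UNIV "\<lambda>\<xi>. (x, \<xi>)"] by (simp add: continuous_on_Pair continuous_on_id)
  qed
  show ?thesis
  proof (cases "p = \<infinity>")
    case True
    have "(\<lambda>\<xi>. SUP x. ennreal (cmod (V x \<xi>))) \<in> borel_measurable borel"
    proof (rule borel_measurableI_greater)
      fix c :: ennreal
      have "{\<xi> \<in> space borel. c < (SUP x. ennreal (cmod (V x \<xi>)))} = (\<Union>x. {\<xi>. c < ennreal (cmod (V x \<xi>))})"
        by (auto simp: less_SUP_iff)
      moreover have "open {\<xi>. c < ennreal (cmod (V x \<xi>))}" for x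
        by (intro open_Collect_less continuous_on_const continuous_on_ennreal continuous_on_norm cont)
      ultimately have "open {\<xi> \<in> space borel. c < (SUP x. ennreal (cmod (V x \<xi>)))}" by auto
      then show "{\<xi> \<in> space borel. c < (SUP x. ennreal (cmod (V x \<xi>)))} \<in> sets borel" by (rule borel_open)
    qed
    then have "(\<lambda>\<xi>. SUP x. ennreal (cmod (V x \<xi>))) \<in> borel_measurable lebesgue" by (intro measurable_completion) simp
    then have "(\<lambda>\<xi>. (SUP x. ennreal (cmod (V x \<xi>))) * ennreal (\<omega> \<xi>)) \<in> borel_measurable lebesgue"
      using \<omega>(1) by measurable
    moreover have "Lp_norm lebesgue p (\<lambda>x. ennreal (cmod (V x \<xi> * of_real (\<omega> \<xi>)))) = (SUP x. ennreal (cmod (V x \<xi>))) * ennreal (\<omega> \<xi>)" for \<xi>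
    proof -
      have "continuous_on UNIV (\<lambda>x. cmod (V x \<xi>) * \<omega> \<xi>)" by (intro continuous_intros cont)
      from esssup_lebesgue_continuous[OF this]
      have "Lp_norm lebesgue p (\<lambda>x. ennreal (cmod (V x \<xi> * of_real (\<omega> \<xi>)))) = (SUP x. ennreal (cmod (V x \<xi>) * \<omega> \<xi>))"
        unfolding Lp_norm_def if_P[OF True] eq .
      also have "\<dots> = (SUP x. ennreal (cmod (V x \<xi>)) * ennreal (\<omega> \<xi>))" using \<omega>(2)[of \<xi>] by (simp add: ennreal_mult)
      also have "\<dots> = (SUP x. ennreal (cmod (V x \<xi>))) * ennreal (\<omega> \<xi>)" by (rule SUP_mult_right_ennreal[symmetric])
      finally show ?thesis .
    qed
    ultimately show ?thesis by simp
  next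
    case False
    define r where "r = enn2real p"
    have Vm: "(\<lambda>z. V (fst z) (snd z)) \<in> borel_measurable (borel \<Otimes>\<^sub>M borel)"
      unfolding borel_prod by (rule borel_measurable_continuous_onI[OF V])
    have "(\<lambda>z. V (snd z) (fst z)) \<in> borel_measurable (borel \<Otimes>\<^sub>M borel)"
      using measurable_compose[OF measurable_pair_swap' Vm] by (simp add: split_beta)
    then have "(\<lambda>(\<xi>, x). ennreal (cmod (V x \<xi>) powr r)) \<in> borel_measurable (borel \<Otimes>\<^sub>M lborel)"
      unfolding split_beta by measurable
    then have "(\<lambda>\<xi>. \<integral>\<^sup>+x. ennreal (cmod (V x \<xi>) powr r) \<partial>lborel) \<in> borel_measurable borel"
      by (rule lborel.borel_measurable_nn_integral)
    then have "(\<lambda>\<xi>. \<integral>\<^sup>+x. ennreal (cmod (V x \<xi>) powr r) \<partial>lborel) \<in> borel_measurable lebesgue" by (intro measurable_completion) simp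
    then have "(\<lambda>\<xi>. ennreal_powr ((\<integral>\<^sup>+x. ennreal (cmod (V x \<xi>) powr r) \<partial>lborel) * ennreal (\<omega> \<xi> powr r)) (1 / r)) \<in> borel_measurable lebesgue"
      using \<omega>(1) by measurable
    moreover have "Lp_norm lebesgue p (\<lambda>x. ennreal (cmod (V x \<xi> * of_real (\<omega> \<xi>)))) =
        ennreal_powr ((\<integral>\<^sup>+x. ennreal (cmod (V x \<xi>) powr r) \<partial>lborel) * ennreal (\<omega> \<xi> powr r)) (1 / r)" for \<xi>
    proof -
      have m: "(\<lambda>x. V x \<xi>) \<in> borel_measurable borel" by (rule borel_measurable_continuous_onI[OF cont(1)])
      have "(\<integral>\<^sup>+x. ennreal_powr (ennreal (cmod (V x \<xi> * of_real (\<omega> \<xi>)))) r \<partial>lebesgue) =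
          (\<integral>\<^sup>+x. ennreal (cmod (V x \<xi>) powr r) * ennreal (\<omega> \<xi> powr r) \<partial>lebesgue)"
      proof (rule nn_integral_cong)
        fix x
        have "ennreal_powr (ennreal (cmod (V x \<xi>) * \<omega> \<xi>)) r = ennreal ((cmod (V x \<xi>) * \<omega> \<xi>) powr r)"
          using \<omega>(2)[of \<xi>] by (intro ennreal_powr_ennreal) simp
        then show "ennreal_powr (ennreal (cmod (V x \<xi> * of_real (\<omega> \<xi>)))) r = ennreal (cmod (V x \<xi>) powr r) * ennreal (\<omega> \<xi> powr r)"
          unfolding eq using \<omega>(2)[of \<xi>] by (simp add: powr_mult ennreal_mult)
      qed
      also have "\<dots> = (\<integral>\<^sup>+x. ennreal (cmod (V x \<xi>) powr r) * ennreal (\<omega> \<xi> powr r) \<partial>lborel)"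
        by (rule nn_integral_completion)
      also have "\<dots> = (\<integral>\<^sup>+x. ennreal (cmod (V x \<xi>) powr r) \<partial>lborel) * ennreal (\<omega> \<xi> powr r)"
        using m by (intro nn_integral_multc) measurable
      finally show ?thesis unfolding Lp_norm_def if_not_P[OF False] r_def[symmetric] by simp
    qed
    ultimately show ?thesis by simp
  qed
qed

section \<open>Regularity at a point and direction excludes it from each set\<close>

locale weighted_distribution =
  fixes X :: "(real^'d) set" and f :: "(real^'d \<Rightarrow> complex) \<Rightarrow> complex"
    and q :: ennreal and \<omega> :: "real^'d \<Rightarrow> real" and Cw :: real and Mw :: nat
  assumes X: "open X" and f: "f \<in> distributions X" and q: "1 \<le> q"
    and \<omega>_pos: "\<And>\<xi>. 0 < \<omega> \<xi>" and Cw: "Cw > 0"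
    and \<omega>_moderate: "\<And>\<xi> \<eta>. \<omega> \<xi> \<le> Cw * jb (\<xi> - \<eta>) ^ Mw * \<omega> \<eta>"
    and \<omega>_measurable: "\<omega> \<in> borel_measurable lebesgue"
begin

lemmas regular_estimate' = regular_estimate[OF f q \<omega>_pos Cw \<omega>_moderate]

lemma fourier_measurable:
  assumes "\<kappa> \<in> test_functions X" "open \<Gamma>"
  shows "(\<lambda>\<xi>. ennreal (cmod (fourier_fun (dmult \<kappa> f) \<xi> * of_real (\<omega> \<xi>)))) \<in> borel_measurable (lebesgue_on \<Gamma>)"
proof -
  have "(\<lambda>\<xi>. f (\<lambda>x. \<kappa> x * ch \<xi> x)) \<in> borel_measurable lebesgue"
    using borel_measurable_continuous_onI[OF continuous_distribution_ch[OF f X assms(1)]]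
    by (intro measurable_completion) simp
  then have "(\<lambda>\<xi>. ennreal (cmod (fourier_fun (dmult \<kappa> f) \<xi> * of_real (\<omega> \<xi>)))) \<in> borel_measurable lebesgue"
    unfolding fourier_fun_dmult[OF f X assms(1)] using \<omega>_measurable by measurable
  then show ?thesis by (rule measurable_restrict_space1)
qed

text \<open>The general estimate with m = 1. The open set V allows the cut-off to be placed in a
  prescribed neighbourhood, such as the interior of a parallelepiped.\<close>

lemma regular_fourier_estimate:
  assumes reg: "locally_regular f X q \<omega> x0 \<xi>0" and V: "open V" "x0 \<in> V"
  shows "\<exists>\<kappa> \<Gamma> S a K. \<kappa> \<in> test_functions (V \<inter> X) \<and> \<kappa> x0 \<noteq> 0 \<and> open_cone \<Gamma> \<and> \<xi>0 \<in> \<Gamma> \<and> separated S \<and>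
    (\<forall>k. 0 \<le> a k) \<and> Lp_norm (count_space S) q (\<lambda>k. ennreal (a k)) < \<infinity> \<and>
    (\<forall>\<xi>\<in>\<Gamma>. ennreal (cmod (fourier_fun (dmult \<kappa> f) \<xi> * of_real (\<omega> \<xi>))) \<le>
      ennreal K * (\<integral>\<^sup>+k. ennreal (a k / jb (\<xi> - k) ^ (2 * (CARD('d) + 2))) \<partial>count_space S))"
proof -
  from regular_estimate'[OF reg] obtain U S \<Gamma> a where U: "open U" "x0 \<in> U" "U \<subseteq> X" and S: "separated S"
    and \<Gamma>: "open_cone \<Gamma>" "\<xi>0 \<in> \<Gamma>" and a: "\<forall>k. 0 \<le> a k" "Lp_norm (count_space S) q (\<lambda>k. ennreal (a k)) < \<infinity>"
    and est: "\<forall>\<kappa>\<in>test_functions U. \<exists>C R n. C \<ge> 0 \<and> R > 0 \<and>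
      (\<forall>m B. smooth m \<longrightarrow> (\<forall>ks. length ks \<le> n \<longrightarrow> (\<forall>x\<in>cball 0 R. cmod (iter_partial ks m x) \<le> B)) \<longrightarrow>
        (\<forall>\<xi>\<in>\<Gamma>. ennreal (cmod (f (\<lambda>x. \<kappa> x * (m x * ch \<xi> x))) * \<omega> \<xi>) \<le>
          ennreal (C * B) * (\<integral>\<^sup>+k. ennreal (a k / jb (\<xi> - k) ^ (2 * (CARD('d) + 2))) \<partial>count_space S)))"
    by (elim exE conjE)
  have "open (U \<inter> V)" "x0 \<in> U \<inter> V" using U V by auto
  then obtain r where r: "r > 0" "cball x0 r \<subseteq> U \<inter> V" using open_contains_cball by blast
  obtain b :: "real^'d \<Rightarrow> real" where b: "(\<lambda>x. of_real (b x)) \<in> test_functions (cball x0 r)" "\<And>x. dist x0 x < r \<Longrightarrow> b x > 0"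
    using bump_function[OF r(1), of x0] by metis
  define \<kappa> where "\<kappa> x = complex_of_real (b x)" for x
  have \<kappa>: "\<kappa> \<in> test_functions (cball x0 r)" using b(1) unfolding \<kappa>_def .
  then have \<kappa>U: "\<kappa> \<in> test_functions U" and \<kappa>X: "\<kappa> \<in> test_functions X" and \<kappa>V: "\<kappa> \<in> test_functions (V \<inter> X)"
    using r(2) U(3) by (auto intro: tf_mono)
  have \<kappa>0: "\<kappa> x0 \<noteq> 0" using b(2)[of x0] r(1) by (simp add: \<kappa>_def)
  from bspec[OF est \<kappa>U] obtain C R n where C: "C \<ge> 0" "R > 0" and
    CR: "\<forall>m B. smooth m \<longrightarrow> (\<forall>ks. length ks \<le> n \<longrightarrow> (\<forall>x\<in>cball 0 R. cmod (iter_partial ks m x) \<le> B)) \<longrightarrow>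
        (\<forall>\<xi>\<in>\<Gamma>. ennreal (cmod (f (\<lambda>x. \<kappa> x * (m x * ch \<xi> x))) * \<omega> \<xi>) \<le>
          ennreal (C * B) * (\<integral>\<^sup>+k. ennreal (a k / jb (\<xi> - k) ^ (2 * (CARD('d) + 2))) \<partial>count_space S))"
    by (elim exE conjE)
  have one: "smooth (\<lambda>x::real^'d. 1)" by simp
  obtain B where B: "B \<ge> 0" "\<forall>ks. length ks \<le> n \<longrightarrow> (\<forall>x\<in>cball 0 R. cmod (iter_partial ks (\<lambda>x::real^'d. 1) x) \<le> B)"
    using smooth_derivs_bounded_on[OF one compact_cball] by blast
  define c where "c = cmod (fc TYPE('d))"
  have "ennreal (cmod (fourier_fun (dmult \<kappa> f) \<xi> * of_real (\<omega> \<xi>))) \<le>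
      ennreal (c * (C * B)) * (\<integral>\<^sup>+k. ennreal (a k / jb (\<xi> - k) ^ (2 * (CARD('d) + 2))) \<partial>count_space S)" if \<xi>: "\<xi> \<in> \<Gamma>" for \<xi>
  proof -
    have "cmod (fourier_fun (dmult \<kappa> f) \<xi> * of_real (\<omega> \<xi>)) = c * (cmod (f (\<lambda>x. \<kappa> x * (1 * ch \<xi> x))) * \<omega> \<xi>)"
      unfolding fourier_fun_dmult[OF f X \<kappa>X] norm_mult c_def using \<omega>_pos[of \<xi>] by simp
    then have "ennreal (cmod (fourier_fun (dmult \<kappa> f) \<xi> * of_real (\<omega> \<xi>))) = ennreal c * ennreal (cmod (f (\<lambda>x. \<kappa> x * (1 * ch \<xi> x))) * \<omega> \<xi>)"
      using \<omega>_pos[of \<xi>] by (simp add: ennreal_mult c_def)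
    also have "\<dots> \<le> ennreal c * (ennreal (C * B) * (\<integral>\<^sup>+k. ennreal (a k / jb (\<xi> - k) ^ (2 * (CARD('d) + 2))) \<partial>count_space S))"
      by (intro mult_left_mono CR[rule_format, OF one B(2)[rule_format] \<xi>]) auto
    also have "\<dots> = ennreal (c * (C * B)) * (\<integral>\<^sup>+k. ennreal (a k / jb (\<xi> - k) ^ (2 * (CARD('d) + 2))) \<partial>count_space S)"
      using C(1) B(1) by (simp add: ennreal_mult c_def mult.assoc)
    finally show ?thesis .
  qed
  then have main: "\<forall>\<xi>\<in>\<Gamma>. ennreal (cmod (fourier_fun (dmult \<kappa> f) \<xi> * of_real (\<omega> \<xi>))) \<le>
      ennreal (c * (C * B)) * (\<integral>\<^sup>+k. ennreal (a k / jb (\<xi> - k) ^ (2 * (CARD('d) + 2))) \<partial>count_space S)" by (rule ballI)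
  show ?thesis
    by (rule exI[of _ \<kappa>], rule exI[of _ \<Gamma>], rule exI[of _ S], rule exI[of _ a], rule exI[of _ "c * (C * B)"])
      (intro conjI \<kappa>V \<kappa>0 \<Gamma> S a main)
qed

lemma regular_not_WF_FL:
  assumes "locally_regular f X q \<omega> x0 \<xi>0"
  shows "(x0, \<xi>0) \<notin> WF_FL q \<omega> X f"
proof -
  from regular_fourier_estimate[OF assms open_UNIV UNIV_I] obtain \<kappa> \<Gamma> S a K where
    \<kappa>: "\<kappa> \<in> test_functions (UNIV \<inter> X)" "\<kappa> x0 \<noteq> 0" and \<Gamma>: "open_cone \<Gamma>" "\<xi>0 \<in> \<Gamma>" and S: "separated S"
    and a: "\<forall>k. 0 \<le> a k" "Lp_norm (count_space S) q (\<lambda>k. ennreal (a k)) < \<infinity>"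
    and est: "\<forall>\<xi>\<in>\<Gamma>. ennreal (cmod (fourier_fun (dmult \<kappa> f) \<xi> * of_real (\<omega> \<xi>))) \<le>
      ennreal K * (\<integral>\<^sup>+k. ennreal (a k / jb (\<xi> - k) ^ (2 * (CARD('d) + 2))) \<partial>count_space S)"
    by (elim exE conjE)
  have \<kappa>X: "\<kappa> \<in> test_functions X" using \<kappa>(1) by simp
  have o: "open \<Gamma>" using \<Gamma>(1) by (simp add: open_cone_def)
  have "FL_norm q \<omega> \<Gamma> (dmult \<kappa> f) < \<infinity>"
    unfolding FL_norm_def
    by (rule amalgam_finite_lebesgue[OF S spec[OF a(1)] a(2) q o fourier_measurable[OF \<kappa>X o] bspec[OF est]])
  then show ?thesis unfolding WF_FL_def using \<kappa>X \<kappa>(2) \<Gamma> by (auto dest: less_imp_neq)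
qed

lemma regular_not_DF_FL:
  assumes "locally_regular f X q \<omega> x0 \<xi>0" and D: "x0 \<in> interior (D x0)" and L: "separated (L x0)"
  shows "(x0, \<xi>0) \<notin> DF_FL L D q \<omega> X f"
proof -
  from regular_fourier_estimate[OF assms(1) open_interior D] obtain \<kappa> \<Gamma> S a K where
    \<kappa>: "\<kappa> \<in> test_functions (interior (D x0) \<inter> X)" "\<kappa> x0 \<noteq> 0" and \<Gamma>: "open_cone \<Gamma>" "\<xi>0 \<in> \<Gamma>" and S: "separated S"
    and a: "\<forall>k. 0 \<le> a k" "Lp_norm (count_space S) q (\<lambda>k. ennreal (a k)) < \<infinity>"
    and est: "\<forall>\<xi>\<in>\<Gamma>. ennreal (cmod (fourier_fun (dmult \<kappa> f) \<xi> * of_real (\<omega> \<xi>))) \<le>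
      ennreal K * (\<integral>\<^sup>+k. ennreal (a k / jb (\<xi> - k) ^ (2 * (CARD('d) + 2))) \<partial>count_space S)"
    by (elim exE conjE)
  have \<kappa>D: "\<kappa> \<in> test_functions (D x0 \<inter> X)"
    by (rule tf_mono[OF \<kappa>(1)]) (use interior_subset in blast)
  have "FL_discrete_norm q \<omega> (\<Gamma> \<inter> L x0) (dmult \<kappa> f) < \<infinity>"
    unfolding FL_discrete_norm_def
    by (rule amalgam_finite_separated[OF S spec[OF a(1)] a(2) q L bspec[OF est]])
  then show ?thesis unfolding DF_FL_def using \<kappa>D \<kappa>(2) \<Gamma> by (auto dest: less_imp_neq)
qed

text \<open>Take m to be the conjugated window translated by x. On the fixed ball its derivatives
  are bounded by a multiple of \<open>1 / jb x ^ N\<close>, so the short-time transform is this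
  profile times the majorant in \<xi>. The L^p norm in x then costs a constant, and what remains is
  the Fourier Lebesgue estimate.\<close>

lemma regular_not_WF_M:
  assumes reg: "locally_regular f X q \<omega> x0 \<xi>0" and p: "1 \<le> p" and w: "w \<in> schwartz"
  shows "(x0, \<xi>0) \<notin> WF_M w p q \<omega> X f"
proof -
  from regular_estimate'[OF reg] obtain U S \<Gamma> a where U: "open U" "x0 \<in> U" "U \<subseteq> X" and S: "separated S"
    and \<Gamma>: "open_cone \<Gamma>" "\<xi>0 \<in> \<Gamma>" and a: "\<forall>k. 0 \<le> a k" "Lp_norm (count_space S) q (\<lambda>k. ennreal (a k)) < \<infinity>"
    and est: "\<forall>\<kappa>\<in>test_functions U. \<exists>C R n. C \<ge> 0 \<and> R > 0 \<and>
      (\<forall>m B. smooth m \<longrightarrow> (\<forall>ks. length ks \<le> n \<longrightarrow> (\<forall>x\<in>cball 0 R. cmod (iter_partial ks m x) \<le> B)) \<longrightarrow>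
        (\<forall>\<xi>\<in>\<Gamma>. ennreal (cmod (f (\<lambda>x. \<kappa> x * (m x * ch \<xi> x))) * \<omega> \<xi>) \<le>
          ennreal (C * B) * (\<integral>\<^sup>+k. ennreal (a k / jb (\<xi> - k) ^ (2 * (CARD('d) + 2))) \<partial>count_space S)))"
    by (elim exE conjE)
  obtain r where r: "r > 0" "cball x0 r \<subseteq> U" using U open_contains_cball by blast
  obtain b :: "real^'d \<Rightarrow> real" where b: "(\<lambda>x. of_real (b x)) \<in> test_functions (cball x0 r)" "\<And>x. dist x0 x < r \<Longrightarrow> b x > 0"
    using bump_function[OF r(1), of x0] by metis
  define \<kappa> where "\<kappa> x = complex_of_real (b x)" for x
  have \<kappa>: "\<kappa> \<in> test_functions (cball x0 r)" using b(1) unfolding \<kappa>_def .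
  then have \<kappa>U: "\<kappa> \<in> test_functions U" and \<kappa>X: "\<kappa> \<in> test_functions X"
    using r(2) U(3) by (auto intro: tf_mono)
  have \<kappa>0: "\<kappa> x0 \<noteq> 0" using b(2)[of x0] r(1) by (simp add: \<kappa>_def)
  from bspec[OF est \<kappa>U] obtain C R n where C: "C \<ge> 0" "R > 0" and
    CR: "\<forall>m B. smooth m \<longrightarrow> (\<forall>ks. length ks \<le> n \<longrightarrow> (\<forall>x\<in>cball 0 R. cmod (iter_partial ks m x) \<le> B)) \<longrightarrow>
        (\<forall>\<xi>\<in>\<Gamma>. ennreal (cmod (f (\<lambda>x. \<kappa> x * (m x * ch \<xi> x))) * \<omega> \<xi>) \<le>
          ennreal (C * B) * (\<integral>\<^sup>+k. ennreal (a k / jb (\<xi> - k) ^ (2 * (CARD('d) + 2))) \<partial>count_space S))"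
    by (elim exE conjE)
  define N where "N = CARD('d) + 2"
  define E where "E \<xi> = (\<integral>\<^sup>+k. ennreal (a k / jb (\<xi> - k) ^ (2 * (CARD('d) + 2))) \<partial>count_space S)" for \<xi>
  have ws: "smooth w" by (rule schwartz_smooth[OF w])
  obtain Bw where Bw: "Bw \<ge> 0" "\<forall>ks. length ks \<le> n \<longrightarrow> (\<forall>x. cmod (iter_partial ks w x) \<le> Bw / jb x ^ N)"
    using schwartz_decay[OF w] by metis
  define c where "c = cmod (fc TYPE('d))"
  define K where "K = c * (C * (Bw * (1 + R) ^ N))"
  have K0: "0 \<le> K" using C Bw(1) by (simp add: K_def c_def)
  define v where "v \<xi> x = ennreal (cmod (stft w (dmult \<kappa> f) x \<xi> * of_real (\<omega> \<xi>)))" for \<xi> x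
  have v: "v \<xi> x \<le> ennreal (1 / jb x ^ N) * (ennreal K * E \<xi>)" if \<xi>: "\<xi> \<in> \<Gamma>" for \<xi> x
  proof -
    have sm: "smooth (\<lambda>y. cnj (w (y - x)))" by (intro smooth_cnj smooth_shift ws)
    have "\<forall>ks. length ks \<le> n \<longrightarrow> (\<forall>y\<in>cball 0 R. cmod (iter_partial ks (\<lambda>y. cnj (w (y - x))) y) \<le> Bw * (1 + R) ^ N / jb x ^ N)"
    proof (intro allI impI ballI)
      fix ks :: "'d list" and y :: "real^'d"
      assume ks: "length ks \<le> n" and y: "y \<in> cball 0 R"
      \<comment> \<open>Decay in y - x is decay in x, at the price of a power of 1 + R, because y
        stays in the ball.\<close>
      have "jb x \<le> jb (x - y) * jb y" by (rule jb_le_mult)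
      also have "\<dots> \<le> jb (y - x) * (1 + R)" unfolding jb_commute[of x y] using y by (intro mult_left_mono) (auto simp: jb_def)
      finally have "jb x ^ N \<le> (jb (y - x) * (1 + R)) ^ N" by (intro power_mono) auto
      then have "1 / jb (y - x) ^ N \<le> (1 + R) ^ N / jb x ^ N"
        using C(2) by (simp add: divide_simps power_mult_distrib mult.commute)
      then have "Bw * (1 / jb (y - x) ^ N) \<le> Bw * ((1 + R) ^ N / jb x ^ N)" using Bw(1) by (rule mult_left_mono)
      moreover have "cmod (iter_partial ks (\<lambda>y. cnj (w (y - x))) y) \<le> Bw / jb (y - x) ^ N"
        unfolding iter_partial_window[OF ws] complex_mod_cnj using Bw(2) ks by blast
      ultimately show "cmod (iter_partial ks (\<lambda>y. cnj (w (y - x))) y) \<le> Bw * (1 + R) ^ N / jb x ^ N" by simp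
    qed
    from CR[rule_format, OF sm this[rule_format] \<xi>]
    have le: "ennreal (cmod (f (\<lambda>y. \<kappa> y * (cnj (w (y - x)) * ch \<xi> y))) * \<omega> \<xi>) \<le> ennreal (C * (Bw * (1 + R) ^ N / jb x ^ N)) * E \<xi>"
      unfolding E_def by simp
    have "cmod (stft w (dmult \<kappa> f) x \<xi> * of_real (\<omega> \<xi>)) = c * (cmod (f (\<lambda>y. \<kappa> y * (cnj (w (y - x)) * ch \<xi> y))) * \<omega> \<xi>)"
      unfolding stft_dmult[OF f X \<kappa>X ws] norm_mult c_def using \<omega>_pos[of \<xi>] by simp
    then have "v \<xi> x = ennreal c * ennreal (cmod (f (\<lambda>y. \<kappa> y * (cnj (w (y - x)) * ch \<xi> y))) * \<omega> \<xi>)"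
      unfolding v_def using \<omega>_pos[of \<xi>] by (simp add: ennreal_mult c_def)
    also have "\<dots> \<le> ennreal c * (ennreal (C * (Bw * (1 + R) ^ N / jb x ^ N)) * E \<xi>)" by (intro mult_left_mono le) simp
    also have "\<dots> = ennreal (c * (C * (Bw * (1 + R) ^ N / jb x ^ N))) * E \<xi>"
    proof -
      have y: "0 \<le> C * (Bw * (1 + R) ^ N / jb x ^ N)" using C Bw(1) by simp
      have c0: "0 \<le> c" by (simp add: c_def)
      show ?thesis unfolding ennreal_mult[OF c0 y] by (simp only: mult.assoc)
    qed
    also have "c * (C * (Bw * (1 + R) ^ N / jb x ^ N)) = 1 / jb x ^ N * K" by (simp add: K_def)
    also have "ennreal (1 / jb x ^ N * K) * E \<xi> = ennreal (1 / jb x ^ N) * (ennreal K * E \<xi>)"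
      using K0 by (subst ennreal_mult) (simp_all add: mult.assoc)
    finally show ?thesis .
  qed
  have "(\<integral>\<^sup>+(x::real^'d). ennreal (1 / jb x ^ N) \<partial>lebesgue) = (\<integral>\<^sup>+(x::real^'d). ennreal (1 / jb x ^ N) \<partial>lborel)"
    by (rule nn_integral_completion)
  also have "\<dots> < \<infinity>" using nn_integral_jb[where 'a = "real^'d"] by (simp add: N_def)
  finally obtain l where l: "(\<integral>\<^sup>+(x::real^'d). ennreal (1 / jb x ^ N) \<partial>lebesgue) = ennreal l" "0 \<le> l"
    by (cases "\<integral>\<^sup>+(x::real^'d). ennreal (1 / jb x ^ N) \<partial>lebesgue") auto
  have mv: "v \<xi> \<in> borel_measurable lebesgue" for \<xi>
  proof -
    have "continuous_on UNIV (\<lambda>x. stft w (dmult \<kappa> f) x \<xi>)"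
      using continuous_on_compose2[OF continuous_stft[OF f X \<kappa>X w], of UNIV "\<lambda>x. (x, \<xi>)"] by (simp add: continuous_on_Pair continuous_on_id)
    then have "(\<lambda>x. stft w (dmult \<kappa> f) x \<xi>) \<in> borel_measurable lebesgue"
      using borel_measurable_continuous_onI by (intro measurable_completion) simp
    then show ?thesis unfolding v_def by measurable
  qed
  have mj: "(\<lambda>x::real^'d. 1 / jb x ^ N) \<in> borel_measurable lebesgue"
    unfolding jb_def by (rule measurable_completion) measurable
  have inner: "Lp_norm lebesgue p (v \<xi>) \<le> ennreal ((l + 1) * K) * E \<xi>" if "\<xi> \<in> \<Gamma>" for \<xi>
  proof -
    have "Lp_norm lebesgue p (v \<xi>) \<le> ennreal (l + 1) * (ennreal K * E \<xi>)"
      by (rule Lp_norm_le[OF p mv mj _ inverse_jb_le_1 _ l(2) v[OF that]]) (use l(1) in simp_all)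
    then show ?thesis using l(2) K0 by (simp add: ennreal_mult mult.assoc)
  qed
  have o: "open \<Gamma>" using \<Gamma>(1) by (simp add: open_cone_def)
  have "(\<lambda>\<xi>. Lp_norm lebesgue p (v \<xi>)) \<in> borel_measurable lebesgue"
    unfolding v_def by (rule Lp_norm_slice_measurable[OF p continuous_stft[OF f X \<kappa>X w] \<omega>_measurable \<omega>_pos])
  then have mu: "(\<lambda>\<xi>. Lp_norm lebesgue p (v \<xi>)) \<in> borel_measurable (lebesgue_on \<Gamma>)" by (rule measurable_restrict_space1)
  have "M_norm w p q \<omega> \<Gamma> (dmult \<kappa> f) < \<infinity>"
    unfolding M_norm_def v_def[symmetric]
    by (rule amalgam_finite_lebesgue[OF S spec[OF a(1)] a(2) q o mu inner[unfolded E_def]])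
  then show ?thesis unfolding WF_M_def using \<kappa>X \<kappa>0 \<Gamma> by (auto dest: less_imp_neq)
qed

end

section \<open>Supports of Gabor windows, and regularity for Gabor coefficients\<close>

lemma supp_gabor:
  "supp (gabor \<psi> s y \<eta>) = supp (\<lambda>x. of_real (\<psi> ((1 / s) *\<^sub>R (x - s *\<^sub>R y))))"
  unfolding supp_def gabor_def by simp

lemma cnj_gabor: "cnj (gabor \<psi> s y \<eta> x) = of_real (\<psi> ((1 / s) *\<^sub>R (x - s *\<^sub>R y))) * ch \<eta> x"
  unfolding gabor_def ch_def by (simp add: exp_cnj)

lemma supp_gabor_subset:
  assumes s: "s > 0" and R: "supp (\<lambda>x. complex_of_real (\<psi> x)) \<subseteq> cball 0 R"
  shows "supp (\<lambda>x. complex_of_real (\<psi> ((1 / s) *\<^sub>R (x - s *\<^sub>R y)))) \<subseteq> cball (s *\<^sub>R y) (s * R)"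
proof (rule supp_subsetI)
  fix x
  assume "x \<notin> cball (s *\<^sub>R y) (s * R)"
  then have "s * R < norm (x - s *\<^sub>R y)" by (simp add: dist_norm norm_minus_commute)
  then have "R < norm ((1 / s) *\<^sub>R (x - s *\<^sub>R y))" using s by (simp add: pos_less_divide_eq mult.commute)
  then have "(1 / s) *\<^sub>R (x - s *\<^sub>R y) \<notin> supp (\<lambda>x. complex_of_real (\<psi> x))" using R by auto
  then show "complex_of_real (\<psi> ((1 / s) *\<^sub>R (x - s *\<^sub>R y))) = 0" by (rule supp_outside)
qed simp

lemma gabor_window_tf:
  fixes y :: "real^'d"
  assumes s: "s > 0" and \<psi>: "(\<lambda>x. complex_of_real (\<psi> x)) \<in> test_functions UNIV"
    and X: "supp (\<lambda>x. complex_of_real (\<psi> ((1 / s) *\<^sub>R (x - s *\<^sub>R y)))) \<subseteq> X"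
  shows "(\<lambda>x. complex_of_real (\<psi> ((1 / s) *\<^sub>R (x - s *\<^sub>R y)))) \<in> test_functions X"
proof -
  obtain R where R: "R > 0" "supp (\<lambda>x. complex_of_real (\<psi> x)) \<subseteq> cball 0 R" using bounded_supp[OF \<psi>] by metis
  have "compact (supp (\<lambda>x. complex_of_real (\<psi> ((1 / s) *\<^sub>R (x - s *\<^sub>R y)))))"
    using bounded_subset[OF bounded_cball supp_gabor_subset[OF s R(2)]] closed_supp
    by (simp add: compact_eq_bounded_closed)
  moreover have "smooth (\<lambda>x. complex_of_real (\<psi> ((1 / s) *\<^sub>R (x - s *\<^sub>R y))))"
    using smooth_affine[OF tf_smooth[OF \<psi>], of "1 / s" "- y"] s by (simp add: scaleR_diff_right)
  ultimately show ?thesis using X unfolding test_functions_def by blast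
qed

text \<open>Windows at scale s are supported in balls of radius s times a constant about s y, so
  only lattice points near x0/s matter, and a separated set has finitely many of these.\<close>

lemma gabor_near_finite:
  assumes s: "s > 0" and \<phi>: "(\<lambda>x. complex_of_real (\<phi> x)) \<in> test_functions UNIV"
    and \<psi>: "(\<lambda>x. complex_of_real (\<psi> x)) \<in> test_functions UNIV" and G1: "separated G1"
  shows "finite (gabor_near G1 G2 \<phi> \<psi> x0 s)"
proof -
  obtain R1 R2 where R: "supp (\<lambda>x. complex_of_real (\<phi> x)) \<subseteq> cball 0 R1" "supp (\<lambda>x. complex_of_real (\<psi> x)) \<subseteq> cball 0 R2"
    using bounded_supp[OF \<phi>] bounded_supp[OF \<psi>] by metis
  have "gabor_near G1 G2 \<phi> \<psi> x0 s \<subseteq> G1 \<inter> cball ((1 / s) *\<^sub>R x0) (max R1 R2)"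
  proof
    fix y assume "y \<in> gabor_near G1 G2 \<phi> \<psi> x0 s"
    then have y: "y \<in> G1" and "x0 \<in> cball (s *\<^sub>R y) (s * R1) \<or> x0 \<in> cball (s *\<^sub>R y) (s * R2)"
      unfolding gabor_near_def supp_gabor using supp_gabor_subset[OF s R(1)] supp_gabor_subset[OF s R(2)] by blast+
    then have "norm (s *\<^sub>R y - x0) \<le> s * max R1 R2"
      using s by (auto simp: dist_norm intro: order_trans mult_left_mono)
    also have "s *\<^sub>R y - x0 = s *\<^sub>R (y - (1 / s) *\<^sub>R x0)" using s by (simp add: scaleR_diff_right)
    finally have "norm (y - (1 / s) *\<^sub>R x0) \<le> max R1 R2" using s by simp
    then show "y \<in> G1 \<inter> cball ((1 / s) *\<^sub>R x0) (max R1 R2)" using y by (simp add: dist_norm norm_minus_commute)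
  qed
  then show ?thesis using separated_finite[OF G1 bounded_cball] finite_subset by blast
qed

text \<open>At a sufficiently small scale all windows attached to x0 are test functions on U, so
  each may serve as the cut-off in the general estimate with m = 1. There are finitely many of them,
  and the inner p-sum costs a constant.\<close>

lemma (in weighted_distribution) regular_not_DF_M:
  assumes reg: "locally_regular f X q \<omega> x0 \<xi>0" and p: "1 \<le> p"
    and G: "separated G1" "separated G2"
    and \<phi>: "(\<lambda>x. complex_of_real (\<phi> x)) \<in> test_functions UNIV"
    and \<psi>: "(\<lambda>x. complex_of_real (\<psi> x)) \<in> test_functions UNIV"
  shows "(x0, \<xi>0) \<notin> DF_M G1 G2 \<phi> \<psi> C0 p q \<omega> X f"
proof -
  from regular_estimate'[OF reg] obtain U S \<Gamma> a where U: "open U" "x0 \<in> U" "U \<subseteq> X" and S: "separated S"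
    and \<Gamma>: "open_cone \<Gamma>" "\<xi>0 \<in> \<Gamma>" and a: "\<forall>k. 0 \<le> a k" "Lp_norm (count_space S) q (\<lambda>k. ennreal (a k)) < \<infinity>"
    and est: "\<forall>\<kappa>\<in>test_functions U. \<exists>C R n. C \<ge> 0 \<and> R > 0 \<and>
      (\<forall>m B. smooth m \<longrightarrow> (\<forall>ks. length ks \<le> n \<longrightarrow> (\<forall>x\<in>cball 0 R. cmod (iter_partial ks m x) \<le> B)) \<longrightarrow>
        (\<forall>\<xi>\<in>\<Gamma>. ennreal (cmod (f (\<lambda>x. \<kappa> x * (m x * ch \<xi> x))) * \<omega> \<xi>) \<le>
          ennreal (C * B) * (\<integral>\<^sup>+k. ennreal (a k / jb (\<xi> - k) ^ (2 * (CARD('d) + 2))) \<partial>count_space S)))"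
    by (elim exE conjE)
  define E where "E \<xi> = (\<integral>\<^sup>+k. ennreal (a k / jb (\<xi> - k) ^ (2 * (CARD('d) + 2))) \<partial>count_space S)" for \<xi>
  obtain r where r: "r > 0" "cball x0 r \<subseteq> U" using U open_contains_cball by blast
  obtain R1 R2 where R12: "R1 > 0" "supp (\<lambda>x. complex_of_real (\<phi> x)) \<subseteq> cball 0 R1" "supp (\<lambda>x. complex_of_real (\<psi> x)) \<subseteq> cball 0 R2"
    using bounded_supp[OF \<phi>] bounded_supp[OF \<psi>] by metis
  define R where "R = max R1 R2"
  have R0: "R > 0" using R12(1) by (simp add: R_def)
  have R: "supp (\<lambda>x. complex_of_real (\<phi> x)) \<subseteq> cball 0 R" "supp (\<lambda>x. complex_of_real (\<psi> x)) \<subseteq> cball 0 R"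
    using R12 unfolding R_def by auto
  \<comment> \<open>A support that contains x0 lies within 2 s R of x0; this scale makes that at
    most r.\<close>
  define s where "s = min 1 (r / (2 * R))"
  have s: "0 < s" "s \<le> 1" using r(1) R0 by (simp_all add: s_def)
  have "s * (2 * R) \<le> r / (2 * R) * (2 * R)" using R0 by (intro mult_right_mono) (simp_all add: s_def)
  then have sr: "2 * (s * R) \<le> r" using R0 by simp
  define J where "J = gabor_near G1 G2 \<phi> \<psi> x0 s"
  define \<psi>' where "\<psi>' y x = complex_of_real (\<psi> ((1 / s) *\<^sub>R (x - s *\<^sub>R y)))" for y x :: "real^'d"
  have J: "finite J" unfolding J_def by (rule gabor_near_finite[OF s(1) \<phi> \<psi> G(1)])
  have sub: "supp (\<psi>' y) \<subseteq> U" if "y \<in> J" for y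
  proof -
    have "x0 \<in> cball (s *\<^sub>R y) (s * R)"
      using that supp_gabor_subset[OF s(1) R(1)] supp_gabor_subset[OF s(1) R(2)] unfolding J_def gabor_near_def supp_gabor by blast
    then have "cball (s *\<^sub>R y) (s * R) \<subseteq> cball x0 r"
    proof (intro subsetI)
      fix z assume "x0 \<in> cball (s *\<^sub>R y) (s * R)" "z \<in> cball (s *\<^sub>R y) (s * R)"
      then show "z \<in> cball x0 r" using sr dist_triangle[of x0 z "s *\<^sub>R y"] by (simp add: dist_commute)
    qed
    then show ?thesis unfolding \<psi>'_def using supp_gabor_subset[OF s(1) R(2), of y] r(2) by blast
  qed
  have tf: "\<psi>' y \<in> test_functions U" if "y \<in> J" for y
    using gabor_window_tf[OF s(1) \<psi> sub[OF that, unfolded \<psi>'_def]] by (simp add: \<psi>'_def[abs_def])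
  have one: "smooth (\<lambda>x::real^'d. 1)" by simp
  have "\<forall>y\<in>J. \<exists>C\<ge>0. \<forall>\<xi>\<in>\<Gamma>. ennreal (cmod (f (\<lambda>x. \<psi>' y x * ch \<xi> x)) * \<omega> \<xi>) \<le> ennreal C * E \<xi>"
  proof
    fix y assume y: "y \<in> J"
    from bspec[OF est tf[OF y]] obtain C R n where C: "C \<ge> 0" "R > 0" and
      CR: "\<forall>m B. smooth m \<longrightarrow> (\<forall>ks. length ks \<le> n \<longrightarrow> (\<forall>x\<in>cball 0 R. cmod (iter_partial ks m x) \<le> B)) \<longrightarrow>
        (\<forall>\<xi>\<in>\<Gamma>. ennreal (cmod (f (\<lambda>x. \<psi>' y x * (m x * ch \<xi> x))) * \<omega> \<xi>) \<le> ennreal (C * B) * E \<xi>)"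
      unfolding E_def by (elim exE conjE)
    obtain B where B: "B \<ge> 0" "\<forall>ks. length ks \<le> n \<longrightarrow> (\<forall>x\<in>cball 0 R. cmod (iter_partial ks (\<lambda>x::real^'d. 1) x) \<le> B)"
      using smooth_derivs_bounded_on[OF one compact_cball] by blast
    have "\<forall>\<xi>\<in>\<Gamma>. ennreal (cmod (f (\<lambda>x. \<psi>' y x * ch \<xi> x)) * \<omega> \<xi>) \<le> ennreal (C * B) * E \<xi>"
    proof
      fix \<xi> assume "\<xi> \<in> \<Gamma>"
      from CR[rule_format, OF one B(2)[rule_format] this]
      show "ennreal (cmod (f (\<lambda>x. \<psi>' y x * ch \<xi> x)) * \<omega> \<xi>) \<le> ennreal (C * B) * E \<xi>" by simp
    qed
    moreover have "0 \<le> C * B" using C(1) B(1) by simp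
    ultimately show "\<exists>C\<ge>0. \<forall>\<xi>\<in>\<Gamma>. ennreal (cmod (f (\<lambda>x. \<psi>' y x * ch \<xi> x)) * \<omega> \<xi>) \<le> ennreal C * E \<xi>" by blast
  qed
  from bchoice[OF this] obtain C where
    C: "\<forall>y\<in>J. C y \<ge> 0 \<and> (\<forall>\<xi>\<in>\<Gamma>. ennreal (cmod (f (\<lambda>x. \<psi>' y x * ch \<xi> x)) * \<omega> \<xi>) \<le> ennreal (C y) * E \<xi>)" ..
  define K where "K = cmod C0 * (\<Sum>y\<in>J. C y)"
  have K0: "0 \<le> K" unfolding K_def using C by (intro mult_nonneg_nonneg sum_nonneg) auto
  define v where "v \<xi> y = ennreal (cmod (gabor_coeff C0 \<psi> f s y \<xi> * of_real (\<omega> \<xi>)))" for \<xi> y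
  have v: "v \<xi> y \<le> ennreal K * E \<xi>" if \<xi>: "\<xi> \<in> \<Gamma>" and y: "y \<in> J" for \<xi> y
  proof -
    have "v \<xi> y = ennreal (cmod C0) * ennreal (cmod (f (\<lambda>x. \<psi>' y x * ch \<xi> x)) * \<omega> \<xi>)"
      unfolding v_def gabor_coeff_def cnj_gabor \<psi>'_def norm_mult using \<omega>_pos[of \<xi>] by (simp add: ennreal_mult mult.assoc)
    also have "\<dots> \<le> ennreal (cmod C0) * (ennreal (C y) * E \<xi>)" using C y \<xi> by (intro mult_left_mono) auto
    also have "\<dots> = ennreal (cmod C0 * C y) * E \<xi>" using C y by (simp add: ennreal_mult mult.assoc)
    also have "\<dots> \<le> ennreal K * E \<xi>"
      unfolding K_def using C J y by (intro mult_right_mono ennreal_leI mult_left_mono member_le_sum) auto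
    finally show ?thesis .
  qed
  define u where "u \<xi> = Lp_norm (count_space J) p (v \<xi>)" for \<xi>
  have u: "u \<xi> \<le> ennreal ((real (card J) + 1) * K) * E \<xi>" if \<xi>: "\<xi> \<in> \<Gamma>" for \<xi>
  proof -
    \<comment> \<open>Set to 0 outside J, since the pointwise bound in \<open>Lp_norm_le\<close> is
      required for all arguments.\<close>
    have "u \<xi> = Lp_norm (count_space J) p (\<lambda>y. if y \<in> J then v \<xi> y else 0)"
    proof (cases "p = \<infinity>")
      case True
      have "esssup (count_space J) (v \<xi>) = esssup (count_space J) (\<lambda>y. if y \<in> J then v \<xi> y else 0)"
        by (rule esssup_AE_cong) (auto simp: AE_count_space)
      then show ?thesis unfolding u_def Lp_norm_def if_P[OF True] .
    next
      case False
      have "(\<integral>\<^sup>+y. ennreal_powr (v \<xi> y) (enn2real p) \<partial>count_space J) = (\<integral>\<^sup>+y. ennreal_powr (if y \<in> J then v \<xi> y else 0) (enn2real p) \<partial>count_space J)"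
        by (rule nn_integral_cong) simp
      then show ?thesis unfolding u_def Lp_norm_def if_not_P[OF False] by simp
    qed
    also have "\<dots> \<le> ennreal (real (card J) + 1) * (ennreal K * E \<xi>)"
      by (rule Lp_norm_le[OF p, where h = "\<lambda>_. 1"]) (use J v[OF \<xi>] in \<open>simp_all add: ennreal_of_nat_eq_real_of_nat\<close>)
    finally show ?thesis using K0 by (simp add: ennreal_mult mult.assoc)
  qed
  have fin: "Lp_norm (count_space (\<Gamma> \<inter> G2)) q u < \<infinity>"
    by (rule amalgam_finite_separated[OF S spec[OF a(1)] a(2) q G(2) u[unfolded E_def]])
  have sX: "\<forall>y\<in>J. \<forall>\<eta>\<in>G2. supp (gabor \<psi> s y \<eta>) \<subseteq> X"
    unfolding supp_gabor using sub U(3) unfolding \<psi>'_def by blast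
  show ?thesis
  proof
    assume "(x0, \<xi>0) \<in> DF_M G1 G2 \<phi> \<psi> C0 p q \<omega> X f"
    then have "Lp_norm (count_space (\<Gamma> \<inter> G2)) q u = \<infinity>"
      using s sX \<Gamma> unfolding DF_M_def mem_Collect_eq case_prod_conv u_def[abs_def] v_def[abs_def] J_def by blast
    then show False using fin by simp
  qed
qed

subsection \<open>Finiteness of one of the Fourier norms implies regularity\<close>

text \<open>Hoelder's inequality on a set of finite measure, with a constant that serves all p. With
  a the L^p norm, the pointwise bound g <= a + a (g/a)^p integrates over Q to at most (l + 1)
  a.\<close>

lemma nn_integral_le_Lp_norm:
  assumes p: "1 \<le> p" and g: "g \<in> borel_measurable M" "\<And>x. 0 \<le> g x"
    and Q: "Q \<in> sets M" "emeasure M Q \<le> ennreal l" "0 \<le> l"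
  shows "(\<integral>\<^sup>+x. ennreal (g x) * indicator Q x \<partial>M) \<le> ennreal (l + 1) * Lp_norm M p (\<lambda>x. ennreal (g x))"
proof (cases "p = \<infinity>")
  case True
  have "(\<integral>\<^sup>+x. ennreal (g x) * indicator Q x \<partial>M) \<le> (\<integral>\<^sup>+x. esssup M (\<lambda>x. ennreal (g x)) * indicator Q x \<partial>M)"
    by (intro nn_integral_mono_AE eventually_mono[OF esssup_AE[where M = M and f = "\<lambda>x. ennreal (g x)"]] mult_right_mono) auto
  also have "\<dots> = esssup M (\<lambda>x. ennreal (g x)) * emeasure M Q" using Q(1) by (rule nn_integral_cmult_indicator)
  also have "\<dots> \<le> esssup M (\<lambda>x. ennreal (g x)) * ennreal (l + 1)"
    by (intro mult_left_mono order_trans[OF Q(2)] ennreal_leI) auto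
  finally show ?thesis unfolding Lp_norm_def if_P[OF True] by (simp add: mult.commute)
next
  case False
  note [measurable] = Q(1) g(1)
  define r where "r = enn2real p"
  have r: "1 \<le> r" unfolding r_def by (rule enn2real_ge_1[OF p False])
  define I where "I = (\<integral>\<^sup>+x. ennreal (g x powr r) \<partial>M)"
  have L: "Lp_norm M p (\<lambda>x. ennreal (g x)) = ennreal_powr I (1 / r)"
    unfolding Lp_norm_def if_not_P[OF False] r_def[symmetric] I_def by (simp only: ennreal_powr_ennreal[OF g(2)])
  show ?thesis
  proof (cases I)
    case top
    have "ennreal (l + 1) \<noteq> 0" using Q(3) by simp
    then have "ennreal (l + 1) * Lp_norm M p (\<lambda>x. ennreal (g x)) = top" unfolding L top ennreal_powr_def by (simp add: ennreal_mult_top)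
    then show ?thesis by simp
  next
    case (real i)
    show ?thesis
    proof (cases "i = 0")
      case True
      have "AE x in M. ennreal (g x powr r) = 0"
        using real True unfolding I_def by (subst nn_integral_0_iff_AE[symmetric]) (use g(1) in \<open>auto\<close>)
      then have "AE x in M. ennreal (g x) * indicator Q x = 0" by (rule AE_mp) (auto simp: powr_eq_0_iff)
      then have "(\<integral>\<^sup>+x. ennreal (g x) * indicator Q x \<partial>M) = (\<integral>\<^sup>+x. 0 \<partial>M)" by (rule nn_integral_cong_AE)
      then show ?thesis by simp
    next
      case False
      then have i: "i > 0" using real by simp
      \<comment> \<open>The L^p norm itself; its r-th power is i, so the second term of the bound
        integrates to a.\<close>
      define a where "a = i powr (1 / r)"
      have a: "a > 0" "a powr r = i" using i r by (simp_all add: a_def powr_powr)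
      have "(\<integral>\<^sup>+x. ennreal (g x) * indicator Q x \<partial>M) \<le> (\<integral>\<^sup>+x. ennreal a * indicator Q x + ennreal (a / i) * ennreal (g x powr r) \<partial>M)"
      proof (intro nn_integral_mono)
        fix x
        have "g x \<le> a + a / i * g x powr r"
        proof (cases "g x \<le> a")
          case True
          then show ?thesis using a(1) i by (simp add: add_increasing2)
        next
          case False
          have "(g x / a) powr 1 \<le> (g x / a) powr r" using r False a(1) by (intro powr_mono) auto
          then have "g x / a \<le> g x powr r / i" using False a g(2)[of x] by (simp add: powr_divide)
          then have "g x \<le> a / i * g x powr r" using a(1) i by (simp add: field_simps)
          then show ?thesis using a(1) by simp
        qed
        then have "ennreal (g x) \<le> ennreal a + ennreal (a / i) * ennreal (g x powr r)"
          using a(1) i by (simp add: ennreal_mult[symmetric] ennreal_plus[symmetric] ennreal_leI del: ennreal_plus)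
        then show "ennreal (g x) * indicator Q x \<le> ennreal a * indicator Q x + ennreal (a / i) * ennreal (g x powr r)"
          by (simp add: indicator_def)
      qed
      also have "\<dots> = (\<integral>\<^sup>+x. ennreal a * indicator Q x \<partial>M) + (\<integral>\<^sup>+x. ennreal (a / i) * ennreal (g x powr r) \<partial>M)"
        by (intro nn_integral_add) measurable
      also have "\<dots> = ennreal a * emeasure M Q + ennreal (a / i) * I"
        unfolding I_def using Q(1) g(1) by (simp add: nn_integral_cmult nn_integral_cmult_indicator)
      also have "\<dots> \<le> ennreal a * ennreal l + ennreal (a / i) * ennreal i"
        using Q(2) real by (intro add_mono mult_left_mono) auto
      also have "\<dots> = ennreal ((l + 1) * a)"
        using a(1) i Q(3) by (simp add: ennreal_mult[symmetric] ennreal_plus[symmetric] algebra_simps del: ennreal_plus)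
      also have "\<dots> = ennreal (l + 1) * Lp_norm M p (\<lambda>x. ennreal (g x))"
        unfolding L real(2) ennreal_powr_ennreal[OF real(1)] a_def[symmetric] using a(1) Q(3) by (intro ennreal_mult) auto
      finally show ?thesis .
    qed
  qed
qed

lemma Lp_norm_dominated:
  assumes u: "u \<in> borel_measurable M" and le: "\<And>x. x \<in> space M \<Longrightarrow> u x \<le> ennreal K * v x" and v: "Lp_norm M q v < \<infinity>"
    and q: "1 \<le> q"
  shows "Lp_norm M q u < \<infinity>"
proof -
  \<comment> \<open>A strictly positive majorant of K, so that u can be divided by it.\<close>
  define c where "c = max K 0 + 1"
  have c: "c > 0" "K \<le> c" by (simp_all add: c_def)
  define u' where "u' x = ennreal (1 / c) * u x" for x
  have inv: "ennreal (1 / c) * ennreal c = 1" "ennreal c * ennreal (1 / c) = 1" using c(1) by (simp_all add: ennreal_mult[symmetric])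
  have uu: "u x = ennreal c * u' x" for x unfolding u'_def by (simp only: mult.assoc[symmetric] inv mult_1)
  have mu': "u' \<in> borel_measurable M" unfolding u'_def using u by measurable
  have "u' x \<le> v x" if "x \<in> space M" for x
  proof -
    have "u' x \<le> ennreal (1 / c) * (ennreal K * v x)" unfolding u'_def by (intro mult_left_mono le that) simp
    also have "\<dots> \<le> ennreal (1 / c) * (ennreal c * v x)" using c by (intro mult_left_mono mult_right_mono ennreal_leI) auto
    also have "\<dots> = v x" by (simp only: mult.assoc[symmetric] inv mult_1)
    finally show ?thesis .
  qed
  from Lp_norm_mono[OF mu' this v] have fin: "Lp_norm M q u' < \<infinity>" .
  show ?thesis
  proof (cases "q = \<infinity>")
    case True
    have e: "esssup M u' < \<infinity>" using fin unfolding Lp_norm_less_top if_P[OF True] .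
    have "esssup M u \<le> ennreal c * esssup M u'"
    proof (rule esssup_I[OF u])
      show "AE x in M. u x \<le> ennreal c * esssup M u'"
        unfolding uu by (rule eventually_mono[OF esssup_AE[where M = M and f = u']]) (rule mult_left_mono, simp_all)
    qed
    also have "\<dots> < \<infinity>" using e by (simp add: ennreal_mult_less_top)
    finally show ?thesis unfolding Lp_norm_less_top if_P[OF True] .
  next
    case False
    define r where "r = enn2real q"
    have r: "1 \<le> r" unfolding r_def by (rule enn2real_ge_1[OF q False])
    have "(\<integral>\<^sup>+x. ennreal_powr (u x) r \<partial>M) \<le> (\<integral>\<^sup>+x. ennreal (c powr r) * ennreal_powr (u' x) r \<partial>M)"
    proof (intro nn_integral_mono)
      fix x
      show "ennreal_powr (u x) r \<le> ennreal (c powr r) * ennreal_powr (u' x) r"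
      proof (cases "u' x")
        case top
        have "ennreal (c powr r) \<noteq> 0" using c(1) by simp
        then show ?thesis unfolding top ennreal_powr_def by (simp add: ennreal_mult_top)
      next
        case (real t)
        then have ux: "u x = ennreal (c * t)" using uu c(1) by (simp add: ennreal_mult)
        have "ennreal_powr (u x) r = ennreal ((c * t) powr r)"
          unfolding ux using real(1) c(1) by (intro ennreal_powr_ennreal) simp
        then show ?thesis using real c(1) by (simp add: ennreal_powr_ennreal powr_mult ennreal_mult)
      qed
    qed
    also have "\<dots> = ennreal (c powr r) * (\<integral>\<^sup>+x. ennreal_powr (u' x) r \<partial>M)"
      using mu' by (intro nn_integral_cmult) measurable
    also have "\<dots> < \<infinity>"
    proof -
      have "(\<integral>\<^sup>+x. ennreal_powr (u' x) r \<partial>M) < \<infinity>" using fin unfolding Lp_norm_less_top if_not_P[OF False] r_def .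
      then show ?thesis by (simp add: ennreal_mult_less_top)
    qed
    finally show ?thesis unfolding Lp_norm_less_top if_not_P[OF False] r_def .
  qed
qed

text \<open>For \<theta> supported where \<kappa> does not vanish, \<theta>/\<kappa> is a test
  function in the parallelepiped. Its product with m is expanded in the Fourier series there, and
  multiplying by \<kappa> recovers \<theta> m.\<close>

lemma expands_parallelepiped:
  fixes e \<epsilon> :: "'d \<Rightarrow> real^'d"
  assumes d: "\<And>i j. e i \<bullet> \<epsilon> j = (if i = j then c else 0)" and c: "0 < c" "c < 2 * pi"
    and \<kappa>: "\<kappa> \<in> test_functions {a + (\<Sum>j\<in>UNIV. t j *\<^sub>R e j) | t. \<forall>j. 0 \<le> t j \<and> t j \<le> 1}"
  shows "expands {x. \<kappa> x \<noteq> 0} (dual_lattice \<epsilon> \<xi>0) {j} (\<lambda>_. \<kappa>)"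
proof -
  define D where "D = {a + (\<Sum>j\<in>UNIV. t j *\<^sub>R e j) | t. \<forall>j. 0 \<le> t j \<and> t j \<le> 1}"
  define L where "L = dual_lattice \<epsilon> \<xi>0"
  have \<kappa>D: "\<kappa> \<in> test_functions D" using \<kappa> unfolding D_def .
  obtain V where V: "\<forall>\<alpha> x. \<alpha> \<in> test_functions D \<longrightarrow> x \<in> D \<longrightarrow>
      \<alpha> x = V * (\<integral>k. (\<integral>y. \<alpha> y * ch (- k) y \<partial>lborel) * ch k x \<partial>count_space L)"
  proof (rule fourier_series[OF d, where a = a and ?\<xi>0.0 = \<xi>0, folded D_def L_def])
    fix V
    assume "\<And>\<alpha> x. \<alpha> \<in> test_functions D \<Longrightarrow> x \<in> D \<Longrightarrow>
      \<alpha> x = V * (\<integral>k. (\<integral>y. \<alpha> y * ch (- k) y \<partial>lborel) * ch k x \<partial>count_space L)"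
    then show thesis by (intro that[of V] allI impI)
  qed (rule c)+
  show ?thesis unfolding expands_def L_def[symmetric]
  proof
    fix \<theta> :: "real^'d \<Rightarrow> complex" assume \<theta>: "\<theta> \<in> test_functions {x. \<kappa> x \<noteq> 0}"
    define \<beta> where "\<beta> x = \<theta> x / \<kappa> x" for x
    have \<beta>: "\<beta> \<in> test_functions {x. \<kappa> x \<noteq> 0}" unfolding \<beta>_def by (rule tf_divide[OF \<theta> tf_smooth[OF \<kappa>D] tf_supp[OF \<theta>]])
    have sub: "{x. \<kappa> x \<noteq> 0} \<subseteq> D" using tf_outside[OF \<kappa>D] by blast
    define \<alpha> where "\<alpha> x = \<beta> x * V" for x
    have \<alpha>: "\<alpha> \<in> test_functions UNIV" unfolding \<alpha>_def by (rule tf_mult[OF tf_mono[OF \<beta>] smooth_const]) simp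
    have "\<theta> x * m x = (\<Sum>i\<in>{j}. \<kappa> x * (\<integral>k. (\<integral>y. \<alpha> y * m y * ch (- k) y \<partial>lborel) * ch k x \<partial>count_space L))" if m: "smooth m" for m x
    proof (cases "x \<in> D")
      case False
      then have "\<kappa> x = 0" "\<theta> x = 0" using tf_outside[OF \<kappa>D] tf_outside[OF \<theta>] sub by blast+
      then show ?thesis by simp
    next
      case True
      have bm: "(\<lambda>x. \<beta> x * m x) \<in> test_functions D" by (rule tf_mono[OF tf_mult[OF \<beta> m] sub])
      have i: "(\<integral>y. \<alpha> y * m y * ch (- k) y \<partial>lborel) = V * (\<integral>y. \<beta> y * m y * ch (- k) y \<partial>lborel)" for k
        unfolding \<alpha>_def by (subst integral_mult_right_zero[symmetric]) (simp add: mult_ac)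
      have "(\<integral>k. (\<integral>y. \<alpha> y * m y * ch (- k) y \<partial>lborel) * ch k x \<partial>count_space L) =
          V * (\<integral>k. (\<integral>y. \<beta> y * m y * ch (- k) y \<partial>lborel) * ch k x \<partial>count_space L)"
        unfolding i mult.assoc[of V] by (rule integral_mult_right_zero)
      also have "\<dots> = \<beta> x * m x" using V[rule_format, OF bm True] by simp
      finally have "(\<integral>k. (\<integral>y. \<alpha> y * m y * ch (- k) y \<partial>lborel) * ch k x \<partial>count_space L) = \<beta> x * m x" .
      moreover have "\<kappa> x * (\<beta> x * m x) = \<theta> x * m x"
      proof (cases "\<kappa> x = 0")
        case True
        then have "\<theta> x = 0" using tf_outside[OF \<theta>, of x] by simp
        then show ?thesis by (simp add: \<beta>_def)
      qed (simp add: \<beta>_def)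
      ultimately show ?thesis by (simp only: sum.insert finite.emptyI empty_iff not_False_eq_True sum.empty add_0_right)
    qed
    then show "\<exists>\<alpha>. (\<forall>i\<in>{j}. \<alpha> i \<in> test_functions UNIV) \<and> (\<forall>m. smooth m \<longrightarrow> (\<lambda>x. \<theta> x * m x) =
       (\<lambda>x. \<Sum>i\<in>{j}. \<kappa> x * (\<integral>k. (\<integral>y. \<alpha> i y * m y * ch (- k) y \<partial>lborel) * ch k x \<partial>count_space L)))"
      by (intro exI[of _ "\<lambda>_. \<alpha>"] conjI ballI \<alpha> allI impI ext)
  qed
qed

text \<open>The sums over the shifted lattices are integrable in the shift, hence one of them is finite.\<close>

lemma finite_lattice_sum:
  fixes h :: "real^'d \<Rightarrow> ennreal"
  assumes s: "s > 0" and h: "h \<in> borel_measurable lebesgue" and fin: "(\<integral>\<^sup>+x. h x \<partial>lebesgue) < \<infinity>"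
  shows "\<exists>\<tau>. (\<integral>\<^sup>+k. h k \<partial>count_space (dual_lattice (\<lambda>j. axis j s) \<tau>)) < \<infinity>"
proof -
  obtain h0 where h0: "h0 \<in> borel_measurable lborel" "AE x in lborel. h x = h0 x"
    using completion_ex_borel_measurable[OF h] by blast
  obtain N where N: "{x \<in> space lborel. h x \<noteq> h0 x} \<subseteq> N" "emeasure lborel N = 0" "N \<in> sets lborel"
    by (rule AE_E[OF h0(2)])
  \<comment> \<open>A Borel majorant of h with the same integral: it is infinite on the null set
    where h may differ from its Borel representative. A pointwise majorant is required because
    lattice sums do not ignore null sets.\<close>
  define H where "H x = h0 x + \<infinity> * indicator N x" for x
  have h0b [measurable]: "h0 \<in> borel_measurable borel" and Nb [measurable]: "N \<in> sets borel" using h0(1) N(3) by simp_all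
  have H: "H \<in> borel_measurable borel" unfolding H_def by measurable
  have hH: "h x \<le> H x" for x
  proof (cases "x \<in> N")
    case False
    then have "h x = h0 x" using N(1) by auto
    then show ?thesis using False by (simp add: H_def)
  qed (simp add: H_def)
  have "(\<integral>\<^sup>+x. H x \<partial>lborel) = (\<integral>\<^sup>+x. h0 x \<partial>lborel) + (\<integral>\<^sup>+x. \<infinity> * indicator N x \<partial>lborel)"
    unfolding H_def by (rule nn_integral_add) simp_all
  also have "(\<integral>\<^sup>+x. \<infinity> * indicator N x \<partial>lborel) = 0" using N(2,3) by (subst nn_integral_cmult_indicator) auto
  also have "(\<integral>\<^sup>+x. h0 x \<partial>lborel) = (\<integral>\<^sup>+x. h x \<partial>lborel)" using h0(2) by (intro nn_integral_cong_AE) auto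
  also have "\<dots> = (\<integral>\<^sup>+x. h x \<partial>lebesgue)" by (rule nn_integral_completion[symmetric])
  finally have finH: "(\<integral>\<^sup>+x. H x \<partial>lborel) < \<infinity>" using fin by simp
  define Z where "Z = {k :: real^'d. int_vec k}"
  have Z: "countable Z" unfolding Z_def by (rule countable_int_vec)
  \<comment> \<open>The translates of this open cube by s times integer vectors are
    disjoint.\<close>
  define Q where "Q = box (0::real^'d) (s *\<^sub>R One)"
  define F where "F \<tau> = (\<integral>\<^sup>+k. H (s *\<^sub>R k + \<tau>) \<partial>count_space Z)" for \<tau>
  have Hm: "(\<lambda>\<tau>. H (s *\<^sub>R k + \<tau>)) \<in> borel_measurable borel" for k by (rule measurable_compose[OF _ H]) simp
  have Qm: "Q \<in> sets borel" by (simp add: Q_def)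
  have QH: "(\<lambda>\<tau>. indicator Q (- (s *\<^sub>R k) + \<tau>) * H \<tau>) \<in> borel_measurable borel" for k
    by (intro borel_measurable_times_ennreal H measurable_compose[OF _ borel_measurable_indicator[OF Qm]]) simp
  have one: "(\<integral>\<^sup>+k. indicator Q (- (s *\<^sub>R k) + \<tau>) \<partial>count_space Z) \<le> (1::ennreal)" for \<tau>
  proof (cases "\<exists>k0\<in>Z. - (s *\<^sub>R k0) + \<tau> \<in> Q")
    case False
    then have "(\<integral>\<^sup>+k. indicator Q (- (s *\<^sub>R k) + \<tau>) \<partial>count_space Z) = (\<integral>\<^sup>+k. (0::ennreal) \<partial>count_space Z)"
      by (intro nn_integral_cong) (auto simp: indicator_def)
    then show ?thesis by simp
  next
    case True
    then obtain k0 where k0: "k0 \<in> Z" "- (s *\<^sub>R k0) + \<tau> \<in> Q" by blast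
    have "k = k0" if k: "k \<in> Z" "- (s *\<^sub>R k) + \<tau> \<in> Q" for k
    proof (rule vec_eq_iff[THEN iffD2], rule allI)
      fix i
      have co: "0 < - (s * l $ i) + \<tau> $ i \<and> - (s * l $ i) + \<tau> $ i < s" if "- (s *\<^sub>R l) + \<tau> \<in> Q" for l
      proof -
        have b: "axis i 1 \<in> (Basis :: (real^'d) set)" by (simp add: axis_in_Basis_iff)
        have "(One :: real^'d) \<bullet> axis i 1 = 1" using inner_sum_left_Basis[OF b, of "\<lambda>_. 1"] by simp
        then show ?thesis using bspec[OF that[unfolded Q_def mem_box] b] by (simp add: inner_axis)
      qed
      obtain a b where ab: "k $ i = of_int a" "k0 $ i = of_int b" using k(1) k0(1) unfolding Z_def int_vec_def by (auto elim!: Ints_cases) (metis Ints_cases)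
      have "\<bar>s * (k $ i - k0 $ i)\<bar> < s" using co[OF k(2)] co[OF k0(2)] by (simp add: right_diff_distrib abs_less_iff)
      then have "\<bar>k $ i - k0 $ i\<bar> < 1" using s by (simp add: abs_mult)
      then have "\<bar>a - b\<bar> < 1" unfolding ab by (metis of_int_diff of_int_abs of_int_less_1_iff)
      then show "k $ i = k0 $ i" unfolding ab by simp
    qed
    then have "(\<integral>\<^sup>+k. indicator Q (- (s *\<^sub>R k) + \<tau>) \<partial>count_space Z) \<le> (\<integral>\<^sup>+k. indicator {k0} k \<partial>count_space Z)"
      by (intro nn_integral_mono) (auto simp: indicator_def)
    also have "\<dots> = 1" using k0(1) by (subst nn_integral_indicator) auto
    finally show ?thesis .
  qed
  \<comment> \<open>The sums over all translates, integrated over one cube of shifts, unfold to at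
    most the integral of H over the whole space.\<close>
  have "(\<integral>\<^sup>+\<tau>. indicator Q \<tau> * F \<tau> \<partial>lborel) = (\<integral>\<^sup>+\<tau>. \<integral>\<^sup>+k. indicator Q \<tau> * H (s *\<^sub>R k + \<tau>) \<partial>count_space Z \<partial>lborel)"
    unfolding F_def by (simp add: nn_integral_cmult)
  also have "\<dots> = (\<integral>\<^sup>+k. \<integral>\<^sup>+\<tau>. indicator Q \<tau> * H (s *\<^sub>R k + \<tau>) \<partial>lborel \<partial>count_space Z)"
  proof (rule nn_integral_count_space_nn_integral[OF Z])
    show "(\<lambda>\<tau>. indicator Q \<tau> * H (s *\<^sub>R k + \<tau>)) \<in> borel_measurable lborel" for k
      using borel_measurable_times_ennreal[OF borel_measurable_indicator[OF Qm] Hm[of k]] by simp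
  qed
  also have "\<dots> = (\<integral>\<^sup>+k. \<integral>\<^sup>+\<tau>. indicator Q (- (s *\<^sub>R k) + \<tau>) * H \<tau> \<partial>lborel \<partial>count_space Z)"
  proof (rule nn_integral_cong)
    fix k :: "real^'d"
    from nn_integral_lborel_shift[OF QH[of k], of "s *\<^sub>R k"]
    show "(\<integral>\<^sup>+\<tau>. indicator Q \<tau> * H (s *\<^sub>R k + \<tau>) \<partial>lborel) = (\<integral>\<^sup>+\<tau>. indicator Q (- (s *\<^sub>R k) + \<tau>) * H \<tau> \<partial>lborel)"
      by simp
  qed
  also have "\<dots> = (\<integral>\<^sup>+\<tau>. \<integral>\<^sup>+k. indicator Q (- (s *\<^sub>R k) + \<tau>) * H \<tau> \<partial>count_space Z \<partial>lborel)"
  proof (rule nn_integral_count_space_nn_integral[OF Z, where M = lborel and f = "\<lambda>k \<tau>. indicator Q (- (s *\<^sub>R k) + \<tau>) * H \<tau>", symmetric])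
    show "(\<lambda>\<tau>. indicator Q (- (s *\<^sub>R k) + \<tau>) * H \<tau>) \<in> borel_measurable lborel" for k
      using QH[of k] by simp
  qed
  also have "\<dots> \<le> (\<integral>\<^sup>+\<tau>. 1 * H \<tau> \<partial>lborel)"
  proof (intro nn_integral_mono)
    fix \<tau> :: "real^'d"
    have "(\<integral>\<^sup>+k. indicator Q (- (s *\<^sub>R k) + \<tau>) * H \<tau> \<partial>count_space Z) = (\<integral>\<^sup>+k. indicator Q (- (s *\<^sub>R k) + \<tau>) \<partial>count_space Z) * H \<tau>"
      by (rule nn_integral_multc) (simp only: borel_measurable_count_space)
    also have "\<dots> \<le> 1 * H \<tau>" by (intro mult_right_mono one) (rule zero_le)
    finally show "(\<integral>\<^sup>+k. indicator Q (- (s *\<^sub>R k) + \<tau>) * H \<tau> \<partial>count_space Z) \<le> 1 * H \<tau>" .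
  qed
  also have "\<dots> < \<infinity>" using finH by (simp only: mult_1)
  finally have le: "(\<integral>\<^sup>+\<tau>. indicator Q \<tau> * F \<tau> \<partial>lborel) < \<infinity>" .
  have "\<exists>\<tau>\<in>Q. F \<tau> < \<infinity>"
  proof (rule ccontr)
    assume "\<not> (\<exists>\<tau>\<in>Q. F \<tau> < \<infinity>)"
    then have top: "F \<tau> = \<infinity>" if "\<tau> \<in> Q" for \<tau> using that by (auto simp: less_top[symmetric])
    have "(\<integral>\<^sup>+\<tau>. indicator Q \<tau> * F \<tau> \<partial>lborel) = (\<integral>\<^sup>+\<tau>. \<infinity> * indicator Q \<tau> \<partial>lborel)"
      by (intro nn_integral_cong) (auto simp: indicator_def top)
    also have "\<dots> = \<infinity> * emeasure lborel Q" using Qm by (subst nn_integral_cmult_indicator) auto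
    also have "emeasure lborel Q = ennreal (\<Prod>b\<in>Basis. (s *\<^sub>R One - (0::real^'d)) \<bullet> b)"
      unfolding Q_def using s by (intro emeasure_lborel_box) auto
    also have "\<infinity> * \<dots> = \<infinity>" using s by (simp add: ennreal_top_mult)
    finally show False using le by simp
  qed
  then obtain \<tau> where \<tau>: "F \<tau> < \<infinity>" by blast
  have "bij_betw (\<lambda>k. s *\<^sub>R k + \<tau>) Z (dual_lattice (\<lambda>j. axis j s) \<tau>)"
  proof (rule bij_betw_imageI)
    show "inj_on (\<lambda>k. s *\<^sub>R k + \<tau>) Z" using s by (auto intro!: inj_onI)
    have "(\<Sum>j\<in>UNIV. (k $ j) *\<^sub>R axis j s) = s *\<^sub>R k" for k :: "real^'d"
      by (simp add: vec_eq_iff axis_def sum_component if_distrib[where f = "\<lambda>x. _ * x"] cong: if_cong)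
    then show "(\<lambda>k. s *\<^sub>R k + \<tau>) ` Z = dual_lattice (\<lambda>j. axis j s) \<tau>"
      unfolding dual_lattice_def Z_def by (auto simp: add.commute)
  qed
  from nn_integral_bij_count_space[OF this, of H]
  have "(\<integral>\<^sup>+k. H k \<partial>count_space (dual_lattice (\<lambda>j. axis j s) \<tau>)) = F \<tau>" unfolding F_def by simp
  moreover have "(\<integral>\<^sup>+k. h k \<partial>count_space (dual_lattice (\<lambda>j. axis j s) \<tau>)) \<le> (\<integral>\<^sup>+k. H k \<partial>count_space (dual_lattice (\<lambda>j. axis j s) \<tau>))"
    by (intro nn_integral_mono hH)
  ultimately show ?thesis using \<tau> by (intro exI[of _ \<tau>]) simp
qed

section \<open>Regularity from finite Fourier Lebesgue norms\<close>

context weighted_distribution begin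

text \<open>One window \<kappa> suffices, with U the open set where it does not vanish; the lattice
  offset is arbitrary.\<close>

lemma locally_regular_single:
  fixes e \<epsilon> :: "'d \<Rightarrow> real^'d"
  assumes d: "\<And>i j. e i \<bullet> \<epsilon> j = (if i = j then c else 0)" and c: "0 < c" "c < 2 * pi"
    and \<kappa>: "\<kappa> \<in> test_functions {a + (\<Sum>j\<in>UNIV. t j *\<^sub>R e j) | t. \<forall>j. 0 \<le> t j \<and> t j \<le> 1}" "\<kappa> \<in> test_functions X" "\<kappa> x0 \<noteq> 0"
    and \<Gamma>: "open_cone \<Gamma>" "\<xi>0 \<in> \<Gamma>"
    and fin: "Lp_norm (count_space (\<Gamma> \<inter> dual_lattice \<epsilon> \<tau>)) q (\<lambda>k. ennreal (cmod (fourier_fun (dmult \<kappa> f) k * of_real (\<omega> k)))) < \<infinity>"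
  shows "locally_regular f X q \<omega> x0 \<xi>0"
proof -
  have ff: "ennreal (cmod (f (\<lambda>x. \<kappa> x * ch k x)) * \<omega> k) \<le> ennreal (1 / cmod (fc TYPE('d))) * ennreal (cmod (fourier_fun (dmult \<kappa> f) k * of_real (\<omega> k)))" for k
    unfolding fourier_fun_dmult[OF f X \<kappa>(2)] norm_mult using \<omega>_pos[of k] by (simp add: ennreal_mult[symmetric])
  have fin': "Lp_norm (count_space (\<Gamma> \<inter> dual_lattice \<epsilon> \<tau>)) q (\<lambda>k. ennreal (cmod (f (\<lambda>x. \<kappa> x * ch k x)) * \<omega> k)) < \<infinity>"
    by (rule Lp_norm_dominated[OF _ ff fin q]) simp
  have U: "open {x. \<kappa> x \<noteq> 0}"
    by (rule open_Collect_neq[OF smooth_continuous_on[OF tf_smooth[OF \<kappa>(2)]] continuous_on_const])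
  have UX: "{x. \<kappa> x \<noteq> 0} \<subseteq> X" using tf_outside[OF \<kappa>(2)] by blast
  show ?thesis unfolding locally_regular_def
    by (rule exI[of _ "{x. \<kappa> x \<noteq> 0}"], rule exI[of _ "dual_lattice \<epsilon> \<tau>"], rule exI[of _ "{0}"], rule exI[of _ "\<lambda>_. \<kappa>"], rule exI[of _ \<Gamma>])
      (intro conjI U UX separated_dual_lattice[OF d c(1)] expands_parallelepiped[OF d c \<kappa>(1)] \<Gamma>, use \<kappa>(2,3) fin' in simp_all)
qed

text \<open>Every translate of the dual lattice of a cube containing the support of \<kappa> may be
  used as the frequency set, and averaging over translates yields one along which the weighted
  transform is q-summable in \<Gamma>.\<close>

lemma not_WF_FL_regular:
  assumes \<kappa>: "\<kappa> \<in> test_functions X" "\<kappa> x0 \<noteq> 0" and \<Gamma>: "open_cone \<Gamma>" "\<xi>0 \<in> \<Gamma>"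
    and fin: "FL_norm q \<omega> \<Gamma> (dmult \<kappa> f) < \<infinity>"
  shows "locally_regular f X q \<omega> x0 \<xi>0"
proof -
  have o: "open \<Gamma>" using \<Gamma>(1) by (simp add: open_cone_def)
  have \<Gamma>m: "\<Gamma> \<inter> space lebesgue \<in> sets lebesgue" using o by simp
  then have [measurable]: "\<Gamma> \<in> sets lebesgue" by simp
  define g where "g \<xi> = cmod (fourier_fun (dmult \<kappa> f) \<xi> * of_real (\<omega> \<xi>))" for \<xi>
  have g0: "0 \<le> g \<xi>" for \<xi> by (simp add: g_def)
  have "(\<lambda>\<xi>. f (\<lambda>x. \<kappa> x * ch \<xi> x)) \<in> borel_measurable lebesgue"
    using borel_measurable_continuous_onI[OF continuous_distribution_ch[OF f X \<kappa>(1)]]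
    by (intro measurable_completion) simp
  then have gm: "g \<in> borel_measurable lebesgue"
    unfolding g_def fourier_fun_dmult[OF f X \<kappa>(1)] using \<omega>_measurable by measurable
  have fin: "Lp_norm (lebesgue_on \<Gamma>) q (\<lambda>\<xi>. ennreal (g \<xi>)) < \<infinity>" using fin unfolding FL_norm_def g_def .
  obtain R where R: "R > 0" "supp \<kappa> \<subseteq> cball 0 R" using bounded_supp[OF \<kappa>(1)] by metis
  \<comment> \<open>Spacing of the lattice biorthogonal, with pairing constant 1, to a cube of side
    2 R.\<close>
  define s where "s = 1 / (2 * R)"
  have s: "s > 0" using R(1) by (simp add: s_def)
  have "\<exists>\<tau>. Lp_norm (count_space (\<Gamma> \<inter> dual_lattice (\<lambda>j. axis j s) \<tau>)) q (\<lambda>k. ennreal (g k)) < \<infinity>"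
  proof (cases "q = \<infinity>")
    case True
    define B where "B = esssup (lebesgue_on \<Gamma>) (\<lambda>\<xi>. ennreal (g \<xi>))"
    have "B < \<infinity>" using fin unfolding Lp_norm_less_top if_P[OF True] B_def .
    then obtain b where b: "B = ennreal b" "b \<ge> 0" by (cases B) auto
    have "AE \<xi> in lebesgue_on \<Gamma>. ennreal (g \<xi>) \<le> B" unfolding B_def by (rule esssup_AE)
    then have ae: "AE \<xi> in lebesgue. \<xi> \<in> \<Gamma> \<longrightarrow> ennreal (g \<xi>) \<le> B" using \<Gamma>m by (simp add: AE_restrict_space_iff)
    \<comment> \<open>For q infinite: infinite on the null set where the essential bound fails and 0
      elsewhere. A translate with finite sum avoids this set.\<close>
    define h where "h \<xi> = \<infinity> * (indicator (\<Gamma> \<inter> ((\<lambda>\<xi>. ennreal (g \<xi>)) -` {B<..} \<inter> space lebesgue)) \<xi> :: ennreal)" for \<xi>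
    have "(\<lambda>\<xi>. ennreal (g \<xi>)) \<in> borel_measurable lebesgue" using gm by measurable
    from measurable_sets[OF this, of "{B<..}"]
    have "\<Gamma> \<inter> ((\<lambda>\<xi>. ennreal (g \<xi>)) -` {B<..} \<inter> space lebesgue) \<in> sets lebesgue" using \<Gamma>m by auto
    then have hm: "h \<in> borel_measurable lebesgue" unfolding h_def by measurable
    have "AE \<xi> in lebesgue. h \<xi> = 0"
      using ae by (rule eventually_mono) (auto simp: h_def indicator_def not_less)
    then have "(\<integral>\<^sup>+\<xi>. h \<xi> \<partial>lebesgue) = (\<integral>\<^sup>+(\<xi>::real^'d). 0 \<partial>lebesgue)"
      by (rule nn_integral_cong_AE)
    then have "(\<integral>\<^sup>+\<xi>. h \<xi> \<partial>lebesgue) < \<infinity>" by simp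
    from finite_lattice_sum[OF s hm this] obtain \<tau> where
      \<tau>: "(\<integral>\<^sup>+k. h k \<partial>count_space (dual_lattice (\<lambda>j. axis j s) \<tau>)) < \<infinity>" by blast
    have "g k \<le> b" if k: "k \<in> \<Gamma> \<inter> dual_lattice (\<lambda>j. axis j s) \<tau>" for k
    proof (rule ccontr)
      assume "\<not> g k \<le> b"
      then have "k \<in> \<Gamma> \<inter> ((\<lambda>\<xi>. ennreal (g \<xi>)) -` {B<..} \<inter> space lebesgue)"
        using k b by (auto intro: ennreal_lessI)
      then have "h k = \<infinity>" unfolding h_def by (simp only: indicator_simps(1) mult_1_right)
      have "h k = (\<integral>\<^sup>+l. h k * indicator {k} l \<partial>count_space (dual_lattice (\<lambda>j. axis j s) \<tau>))"
        using k by (subst nn_integral_cmult_indicator) auto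
      also have "\<dots> \<le> (\<integral>\<^sup>+k. h k \<partial>count_space (dual_lattice (\<lambda>j. axis j s) \<tau>))"
        by (intro nn_integral_mono) (auto simp: indicator_def)
      finally show False using \<tau> \<open>h k = \<infinity>\<close> by simp
    qed
    then have "Lp_norm (count_space (\<Gamma> \<inter> dual_lattice (\<lambda>j. axis j s) \<tau>)) q (\<lambda>k. ennreal (g k)) < \<infinity>"
      unfolding Lp_norm_count_space[OF g0] if_P[OF True] using b(2) by blast
    then show ?thesis ..
  next
    case False
    define r where "r = enn2real q"
    define h where "h \<xi> = ennreal (g \<xi> powr r) * indicator \<Gamma> \<xi>" for \<xi>
    have hm: "h \<in> borel_measurable lebesgue" unfolding h_def using gm \<Gamma>m by measurable
    have "(\<integral>\<^sup>+\<xi>. ennreal_powr (ennreal (g \<xi>)) r \<partial>lebesgue_on \<Gamma>) < \<infinity>"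
      using fin unfolding Lp_norm_less_top if_not_P[OF False] r_def .
    then have "(\<integral>\<^sup>+\<xi>. h \<xi> \<partial>lebesgue) < \<infinity>"
      unfolding ennreal_powr_ennreal[OF g0] h_def using nn_integral_restrict_space[OF \<Gamma>m, of "\<lambda>\<xi>. ennreal (g \<xi> powr r)"] by simp
    from finite_lattice_sum[OF s hm this] obtain \<tau> where
      \<tau>: "(\<integral>\<^sup>+k. h k \<partial>count_space (dual_lattice (\<lambda>j. axis j s) \<tau>)) < \<infinity>" by blast
    have "(\<integral>\<^sup>+k. ennreal (g k powr r) \<partial>count_space (\<Gamma> \<inter> dual_lattice (\<lambda>j. axis j s) \<tau>)) =
        (\<integral>\<^sup>+k. h k \<partial>count_space (\<Gamma> \<inter> dual_lattice (\<lambda>j. axis j s) \<tau>))"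
      unfolding h_def by (rule nn_integral_cong) simp
    also have "\<dots> = (\<integral>\<^sup>+k. h k \<partial>count_space (dual_lattice (\<lambda>j. axis j s) \<tau>))"
      unfolding h_def by (rule nn_integral_count_space_eq) auto
    finally have "Lp_norm (count_space (\<Gamma> \<inter> dual_lattice (\<lambda>j. axis j s) \<tau>)) q (\<lambda>k. ennreal (g k)) < \<infinity>"
      unfolding Lp_norm_count_space[OF g0] if_not_P[OF False] r_def[symmetric] using \<tau> by simp
    then show ?thesis ..
  qed
  then obtain \<tau> where \<tau>: "Lp_norm (count_space (\<Gamma> \<inter> dual_lattice (\<lambda>j. axis j (1 / (2 * R))) \<tau>)) q (\<lambda>k. ennreal (g k)) < \<infinity>"
    unfolding s_def by blast
  have "supp \<kappa> \<subseteq> {(- R) *\<^sub>R One + (\<Sum>j\<in>UNIV. t j *\<^sub>R axis j (2 * R)) | t. \<forall>j. 0 \<le> t j \<and> t j \<le> 1}"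
    using R(2) box_lattice(2)[OF R(1)] by blast
  note \<kappa>D = tf_supp_subset[OF \<kappa>(1) this]
  have pi: "1 < 2 * pi" using pi_gt3 by linarith
  show ?thesis
    by (rule locally_regular_single[OF box_lattice(1)[OF R(1)] zero_less_one pi \<kappa>D \<kappa> \<Gamma> \<tau>[unfolded g_def]])
qed

text \<open>The given parallelepiped and lattice already have the form required by the Fourier
  series expansion; the proof only rewrites integer-valued functions as integer vectors.\<close>

lemma not_DF_FL_regular:
  assumes sa: "strongly_admissible e \<Lambda>1 \<epsilon> \<Lambda>2" and D: "D \<in> parallelepipeds e \<Lambda>1"
    and \<kappa>: "\<kappa> \<in> test_functions (D \<inter> X)" "\<kappa> x0 \<noteq> 0" and \<Gamma>: "open_cone \<Gamma>" "\<xi>0 \<in> \<Gamma>"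
    and fin: "FL_discrete_norm q \<omega> (\<Gamma> \<inter> \<Lambda>2) (dmult \<kappa> f) < \<infinity>"
  shows "locally_regular f X q \<omega> x0 \<xi>0"
proof -
  obtain c where c: "0 < c" "c < 2 * pi" and "\<forall>j. e j \<bullet> \<epsilon> j = c" "\<forall>j k. j \<noteq> k \<longrightarrow> e j \<bullet> \<epsilon> k = 0"
    using sa unfolding strongly_admissible_def by blast
  then have d: "\<And>i j. e i \<bullet> \<epsilon> j = (if i = j then c else 0)" by simp
  obtain \<tau> where \<tau>: "\<Lambda>2 = {\<tau> + (\<Sum>j\<in>UNIV. of_int (t j) *\<^sub>R \<epsilon> j) | t :: 'd \<Rightarrow> int. True}"
    using sa unfolding strongly_admissible_def lattice_with_basis_def by blast
  have "\<Lambda>2 = dual_lattice \<epsilon> \<tau>"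
  proof (rule set_eqI)
    fix x
    show "x \<in> \<Lambda>2 \<longleftrightarrow> x \<in> dual_lattice \<epsilon> \<tau>"
    proof
      assume "x \<in> \<Lambda>2"
      then obtain t :: "'d \<Rightarrow> int" where t: "x = \<tau> + (\<Sum>j\<in>UNIV. of_int (t j) *\<^sub>R \<epsilon> j)" unfolding \<tau> by blast
      define k :: "real^'d" where "k = (\<chi> j. of_int (t j))"
      have "int_vec k" "x = \<tau> + (\<Sum>j\<in>UNIV. (k $ j) *\<^sub>R \<epsilon> j)" by (simp_all add: k_def int_vec_def t)
      then show "x \<in> dual_lattice \<epsilon> \<tau>" unfolding dual_lattice_def by blast
    next
      assume "x \<in> dual_lattice \<epsilon> \<tau>"
      then obtain k where k: "int_vec k" "x = \<tau> + (\<Sum>j\<in>UNIV. (k $ j) *\<^sub>R \<epsilon> j)" unfolding dual_lattice_def by blast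
      have fl: "k $ j = of_int \<lfloor>k $ j\<rfloor>" for j using k(1) unfolding int_vec_def by (metis Ints_cases floor_of_int)
      have "(\<Sum>j\<in>UNIV. (k $ j) *\<^sub>R \<epsilon> j) = (\<Sum>j\<in>UNIV. of_int \<lfloor>k $ j\<rfloor> *\<^sub>R \<epsilon> j)"
        by (intro sum.cong refl arg_cong2[where f = scaleR] fl)
      then have "x = \<tau> + (\<Sum>j\<in>UNIV. of_int \<lfloor>k $ j\<rfloor> *\<^sub>R \<epsilon> j)" using k(2) by simp
      then show "x \<in> \<Lambda>2" unfolding \<tau> by (intro CollectI exI[of _ "\<lambda>j. \<lfloor>k $ j\<rfloor>"]) simp
    qed
  qed
  then have fin': "Lp_norm (count_space (\<Gamma> \<inter> dual_lattice \<epsilon> \<tau>)) q (\<lambda>k. ennreal (cmod (fourier_fun (dmult \<kappa> f) k * of_real (\<omega> k)))) < \<infinity>"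
    using fin unfolding FL_discrete_norm_def by simp
  obtain a where a: "D = {a + (\<Sum>j\<in>UNIV. t j *\<^sub>R e j) | t. \<forall>j. 0 \<le> t j \<and> t j \<le> 1}"
    using D unfolding parallelepipeds_def by blast
  have \<kappa>D: "\<kappa> \<in> test_functions {a + (\<Sum>j\<in>UNIV. t j *\<^sub>R e j) | t. \<forall>j. 0 \<le> t j \<and> t j \<le> 1}"
    unfolding a[symmetric] using \<kappa>(1) by (rule tf_mono) simp
  have \<kappa>X: "\<kappa> \<in> test_functions X" using \<kappa>(1) by (rule tf_mono) simp
  show ?thesis by (rule locally_regular_single[OF d c \<kappa>D \<kappa>X \<kappa>(2) \<Gamma> fin'])
qed

end

subsection \<open>Finiteness of one of the modulation space norms implies regularity\<close>

text \<open>On a small box about y - z the conjugated window stays close to its nonzero value at z.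
  Multiplied by \<open>w z\<close> it has positive real part there, so nothing cancels.\<close>

lemma averaged_window_nonzero:
  fixes w :: "real^'d \<Rightarrow> complex"
  assumes w: "continuous_on UNIV w" "w z \<noteq> 0"
  shows "\<exists>a b. (\<integral>t. indicator (cbox a b) t *\<^sub>R cnj (w (y - t)) \<partial>lborel) \<noteq> 0"
proof -
  define v where "v t = cnj (w (y - t)) * w z" for t
  have vc: "continuous_on S v" for S
    unfolding v_def by (intro continuous_intros continuous_on_compose2[OF w(1)]) auto
  have "0 < Re (v (y - z))" using w(2) unfolding v_def by (simp add: complex_eq_iff) (metis not_sum_power2_lt_zero power2_eq_square sum_power2_gt_zero_iff)
  moreover define c where "c = Re (v (y - z)) / 2"
  ultimately have c: "c > 0" "c < Re (v (y - z))" by (simp_all add: c_def)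
  have o: "open {t. c < Re (v t)}" by (intro open_Collect_less continuous_intros vc)
  have "y - z \<in> {t. c < Re (v t)}" using c by simp
  then obtain a b where ab: "cbox a b \<subseteq> {t. c < Re (v t)}" "y - z \<in> box a b" "\<forall>i\<in>Basis. a \<bullet> i < b \<bullet> i"
    by (rule open_contains_cbox[OF o])
  have ib: "integrable lborel (\<lambda>t. indicator (cbox a b) t *\<^sub>R v t)" by (rule borel_integrable_compact[OF compact_cbox vc])
  have ic: "integrable lborel (\<lambda>t. indicator (cbox a b) t *\<^sub>R c)" by (rule borel_integrable_compact[OF compact_cbox continuous_on_const])
  have "0 < measure lborel (cbox a b)" by (rule content_pos_lt[OF ab(3)])
  then have "0 < measure lborel (cbox a b) * c" using c by simp
  also have "\<dots> = (\<integral>t. indicator (cbox a b) t *\<^sub>R c \<partial>lborel)" by simp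
  also have "\<dots> \<le> (\<integral>t. Re (indicator (cbox a b) t *\<^sub>R v t) \<partial>lborel)"
    using ab(1) by (intro integral_mono ic integrable_Re ib) (auto simp: indicator_def less_imp_le)
  also have "\<dots> = Re (\<integral>t. indicator (cbox a b) t *\<^sub>R v t \<partial>lborel)" by (rule integral_Re[OF ib])
  also have "(\<integral>t. indicator (cbox a b) t *\<^sub>R v t \<partial>lborel) = (\<integral>t. indicator (cbox a b) t *\<^sub>R cnj (w (y - t)) * w z \<partial>lborel)"
    by (simp add: v_def)
  also have "\<dots> = (\<integral>t. indicator (cbox a b) t *\<^sub>R cnj (w (y - t)) \<partial>lborel) * w z" by (rule integral_mult_left_zero)
  finally have "(\<integral>t. indicator (cbox a b) t *\<^sub>R cnj (w (y - t)) \<partial>lborel) \<noteq> 0" by auto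
  then show ?thesis by blast
qed

text \<open>A box is chosen for which the averaged window m does not vanish at x0. Then \<kappa> m
  is a cut-off whose Fourier Lebesgue integrand is bounded, by Hoelder over the box, by the inner
  L^p norm, and the Fourier Lebesgue case applies.\<close>

lemma (in weighted_distribution) not_WF_M_regular:
  assumes p: "1 \<le> p" and w: "w \<in> schwartz" "w \<noteq> (\<lambda>x. 0)"
    and \<kappa>: "\<kappa> \<in> test_functions X" "\<kappa> x0 \<noteq> 0" and \<Gamma>: "open_cone \<Gamma>" "\<xi>0 \<in> \<Gamma>"
    and fin: "M_norm w p q \<omega> \<Gamma> (dmult \<kappa> f) < \<infinity>"
  shows "locally_regular f X q \<omega> x0 \<xi>0"
proof -
  obtain z where "w z \<noteq> 0" using w(2) by blast
  from averaged_window_nonzero[OF smooth_continuous_on[OF schwartz_smooth[OF w(1)]] this, of x0]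
  obtain a b where ab: "(\<integral>t. indicator (cbox a b) t *\<^sub>R cnj (w (x0 - t)) \<partial>lborel) \<noteq> 0" by blast
  define m where "m y = (\<integral>t. indicator (cbox a b) t *\<^sub>R cnj (w (y - t)) \<partial>lborel)" for y
  note aw = averaged_window[OF f X \<kappa>(1) w(1), of a b, folded m_def[abs_def]]
  define \<kappa>' where "\<kappa>' y = \<kappa> y * m y" for y
  have \<kappa>': "\<kappa>' \<in> test_functions X" unfolding \<kappa>'_def by (rule tf_mult[OF \<kappa>(1)]) (use aw(1) in \<open>simp add: m_def[abs_def]\<close>)
  have \<kappa>'0: "\<kappa>' x0 \<noteq> 0" using \<kappa>(2) ab by (simp add: \<kappa>'_def m_def)
  have o: "open \<Gamma>" using \<Gamma>(1) by (simp add: open_cone_def)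
  define V where "V t \<xi> = stft w (dmult \<kappa> f) t \<xi>" for t \<xi>
  have Vc: "continuous_on UNIV (\<lambda>t. V t \<xi>)" for \<xi>
    using continuous_on_compose2[OF continuous_stft[OF f X \<kappa>(1) w(1)], of UNIV "\<lambda>x. (x, \<xi>)"]
    unfolding V_def by (simp add: continuous_on_Pair continuous_on_id)
  define l where "l = measure lborel (cbox a b)"
  have le: "ennreal (cmod (fourier_fun (dmult \<kappa>' f) \<xi> * of_real (\<omega> \<xi>))) \<le>
      ennreal (l + 1) * Lp_norm lebesgue p (\<lambda>x. ennreal (cmod (stft w (dmult \<kappa> f) x \<xi> * of_real (\<omega> \<xi>))))" for \<xi>
  proof -
    have "fourier_fun (dmult \<kappa>' f) \<xi> = (\<integral>t. indicator (cbox a b) t *\<^sub>R V t \<xi> \<partial>lborel)"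
      unfolding fourier_fun_dmult[OF f X \<kappa>'] \<kappa>'_def V_def m_def by (rule averaged_window(3)[OF f X \<kappa>(1) w(1)])
    then have "fourier_fun (dmult \<kappa>' f) \<xi> * of_real (\<omega> \<xi>) = (\<integral>t. indicator (cbox a b) t *\<^sub>R V t \<xi> * of_real (\<omega> \<xi>) \<partial>lborel)"
      by (simp only: integral_mult_left_zero)
    then have "ennreal (cmod (fourier_fun (dmult \<kappa>' f) \<xi> * of_real (\<omega> \<xi>))) =
        ennreal (cmod (\<integral>t. indicator (cbox a b) t *\<^sub>R V t \<xi> * of_real (\<omega> \<xi>) \<partial>lborel))" by simp
    also have "\<dots> \<le> (\<integral>\<^sup>+t. ennreal (cmod (indicator (cbox a b) t *\<^sub>R V t \<xi> * of_real (\<omega> \<xi>))) \<partial>lborel)"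
      by (intro integral_norm_bound_ennreal integrable_mult_left borel_integrable_compact compact_cbox continuous_on_subset[OF Vc]) simp
    also have "\<dots> = (\<integral>\<^sup>+t. ennreal (cmod (V t \<xi> * of_real (\<omega> \<xi>))) * indicator (cbox a b) t \<partial>lborel)"
      by (intro nn_integral_cong) (simp add: indicator_def)
    also have "\<dots> = (\<integral>\<^sup>+t. ennreal (cmod (V t \<xi> * of_real (\<omega> \<xi>))) * indicator (cbox a b) t \<partial>lebesgue)"
      by (rule nn_integral_completion[symmetric])
    also have "\<dots> \<le> ennreal (l + 1) * Lp_norm lebesgue p (\<lambda>x. ennreal (cmod (V x \<xi> * of_real (\<omega> \<xi>))))"
    proof (rule nn_integral_le_Lp_norm[OF p])
      have "(\<lambda>t. V t \<xi>) \<in> borel_measurable lebesgue"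
        using borel_measurable_continuous_onI[OF Vc] by (intro measurable_completion) simp
      then show "(\<lambda>t. cmod (V t \<xi> * of_real (\<omega> \<xi>))) \<in> borel_measurable lebesgue" by measurable
      have "emeasure lebesgue (cbox a b) = emeasure lborel (cbox a b)" by simp
      also have "\<dots> = ennreal l" unfolding l_def using emeasure_eq_ennreal_measure[of lborel "cbox a b"] emeasure_lborel_cbox_finite[of a b] by simp
      finally show "emeasure lebesgue (cbox a b) \<le> ennreal l" by simp
    qed (simp_all add: l_def)
    finally show ?thesis unfolding V_def .
  qed
  have "FL_norm q \<omega> \<Gamma> (dmult \<kappa>' f) < \<infinity>"
    unfolding FL_norm_def
    by (rule Lp_norm_dominated[OF fourier_measurable[OF \<kappa>' o] le fin[unfolded M_norm_def] q])
  then show ?thesis by (rule not_WF_FL_regular[OF \<kappa>' \<kappa>'0 \<Gamma>])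
qed

section \<open>Frame expansions paired with test functions\<close>

lemma L2_norm_sq_tf:
  fixes h :: "real^'d \<Rightarrow> complex"
  assumes h: "h \<in> test_functions UNIV"
  shows "integrable lborel (\<lambda>x. (cmod (h x))\<^sup>2)" "L2_norm_sq h = (\<integral>x. (cmod (h x))\<^sup>2 \<partial>lborel)" "h \<in> L2"
proof -
  have m: "h \<in> borel_measurable borel" by (rule smooth_measurable[OF tf_smooth[OF h]])
  have hc: "(\<lambda>x. h x * cnj (h x)) \<in> test_functions UNIV" by (intro tf_mult h smooth_cnj tf_smooth[OF h])
  show i: "integrable lborel (\<lambda>x. (cmod (h x))\<^sup>2)"
    using integrable_Re[OF tf_integrable[OF hc]] by (simp add: complex_mult_cnj cmod_power2)
  show "L2_norm_sq h = (\<integral>x. (cmod (h x))\<^sup>2 \<partial>lborel)"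
    unfolding L2_norm_sq_def using m by (intro integral_completion) simp
  have "integrable lebesgue (\<lambda>x. (cmod (h x))\<^sup>2)"
    using i m by (subst integrable_completion) simp_all
  moreover have "h \<in> borel_measurable lebesgue" using m by (intro measurable_completion) simp
  ultimately show "h \<in> L2" unfolding L2_def by blast
qed

text \<open>Cauchy-Schwarz with a free parameter t, stated in squared norms because these occur in
  the definition of dual frames.\<close>

lemma L2_pairing_bound:
  fixes h u :: "real^'d \<Rightarrow> complex"
  assumes h: "h \<in> test_functions UNIV" and u: "u \<in> test_functions UNIV" and t: "t > 0"
  shows "cmod (\<integral>x. h x * u x \<partial>lborel) \<le> L2_norm_sq h / t + t * L2_norm_sq u"
proof -
  note i = L2_norm_sq_tf(1)[OF h] L2_norm_sq_tf(1)[OF u]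
  have "cmod (\<integral>x. h x * u x \<partial>lborel) \<le> (\<integral>x. (cmod (h x))\<^sup>2 / t + t * (cmod (u x))\<^sup>2 \<partial>lborel)"
  proof (rule norm_integral_le)
    show "integrable lborel (\<lambda>x. h x * u x)" by (rule tf_integrable[OF tf_mult[OF h tf_smooth[OF u]]])
    show "integrable lborel (\<lambda>x. (cmod (h x))\<^sup>2 / t + t * (cmod (u x))\<^sup>2)" using i by simp
    show "cmod (h x * u x) \<le> (cmod (h x))\<^sup>2 / t + t * (cmod (u x))\<^sup>2" for x
    proof -
      have "0 \<le> (cmod (h x) - t * cmod (u x))\<^sup>2" by simp
      then have "2 * (cmod (h x) * cmod (u x)) * t \<le> (cmod (h x))\<^sup>2 + t * t * (cmod (u x))\<^sup>2"
        by (simp add: power2_eq_square algebra_simps)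
      then have "2 * (cmod (h x) * cmod (u x)) \<le> (cmod (h x))\<^sup>2 / t + t * (cmod (u x))\<^sup>2"
        using t by (simp add: field_simps power2_eq_square)
      moreover have "0 \<le> cmod (h x) * cmod (u x)" by simp
      ultimately show ?thesis unfolding norm_mult by linarith
    qed
  qed
  also have "\<dots> = L2_norm_sq h / t + t * L2_norm_sq u"
    unfolding L2_norm_sq_tf(2)[OF h] L2_norm_sq_tf(2)[OF u] using i by simp
  finally show ?thesis .
qed

text \<open>Convergence of the frame expansion of g in L^2, paired with h. Only this weak form
  enters the reconstruction, and the terms are plain numbers.\<close>

lemma dual_frames_pairing:
  fixes v u :: "'i \<Rightarrow> real^'d \<Rightarrow> complex"
  assumes df: "dual_frames I u v" and u: "\<And>i. i \<in> I \<Longrightarrow> u i \<in> test_functions UNIV" and v: "\<And>i. i \<in> I \<Longrightarrow> v i \<in> test_functions UNIV"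
    and g: "g \<in> test_functions UNIV" and h: "h \<in> test_functions UNIV"
  shows "((\<lambda>i. (\<integral>x. g x * cnj (v i x) \<partial>lborel) * (\<integral>x. u i x * h x \<partial>lborel)) has_sum (\<integral>x. g x * h x \<partial>lborel)) I"
proof -
  define c where "c i = (\<integral>x. g x * cnj (v i x) \<partial>lborel)" for i
  have c: "L2_inner g (v i) = c i" if "i \<in> I" for i
    unfolding L2_inner_def c_def
    using smooth_measurable[OF smooth_mult[OF tf_smooth[OF g] smooth_cnj[OF tf_smooth[OF v[OF that]]]]]
    by (intro integral_completion) simp
  define r where "r F x = g x - (\<Sum>i\<in>F. c i * u i x)" for F x
  have r: "r F \<in> test_functions UNIV" if "F \<subseteq> I" for F
  proof -
    have "(\<lambda>x. \<Sum>i\<in>F. c i * u i x) \<in> test_functions UNIV" using that by (intro tf_sum tf_mult_left u) auto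
    then have "(\<lambda>x. - 1 * (\<Sum>i\<in>F. c i * u i x)) \<in> test_functions UNIV" by (rule tf_mult_left) simp
    from tf_add[OF g this] show ?thesis unfolding r_def[abs_def] by simp
  qed
  have "((\<lambda>F. L2_norm_sq (\<lambda>x. g x - (\<Sum>i\<in>F. L2_inner g (v i) * u i x))) \<longlongrightarrow> 0) (finite_subsets_at_top I)"
    by (rule bspec[OF conjunct2[OF conjunct2[OF df[unfolded dual_frames_def]]] L2_norm_sq_tf(3)[OF g]])
  moreover have "\<forall>\<^sub>F F in finite_subsets_at_top I. L2_norm_sq (\<lambda>x. g x - (\<Sum>i\<in>F. L2_inner g (v i) * u i x)) = L2_norm_sq (r F)"
  proof (rule eventually_finite_subsets_at_top_weakI)
    fix F assume F: "finite F" "F \<subseteq> I"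
    have "(\<Sum>i\<in>F. L2_inner g (v i) * u i x) = (\<Sum>i\<in>F. c i * u i x)" for x
      using F(2) by (intro sum.cong) (auto simp: c)
    then show "L2_norm_sq (\<lambda>x. g x - (\<Sum>i\<in>F. L2_inner g (v i) * u i x)) = L2_norm_sq (r F)" by (simp add: r_def[abs_def])
  qed
  ultimately have lim: "((\<lambda>F. L2_norm_sq (r F)) \<longlongrightarrow> 0) (finite_subsets_at_top I)" by (rule Lim_transform_eventually)
  have eq: "(\<Sum>i\<in>F. c i * (\<integral>x. u i x * h x \<partial>lborel)) = (\<integral>x. g x * h x \<partial>lborel) - (\<integral>x. r F x * h x \<partial>lborel)" if F: "F \<subseteq> I" for F
  proof -
    have i: "integrable lborel (\<lambda>x. u i x * h x)" if "i \<in> F" for i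
      using that F by (intro tf_integrable[OF tf_mult[OF u tf_smooth[OF h]]]) auto
    have "(\<Sum>i\<in>F. c i * (\<integral>x. u i x * h x \<partial>lborel)) = (\<Sum>i\<in>F. \<integral>x. c i * (u i x * h x) \<partial>lborel)" by simp
    also have "\<dots> = (\<integral>x. (\<Sum>i\<in>F. c i * (u i x * h x)) \<partial>lborel)"
      by (rule Bochner_Integration.integral_sum[symmetric]) (use i in simp)
    also have "\<dots> = (\<integral>x. g x * h x - r F x * h x \<partial>lborel)"
      by (rule Bochner_Integration.integral_cong) (simp_all add: r_def left_diff_distrib sum_distrib_right mult.assoc)
    also have "\<dots> = (\<integral>x. g x * h x \<partial>lborel) - (\<integral>x. r F x * h x \<partial>lborel)"
      by (rule Bochner_Integration.integral_diff[OF tf_integrable[OF tf_mult[OF g tf_smooth[OF h]]] tf_integrable[OF tf_mult[OF r[OF F] tf_smooth[OF h]]]])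
    finally show ?thesis .
  qed
  have "((\<lambda>F. \<Sum>i\<in>F. c i * (\<integral>x. u i x * h x \<partial>lborel)) \<longlongrightarrow> (\<integral>x. g x * h x \<partial>lborel)) (finite_subsets_at_top I)"
  proof (rule tendstoI)
    fix e :: real assume e: "e > 0"
    have H0: "0 \<le> L2_norm_sq h" unfolding L2_norm_sq_def by simp
    \<comment> \<open>Makes the part of the bound involving h at most e/2; convergence in L^2 then
      handles the other part.\<close>
    define t where "t = e / (2 * (L2_norm_sq h + 1))"
    have t: "t > 0" using e H0 by (simp add: t_def)
    have th: "t * L2_norm_sq h \<le> e / 2" using e H0 by (simp add: t_def field_simps)
    have "e / 2 * t > 0" using e t by simp
    from tendstoD[OF lim this]
    have "\<forall>\<^sub>F F in finite_subsets_at_top I. L2_norm_sq (r F) < e / 2 * t"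
      by (rule eventually_mono) (simp add: dist_norm)
    moreover have "\<forall>\<^sub>F F in finite_subsets_at_top I. F \<subseteq> I" by (rule eventually_finite_subsets_at_top_weakI)
    ultimately show "\<forall>\<^sub>F F in finite_subsets_at_top I. dist (\<Sum>i\<in>F. c i * (\<integral>x. u i x * h x \<partial>lborel)) (\<integral>x. g x * h x \<partial>lborel) < e"
    proof eventually_elim
      case (elim F)
      have "cmod (\<integral>x. r F x * h x \<partial>lborel) \<le> L2_norm_sq (r F) / t + t * L2_norm_sq h"
        by (rule L2_pairing_bound[OF r[OF elim(2)] h t])
      also have "L2_norm_sq (r F) / t < e / 2" using elim(1) t by (simp add: pos_divide_less_eq)
      also have "e / 2 + t * L2_norm_sq h \<le> e" using th by simp
      finally show ?case unfolding eq[OF elim(2)] dist_norm by simp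
    qed
  qed
  then show ?thesis unfolding has_sum_def c_def .
qed

lemma integrable_count_space_has_sum:
  fixes b :: "'k \<Rightarrow> complex"
  assumes "integrable (count_space S) b"
  shows "(b has_sum (\<integral>k. b k \<partial>count_space S)) S"
proof -
  have 1: "Infinite_Set_Sum.abs_summable_on b S" unfolding Infinite_Set_Sum.abs_summable_on_def by (rule assms)
  have "b summable_on S" by (rule abs_summable_summable[OF abs_summable_equivalent[THEN iffD2, OF 1]])
  then have "(b has_sum infsum b S) S" by (rule has_sum_infsum)
  then show ?thesis unfolding infsetsum_infsum[OF 1, symmetric] infsetsum_def .
qed

lemma continuous_L2_zero:
  fixes H :: "real^'d \<Rightarrow> complex"
  assumes H: "H \<in> test_functions UNIV" and 0: "(\<integral>x. cnj (H x) * H x \<partial>lborel) = 0"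
  shows "H x = 0"
proof -
  note i = L2_norm_sq_tf(1)[OF H]
  have m: "H \<in> borel_measurable borel" by (rule smooth_measurable[OF tf_smooth[OF H]])
  have eq: "cnj (H x) * H x = of_real ((cmod (H x))\<^sup>2)" for x using complex_norm_square[of "H x"] by (simp add: mult.commute)
  have "complex_of_real (\<integral>x. (cmod (H x))\<^sup>2 \<partial>lborel) = 0" using 0 unfolding eq by (simp only: integral_complex_of_real)
  then have "(\<integral>x. (cmod (H x))\<^sup>2 \<partial>lborel) = 0" by simp
  then have "AE x in lborel. (cmod (H x))\<^sup>2 = 0" using integral_nonneg_eq_0_iff_AE[OF i] by simp
  then have "AE x in lebesgue. (cmod (H x))\<^sup>2 = 0" by (rule AE_completion)
  then have ae: "AE x in lebesgue. H x = 0" by simp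
  have o: "open {x. H x \<noteq> 0}" by (intro open_Collect_neq smooth_continuous_on[OF tf_smooth[OF H]] continuous_on_const)
  have "{x \<in> space lebesgue. \<not> H x = 0} \<in> null_sets lebesgue"
    using ae o by (intro AE_iff_null_sets[THEN iffD2]) auto
  then have "negligible {x. H x \<noteq> 0}" by (simp add: negligible_iff_null_sets)
  then have "{x. H x \<noteq> 0} = {}" using o open_not_negligible by blast
  then show ?thesis by blast
qed

text \<open>Let H be the difference of the two sides. The frame expansion of the conjugate of H is
  paired with \<theta> m. Its \<phi>-factors become the coefficients of
  \<open>\<theta> * \<phi>' y * m\<close>, which decay rapidly in k and vanish for y outside J.
  Summing over k first reproduces the pairing with the right-hand side, so |H|^2 integrates to 0 and
  H vanishes by continuity. The \<psi>-windows end up as outer factors, as the Gabor coefficients of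
  f demand.\<close>

lemma gabor_expansion:
  fixes \<phi>' \<psi>' :: "real^'d \<Rightarrow> real^'d \<Rightarrow> complex"
  assumes df: "dual_frames (G1 \<times> G2) (\<lambda>(y, \<eta>) x. \<phi>' y x * ch (- \<eta>) x) (\<lambda>(y, \<eta>) x. cnj (\<psi>' y x * ch \<eta> x))"
    and \<phi>: "\<And>y. \<phi>' y \<in> test_functions UNIV" and \<psi>: "\<And>y. \<psi>' y \<in> test_functions UNIV"
    and G2: "separated G2" and J: "finite J" "J \<subseteq> G1"
    and \<theta>: "\<theta> \<in> test_functions UNIV" and off: "\<And>y x. y \<in> G1 \<Longrightarrow> y \<notin> J \<Longrightarrow> \<theta> x * \<phi>' y x = 0" and m: "smooth m"
  shows "\<theta> x * m x = (\<Sum>y\<in>J. \<psi>' y x * (\<integral>k. (\<integral>z. \<theta> z * \<phi>' y z * m z * ch (- k) z \<partial>lborel) * ch k x \<partial>count_space G2))"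
proof -
  define u where "u x = \<theta> x * m x" for x
  have u: "u \<in> test_functions UNIV" unfolding u_def by (rule tf_mult[OF \<theta> m])
  define \<alpha> where "\<alpha> y x = \<theta> x * \<phi>' y x" for y x
  have \<alpha>: "\<alpha> y \<in> test_functions UNIV" for y unfolding \<alpha>_def by (rule tf_mult[OF \<theta> tf_smooth[OF \<phi>]])
  define b where "b y k = (\<integral>z. \<alpha> y z * m z * ch (- k) z \<partial>lborel)" for y k
  define S where "S y x = (\<integral>k. b y k * ch k x \<partial>count_space G2)" for y x
  \<comment> \<open>The zero distribution merely instantiates \<open>expansion_apply\<close>, of
    which only the smoothness of the series is taken.\<close>
  have zd: "(\<lambda>_. 0) \<in> distributions (UNIV :: (real^'d) set)"
    unfolding distributions_def by (auto intro!: exI[of _ 0])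
  have S: "smooth (S y)" for y
    unfolding S_def b_def by (rule expansion_apply(3)[OF zd tf_zero G2 \<alpha> m])
  define H where "H x = u x + - 1 * (\<Sum>y\<in>J. \<psi>' y x * S y x)" for x
  have H: "H \<in> test_functions UNIV"
    unfolding H_def by (intro tf_add u tf_mult_left tf_sum tf_mult \<psi> S) simp
  \<comment> \<open>The test object is the conjugated error itself, so that its pairing with H is
    the squared norm of the error.\<close>
  define g where "g x = cnj (H x)" for x
  have g: "g \<in> test_functions UNIV" unfolding g_def by (rule tf_cnj[OF H])
  define c where "c y k = (\<integral>x. g x * (\<psi>' y x * ch k x) \<partial>lborel)" for y k
  have "((\<lambda>i. (\<integral>x. g x * cnj ((\<lambda>(y, \<eta>) x. cnj (\<psi>' y x * ch \<eta> x)) i x) \<partial>lborel) *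
      (\<integral>x. (\<lambda>(y, \<eta>) x. \<phi>' y x * ch (- \<eta>) x) i x * u x \<partial>lborel)) has_sum (\<integral>x. g x * u x \<partial>lborel)) (G1 \<times> G2)"
    by (rule dual_frames_pairing[OF df _ _ g u])
      (auto simp: split_beta intro!: tf_mult[OF \<phi> smooth_ch] tf_cnj tf_mult[OF \<psi> smooth_ch] simp del: complex_cnj_mult)
  moreover have "(\<integral>x. g x * cnj ((\<lambda>(y, \<eta>) x. cnj (\<psi>' y x * ch \<eta> x)) i x) \<partial>lborel) *
      (\<integral>x. (\<lambda>(y, \<eta>) x. \<phi>' y x * ch (- \<eta>) x) i x * u x \<partial>lborel) = c (fst i) (snd i) * b (fst i) (snd i)" for i
    unfolding c_def b_def u_def \<alpha>_def by (simp add: split_beta mult_ac)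
  ultimately have hs: "((\<lambda>i. c (fst i) (snd i) * b (fst i) (snd i)) has_sum (\<integral>x. g x * u x \<partial>lborel)) (G1 \<times> G2)" by simp
  have b0: "b y k = 0" if "y \<in> G1" "y \<notin> J" for y k unfolding b_def \<alpha>_def off[OF that] by simp
  have hsJ: "((\<lambda>i. c (fst i) (snd i) * b (fst i) (snd i)) has_sum (\<integral>x. g x * u x \<partial>lborel)) (J \<times> G2)"
  proof (rule has_sum_cong_neutral[THEN iffD1, OF _ _ _ hs])
    fix i assume "i \<in> G1 \<times> G2 - J \<times> G2"
    then have "fst i \<in> G1" "fst i \<notin> J" by (auto simp: mem_Times_iff)
    then show "c (fst i) (snd i) * b (fst i) (snd i) = 0" using b0 by simp
  next
    fix i assume "i \<in> J \<times> G2 - G1 \<times> G2"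
    then show "c (fst i) (snd i) * b (fst i) (snd i) = 0" using J(2) by (auto simp: mem_Times_iff)
  qed simp
  have cG2: "countable G2" using G2 by (simp add: separated_def)
  have hsy: "((\<lambda>k. c y k * b y k) has_sum (\<integral>x. g x * (\<psi>' y x * S y x) \<partial>lborel)) G2" for y
  proof -
    define G where "G k t = g t * \<psi>' y t * (b y k * ch k t)" for k t
    have gp: "(\<lambda>t. g t * \<psi>' y t) \<in> test_functions UNIV" by (rule tf_mult[OF g tf_smooth[OF \<psi>]])
    have Gi: "integrable lborel (G k)" for k
      unfolding G_def by (rule tf_integrable[OF tf_mult[OF gp smooth_mult[OF smooth_const smooth_ch]]])
    have "integrable (count_space G2) (\<lambda>k. cmod (b y k) * jb k ^ 0)"
      unfolding b_def by (rule decay_integrable[OF G2 coeff_decay[OF \<alpha> m]])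
    then have bi: "integrable (count_space G2) (\<lambda>k. cmod (b y k) * (\<integral>t. cmod (g t * \<psi>' y t) \<partial>lborel))" by simp
    have n: "(\<integral>t. cmod (G k t) \<partial>lborel) = cmod (b y k) * (\<integral>t. cmod (g t * \<psi>' y t) \<partial>lborel)" for k
      unfolding G_def norm_mult norm_ch by (simp add: mult.commute)
    have Gn: "integrable (count_space G2) (\<lambda>k. \<integral>t. cmod (G k t) \<partial>lborel)" unfolding n by (rule bi)
    have Gc: "(\<integral>t. G k t \<partial>lborel) = c y k * b y k" for k
    proof -
      have "(\<integral>t. G k t \<partial>lborel) = (\<integral>t. g t * (\<psi>' y t * ch k t) * b y k \<partial>lborel)" unfolding G_def by (simp add: mult_ac)
      then show ?thesis unfolding c_def by (simp only: integral_mult_left_zero)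
    qed
    have ic: "integrable (count_space G2) (\<lambda>k. c y k * b y k)"
    proof (rule Bochner_Integration.integrable_bound[OF Gn])
      show "AE k in count_space G2. norm (c y k * b y k) \<le> norm (\<integral>t. cmod (G k t) \<partial>lborel)"
        unfolding Gc[symmetric] by (intro AE_I2 order_trans[OF integral_norm_bound]) simp
    qed simp
    have GS: "(\<integral>k. G k t \<partial>count_space G2) = g t * (\<psi>' y t * S y t)" for t
      unfolding G_def S_def by (simp only: integral_mult_right_zero mult.assoc)
    have "(\<integral>k. c y k * b y k \<partial>count_space G2) = (\<integral>t. \<integral>k. G k t \<partial>count_space G2 \<partial>lborel)"
      unfolding Gc[symmetric] by (rule fubini_count_space(1)[OF cG2 Gi Gn, symmetric])
    then have "(\<integral>k. c y k * b y k \<partial>count_space G2) = (\<integral>x. g x * (\<psi>' y x * S y x) \<partial>lborel)" unfolding GS .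
    then show ?thesis using integrable_count_space_has_sum[OF ic] by simp
  qed
  \<comment> \<open>The double sum is evaluated with the inner sum over frequencies, which has been
    identified with the integral against \<open>S y\<close>.\<close>
  have "((\<lambda>y. \<integral>x. g x * (\<psi>' y x * S y x) \<partial>lborel) has_sum (\<integral>x. g x * u x \<partial>lborel)) J"
    by (rule has_sum_SigmaD[OF hsJ]) (use hsy in simp)
  then have eq: "(\<integral>x. g x * u x \<partial>lborel) = (\<Sum>y\<in>J. \<integral>x. g x * (\<psi>' y x * S y x) \<partial>lborel)"
    using has_sum_finite[OF J(1)] has_sum_unique by blast
  have i: "integrable lborel (\<lambda>x. g x * (\<psi>' y x * S y x))" for y
    by (rule tf_integrable[OF tf_mult[OF g smooth_mult[OF tf_smooth[OF \<psi>] S]]])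
  have iu: "integrable lborel (\<lambda>x. g x * u x)" by (rule tf_integrable[OF tf_mult[OF g tf_smooth[OF u]]])
  have Hx: "H x = u x - (\<Sum>y\<in>J. \<psi>' y x * S y x)" for x unfolding H_def by simp
  have "g x * H x = g x * u x - (\<Sum>y\<in>J. g x * (\<psi>' y x * S y x))" for x
    unfolding Hx right_diff_distrib sum_distrib_left ..
  then have "(\<integral>x. cnj (H x) * H x \<partial>lborel) = (\<integral>x. g x * u x - (\<Sum>y\<in>J. g x * (\<psi>' y x * S y x)) \<partial>lborel)"
    unfolding g_def by simp
  also have "\<dots> = (\<integral>x. g x * u x \<partial>lborel) - (\<integral>x. (\<Sum>y\<in>J. g x * (\<psi>' y x * S y x)) \<partial>lborel)"
    by (rule Bochner_Integration.integral_diff[OF iu]) (intro Bochner_Integration.integrable_sum i)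
  also have "(\<integral>x. (\<Sum>y\<in>J. g x * (\<psi>' y x * S y x)) \<partial>lborel) = (\<Sum>y\<in>J. \<integral>x. g x * (\<psi>' y x * S y x) \<partial>lborel)"
    by (rule Bochner_Integration.integral_sum) (rule i)
  finally have "(\<integral>x. cnj (H x) * H x \<partial>lborel) = 0" unfolding eq by simp
  from continuous_L2_zero[OF H this, of x] have "u x = (\<Sum>y\<in>J. \<psi>' y x * S y x)" unfolding H_def by simp
  then show ?thesis unfolding u_def S_def b_def \<alpha>_def .
qed

text \<open>Only finitely many \<phi>-supports meet the unit ball about x0. Those not containing x0
  are closed, so removing them leaves an open neighbourhood that meets only supports belonging to
  indices near x0.\<close>

lemma gabor_near_neighbourhood:
  fixes X :: "(real^'d) set"
  assumes X: "open X" "x0 \<in> X" and s: "s > 0" and \<phi>: "(\<lambda>x. complex_of_real (\<phi> x)) \<in> test_functions UNIV"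
    and G: "separated G1" "G2 \<noteq> {}"
  shows "\<exists>U. open U \<and> x0 \<in> U \<and> U \<subseteq> X \<and>
    (\<forall>y\<in>G1 - gabor_near G1 G2 \<phi> \<psi> x0 s. U \<inter> supp (\<lambda>x. complex_of_real (\<phi> ((1 / s) *\<^sub>R (x - s *\<^sub>R y)))) = {})"
proof -
  define J where "J = gabor_near G1 G2 \<phi> \<psi> x0 s"
  define T where "T y = supp (\<lambda>x. complex_of_real (\<phi> ((1 / s) *\<^sub>R (x - s *\<^sub>R y))))" for y
  obtain R where R: "supp (\<lambda>x. complex_of_real (\<phi> x)) \<subseteq> cball 0 R" using bounded_supp[OF \<phi>] by metis
  define J2 where "J2 = {y \<in> G1. T y \<inter> ball x0 1 \<noteq> {}}"
  have "J2 \<subseteq> G1 \<inter> cball ((1 / s) *\<^sub>R x0) (R + 1 / s)"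
  proof
    fix y assume "y \<in> J2"
    then obtain z where y: "y \<in> G1" and z: "z \<in> T y" "dist x0 z < 1" unfolding J2_def by auto
    have "z \<in> cball (s *\<^sub>R y) (s * R)" using z(1) supp_gabor_subset[OF s R, of y] unfolding T_def by blast
    then have "norm (s *\<^sub>R y - x0) \<le> s * R + 1"
      using z(2) dist_triangle[of "s *\<^sub>R y" x0 z] by (simp add: dist_commute dist_norm[symmetric])
    also have "s *\<^sub>R y - x0 = s *\<^sub>R (y - (1 / s) *\<^sub>R x0)" using s by (simp add: scaleR_diff_right)
    finally have "s * norm (y - (1 / s) *\<^sub>R x0) \<le> s * R + 1" using s by simp
    then have "norm (y - (1 / s) *\<^sub>R x0) \<le> (s * R + 1) / s" using s by (simp only: pos_le_divide_eq mult.commute)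
    also have "\<dots> = R + 1 / s" using s by (simp add: add_divide_distrib)
    finally have "norm (y - (1 / s) *\<^sub>R x0) \<le> R + 1 / s" .
    then show "y \<in> G1 \<inter> cball ((1 / s) *\<^sub>R x0) (R + 1 / s)" using y by (simp add: dist_norm norm_minus_commute)
  qed
  then have fin: "finite J2" using separated_finite[OF G(1) bounded_cball] finite_subset by blast
  define U where "U = X \<inter> ball x0 1 \<inter> (\<Inter>y\<in>J2 - J. - T y)"
  have "open U" unfolding U_def using fin X(1) by (intro open_Int open_INT ballI open_Compl) (simp_all add: T_def closed_supp)
  moreover have "x0 \<in> U"
  proof -
    have "x0 \<notin> T y" if "y \<in> J2 - J" for y
      using that G(2) unfolding J_def J2_def gabor_near_def supp_gabor T_def by blast
    then show ?thesis unfolding U_def using X(2) by simp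
  qed
  moreover have "U \<subseteq> X" unfolding U_def by blast
  moreover have "\<forall>y\<in>G1 - J. U \<inter> T y = {}" unfolding U_def J2_def by blast
  ultimately show ?thesis unfolding J_def T_def by blast
qed

text \<open>On the neighbourhood just described, every test function \<theta> is expanded with
  \<open>\<theta> * \<phi>' y\<close> as the inner functions and \<open>\<psi>' y\<close> as
  windows, y in the finite set J. Finiteness of J makes the sum over windows comparable with the
  inner l^p norm of the Gabor coefficients.\<close>

lemma (in weighted_distribution) not_DF_M_regular:
  assumes p: "1 \<le> p" and ag: "admissible_gabor_pair G1 G2 \<phi> \<psi>" and C0: "C0 \<noteq> 0" and x0: "x0 \<in> X" and s: "0 < s" "s \<le> 1"
    and sX: "\<forall>y\<in>gabor_near G1 G2 \<phi> \<psi> x0 s. \<forall>\<eta>\<in>G2. supp (gabor \<psi> s y \<eta>) \<subseteq> X"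
    and \<Gamma>: "open_cone \<Gamma>" "\<xi>0 \<in> \<Gamma>"
    and fin: "Lp_norm (count_space (\<Gamma> \<inter> G2)) q (\<lambda>\<eta>. Lp_norm (count_space (gabor_near G1 G2 \<phi> \<psi> x0 s)) p (\<lambda>y.
            ennreal (cmod (gabor_coeff C0 \<psi> f s y \<eta> * of_real (\<omega> \<eta>))))) < \<infinity>"
  shows "locally_regular f X q \<omega> x0 \<xi>0"
proof -
  obtain e \<epsilon> where G: "lattice_with_basis e G1" "lattice_with_basis \<epsilon> G2"
    and \<phi>: "(\<lambda>x. complex_of_real (\<phi> x)) \<in> test_functions UNIV" and \<psi>: "(\<lambda>x. complex_of_real (\<psi> x)) \<in> test_functions UNIV"
    using ag unfolding admissible_gabor_pair_def by blast
  have df: "dual_frames (G1 \<times> G2) (\<lambda>(y, \<eta>). gabor \<phi> s y \<eta>) (\<lambda>(y, \<eta>). gabor \<psi> s y \<eta>)"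
    using ag s unfolding admissible_gabor_pair_def by blast
  note sep = lattice_separated[OF G(1)] lattice_separated[OF G(2)]
  have ne: "G2 \<noteq> {}" using G(2) unfolding lattice_with_basis_def by blast
  define J where "J = gabor_near G1 G2 \<phi> \<psi> x0 s"
  have J: "finite J" unfolding J_def by (rule gabor_near_finite[OF s(1) \<phi> \<psi> sep(1)])
  have JG: "J \<subseteq> G1" unfolding J_def gabor_near_def by blast
  define \<phi>' where "\<phi>' y x = complex_of_real (\<phi> ((1 / s) *\<^sub>R (x - s *\<^sub>R y)))" for y x :: "real^'d"
  define \<psi>' where "\<psi>' y x = complex_of_real (\<psi> ((1 / s) *\<^sub>R (x - s *\<^sub>R y)))" for y x :: "real^'d"
  have \<phi>'tf: "\<phi>' y \<in> test_functions UNIV" for y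
    unfolding \<phi>'_def[abs_def] by (rule gabor_window_tf[OF s(1) \<phi>]) simp
  have \<psi>'tf: "\<psi>' y \<in> test_functions UNIV" for y
    unfolding \<psi>'_def[abs_def] by (rule gabor_window_tf[OF s(1) \<psi>]) simp
  have \<psi>'X: "\<psi>' y \<in> test_functions X" if "y \<in> J" for y
    unfolding \<psi>'_def[abs_def] by (rule gabor_window_tf[OF s(1) \<psi>]) (use sX ne that in \<open>auto simp: supp_gabor J_def\<close>)
  have "(\<lambda>(y, \<eta>). gabor \<phi> s y \<eta>) = (\<lambda>(y, \<eta>) x. \<phi>' y x * ch (- \<eta>) x)"
    by (intro ext) (simp add: split_beta gabor_def ch_def \<phi>'_def)
  moreover have "(\<lambda>(y, \<eta>). gabor \<psi> s y \<eta>) = (\<lambda>(y, \<eta>) x. cnj (\<psi>' y x * ch \<eta> x))"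
    unfolding \<psi>'_def cnj_gabor[symmetric] by (intro ext) (simp add: split_beta)
  ultimately have df': "dual_frames (G1 \<times> G2) (\<lambda>(y, \<eta>) x. \<phi>' y x * ch (- \<eta>) x) (\<lambda>(y, \<eta>) x. cnj (\<psi>' y x * ch \<eta> x))"
    using df by simp
  from gabor_near_neighbourhood[OF X x0 s(1) \<phi> sep(1) ne, of \<psi>]
  obtain U where U: "open U" "x0 \<in> U" "U \<subseteq> X"
    and UJ: "\<forall>y\<in>G1 - J. U \<inter> supp (\<phi>' y) = {}"
    unfolding J_def \<phi>'_def[abs_def] by blast
  have ex: "expands U G2 J \<psi>'"
    unfolding expands_def
  proof
    fix \<theta> assume \<theta>: "\<theta> \<in> test_functions U"
    have \<theta>': "\<theta> \<in> test_functions UNIV" using \<theta> by (rule tf_mono) simp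
    have off: "\<theta> x * \<phi>' y x = 0" if "y \<in> G1" "y \<notin> J" for y x
      using UJ that tf_outside[OF \<theta>, of x] supp_outside[of x "\<phi>' y"] by (cases "x \<in> U") auto
    show "\<exists>\<alpha>. (\<forall>y\<in>J. \<alpha> y \<in> test_functions UNIV) \<and> (\<forall>m. smooth m \<longrightarrow> (\<lambda>x. \<theta> x * m x) =
       (\<lambda>x. \<Sum>y\<in>J. \<psi>' y x * (\<integral>k. (\<integral>z. \<alpha> y z * m z * ch (- k) z \<partial>lborel) * ch k x \<partial>count_space G2)))"
    proof (rule exI[of _ "\<lambda>y x. \<theta> x * \<phi>' y x"], intro conjI ballI allI impI ext)
      show "(\<lambda>x. \<theta> x * \<phi>' y x) \<in> test_functions UNIV" for y by (rule tf_mult[OF \<theta>' tf_smooth[OF \<phi>'tf]])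
    next
      fix m :: "real^'d \<Rightarrow> complex" and x assume sm: "smooth m"
      show "\<theta> x * m x = (\<Sum>y\<in>J. \<psi>' y x * (\<integral>k. (\<integral>z. \<theta> z * \<phi>' y z * m z * ch (- k) z \<partial>lborel) * ch k x \<partial>count_space G2))"
        by (rule gabor_expansion[OF df' \<phi>'tf \<psi>'tf sep(2) J JG \<theta>' off sm])
    qed
  qed
  define v where "v \<eta> y = cmod (gabor_coeff C0 \<psi> f s y \<eta> * of_real (\<omega> \<eta>))" for \<eta> y
  define N where "N \<eta> = Lp_norm (count_space J) p (\<lambda>y. ennreal (v \<eta> y))" for \<eta>
  \<comment> \<open>A single entry against the l^p norm: Hoelder on a one-point set, whose measure 1
    gives the factor 1 + 1.\<close>
  have vN: "ennreal (v \<eta> y) \<le> ennreal 2 * N \<eta>" if y: "y \<in> J" for \<eta> y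
  proof -
    have "ennreal (v \<eta> y) = (\<integral>\<^sup>+l. ennreal (v \<eta> y) * indicator {y} l \<partial>count_space J)"
      using y by (subst nn_integral_cmult_indicator) auto
    also have "\<dots> = (\<integral>\<^sup>+l. ennreal (v \<eta> l) * indicator {y} l \<partial>count_space J)"
      by (rule nn_integral_cong) (simp add: indicator_def)
    also have "\<dots> \<le> ennreal (1 + 1) * N \<eta>"
      unfolding N_def by (rule nn_integral_le_Lp_norm[OF p]) (use y in \<open>simp_all add: v_def\<close>)
    finally show ?thesis by simp
  qed
  have le: "ennreal ((\<Sum>y\<in>J. cmod (f (\<lambda>x. \<psi>' y x * ch k x))) * \<omega> k) \<le> ennreal (1 / cmod C0 * real (card J) * 2) * N k" for k
  proof -
    have "(\<Sum>y\<in>J. cmod (f (\<lambda>x. \<psi>' y x * ch k x))) * \<omega> k = 1 / cmod C0 * (\<Sum>y\<in>J. v k y)"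
      unfolding v_def gabor_coeff_def cnj_gabor \<psi>'_def norm_mult using C0 \<omega>_pos[of k]
      by (simp add: sum_distrib_left sum_distrib_right)
    then have "ennreal ((\<Sum>y\<in>J. cmod (f (\<lambda>x. \<psi>' y x * ch k x))) * \<omega> k) = ennreal (1 / cmod C0 * (\<Sum>y\<in>J. v k y))"
      by (simp only:)
    also have "\<dots> = ennreal (1 / cmod C0) * ennreal (\<Sum>y\<in>J. v k y)"
      by (rule ennreal_mult) (simp_all add: v_def sum_nonneg)
    also have "ennreal (\<Sum>y\<in>J. v k y) = (\<Sum>y\<in>J. ennreal (v k y))" by (rule sum_ennreal[symmetric]) (simp add: v_def)
    also have "ennreal (1 / cmod C0) * (\<Sum>y\<in>J. ennreal (v k y)) \<le> ennreal (1 / cmod C0) * (\<Sum>y\<in>J. ennreal 2 * N k)" by (intro mult_left_mono sum_mono vN) simp_all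
    also have "\<dots> = ennreal (1 / cmod C0 * real (card J) * 2) * N k"
    proof -
      have "ennreal (1 / cmod C0 * real (card J) * 2) = ennreal (1 / cmod C0) * ennreal (real (card J)) * ennreal 2"
        by (simp only: ennreal_mult zero_le_divide_1_iff norm_ge_zero of_nat_0_le_iff zero_le_numeral mult_nonneg_nonneg)
      then show ?thesis by (simp only: sum_constant ennreal_of_nat_eq_real_of_nat mult.assoc)
    qed
    finally show ?thesis .
  qed
  have fin': "Lp_norm (count_space (\<Gamma> \<inter> G2)) q N < \<infinity>" using fin unfolding N_def[abs_def] v_def J_def .
  have reg: "Lp_norm (count_space (\<Gamma> \<inter> G2)) q (\<lambda>k. ennreal ((\<Sum>y\<in>J. cmod (f (\<lambda>x. \<psi>' y x * ch k x))) * \<omega> k)) < \<infinity>"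
    by (rule Lp_norm_dominated[OF _ le fin' q]) simp
  show ?thesis unfolding locally_regular_def
    by (rule exI[of _ U], rule exI[of _ G2], rule exI[of _ J], rule exI[of _ \<psi>'], rule exI[of _ \<Gamma>])
      (intro conjI ballI U sep J \<psi>'X ex \<Gamma> reg)
qed

section \<open>Equality of the four wave-front sets through the set of irregular pairs\<close>

theorem theorem5p3:
  fixes X :: "(real^'d) set"
    and \<Omega> :: "(real^'d) \<times> (real^'d) \<Rightarrow> real" and \<omega> :: "real^'d \<Rightarrow> real"
    and f :: "(real^'d \<Rightarrow> complex) \<Rightarrow> complex"
    and p q :: ennreal
    and w :: "real^'d \<Rightarrow> complex"
    and e \<epsilon> :: "real^'d \<Rightarrow> 'd \<Rightarrow> real^'d"
    and \<Lambda>1 \<Lambda>2 D :: "real^'d \<Rightarrow> (real^'d) set"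
    and G1 G2 :: "(real^'d) set" and \<phi> \<psi> :: "real^'d \<Rightarrow> real" and C :: complex
  assumes "open X"
    and "\<Omega> \<in> moderate_weights" and "\<And>x \<xi>. \<Omega> (x, \<xi>) = \<omega> \<xi>"
    and "f \<in> distributions X"
    and "1 \<le> p" and "1 \<le> q"
    and "w \<in> schwartz" and "w \<noteq> (\<lambda>x. 0)"
    and "DF_FL_choice X e \<Lambda>1 \<epsilon> \<Lambda>2 D"
    and "admissible_gabor_pair G1 G2 \<phi> \<psi>" and "C \<noteq> 0"
  shows "WF_FL q \<omega> X f = WF_M w p q \<omega> X f
    \<and> WF_M w p q \<omega> X f = DF_FL \<Lambda>2 D q \<omega> X f
    \<and> DF_FL \<Lambda>2 D q \<omega> X f = DF_M G1 G2 \<phi> \<psi> C p q \<omega> X f"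
proof -
  obtain Cw Mw where \<omega>: "\<And>\<xi>. 0 < \<omega> \<xi>" "Cw > 0" "\<And>\<xi> \<eta>. \<omega> \<xi> \<le> Cw * jb (\<xi> - \<eta>) ^ Mw * \<omega> \<eta>"
    "\<omega> \<in> borel_measurable lebesgue"
    using weight_moderate[OF assms(2,3)] by blast
  interpret weighted_distribution X f q \<omega> Cw Mw
    by unfold_locales (use assms(1,4,6) \<omega> in blast)+
  obtain eG \<epsilon>G where G: "lattice_with_basis eG G1" "lattice_with_basis \<epsilon>G G2"
    and \<phi>: "(\<lambda>x. complex_of_real (\<phi> x)) \<in> test_functions UNIV" and \<psi>: "(\<lambda>x. complex_of_real (\<psi> x)) \<in> test_functions UNIV"
    using assms(10) unfolding admissible_gabor_pair_def by blast
  note sep = lattice_separated[OF G(1)] lattice_separated[OF G(2)]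
  have sa: "strongly_admissible (e x0) (\<Lambda>1 x0) (\<epsilon> x0) (\<Lambda>2 x0)" "D x0 \<in> parallelepipeds (e x0) (\<Lambda>1 x0)" "x0 \<in> interior (D x0)"
    if "x0 \<in> X" for x0
    using assms(9) that unfolding DF_FL_choice_def by blast+
  \<comment> \<open>The common value of the four sets. Each equality is proved by contraposition in
    both directions: regularity yields a finite norm, and a finite norm yields regularity.\<close>
  define W where "W = {(x0, \<xi>0). x0 \<in> X \<and> \<xi>0 \<noteq> 0 \<and> \<not> locally_regular f X q \<omega> x0 \<xi>0}"
  have fin: "a < \<infinity>" if "a \<noteq> \<infinity>" for a :: ennreal using that by (simp add: less_top)
  have "WF_FL q \<omega> X f = W"
  proof (intro set_eqI iffI)
    fix z assume z: "z \<in> WF_FL q \<omega> X f"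
    obtain x0 \<xi>0 where z': "z = (x0, \<xi>0)" by (cases z)
    have "x0 \<in> X" "\<xi>0 \<noteq> 0" using z unfolding z' WF_FL_def by blast+
    moreover have "\<not> locally_regular f X q \<omega> x0 \<xi>0" using z regular_not_WF_FL unfolding z' by blast
    ultimately show "z \<in> W" unfolding z' W_def by blast
  next
    fix z assume z: "z \<in> W"
    obtain x0 \<xi>0 where z': "z = (x0, \<xi>0)" by (cases z)
    have x0: "x0 \<in> X" "\<xi>0 \<noteq> 0" and nr: "\<not> locally_regular f X q \<omega> x0 \<xi>0" using z unfolding z' W_def by blast+
    have "FL_norm q \<omega> \<Gamma> (dmult \<kappa> f) = \<infinity>" if "\<kappa> \<in> test_functions X" "\<kappa> x0 \<noteq> 0" "open_cone \<Gamma>" "\<xi>0 \<in> \<Gamma>" for \<kappa> \<Gamma>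
      using not_WF_FL_regular[OF that fin] nr by blast
    then show "z \<in> WF_FL q \<omega> X f" unfolding z' WF_FL_def using x0 by blast
  qed
  moreover have "WF_M w p q \<omega> X f = W"
  proof (intro set_eqI iffI)
    fix z assume z: "z \<in> WF_M w p q \<omega> X f"
    obtain x0 \<xi>0 where z': "z = (x0, \<xi>0)" by (cases z)
    have "x0 \<in> X" "\<xi>0 \<noteq> 0" using z unfolding z' WF_M_def by blast+
    moreover have "\<not> locally_regular f X q \<omega> x0 \<xi>0" using z regular_not_WF_M[OF _ assms(5,7)] unfolding z' by blast
    ultimately show "z \<in> W" unfolding z' W_def by blast
  next
    fix z assume z: "z \<in> W"
    obtain x0 \<xi>0 where z': "z = (x0, \<xi>0)" by (cases z)
    have x0: "x0 \<in> X" "\<xi>0 \<noteq> 0" and nr: "\<not> locally_regular f X q \<omega> x0 \<xi>0" using z unfolding z' W_def by blast+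
    have "M_norm w p q \<omega> \<Gamma> (dmult \<kappa> f) = \<infinity>" if "\<kappa> \<in> test_functions X" "\<kappa> x0 \<noteq> 0" "open_cone \<Gamma>" "\<xi>0 \<in> \<Gamma>" for \<kappa> \<Gamma>
      using not_WF_M_regular[OF assms(5,7,8) that fin] nr by blast
    then show "z \<in> WF_M w p q \<omega> X f" unfolding z' WF_M_def using x0 by blast
  qed
  moreover have "DF_FL \<Lambda>2 D q \<omega> X f = W"
  proof (intro set_eqI iffI)
    fix z assume z: "z \<in> DF_FL \<Lambda>2 D q \<omega> X f"
    obtain x0 \<xi>0 where z': "z = (x0, \<xi>0)" by (cases z)
    have x0: "x0 \<in> X" "\<xi>0 \<noteq> 0" using z unfolding z' DF_FL_def by blast+
    have "separated (\<Lambda>2 x0)" using sa(1)[OF x0(1)] unfolding strongly_admissible_def by (blast intro: lattice_separated)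
    then have "\<not> locally_regular f X q \<omega> x0 \<xi>0" using z regular_not_DF_FL[where D = D and L = \<Lambda>2, OF _ sa(3)[OF x0(1)]] unfolding z' by blast
    then show "z \<in> W" unfolding z' W_def using x0 by blast
  next
    fix z assume z: "z \<in> W"
    obtain x0 \<xi>0 where z': "z = (x0, \<xi>0)" by (cases z)
    have x0: "x0 \<in> X" "\<xi>0 \<noteq> 0" and nr: "\<not> locally_regular f X q \<omega> x0 \<xi>0" using z unfolding z' W_def by blast+
    have "FL_discrete_norm q \<omega> (\<Gamma> \<inter> \<Lambda>2 x0) (dmult \<kappa> f) = \<infinity>"
      if "\<kappa> \<in> test_functions (D x0 \<inter> X)" "\<kappa> x0 \<noteq> 0" "open_cone \<Gamma>" "\<xi>0 \<in> \<Gamma>" for \<kappa> \<Gamma>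
      using not_DF_FL_regular[OF sa(1,2)[OF x0(1)] that fin] nr by blast
    then show "z \<in> DF_FL \<Lambda>2 D q \<omega> X f" unfolding z' DF_FL_def using x0 by blast
  qed
  moreover have "DF_M G1 G2 \<phi> \<psi> C p q \<omega> X f = W"
  proof (intro set_eqI iffI)
    fix z assume z: "z \<in> DF_M G1 G2 \<phi> \<psi> C p q \<omega> X f"
    obtain x0 \<xi>0 where z': "z = (x0, \<xi>0)" by (cases z)
    have "x0 \<in> X" "\<xi>0 \<noteq> 0" using z unfolding z' DF_M_def by blast+
    moreover have "\<not> locally_regular f X q \<omega> x0 \<xi>0"
      using z regular_not_DF_M[OF _ assms(5) sep \<phi> \<psi>] unfolding z' by blast
    ultimately show "z \<in> W" unfolding z' W_def by blast
  next
    fix z assume z: "z \<in> W"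
    obtain x0 \<xi>0 where z': "z = (x0, \<xi>0)" by (cases z)
    have x0: "x0 \<in> X" "\<xi>0 \<noteq> 0" and nr: "\<not> locally_regular f X q \<omega> x0 \<xi>0" using z unfolding z' W_def by blast+
    show "z \<in> DF_M G1 G2 \<phi> \<psi> C p q \<omega> X f"
      unfolding z' DF_M_def mem_Collect_eq case_prod_conv
    proof (intro conjI x0 allI impI, elim conjE)
      fix s :: real and \<Gamma> :: "(real^'d) set"
      assume h: "0 < s" "s \<le> 1" "\<forall>y\<in>gabor_near G1 G2 \<phi> \<psi> x0 s. \<forall>\<eta>\<in>G2. supp (gabor \<psi> s y \<eta>) \<subseteq> X"
        "open_cone \<Gamma>" "\<xi>0 \<in> \<Gamma>"
      show "Lp_norm (count_space (\<Gamma> \<inter> G2)) q (\<lambda>\<eta>.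
          Lp_norm (count_space (gabor_near G1 G2 \<phi> \<psi> x0 s)) p (\<lambda>y.
            ennreal (cmod (gabor_coeff C \<psi> f s y \<eta> * of_real (\<omega> \<eta>))))) = \<infinity>"
        using not_DF_M_regular[OF assms(5,10,11) x0(1) h fin] nr by blast
    qed
  qed
  ultimately show ?thesis by simp
qed

end
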